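(* Let $\mathcal{X}$ and $\mathcal{Y}$ be infinite dimensional complex Banach spaces and let $A\in B(\mathcal{X})$ and $B\in B(\mathcal{Y})$ be two operators that satisfy the generalized Browder's theorem. Suppose either that $A$ and $B$ are both not algebraic and $0\notin\Pi(A\otimes B)$ $(=\Pi(\tau_{AB}))$, or that only one of the operators $A$, $B$ is algebraic, this one is not nilpotent, and the other one is not Drazin invertible. (a) The following statements are equivalent: (i) the (generalized) Browder's theorem holds for $A\otimes B\in B(\mathcal{X}\overline{\otimes}\mathcal{Y})$; (ii) $\sigma_{BW}(A\otimes B)=\sigma(A)\sigma_{BW}(B)\cup\sigma_{BW}(A)\sigma(B)$; (iii) $\sigma_w(A\otimes B)=\sigma_w(A)\sigma(B)\cup\sigma(A)\sigma_w(B)$. (b) The following statements are equivalent: (i) the (generalized) Browder's theorem holds for $\tau_{AB}\in B(B(\mathcal{Y},\mathcal{X}))$; (ii) $\sigma_{BW}(\tau_{AB})=\sigma(A)\sigma_{BW}(B)\cup\sigma_{BW}(A)\sigma(B)$; (iii) $\sigma_w(\tau_{AB})=\sigma_w(A)\sigma(B)\cup\sigma(A)\sigma_w(B)$.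
   Context: $B(\mathcal{Y},\mathcal{X})$ is the space of bounded linear maps from $\mathcal{Y}$ to $\mathcal{X}$, and $B(\mathcal{X})=B(\mathcal{X},\mathcal{X})$. $\mathcal{X}\overline{\otimes}\mathcal{Y}$ is the completion of the algebraic tensor product $\mathcal{X}\otimes\mathcal{Y}$ with respect to a reasonable uniform cross-norm (in particular $\|x\otimes y\|=\|x\|\,\|y\|$, and $A\otimes B$ extends to a bounded operator on the completion with $\|A\otimes B\|\le\|A\|\,\|B\|$, for all bounded $A$ on $\mathcal{X}$ and $B$ on $\mathcal{Y}$). $A\otimes B$ denotes this tensor product operator. $\tau_{AB}\in B(B(\mathcal{Y},\mathcal{X}))$ is the multiplication operator $\tau_{AB}(U)=AUB$. For subsets $K,K'$ of $\mathbb{C}$, $KK'=\{kk'\colon k\in K,\ k'\in K'\}$ (empty if either set is empty). A bounded operator $T$ is algebraic if $P(T)=0$ for some non-constant polynomial $P\in\mathbb{C}[X]$. A bounded operator $T$ on a Banach space $\mathcal{Z}$ is Drazin invertible if there are $S\in B(\mathcal{Z})$ and $m\in\mathbb{N}$ with $T^m=T^mST$, $STS=S$, $TS=ST$ (so invertible operators are Drazin invertible). $T$ is Weyl if $\dim N(T)$ and $\dim \mathcal{Z}/R(T)$ are finite and equal, where $N$ and $R$ denote null space and range; $\sigma_w(T)=\{\lambda\in\mathbb{C}\colon T-\lambda\text{ is not Weyl}\}$. $T$ is B-Weyl if there is $n\in\mathbb{N}$ such that $R(T^n)$ is closed and the operator induced by $T$ on $R(T^n)$ is Weyl; $\sigma_{BW}(T)=\{\lambda\in\mathbb{C}\colon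 T-\lambda \text{ is not B-Weyl}\}$. The ascent (descent) of $T$ is the smallest integer $n\ge 0$ with $N(T^n)=N(T^{n+1})$ (respectively $R(T^n)=R(T^{n+1})$), or $\infty$ if there is none. $\Pi(T)$ is the set of poles of $T$: those $\lambda\in\sigma(T)$ such that the ascent and the descent of $T-\lambda$ are finite. $\Pi_0(T)=\{\lambda\in\Pi(T)\colon\dim N(T-\lambda)<\infty\}$. $T$ satisfies Browder's theorem if $\sigma_w(T)=\sigma(T)\setminus\Pi_0(T)$, and the generalized Browder's theorem if $\sigma_{BW}(T)=\sigma(T)\setminus\Pi(T)$. These two properties are known to be equivalent, so "the (generalized) Browder's theorem" may be read as either one. *)

theory Defs
  imports "HOL-Analysis.Analysis" "HOL-Computational_Algebra.Polynomial"
begin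

section \<open>Complex Banach spaces\<close>

class complex_normed_vector = real_normed_vector +
  fixes scaleC :: "complex \<Rightarrow> 'a \<Rightarrow> 'a"  (infixr \<open>*\<^sub>C\<close> 75)
  assumes scaleC_add_right: "c *\<^sub>C (x + y) = c *\<^sub>C x + c *\<^sub>C y"
    and scaleC_add_left: "(c + d) *\<^sub>C x = c *\<^sub>C x + d *\<^sub>C x"
    and scaleC_scaleC: "c *\<^sub>C d *\<^sub>C x = (c * d) *\<^sub>C x"
    and scaleC_one: "1 *\<^sub>C x = x"
    and scaleR_scaleC: "scaleR r x = complex_of_real r *\<^sub>C x"
    and norm_scaleC: "norm (c *\<^sub>C x) = cmod c * norm x"

class cbanach = complex_normed_vector + banach

instantiation complex :: cbanach
begin
definition scaleC_complex_def: "c *\<^sub>C x = c * (x::complex)"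
instance
  by standard (simp_all add: scaleC_complex_def distrib_left distrib_right norm_mult scaleR_conv_of_real)
end

interpretation complex_vector: vector_space
  "scaleC :: complex \<Rightarrow> 'a \<Rightarrow> 'a::complex_normed_vector"
  by unfold_locales (simp_all add: scaleC_add_right scaleC_add_left scaleC_scaleC scaleC_one)

lemma bounded_linear_scaleC: "bounded_linear (\<lambda>x::'a::complex_normed_vector. c *\<^sub>C x)"
  by (rule bounded_linear_intro[where K = "cmod c"])
     (simp_all add: scaleC_add_right norm_scaleC scaleR_scaleC scaleC_scaleC mult.commute)


section \<open>Bounded complex-linear maps\<close>

lift_definition blinfun_scaleC ::
  "complex \<Rightarrow> ('a::real_normed_vector \<Rightarrow>\<^sub>L 'b::complex_normed_vector) \<Rightarrow> 'a \<Rightarrow>\<^sub>L 'b"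
  is "\<lambda>c f x. c *\<^sub>C f x"
  by (rule bounded_linear_compose[OF bounded_linear_scaleC])

lemma norm_blinfun_scaleC: "norm (blinfun_scaleC c f) = cmod c * norm f"
proof (cases "c = 0")
  case True
  then have "blinfun_scaleC c f = 0"
    by (intro blinfun_eqI) (simp add: blinfun_scaleC.rep_eq)
  then show ?thesis using True by simp
next
  case False
  have "norm (blinfun_scaleC c f) \<le> cmod c * norm f"
    by (rule norm_blinfun_bound)
       (simp_all add: blinfun_scaleC.rep_eq norm_scaleC mult.assoc mult_left_mono norm_blinfun)
  moreover have "norm f \<le> norm (blinfun_scaleC c f) / cmod c"
  proof (rule norm_blinfun_bound)
    fix x
    have "cmod c * norm (f x) \<le> norm (blinfun_scaleC c f) * norm x"
      using norm_blinfun[of "blinfun_scaleC c f" x] by (simp add: blinfun_scaleC.rep_eq norm_scaleC)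
    then show "norm (f x) \<le> norm (blinfun_scaleC c f) / cmod c * norm x"
      using False by (simp add: field_simps)
  qed simp
  ultimately show ?thesis using False by (simp add: field_simps)
qed

text \<open>The space of bounded complex-linear maps, as a subspace of the library's space of bounded
  real-linear maps; it inherits the operator norm.\<close>

typedef (overloaded) ('a, 'b) cblinfun (\<open>(_ \<Rightarrow>\<^sub>C\<^sub>L /_)\<close> [22, 21] 21) =
  "{f :: 'a::complex_normed_vector \<Rightarrow>\<^sub>L 'b::complex_normed_vector.
      \<forall>c x. blinfun_apply f (c *\<^sub>C x) = c *\<^sub>C blinfun_apply f x}"
  morphisms blinfun_of_cblinfun Abs_cblinfun
  by (rule exI[of _ 0]) simp

setup_lifting type_definition_cblinfun

lift_definition cblinfun_apply ::
  "('a::complex_normed_vector \<Rightarrow>\<^sub>C\<^sub>L 'b::complex_normed_vector) \<Rightarrow> 'a \<Rightarrow> 'b"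
  is blinfun_apply .

declare [[coercion "cblinfun_apply ::
  ('a::complex_normed_vector \<Rightarrow>\<^sub>C\<^sub>L 'b::complex_normed_vector) \<Rightarrow> 'a \<Rightarrow> 'b"]]

instantiation cblinfun :: (complex_normed_vector, complex_normed_vector) complex_normed_vector
begin

lift_definition norm_cblinfun :: "'a \<Rightarrow>\<^sub>C\<^sub>L 'b \<Rightarrow> real" is norm .

lift_definition minus_cblinfun :: "'a \<Rightarrow>\<^sub>C\<^sub>L 'b \<Rightarrow> 'a \<Rightarrow>\<^sub>C\<^sub>L 'b \<Rightarrow> 'a \<Rightarrow>\<^sub>C\<^sub>L 'b" is "(-)"
  by (simp add: blinfun.diff_left complex_vector.scale_right_diff_distrib)

lift_definition uminus_cblinfun :: "'a \<Rightarrow>\<^sub>C\<^sub>L 'b \<Rightarrow> 'a \<Rightarrow>\<^sub>C\<^sub>L 'b" is uminus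
  by (simp add: blinfun.minus_left)

lift_definition zero_cblinfun :: "'a \<Rightarrow>\<^sub>C\<^sub>L 'b" is 0
  by simp

lift_definition plus_cblinfun :: "'a \<Rightarrow>\<^sub>C\<^sub>L 'b \<Rightarrow> 'a \<Rightarrow>\<^sub>C\<^sub>L 'b \<Rightarrow> 'a \<Rightarrow>\<^sub>C\<^sub>L 'b" is "(+)"
  by (simp add: blinfun.add_left scaleC_add_right)

lift_definition scaleC_cblinfun :: "complex \<Rightarrow> 'a \<Rightarrow>\<^sub>C\<^sub>L 'b \<Rightarrow> 'a \<Rightarrow>\<^sub>C\<^sub>L 'b"
  is blinfun_scaleC
  by (simp add: blinfun_scaleC.rep_eq scaleC_scaleC mult.commute)

lift_definition scaleR_cblinfun :: "real \<Rightarrow> 'a \<Rightarrow>\<^sub>C\<^sub>L 'b \<Rightarrow> 'a \<Rightarrow>\<^sub>C\<^sub>L 'b" is "scaleR"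
  by (simp add: blinfun.scaleR_left scaleR_scaleC scaleC_scaleC mult.commute)

definition dist_cblinfun :: "'a \<Rightarrow>\<^sub>C\<^sub>L 'b \<Rightarrow> 'a \<Rightarrow>\<^sub>C\<^sub>L 'b \<Rightarrow> real"
  where "dist_cblinfun a b = norm (a - b)"

definition "(uniformity :: (('a \<Rightarrow>\<^sub>C\<^sub>L 'b) \<times> ('a \<Rightarrow>\<^sub>C\<^sub>L 'b)) filter) =
  (INF e\<in>{0 <..}. principal {(x, y). dist x y < e})"

definition open_cblinfun :: "('a \<Rightarrow>\<^sub>C\<^sub>L 'b) set \<Rightarrow> bool"
  where "open_cblinfun S = (\<forall>x\<in>S. \<forall>\<^sub>F (x', y) in uniformity. x' = x \<longrightarrow> y \<in> S)"

definition sgn_cblinfun :: "'a \<Rightarrow>\<^sub>C\<^sub>L 'b \<Rightarrow> 'a \<Rightarrow>\<^sub>C\<^sub>L 'b"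
  where "sgn_cblinfun x = scaleR (inverse (norm x)) x"

instance
proof
  fix f g h :: "'a \<Rightarrow>\<^sub>C\<^sub>L 'b" and a b :: real and c d :: complex
  show "f + g + h = f + (g + h)" "f + g = g + f" "0 + f = f" "- f + f = 0" "f - g = f + - g"
    by (transfer, simp add: add.assoc add.commute)+
  show "a *\<^sub>R (f + g) = a *\<^sub>R f + a *\<^sub>R g" "(a + b) *\<^sub>R f = a *\<^sub>R f + b *\<^sub>R f"
    "a *\<^sub>R b *\<^sub>R f = (a * b) *\<^sub>R f" "1 *\<^sub>R f = f"
    by (transfer, simp add: scaleR_add_left scaleR_add_right)+
  show "dist f g = norm (f - g)" "sgn f = inverse (norm f) *\<^sub>R f"
    by (rule dist_cblinfun_def, rule sgn_cblinfun_def)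
  show "(uniformity :: (('a \<Rightarrow>\<^sub>C\<^sub>L 'b) \<times> ('a \<Rightarrow>\<^sub>C\<^sub>L 'b)) filter) =
      (INF e\<in>{0 <..}. principal {(x, y). dist x y < e})"
    by (rule uniformity_cblinfun_def)
  show "open U = (\<forall>x\<in>U. \<forall>\<^sub>F (x', y) in uniformity. x' = x \<longrightarrow> y \<in> U)" for U :: "('a \<Rightarrow>\<^sub>C\<^sub>L 'b) set"
    by (rule open_cblinfun_def)
  show "(norm f = 0) = (f = 0)"
    by transfer simp
  show "norm (f + g) \<le> norm f + norm g"
    by transfer (rule norm_triangle_ineq)
  show "norm (a *\<^sub>R f) = \<bar>a\<bar> * norm f"
    by transfer simp
  show "c *\<^sub>C (f + g) = c *\<^sub>C f + c *\<^sub>C g"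
    by (transfer, rule blinfun_eqI)
       (simp only: blinfun_scaleC.rep_eq blinfun.add_left scaleC_add_right)
  show "(c + d) *\<^sub>C f = c *\<^sub>C f + d *\<^sub>C f"
    by (transfer, rule blinfun_eqI)
       (simp only: blinfun_scaleC.rep_eq blinfun.add_left scaleC_add_left)
  show "c *\<^sub>C d *\<^sub>C f = (c * d) *\<^sub>C f"
    by (transfer, rule blinfun_eqI) (simp only: blinfun_scaleC.rep_eq scaleC_scaleC)
  show "1 *\<^sub>C f = f"
    by (transfer, rule blinfun_eqI) (simp only: blinfun_scaleC.rep_eq scaleC_one)
  show "a *\<^sub>R f = complex_of_real a *\<^sub>C f"
    by (transfer, rule blinfun_eqI)
       (simp only: blinfun_scaleC.rep_eq blinfun.scaleR_left scaleR_scaleC)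
  show "norm (c *\<^sub>C f) = cmod c * norm f"
    by transfer (rule norm_blinfun_scaleC)
qed

end

lemma cblinfun_eqI: "(\<And>x. cblinfun_apply f x = cblinfun_apply g x) \<Longrightarrow> f = g"
  by transfer (rule blinfun_eqI)

lemma norm_cblinfun_bound:
  "0 \<le> b \<Longrightarrow> (\<And>x. norm (cblinfun_apply f x) \<le> b * norm x) \<Longrightarrow> norm f \<le> b"
  by transfer (rule norm_blinfun_bound)

lemma norm_cblinfun: "norm (cblinfun_apply f x) \<le> norm f * norm x"
  by transfer (rule norm_blinfun)

lemma bounded_linear_cblinfun_apply: "bounded_linear (cblinfun_apply f)"
  by transfer (rule blinfun.bounded_linear_right)

lemma cblinfun_apply_add_right: "cblinfun_apply f (x + y) = cblinfun_apply f x + cblinfun_apply f y"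
  by (simp add: bounded_linear_cblinfun_apply linear_add bounded_linear.linear)

lemma cblinfun_apply_scaleC_right: "cblinfun_apply f (c *\<^sub>C x) = c *\<^sub>C cblinfun_apply f x"
  by transfer simp

lemma cblinfun_apply_zero_left [simp]: "cblinfun_apply 0 x = 0"
  by transfer simp

lemma cblinfun_apply_add_left: "cblinfun_apply (f + g) x = cblinfun_apply f x + cblinfun_apply g x"
  by transfer (simp add: blinfun.add_left)

lemma cblinfun_apply_diff_left: "cblinfun_apply (f - g) x = cblinfun_apply f x - cblinfun_apply g x"
  by transfer (simp add: blinfun.diff_left)

lemma cblinfun_apply_scaleC_left: "cblinfun_apply (c *\<^sub>C f) x = c *\<^sub>C cblinfun_apply f x"
  by transfer (simp add: blinfun_scaleC.rep_eq)

instance cblinfun :: (complex_normed_vector, cbanach) cbanach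
proof
  fix X :: "nat \<Rightarrow> 'a \<Rightarrow>\<^sub>C\<^sub>L 'b"
  let ?R = "blinfun_of_cblinfun :: ('a \<Rightarrow>\<^sub>C\<^sub>L 'b) \<Rightarrow> _"
  have norm_R: "norm (x - y) = norm (?R x - ?R y)" for x y :: "'a \<Rightarrow>\<^sub>C\<^sub>L 'b"
    by (simp add: norm_cblinfun.rep_eq minus_cblinfun.rep_eq)
  assume "Cauchy X"
  then have "Cauchy (\<lambda>n. ?R (X n))"
    by (simp add: Cauchy_def dist_norm norm_R)
  then obtain L where L: "(\<lambda>n. ?R (X n)) \<longlonglongrightarrow> L"
    using Cauchy_convergent convergent_def by blast
  then have lim: "(\<lambda>n. blinfun_apply (?R (X n)) x) \<longlonglongrightarrow> blinfun_apply L x" for x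
    by (rule bounded_linear.tendsto[OF blinfun.bounded_linear_left])
  have "blinfun_apply L (c *\<^sub>C x) = c *\<^sub>C blinfun_apply L x" for c x
  proof (rule LIMSEQ_unique)
    show "(\<lambda>n. blinfun_apply (?R (X n)) (c *\<^sub>C x)) \<longlonglongrightarrow> blinfun_apply L (c *\<^sub>C x)"
      by (rule lim)
    have "blinfun_apply (?R (X n)) (c *\<^sub>C x) = c *\<^sub>C blinfun_apply (?R (X n)) x" for n
      using blinfun_of_cblinfun[of "X n"] by simp
    then show "(\<lambda>n. blinfun_apply (?R (X n)) (c *\<^sub>C x)) \<longlonglongrightarrow> c *\<^sub>C blinfun_apply L x"
      using bounded_linear.tendsto[OF bounded_linear_scaleC lim] by simp
  qed
  then have "?R (Abs_cblinfun L) = L"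
    by (simp add: Abs_cblinfun_inverse)
  then have "X \<longlonglongrightarrow> Abs_cblinfun L"
    using L by (simp add: LIMSEQ_def dist_norm norm_R)
  then show "convergent X"
    by (rule convergentI)
qed

lift_definition id_cblinfun :: "'a::complex_normed_vector \<Rightarrow>\<^sub>C\<^sub>L 'a" is id_blinfun
  by simp

lift_definition cblinfun_compose ::
  "('b::complex_normed_vector \<Rightarrow>\<^sub>C\<^sub>L 'c::complex_normed_vector) \<Rightarrow>
   ('a::complex_normed_vector \<Rightarrow>\<^sub>C\<^sub>L 'b) \<Rightarrow> 'a \<Rightarrow>\<^sub>C\<^sub>L 'c"  (infixl \<open>o\<^sub>C\<close> 67)
  is "(o\<^sub>L)"
  by simp

primrec cblinfun_power ::
  "('a::complex_normed_vector \<Rightarrow>\<^sub>C\<^sub>L 'a) \<Rightarrow> nat \<Rightarrow> 'a \<Rightarrow>\<^sub>C\<^sub>L 'a"  (infixr \<open>^\<^sub>C\<close> 80)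
where
  "T ^\<^sub>C 0 = id_cblinfun"
| "T ^\<^sub>C Suc n = T o\<^sub>C (T ^\<^sub>C n)"

lemma cblinfun_apply_id [simp]: "cblinfun_apply id_cblinfun x = x"
  by transfer simp

lemma cblinfun_apply_compose [simp]:
  "cblinfun_apply (S o\<^sub>C T) x = cblinfun_apply S (cblinfun_apply T x)"
  by transfer simp

lemma norm_cblinfun_compose: "norm (S o\<^sub>C T) \<le> norm S * norm T"
  by transfer (rule norm_blinfun_compose)

definition null_space :: "('a::complex_normed_vector \<Rightarrow>\<^sub>C\<^sub>L 'b::complex_normed_vector) \<Rightarrow> 'a set"
  where "null_space T = {x. T x = 0}"


section \<open>Dimension and codimension\<close>

text \<open>The library's \<open>dim\<close> is \<open>0\<close> on infinite-dimensional subspaces, hence the value \<open>\<infinity>\<close>.\<close>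

definition cdim :: "'a::complex_normed_vector set \<Rightarrow> enat" where
  "cdim M = (if \<exists>B. finite B \<and> M \<subseteq> complex_vector.span B
             then enat (complex_vector.dim M) else \<infinity>)"

text \<open>The cosets \<open>b + N\<close>, \<open>b \<in> B\<close>, are pairwise distinct and form a (finite) basis of the quotient
  space \<open>M / N\<close>, for subspaces \<open>N \<subseteq> M\<close>.\<close>

definition quotient_basis ::
  "'a::complex_normed_vector set \<Rightarrow> 'a set \<Rightarrow> 'a set \<Rightarrow> bool" where
  "quotient_basis M N B \<longleftrightarrow> finite B \<and> B \<subseteq> M \<and>
     (\<forall>c. (\<Sum>b\<in>B. c b *\<^sub>C b) \<in> N \<longrightarrow> (\<forall>b\<in>B. c b = 0)) \<and>
     (\<forall>x\<in>M. \<exists>c. x - (\<Sum>b\<in>B. c b *\<^sub>C b) \<in> N)"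

definition quotient_cdim :: "'a::complex_normed_vector set \<Rightarrow> 'a set \<Rightarrow> enat" where
  "quotient_cdim M N = (if \<exists>B. quotient_basis M N B
                        then enat (card (SOME B. quotient_basis M N B)) else \<infinity>)"


section \<open>Spectra, poles and generalized Browder's theorem\<close>

definition spectrum :: "('a::cbanach \<Rightarrow>\<^sub>C\<^sub>L 'a) \<Rightarrow> complex set" where
  "spectrum T = {\<mu>. \<not> (\<exists>S. (T - \<mu> *\<^sub>C id_cblinfun) o\<^sub>C S = id_cblinfun \<and>
                            S o\<^sub>C (T - \<mu> *\<^sub>C id_cblinfun) = id_cblinfun)}"

text \<open>For a subspace \<open>M\<close> invariant under \<open>T\<close>: the operator induced by \<open>T\<close> on \<open>M\<close> is Weyl.\<close>

definition weyl_on :: "'a::cbanach set \<Rightarrow> ('a \<Rightarrow>\<^sub>C\<^sub>L 'a) \<Rightarrow> bool" where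
  "weyl_on M T \<longleftrightarrow> cdim (null_space T \<inter> M) < \<infinity> \<and> quotient_cdim M (T ` M) < \<infinity> \<and>
                  cdim (null_space T \<inter> M) = quotient_cdim M (T ` M)"

definition weyl :: "('a::cbanach \<Rightarrow>\<^sub>C\<^sub>L 'a) \<Rightarrow> bool" where
  "weyl T \<longleftrightarrow> weyl_on UNIV T"

definition b_weyl :: "('a::cbanach \<Rightarrow>\<^sub>C\<^sub>L 'a) \<Rightarrow> bool" where
  "b_weyl T \<longleftrightarrow> (\<exists>n. closed (range (T ^\<^sub>C n)) \<and> weyl_on (range (T ^\<^sub>C n)) T)"

definition weyl_spectrum :: "('a::cbanach \<Rightarrow>\<^sub>C\<^sub>L 'a) \<Rightarrow> complex set" where
  "weyl_spectrum T = {\<mu>. \<not> weyl (T - \<mu> *\<^sub>C id_cblinfun)}"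

definition b_weyl_spectrum :: "('a::cbanach \<Rightarrow>\<^sub>C\<^sub>L 'a) \<Rightarrow> complex set" where
  "b_weyl_spectrum T = {\<mu>. \<not> b_weyl (T - \<mu> *\<^sub>C id_cblinfun)}"

text \<open>In \<open>enat\<close>, the infimum of the empty set is \<open>\<infinity>\<close>.\<close>

definition ascent :: "('a::cbanach \<Rightarrow>\<^sub>C\<^sub>L 'a) \<Rightarrow> enat" where
  "ascent T = (INF n\<in>{n. null_space (T ^\<^sub>C n) = null_space (T ^\<^sub>C Suc n)}. enat n)"

definition descent :: "('a::cbanach \<Rightarrow>\<^sub>C\<^sub>L 'a) \<Rightarrow> enat" where
  "descent T = (INF n\<in>{n. range (T ^\<^sub>C n) = range (T ^\<^sub>C Suc n)}. enat n)"

definition poles :: "('a::cbanach \<Rightarrow>\<^sub>C\<^sub>L 'a) \<Rightarrow> complex set" where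
  "poles T = {\<mu> \<in> spectrum T. ascent (T - \<mu> *\<^sub>C id_cblinfun) < \<infinity> \<and>
                              descent (T - \<mu> *\<^sub>C id_cblinfun) < \<infinity>}"

definition generalized_browder :: "('a::cbanach \<Rightarrow>\<^sub>C\<^sub>L 'a) \<Rightarrow> bool" where
  "generalized_browder T \<longleftrightarrow> b_weyl_spectrum T = spectrum T - poles T"


section \<open>Algebraic, nilpotent and Drazin invertible operators\<close>

definition poly_cblinfun :: "complex poly \<Rightarrow> ('a::cbanach \<Rightarrow>\<^sub>C\<^sub>L 'a) \<Rightarrow> 'a \<Rightarrow>\<^sub>C\<^sub>L 'a" where
  "poly_cblinfun P T = (\<Sum>i\<le>degree P. coeff P i *\<^sub>C (T ^\<^sub>C i))"

definition algebraic_op :: "('a::cbanach \<Rightarrow>\<^sub>C\<^sub>L 'a) \<Rightarrow> bool" where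
  "algebraic_op T \<longleftrightarrow> (\<exists>P. degree P > 0 \<and> poly_cblinfun P T = 0)"

definition nilpotent_op :: "('a::cbanach \<Rightarrow>\<^sub>C\<^sub>L 'a) \<Rightarrow> bool" where
  "nilpotent_op T \<longleftrightarrow> (\<exists>n. T ^\<^sub>C n = 0)"

definition drazin_invertible :: "('a::cbanach \<Rightarrow>\<^sub>C\<^sub>L 'a) \<Rightarrow> bool" where
  "drazin_invertible T \<longleftrightarrow> (\<exists>S m. T ^\<^sub>C m = (T ^\<^sub>C m) o\<^sub>C S o\<^sub>C T \<and>
                                 S o\<^sub>C T o\<^sub>C S = S \<and> T o\<^sub>C S = S o\<^sub>C T)"


section \<open>Multiplication operators and tensor products\<close>

lemma bounded_linear_mult_op:
  fixes A :: "'x::complex_normed_vector \<Rightarrow>\<^sub>C\<^sub>L 'x" and B :: "'y::complex_normed_vector \<Rightarrow>\<^sub>C\<^sub>L 'y"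
  shows "bounded_linear (\<lambda>U. A o\<^sub>C U o\<^sub>C B)"
proof (rule bounded_linear_intro)
  fix U V :: "'y \<Rightarrow>\<^sub>C\<^sub>L 'x" and r :: real
  show "A o\<^sub>C (U + V) o\<^sub>C B = A o\<^sub>C U o\<^sub>C B + A o\<^sub>C V o\<^sub>C B"
    by (rule cblinfun_eqI) (simp add: cblinfun_apply_add_left cblinfun_apply_add_right)
  show "A o\<^sub>C (r *\<^sub>R U) o\<^sub>C B = r *\<^sub>R (A o\<^sub>C U o\<^sub>C B)"
    by (rule cblinfun_eqI)
       (simp add: scaleR_scaleC cblinfun_apply_scaleC_left cblinfun_apply_scaleC_right)
  have "norm (A o\<^sub>C U o\<^sub>C B) \<le> norm A * norm U * norm B"
    by (meson norm_cblinfun_compose order_trans mult_right_mono norm_ge_zero)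
  then show "norm (A o\<^sub>C U o\<^sub>C B) \<le> norm U * (norm A * norm B)"
    by (simp add: mult_ac)
qed

definition mult_op ::
  "('x::cbanach \<Rightarrow>\<^sub>C\<^sub>L 'x) \<Rightarrow> ('y::cbanach \<Rightarrow>\<^sub>C\<^sub>L 'y) \<Rightarrow> ('y \<Rightarrow>\<^sub>C\<^sub>L 'x) \<Rightarrow>\<^sub>C\<^sub>L ('y \<Rightarrow>\<^sub>C\<^sub>L 'x)"
  where "mult_op A B = Abs_cblinfun (Blinfun (\<lambda>U. A o\<^sub>C U o\<^sub>C B))"

lemma mult_op_apply: "cblinfun_apply (mult_op A B) U = A o\<^sub>C U o\<^sub>C B"
proof -
  let ?F = "Blinfun (\<lambda>U. A o\<^sub>C U o\<^sub>C B)"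
  have F: "blinfun_apply ?F V = A o\<^sub>C V o\<^sub>C B" for V
    by (simp only: bounded_linear_Blinfun_apply[OF bounded_linear_mult_op])
  have "A o\<^sub>C (c *\<^sub>C V) o\<^sub>C B = c *\<^sub>C (A o\<^sub>C V o\<^sub>C B)" for c V
    by (rule cblinfun_eqI) (simp add: cblinfun_apply_scaleC_left cblinfun_apply_scaleC_right)
  then have "?F \<in> {f. \<forall>c x. blinfun_apply f (c *\<^sub>C x) = c *\<^sub>C blinfun_apply f x}"
    by (simp only: F mem_Collect_eq simp_thms)
  then have "blinfun_of_cblinfun (mult_op A B) = ?F"
    unfolding mult_op_def by (rule Abs_cblinfun_inverse)
  then show ?thesis
    by (simp only: cblinfun_apply.rep_eq F)
qed

text \<open>
  \<open>tensor_completion t\<close>: the bilinear map \<open>t = (\<lambda>x y. x \<otimes> y)\<close> exhibits the Banach space \<open>'z\<close> as the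
  completion of the algebraic tensor product of \<open>'x\<close> and \<open>'y\<close> for a reasonable uniform cross-norm.
  After bilinearity, the next condition says that the linear map from the algebraic tensor product to \<open>'z\<close>
  induced by \<open>t\<close> is injective (so that \<open>'z\<close> induces a norm on the algebraic tensor product), the
  one after that its range is dense. The remaining ones are the cross-norm property, reasonableness
  (functionals \<open>f \<otimes> g\<close> are bounded with norm at most \<open>\<parallel>f\<parallel> \<parallel>g\<parallel>\<close>) and uniformity.
\<close>

definition tensor_completion :: "('x::cbanach \<Rightarrow> 'y::cbanach \<Rightarrow> 'z::cbanach) \<Rightarrow> bool" where
  "tensor_completion t \<longleftrightarrow>
     (\<forall>y. Vector_Spaces.linear scaleC scaleC (\<lambda>x. t x y)) \<and>
     (\<forall>x. Vector_Spaces.linear scaleC scaleC (\<lambda>y. t x y)) \<and>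
     (\<forall>F v. finite F \<and> complex_vector.independent F \<and> (\<Sum>x\<in>F. t x (v x)) = 0 \<longrightarrow>
        (\<forall>x\<in>F. v x = 0)) \<and>
     closure (complex_vector.span {t x y | x y. True}) = UNIV \<and>
     (\<forall>x y. norm (t x y) = norm x * norm y) \<and>
     (\<forall>(f :: 'x \<Rightarrow>\<^sub>C\<^sub>L complex) (g :: 'y \<Rightarrow>\<^sub>C\<^sub>L complex).
        \<exists>h :: 'z \<Rightarrow>\<^sub>C\<^sub>L complex.
          (\<forall>x y. cblinfun_apply h (t x y) = cblinfun_apply f x * cblinfun_apply g y) \<and> norm h \<le> norm f * norm g) \<and>
     (\<forall>(A :: 'x \<Rightarrow>\<^sub>C\<^sub>L 'x) (B :: 'y \<Rightarrow>\<^sub>C\<^sub>L 'y).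
        \<exists>T :: 'z \<Rightarrow>\<^sub>C\<^sub>L 'z.
          (\<forall>x y. cblinfun_apply T (t x y) = t (cblinfun_apply A x) (cblinfun_apply B y)) \<and> norm T \<le> norm A * norm B)"

definition tensor_op :: "('x::cbanach \<Rightarrow> 'y::cbanach \<Rightarrow> 'z::cbanach) \<Rightarrow>
    ('x \<Rightarrow>\<^sub>C\<^sub>L 'x) \<Rightarrow> ('y \<Rightarrow>\<^sub>C\<^sub>L 'y) \<Rightarrow> 'z \<Rightarrow>\<^sub>C\<^sub>L 'z" where
  "tensor_op t A B = (THE T. \<forall>x y. cblinfun_apply T (t x y) = t (A x) (B y))"

lemma tensor_op_apply:
  assumes "tensor_completion t"
  shows "tensor_op t A B (t x y) = t (A x) (B y)"
proof -
  have "\<exists>T. (\<forall>x y. cblinfun_apply T (t x y) = t (A x) (B y)) \<and> norm T \<le> norm A * norm B"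
    using assms unfolding tensor_completion_def by (elim conjE allE)
  then obtain T where T: "\<forall>x y. cblinfun_apply T (t x y) = t (A x) (B y)"
    by (elim exE conjE)
  have "S = T" if S: "\<forall>x y. cblinfun_apply S (t x y) = t (A x) (B y)" for S
  proof (rule cblinfun_eqI)
    fix z
    let ?E = "{z. cblinfun_apply S z = cblinfun_apply T z}"
    have "complex_vector.span {t x y | x y. True} \<subseteq> ?E"
    proof (rule complex_vector.span_minimal)
      show "{t x y | x y. True} \<subseteq> ?E" using S T by auto
      show "complex_vector.subspace ?E"
        by (rule complex_vector.subspaceI)
           (simp_all add: cblinfun_apply_add_right cblinfun_apply_scaleC_right
              linear_0 bounded_linear.linear[OF bounded_linear_cblinfun_apply])
    qed
    moreover have "closed ?E"
      by (intro closed_Collect_eq linear_continuous_on bounded_linear_cblinfun_apply)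
    ultimately have "closure (complex_vector.span {t x y | x y. True}) \<subseteq> ?E"
      by (rule closure_minimal)
    moreover have "closure (complex_vector.span {t x y | x y. True}) = UNIV"
      using assms unfolding tensor_completion_def by (elim conjE)
    ultimately show "cblinfun_apply S z = cblinfun_apply T z" by auto
  qed
  then have "\<forall>x y. cblinfun_apply (tensor_op t A B) (t x y) = t (A x) (B y)"
    unfolding tensor_op_def by (rule theI[where a = T and
        P = "\<lambda>T. \<forall>x y. cblinfun_apply T (t x y) = t (A x) (B y)", OF T])
  then show ?thesis by (elim allE)
qed

end

theory Submission
  imports Defs "HOL-Complex_Analysis.Complex_Analysis"
begin

text \<open>The maps \<open>(a, b) \<mapsto> a \<otimes> b\<close> and \<open>(a, b) \<mapsto> (U \<mapsto> a U b)\<close> (with \<open>b\<close> in the opposite algebra) are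
  multiplicative pairings of Banach algebras with \<open>\<parallel>a \<odot> b\<parallel> = \<parallel>a\<parallel> \<parallel>b\<parallel>\<close>, and \<open>a \<odot> b\<close> is the product of
  the commuting elements \<open>a \<odot> 1\<close> and \<open>1 \<odot> b\<close>. The upper bounds for the spectrum, the Drazin spectrum
  and the Browder spectrum of such a product come from one argument: an element fails to have the
  property in question only if a suitable ideal of the commutative bicommutant is proper, and modulo
  a proper ideal both factors can be made scalar (Gelfand-Mazur). The lower bounds use that a
  boundary point of the spectrum of one factor has approximate null vectors, on which \<open>a \<odot> b\<close> acts
  like a multiple of the other factor.

  Browder's theorem for \<open>T\<close> says that the Weyl spectrum is the Browder spectrum, the generalized one
  that the B-Weyl spectrum is the Drazin spectrum; both fail exactly when a point is B-Weyl without
  being a pole or a resolvent point, and then all nearby points are eigenvalues at which \<open>T\<close> is Weyl.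
  So (i), (ii) and (iii) are the same condition once the Drazin and Browder spectra of \<open>a \<odot> b\<close> obey
  the product formulas. The Browder spectrum does so always, the Drazin spectrum always outside
  \<open>0\<close>; the case distinction of the theorem settles the point \<open>0\<close>.\<close>

section \<open>The Hahn-Banach theorem\<close>

text \<open>A Drazin inverse of \<open>a \<odot> b\<close> need not have the form
  \<open>c \<odot> d\<close>, so it cannot be read off in a factor. What passes to a factor is a
  pair of norm inequalities, \<open>norm (x ^ p * c) \<le> K * norm (x ^ Suc p * c)\<close> and its
  mirror image: the norm of \<open>c \<odot> d\<close> factorises, so testing on such elements
  isolates one factor. In the algebra of all bounded operators, rank-one operators turn the two
  inequalities back into stable kernels and ranges. The upper bounds get by without maximal ideals
  or characters: only two elements have to become scalar, and enlarging a proper ideal twice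
  achieves this. The point \<open>0\<close> is exceptional because a product of two Drazin
  invertible factors is Drazin invertible, while the product formula contains \<open>0\<close> as
  soon as one spectrum contains \<open>0\<close> and the Drazin spectrum of the other factor is
  nonempty. For the Browder spectrum there is no such conflict: in infinite dimension,
  \<open>0\<close> in the spectrum of one factor rules out a finite-rank spectral idempotent of the
  product.\<close>

definition sublinear :: "('a::real_vector \<Rightarrow> real) \<Rightarrow> bool" where
  "sublinear q \<longleftrightarrow> (\<forall>x y. q (x + y) \<le> q x + q y) \<and> (\<forall>r x. 0 \<le> r \<longrightarrow> q (r *\<^sub>R x) = r * q x)"

lemma sublinear_add: "sublinear q \<Longrightarrow> q (x + y) \<le> q x + q y"
  and sublinear_scale: "sublinear q \<Longrightarrow> 0 \<le> r \<Longrightarrow> q (r *\<^sub>R x) = r * q x"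
  by (auto simp: sublinear_def)

lemma sublinear_zero: "sublinear q \<Longrightarrow> q 0 = 0"
  using sublinear_scale[of q 0 0] by simp

lemma sublinear_minus: "sublinear q \<Longrightarrow> - q (- x) \<le> q x"
  using sublinear_add[of q x "- x"] sublinear_zero[of q] by simp

text \<open>The reverse scaling inequality is the assumed one with factor \<open>1 / r\<close> at
  \<open>r *\<^sub>R x\<close>, so constructions by infima have to prove one direction only.\<close>

lemma sublinearI:
  assumes add: "\<And>x y. q (x + y) \<le> q x + q y"
    and scale: "\<And>r x. 0 < r \<Longrightarrow> q (r *\<^sub>R x) \<le> r * q x" and zero: "q 0 = 0"
  shows "sublinear q"
  unfolding sublinear_def
proof (intro conjI allI impI add)
  fix r :: real and x :: 'a
  assume "0 \<le> r"
  show "q (r *\<^sub>R x) = r * q x"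
  proof (cases "r = 0")
    case False
    then have r: "0 < r" using \<open>0 \<le> r\<close> by simp
    have "q ((1 / r) *\<^sub>R (r *\<^sub>R x)) \<le> (1 / r) * q (r *\<^sub>R x)"
      using r by (intro scale) simp
    then have "r * q x \<le> q (r *\<^sub>R x)"
      using r by (simp add: field_simps)
    then show ?thesis using scale[OF r, of x] by simp
  qed (simp add: zero)
qed

text \<open>\<open>q'\<close> lies below \<open>q\<close> (take \<open>t = 0\<close>) and satisfies
  \<open>q' (- y) \<le> - q y\<close> (take \<open>t = 1\<close>), so it is pushed down as far as
  linearity along \<open>y\<close> demands. This one construction makes minimal functionals additive
  and also prescribes the value at a given vector.\<close>

lemma sublinear_shift:
  fixes q :: "'a::real_vector \<Rightarrow> real"
  assumes q: "sublinear q"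
  obtains q' where "sublinear q'" "\<And>x t. 0 \<le> t \<Longrightarrow> q' x \<le> q (x + t *\<^sub>R y) - t * q y"
proof
  let ?q = "\<lambda>x. INF t\<in>{0..}. q (x + t *\<^sub>R y) - t * q y"
  have low: "- q (- x) \<le> q (x + t *\<^sub>R y) - t * q y" if "0 \<le> t" for x t
    using sublinear_add[OF q, of "x + t *\<^sub>R y" "- x"] sublinear_scale[OF q that, of y] by simp
  have bdd: "bdd_below ((\<lambda>t. q (x + t *\<^sub>R y) - t * q y) ` {0..})" for x
    using low by (intro bdd_belowI2[where m = "- q (- x)"]) simp
  show le: "?q x \<le> q (x + t *\<^sub>R y) - t * q y" if "0 \<le> t" for x t
    using that by (intro cINF_lower[OF bdd]) simp
  have add: "?q (x + z) \<le> (q (x + t *\<^sub>R y) - t * q y) + (q (z + s *\<^sub>R y) - s * q y)"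
    if "0 \<le> t" "0 \<le> s" for x z t s
  proof -
    have "?q (x + z) \<le> q (x + z + (t + s) *\<^sub>R y) - (t + s) * q y"
      using that by (intro le) simp
    also have "x + z + (t + s) *\<^sub>R y = (x + t *\<^sub>R y) + (z + s *\<^sub>R y)"
      by (simp add: algebra_simps)
    also have "q \<dots> - (t + s) * q y \<le> (q (x + t *\<^sub>R y) - t * q y) + (q (z + s *\<^sub>R y) - s * q y)"
      using sublinear_add[OF q, of "x + t *\<^sub>R y" "z + s *\<^sub>R y"] by (simp add: algebra_simps)
    finally show ?thesis .
  qed
  show "sublinear ?q"
  proof (rule sublinearI)
    fix x z
    \<comment> \<open>The two infima are removed one at a time: \<open>s\<close> stays fixed while
      \<open>t\<close> varies, and \<open>s\<close> varies afterwards.\<close>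
    have "?q (x + z) - (q (z + s *\<^sub>R y) - s * q y) \<le> ?q x" if "0 \<le> s" for s
      using add[OF _ that, of _ x z] by (intro cINF_greatest) (auto simp: algebra_simps)
    then have "?q (x + z) - ?q x \<le> ?q z"
      by (intro cINF_greatest) (auto simp: algebra_simps)
    then show "?q (x + z) \<le> ?q x + ?q z" by simp
  next
    fix r :: real and x assume r: "0 < r"
    have "?q (r *\<^sub>R x) / r \<le> ?q x"
    proof (intro cINF_greatest)
      fix t :: real assume "t \<in> {0..}"
      then have "?q (r *\<^sub>R x) \<le> q (r *\<^sub>R x + (r * t) *\<^sub>R y) - (r * t) * q y"
        using r by (intro le) simp
      also have "r *\<^sub>R x + (r * t) *\<^sub>R y = r *\<^sub>R (x + t *\<^sub>R y)"
        by (simp add: algebra_simps)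
      also have "q \<dots> = r * q (x + t *\<^sub>R y)"
        using r by (simp add: sublinear_scale[OF q])
      finally have "?q (r *\<^sub>R x) \<le> r * (q (x + t *\<^sub>R y) - t * q y)"
        by (simp add: right_diff_distrib mult.assoc)
      then show "?q (r *\<^sub>R x) / r \<le> q (x + t *\<^sub>R y) - t * q y"
        using r by (simp only: pos_divide_le_eq mult.commute)
    qed simp
    then show "?q (r *\<^sub>R x) \<le> r * ?q x"
      using r by (simp add: field_simps)
  next
    have "?q 0 \<le> 0" using le[of 0 0] sublinear_zero[OF q] by simp
    moreover have "0 \<le> ?q 0"
      using sublinear_scale[OF q] by (intro cINF_greatest) auto
    ultimately show "?q 0 = 0" by simp
  qed
qed

text \<open>The shift of \<open>q\<close> along \<open>y\<close> lies below \<open>q\<close>, hence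
  equals it, and its defining bound at \<open>t = 1\<close> is superadditivity.\<close>

lemma minimal_sublinear_linear:
  assumes q: "sublinear q" and min: "\<And>q'. sublinear q' \<Longrightarrow> (\<And>x. q' x \<le> q x) \<Longrightarrow> q' = q"
  shows "q (x + y) = q x + q y" "q (- x) = - q x"
proof -
  show *: "q (x + y) = q x + q y" for x y
  proof -
    obtain q' where q': "sublinear q'" "\<And>x t. 0 \<le> t \<Longrightarrow> q' x \<le> q (x + t *\<^sub>R y) - t * q y"
      using sublinear_shift[OF q] by blast
    have "q' = q"
      using q'(2)[of 0] by (intro min q') simp
    then have "q x \<le> q (x + y) - q y"
      using q'(2)[of 1 x] by simp
    then show ?thesis using sublinear_add[OF q, of x y] by simp
  qed
  show "q (- x) = - q x"
    using *[of x "- x"] sublinear_zero[OF q] by simp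
qed

lemma exists_minimal_sublinear:
  fixes p :: "'a::real_vector \<Rightarrow> real"
  assumes p: "sublinear p"
  obtains q where "sublinear q" "\<And>x. q x \<le> p x"
    "\<And>q'. sublinear q' \<Longrightarrow> (\<And>x. q' x \<le> q x) \<Longrightarrow> q' = q"
proof -
  let ?A = "{q. sublinear q \<and> (\<forall>x. q x \<le> p x)}"
  \<comment> \<open>The order is reversed, so the maximal element supplied by Zorn's lemma is a
    minimal functional.\<close>
  let ?P = "\<lambda>a b :: 'a \<Rightarrow> real. \<forall>x. b x \<le> a x"
  have "\<exists>m\<in>?A. \<forall>a\<in>?A. ?P m a \<longrightarrow> a = m"
  proof (rule predicate_Zorn)
    show "partial_order_on ?A (relation_of ?P ?A)"
      by (rule partial_order_on_relation_ofI) (auto intro: order_trans order_antisym simp: fun_eq_iff)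
  next
    fix C assume C: "C \<in> Chains (relation_of ?P ?A)"
    then have CA: "C \<subseteq> ?A" and chain: "\<And>a b. a \<in> C \<Longrightarrow> b \<in> C \<Longrightarrow> ?P a b \<or> ?P b a"
      by (auto simp: Chains_def relation_of_def)
    show "\<exists>u\<in>?A. \<forall>a\<in>C. ?P a u"
    proof (cases "C = {}")
      case True
      then show ?thesis using p by auto
    next
      case False
      let ?u = "\<lambda>x. INF q\<in>C. q x"
      have sub: "sublinear q" if "q \<in> C" for q using that CA by auto
      \<comment> \<open>This bound is uniform over the chain and keeps the pointwise infimum
        finite.\<close>
      have "- p (- x) \<le> q x" if "q \<in> C" for q x
      proof -
        have "q (- x) \<le> p (- x)" using that CA by auto
        then show ?thesis using sublinear_minus[OF sub[OF that], of x] by linarith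
      qed
      then have bdd: "bdd_below ((\<lambda>q. q x) ` C)" for x
        by (intro bdd_belowI2)
      have le: "?u x \<le> q x" if "q \<in> C" for q x
        using that by (intro cINF_lower[OF bdd])
      have "sublinear ?u"
      proof (rule sublinearI)
        fix x y
        have both: "?u (x + y) \<le> a x + b y" if "a \<in> C" "b \<in> C" for a b
        proof -
          \<comment> \<open>In a chain the smaller of \<open>a\<close> and \<open>b\<close> works at
            both points.\<close>
          have "\<exists>c\<in>C. c x \<le> a x \<and> c y \<le> b y"
            using chain[OF that] that by (meson order_refl)
          then obtain c where c: "c \<in> C" "c x \<le> a x" "c y \<le> b y"
            by blast
          then have "?u (x + y) \<le> c (x + y)" by (intro le)
          also have "\<dots> \<le> c x + c y" using sub c by (intro sublinear_add) auto
          finally show ?thesis using c by linarith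
        qed
        have "?u (x + y) - b y \<le> ?u x" if "b \<in> C" for b
          using both[OF _ that] by (intro cINF_greatest[OF False]) (simp add: algebra_simps)
        then have "?u (x + y) - ?u x \<le> ?u y"
          by (intro cINF_greatest[OF False]) (simp add: algebra_simps)
        then show "?u (x + y) \<le> ?u x + ?u y" by simp
      next
        fix r :: real and x assume r: "0 < r"
        have "?u (r *\<^sub>R x) / r \<le> ?u x"
        proof (rule cINF_greatest[OF False])
          fix q assume "q \<in> C"
          then show "?u (r *\<^sub>R x) / r \<le> q x"
            using le[of q "r *\<^sub>R x"] sublinear_scale[OF sub[of q], of r x] r by (simp add: field_simps)
        qed
        then show "?u (r *\<^sub>R x) \<le> r * ?u x" using r by (simp add: field_simps)
      next
        have "(\<lambda>q. q 0) ` C = {0}"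
          using sublinear_zero[OF sub] False by force
        then show "?u 0 = 0" by simp
      qed
      moreover have "?u x \<le> p x" for x
      proof -
        obtain q where "q \<in> C" using False by auto
        then show ?thesis using le[of q x] CA by (auto intro: order_trans)
      qed
      ultimately show ?thesis using le by auto
    qed
  qed
  then obtain q where q: "sublinear q" "\<forall>x. q x \<le> p x"
    and min: "\<And>a. sublinear a \<Longrightarrow> \<forall>x. a x \<le> p x \<Longrightarrow> \<forall>x. a x \<le> q x \<Longrightarrow> a = q"
    by auto
  show thesis
  proof (rule that[OF q(1)])
    fix q' assume "sublinear q'" "\<And>x. q' x \<le> q x"
    then show "q' = q" using q(2) by (intro min) (auto intro: order_trans)
  qed (use q(2) in auto)
qed

text \<open>A minimal functional below the shift of \<open>p\<close> along \<open>x0\<close> is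
  linear, and the shift forces \<open>f (- x0) \<le> - p x0\<close>. This takes the place of
  extending a functional from the line through \<open>x0\<close>.\<close>

theorem Hahn_Banach_real:
  fixes p :: "'a::real_vector \<Rightarrow> real"
  assumes p: "sublinear p"
  obtains f where "\<And>x y. f (x + y) = f x + f y" "\<And>r x. f (r *\<^sub>R x) = r * f x"
    "\<And>x. f x \<le> p x" "f x0 = p x0"
proof -
  obtain p' where p': "sublinear p'" "\<And>x t. 0 \<le> t \<Longrightarrow> p' x \<le> p (x + t *\<^sub>R x0) - t * p x0"
    using sublinear_shift[OF p] by blast
  obtain f where f: "sublinear f" "\<And>x. f x \<le> p' x"
    "\<And>q'. sublinear q' \<Longrightarrow> (\<And>x. q' x \<le> f x) \<Longrightarrow> q' = f"
    using exists_minimal_sublinear[OF p'(1)] by blast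
  note lin = minimal_sublinear_linear[OF f(1,3)]
  show thesis
  proof
    show "f (x + y) = f x + f y" for x y by (rule lin)
    show "f (r *\<^sub>R x) = r * f x" for r x
    proof (cases "0 \<le> r")
      case False
      then show ?thesis using sublinear_scale[OF f(1), of "- r" x] lin(2)[of "r *\<^sub>R x"] by simp
    qed (simp add: sublinear_scale[OF f(1)])
    show le: "f x \<le> p x" for x using f(2)[of x] p'(2)[of 0 x] by simp
    have "f (- x0) \<le> - p x0"
      using f(2)[of "- x0"] p'(2)[of 1 "- x0"] sublinear_zero[OF p] by simp
    then show "f x0 = p x0" using lin(2)[of x0] le[of x0] by simp
  qed
qed

lemma cblinfun_exists:
  fixes f :: "'a::complex_normed_vector \<Rightarrow> 'b::complex_normed_vector"
  assumes "\<And>x y. f (x + y) = f x + f y" "\<And>c x. f (c *\<^sub>C x) = c *\<^sub>C f x"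
    "\<And>x. norm (f x) \<le> K * norm x"
  obtains g where "\<And>x. cblinfun_apply g x = f x"
proof -
  have "bounded_linear f"
    using assms by (intro bounded_linear_intro[where K = K]) (simp_all add: scaleR_scaleC mult.commute)
  then have "blinfun_apply (Blinfun f) = f" by (rule bounded_linear_Blinfun_apply)
  then have "cblinfun_apply (Abs_cblinfun (Blinfun f)) = f"
    by (subst cblinfun_apply.rep_eq, subst Abs_cblinfun_inverse) (simp_all add: assms(2))
  then show thesis using that[of "Abs_cblinfun (Blinfun f)"] by simp
qed

theorem Hahn_Banach:
  fixes p :: "'a::complex_normed_vector \<Rightarrow> real"
  assumes add: "\<And>x y. p (x + y) \<le> p x + p y" and scale: "\<And>c x. p (c *\<^sub>C x) = cmod c * p x"
    and le: "\<And>x. p x \<le> norm x"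
  obtains f :: "'a \<Rightarrow>\<^sub>C\<^sub>L complex" where "\<And>x. cmod (f x) \<le> p x" "f x0 = complex_of_real (p x0)"
proof -
  have "sublinear p"
    by (simp add: sublinear_def add scaleR_scaleC scale)
  then obtain g where g: "\<And>x y. g (x + y) = g x + g y" "\<And>r x. g (r *\<^sub>R x) = r * g x"
    "\<And>x. g x \<le> p x" "g x0 = p x0"
    using Hahn_Banach_real[where ?x0.0 = x0] by blast
  \<comment> \<open>The complex-linear functional with real part \<open>g\<close>: its imaginary
    part at \<open>x\<close> has to be \<open>- g (\<i> *\<^sub>C x)\<close>.\<close>
  let ?f = "\<lambda>x. Complex (g x) (- g (\<i> *\<^sub>C x))"
  have f_add: "?f (x + y) = ?f x + ?f y" for x y
    by (simp add: g(1) scaleC_add_right complex_eq_iff)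
  have f_scale: "?f (c *\<^sub>C x) = c *\<^sub>C ?f x" for c x
  proof -
    have neg: "g (- x) = - g x" for x using g(2)[of "-1" x] by simp
    have c: "c *\<^sub>C x = Re c *\<^sub>R x + Im c *\<^sub>R (\<i> *\<^sub>C x)" for x
      by (simp add: scaleR_scaleC scaleC_scaleC scaleC_add_left[symmetric] complex_eq[symmetric] mult.commute)
    have "\<i> *\<^sub>C \<i> *\<^sub>C x = - x"
      using complex_vector.scale_minus_left[of 1 x] by (simp add: scaleC_scaleC scaleC_one)
    then have "g (c *\<^sub>C \<i> *\<^sub>C x) = Re c * g (\<i> *\<^sub>C x) - Im c * g x"
      unfolding c[of "\<i> *\<^sub>C x"] using g(1)[of "Re c *\<^sub>R \<i> *\<^sub>C x" "- (Im c *\<^sub>R x)"] by (simp add: g(2) neg)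
    moreover have "g (c *\<^sub>C x) = Re c * g x + Im c * g (\<i> *\<^sub>C x)"
      unfolding c[of x] by (simp add: g)
    moreover have "\<i> *\<^sub>C c *\<^sub>C x = c *\<^sub>C \<i> *\<^sub>C x"
      by (simp only: scaleC_scaleC mult.commute[of c])
    ultimately show ?thesis
      by (simp add: scaleC_complex_def complex_eq_iff del: complex_vector.scale_scale)
  qed
  have f_le: "cmod (?f x) \<le> p x" for x
  proof (cases "?f x = 0")
    case True
    have "- p x \<le> p x" using add[of x "- x"] scale[of "-1" x] scale[of 0 0] complex_vector.scale_minus_left[of 1 x]
      by (simp add: scaleC_one)
    then show ?thesis using True by simp
  next
    case False
    \<comment> \<open>Rotating \<open>x\<close> by a unimodular \<open>u\<close> makes the value
      real and nonnegative, where the bound on \<open>g\<close> applies.\<close>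
    define z where "z = ?f x"
    define u where "u = cnj z / complex_of_real (cmod z)"
    have z: "z \<noteq> 0" using False by (simp add: z_def)
    then have u1: "cmod u = 1" by (simp add: u_def norm_divide)
    have "u * z = complex_of_real ((cmod z)\<^sup>2) / complex_of_real (cmod z)"
      using complex_norm_square[of z] by (simp add: u_def mult.commute)
    then have u: "cmod u = 1" "u * ?f x = complex_of_real (cmod (?f x))"
      using z u1 by (simp_all add: power2_eq_square z_def)
    have "cmod (?f x) = Re (?f (u *\<^sub>C x))"
      unfolding f_scale scaleC_complex_def u(2) by simp
    also have "\<dots> \<le> p (u *\<^sub>C x)" using g(3) by simp
    finally show ?thesis using scale[of u x] u by simp
  qed
  have "cmod (?f x) \<le> 1 * norm x" for x
    using f_le[of x] le[of x] by simp
  from cblinfun_exists[of ?f, OF f_add f_scale this] obtain f :: "'a \<Rightarrow>\<^sub>C\<^sub>L complex"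
    where f: "\<And>x. cblinfun_apply f x = ?f x" by blast
  show thesis
  proof
    show "cmod (f x) \<le> p x" for x using f_le by (simp add: f)
    \<comment> \<open>The real part at \<open>x0\<close> already exhausts the bound
      \<open>p x0\<close> on the modulus, so the imaginary part vanishes.\<close>
    have "(cmod (?f x0))\<^sup>2 \<le> (p x0)\<^sup>2"
      by (intro power_mono f_le) simp
    then have "g (\<i> *\<^sub>C x0) = 0"
      by (simp add: cmod_power2 g(4))
    then show "f x0 = complex_of_real (p x0)"
      by (simp add: f g(4) complex_eq_iff)
  qed
qed

text \<open>The distance to \<open>S\<close> is the quotient seminorm modulo \<open>S\<close>. As
  the dominating function in the Hahn-Banach theorem it forces the functional to vanish on
  \<open>S\<close> while its value at \<open>x0\<close> is the distance of
  \<open>x0\<close>.\<close>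

lemma infdist_subspace_seminorm:
  fixes S :: "'a::complex_normed_vector set"
  assumes S: "complex_vector.subspace S"
  shows "infdist (x + y) S \<le> infdist x S + infdist y S"
    and "infdist (c *\<^sub>C x) S = cmod c * infdist x S"
    and "infdist x S \<le> norm x"
proof -
  have ne: "S \<noteq> {}" using complex_vector.subspace_0[OF S] by auto
  have inf: "infdist z S = (INF a\<in>S. dist z a)" for z using ne by (simp add: infdist_def)
  have both: "infdist (x + y) S \<le> dist x a + dist y b" if "a \<in> S" "b \<in> S" for a b
  proof -
    have "infdist (x + y) S \<le> dist (x + y) (a + b)"
      using that by (intro infdist_le complex_vector.subspace_add[OF S])
    then show ?thesis using dist_triangle_add[of x y a b] by linarith
  qed
  have "infdist (x + y) S - dist y b \<le> infdist x S" if "b \<in> S" for b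
    unfolding inf[of x] using both[OF _ that] by (intro cINF_greatest[OF ne]) (simp add: algebra_simps)
  then have "infdist (x + y) S - infdist x S \<le> infdist y S"
    unfolding inf[of y] by (intro cINF_greatest[OF ne]) (simp add: algebra_simps)
  then show "infdist (x + y) S \<le> infdist x S + infdist y S" by simp
  have le: "infdist (c *\<^sub>C x) S \<le> cmod c * infdist x S" if "c \<noteq> 0" for c x
  proof -
    have "infdist (c *\<^sub>C x) S / cmod c \<le> infdist x S"
      unfolding inf[of x]
    proof (rule cINF_greatest[OF ne])
      fix a assume "a \<in> S"
      then have "infdist (c *\<^sub>C x) S \<le> dist (c *\<^sub>C x) (c *\<^sub>C a)"
        by (intro infdist_le complex_vector.subspace_scale[OF S])
      also have "\<dots> = cmod c * dist x a"
        by (simp add: dist_norm norm_scaleC[symmetric] complex_vector.scale_right_diff_distrib)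
      finally show "infdist (c *\<^sub>C x) S / cmod c \<le> dist x a"
        using that by (simp add: field_simps)
    qed
    then show ?thesis using that by (simp add: field_simps)
  qed
  show "infdist (c *\<^sub>C x) S = cmod c * infdist x S"
  proof (cases "c = 0")
    case True
    then show ?thesis using complex_vector.subspace_0[OF S] by simp
  next
    case False
    have "inverse c *\<^sub>C c *\<^sub>C x = x" using False by simp
    then have "infdist x S \<le> cmod (inverse c) * infdist (c *\<^sub>C x) S"
      using le[of "inverse c" "c *\<^sub>C x"] False by (simp del: complex_vector.scale_scale)
    then have "cmod c * infdist x S \<le> infdist (c *\<^sub>C x) S"
      using False by (simp add: norm_inverse) (simp add: field_simps)
    then show ?thesis using le[OF False, of x] by simp
  qed
  show "infdist x S \<le> norm x"
    using infdist_le[OF complex_vector.subspace_0[OF S], of x] by simp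
qed

lemma Hahn_Banach_infdist:
  fixes S :: "'a::complex_normed_vector set"
  assumes S: "complex_vector.subspace S"
  obtains f :: "'a \<Rightarrow>\<^sub>C\<^sub>L complex" where "\<And>x. x \<in> S \<Longrightarrow> f x = 0"
    "f x0 = complex_of_real (infdist x0 S)"
proof -
  obtain f :: "'a \<Rightarrow>\<^sub>C\<^sub>L complex" where f: "\<And>x. cmod (f x) \<le> infdist x S"
    "f x0 = complex_of_real (infdist x0 S)"
    using Hahn_Banach[of "\<lambda>x. infdist x S" x0] infdist_subspace_seminorm[OF S] by metis
  show thesis
  proof (rule that[OF _ f(2)])
    fix x assume "x \<in> S"
    then show "f x = 0" using f(1)[of x] by simp
  qed
qed

lemma Hahn_Banach_norm:
  fixes x0 :: "'a::complex_normed_vector"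
  obtains f :: "'a \<Rightarrow>\<^sub>C\<^sub>L complex" where "norm f \<le> 1" "f x0 = complex_of_real (norm x0)"
proof -
  obtain f :: "'a \<Rightarrow>\<^sub>C\<^sub>L complex" where f: "\<And>x. cmod (f x) \<le> norm x"
    "f x0 = complex_of_real (norm x0)"
    using Hahn_Banach[of norm x0] by (metis norm_triangle_ineq norm_scaleC order_refl)
  show thesis
  proof (rule that[OF _ f(2)])
    show "norm f \<le> 1" using f(1) by (intro norm_cblinfun_bound) simp_all
  qed
qed

section \<open>Complex Banach algebras\<close>

text \<open>The zero algebra is allowed, since the operators on the zero space form an instance.\<close>

class cbanach_algebra = cbanach + ring + monoid_mult +
  assumes norm_mult_le: "norm (x * y) \<le> norm x * norm y"
    and scaleC_mult_left: "(c *\<^sub>C x) * y = c *\<^sub>C (x * y)"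
    and scaleC_mult_right: "x * (c *\<^sub>C y) = c *\<^sub>C (x * y)"
    and norm_one_le: "norm 1 \<le> 1"

section \<open>Invertible elements, resolvents and the spectrum\<close>

definition invertible_elem :: "'a::monoid_mult \<Rightarrow> bool" where
  "invertible_elem x \<longleftrightarrow> (\<exists>y. x * y = 1 \<and> y * x = 1)"

lemma invertible_elemI: "x * y = 1 \<Longrightarrow> z * x = 1 \<Longrightarrow> invertible_elem x"
  unfolding invertible_elem_def by (metis mult.assoc mult_1_left mult_1_right)

lemma invertible_elem_mult: "invertible_elem x \<Longrightarrow> invertible_elem y \<Longrightarrow> invertible_elem (x * y)"
proof -
  assume "invertible_elem x" "invertible_elem y"
  then obtain x' y' where "x * x' = 1" "x' * x = 1" "y * y' = 1" "y' * y = 1"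
    by (auto simp: invertible_elem_def)
  then have "(x * y) * (y' * x') = 1" "(y' * x') * (x * y) = 1"
    by (metis mult.assoc mult_1_right)+
  then show ?thesis by (rule invertible_elemI)
qed

lemma invertible_elem_scaleC:
  fixes x :: "'a::cbanach_algebra"
  assumes "c \<noteq> 0"
  shows "invertible_elem (c *\<^sub>C x) \<longleftrightarrow> invertible_elem x"
proof -
  have *: "invertible_elem (c *\<^sub>C x)" if "invertible_elem x" "c \<noteq> 0" for c and x :: 'a
  proof -
    obtain y where "x * y = 1" "y * x = 1" using \<open>invertible_elem x\<close> by (auto simp: invertible_elem_def)
    then show ?thesis using \<open>c \<noteq> 0\<close>
      by (intro invertible_elemI[where y = "inverse c *\<^sub>C y" and z = "inverse c *\<^sub>C y"])
         (simp_all add: scaleC_mult_left scaleC_mult_right scaleC_one)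
  qed
  show ?thesis
    using *[of x c] *[of "c *\<^sub>C x" "inverse c"] assms by (auto simp: scaleC_one)
qed

lemma bounded_linear_mult_left':
  "bounded_linear (\<lambda>x::'a::cbanach_algebra. x * y)"
  by (rule bounded_linear_intro[where K = "norm y"])
     (simp_all add: distrib_right scaleR_scaleC scaleC_mult_left norm_mult_le)

lemma bounded_linear_mult_right':
  "bounded_linear (\<lambda>y::'a::cbanach_algebra. x * y)"
  by (rule bounded_linear_intro[where K = "norm x"])
     (simp_all add: distrib_left scaleR_scaleC scaleC_mult_right norm_mult_le mult.commute[of _ "norm x"])

lemma norm_power_le': "norm (x ^ n) \<le> norm x ^ n" for x :: "'a::cbanach_algebra"
proof (induction n)
  case (Suc n)
  have "norm (x ^ Suc n) \<le> norm x * norm (x ^ n)" by (simp add: norm_mult_le)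
  also have "\<dots> \<le> norm x * norm x ^ n" using Suc by (intro mult_left_mono) auto
  finally show ?case by simp
qed (simp add: norm_one_le)

lemma invertible_elem_Neumann:
  fixes x :: "'a::cbanach_algebra"
  assumes "norm x < 1"
  shows "invertible_elem (1 - x)"
proof -
  have "summable (\<lambda>n. norm x ^ n)"
    using assms by (intro summable_geometric) simp
  then have s: "summable (\<lambda>n. x ^ n)"
    using norm_power_le' by (rule summable_comparison_test'[where N = 0])
  let ?s = "\<Sum>n. x ^ n"
  have "?s = 1 + (\<Sum>n. x ^ Suc n)" using suminf_split_head[OF s] by simp
  also have "(\<Sum>n. x ^ Suc n) = x * ?s"
    using bounded_linear.suminf[OF bounded_linear_mult_right' s, of x] by simp
  finally have 1: "(1 - x) * ?s = 1" by (simp add: algebra_simps)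
  have "?s = 1 + (\<Sum>n. x ^ Suc n)" using suminf_split_head[OF s] by simp
  also have "(\<Sum>n. x ^ Suc n) = ?s * x"
    using bounded_linear.suminf[OF bounded_linear_mult_left' s, of x] by (simp add: power_commutes)
  finally have 2: "?s * (1 - x) = 1" by (simp add: algebra_simps)
  show ?thesis using 1 2 by (rule invertible_elemI)
qed

lemma invertible_elem_open:
  fixes x :: "'a::cbanach_algebra"
  assumes "invertible_elem x"
  obtains d where "0 < d" "\<And>y. norm (x - y) < d \<Longrightarrow> invertible_elem y"
proof -
  obtain x' where x': "x * x' = 1" "x' * x = 1" using assms by (auto simp: invertible_elem_def)
  \<comment> \<open>The summand \<open>1\<close> keeps the radius positive when
    \<open>x' = 0\<close>, which happens in the zero algebra.\<close>
  show thesis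
  proof (rule that[of "1 / (norm x' + 1)"])
    fix y assume y: "norm (x - y) < 1 / (norm x' + 1)"
    have "norm (x' * (x - y)) \<le> norm x' * norm (x - y)" by (rule norm_mult_le)
    also have "\<dots> \<le> norm x' * (1 / (norm x' + 1))" using y by (intro mult_left_mono) auto
    also have "\<dots> < 1" by (simp add: divide_less_eq) (smt (verit) norm_ge_zero)
    finally have "invertible_elem (x * (1 - x' * (x - y)))"
      using assms by (intro invertible_elem_mult invertible_elem_Neumann)
    also have "x * (1 - x' * (x - y)) = y"
      by (simp add: right_diff_distrib mult.assoc[symmetric] x')
    finally show "invertible_elem y" .
  qed (simp add: add_nonneg_pos)
qed

definition spec :: "'a::cbanach_algebra \<Rightarrow> complex set" where
  "spec a = {s. \<not> invertible_elem (a - s *\<^sub>C 1)}"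

text \<open>From \<open>s v = a v - 1\<close> and \<open>norm a < cmod s / 2\<close>. The decay in
  \<open>s\<close> is what makes the entire function of the Gelfand-Mazur argument vanish at
  infinity.\<close>

lemma resolvent_bound:
  fixes a :: "'a::cbanach_algebra"
  assumes "2 * norm a < cmod s"
  obtains v where "(a - s *\<^sub>C 1) * v = 1" "v * (a - s *\<^sub>C 1) = 1" "norm v \<le> 2 / cmod s"
proof -
  have s: "s \<noteq> 0" using assms by auto
  have "norm (inverse s *\<^sub>C a) < 1"
    using assms s by (simp add: norm_scaleC norm_inverse) (simp add: field_simps, smt (verit) norm_ge_zero)
  then have "invertible_elem ((- s) *\<^sub>C (1 - inverse s *\<^sub>C a))"
    using s by (simp add: invertible_elem_scaleC invertible_elem_Neumann del: complex_vector.scale_minus_left)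
  also have "(- s) *\<^sub>C (1 - inverse s *\<^sub>C a) = a - s *\<^sub>C 1"
    using s by (simp add: complex_vector.scale_right_diff_distrib scaleC_one)
  finally obtain v where v: "(a - s *\<^sub>C 1) * v = 1" "v * (a - s *\<^sub>C 1) = 1"
    by (auto simp: invertible_elem_def)
  have "s *\<^sub>C v = a * v - 1" using v(1) by (simp add: left_diff_distrib scaleC_mult_left algebra_simps)
  then have "cmod s * norm v \<le> norm a * norm v + norm (1::'a)"
    by (metis norm_scaleC norm_triangle_ineq4 norm_mult_le add_right_mono order_trans)
  then have "cmod s * norm v \<le> (cmod s / 2) * norm v + norm (1::'a)"
    using assms mult_right_mono[of "norm a" "cmod s / 2" "norm v"] by simp
  then have "norm v \<le> 2 / cmod s"
    using s norm_one_le[where 'a='a] by (simp add: field_simps)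
  with v show thesis by (rule that)
qed

lemma bounded_spec: "bounded (spec a)"
proof (rule boundedI[of _ "2 * norm a"])
  fix s assume "s \<in> spec a"
  then show "norm s \<le> 2 * norm a"
    by (cases "2 * norm a < norm s") (auto simp: spec_def elim: resolvent_bound intro: invertible_elemI)
qed

lemma spec_complement_open:
  assumes "s \<notin> spec a"
  obtains d where "0 < d" "\<And>s'. cmod (s - s') < d \<Longrightarrow> s' \<notin> spec a"
proof -
  obtain d where d: "0 < d" "\<And>y. norm (a - s *\<^sub>C 1 - y) < d \<Longrightarrow> invertible_elem y"
    using assms invertible_elem_open[of "a - s *\<^sub>C 1"] by (auto simp: spec_def)
  show thesis
  proof (rule that[of "d / (norm (1::'a) + 1)"])
    fix s' assume s': "cmod (s - s') < d / (norm (1::'a) + 1)"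
    have "norm (a - s *\<^sub>C 1 - (a - s' *\<^sub>C 1)) = cmod (s - s') * norm (1::'a)"
      by (simp add: norm_scaleC[symmetric] complex_vector.scale_left_diff_distrib norm_minus_commute)
    also have "\<dots> \<le> cmod (s - s') * (norm (1::'a) + 1)" by (intro mult_left_mono) auto
    also have "\<dots> < d"
      using s' by (simp add: field_simps add_pos_nonneg)
    finally show "s' \<notin> spec a" using d(2) by (simp add: spec_def)
  qed (use d in \<open>simp add: add_nonneg_pos\<close>)
qed

lemma closed_spec: "closed (spec a)"
  unfolding closed_def open_dist
proof
  fix s assume "s \<in> - spec a"
  then obtain d where "0 < d" "\<And>s'. cmod (s - s') < d \<Longrightarrow> s' \<notin> spec a"
    using spec_complement_open by (metis ComplD)
  then show "\<exists>e>0. \<forall>y. dist y s < e \<longrightarrow> y \<in> - spec a"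
    by (auto simp: dist_norm norm_minus_commute)
qed

text \<open>Boundary points of the spectrum are topological divisors of zero: normalise the
  resolvents at points outside the spectrum.\<close>

lemma spec_boundary_approx:
  fixes a :: "'a::cbanach_algebra"
  assumes s: "s \<in> spec a" and bd: "\<And>d. 0 < d \<Longrightarrow> \<exists>s'. s' \<notin> spec a \<and> cmod (s - s') < d" and e: "0 < e"
  obtains c where "norm c = 1" "norm ((a - s *\<^sub>C 1) * c) < e" "norm (c * (a - s *\<^sub>C 1)) < e"
proof -
  have "\<exists>s'. s' \<notin> spec a \<and> cmod (s - s') < e / 2" using e by (intro bd) simp
  then obtain s' where s': "s' \<notin> spec a" "cmod (s - s') < e / 2" by blast
  define d where "d = cmod (s - s')"
  have "0 < d" using s s' by (auto simp: d_def)
  obtain r where r: "(a - s' *\<^sub>C 1) * r = 1" "r * (a - s' *\<^sub>C 1) = 1"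
    using s' by (auto simp: spec_def invertible_elem_def)
  \<comment> \<open>A smaller resolvent would let a Neumann series invert \<open>a - s\<close> from
    \<open>a - s'\<close>, against \<open>s\<close> being in the spectrum.\<close>
  have "1 / d \<le> norm r"
  proof (rule ccontr)
    assume "\<not> 1 / d \<le> norm r"
    then have "norm ((s - s') *\<^sub>C r) < 1"
      using \<open>0 < d\<close> by (simp only: norm_scaleC d_def[symmetric]) (simp add: field_simps)
    then have "invertible_elem ((a - s' *\<^sub>C 1) * (1 - (s - s') *\<^sub>C r))"
      using r by (intro invertible_elem_mult invertible_elem_Neumann) (auto intro: invertible_elemI)
    also have "(a - s' *\<^sub>C 1) * (1 - (s - s') *\<^sub>C r) = a - s *\<^sub>C 1"
      by (simp add: right_diff_distrib scaleC_mult_right r complex_vector.scale_left_diff_distrib)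
    finally show False using s by (simp add: spec_def)
  qed
  moreover from this have "0 < norm r" using \<open>0 < d\<close>
    by (meson divide_pos_pos less_le_trans zero_less_one)
  ultimately have r0: "0 < norm r" "1 / norm r \<le> d"
    using \<open>0 < d\<close> by (auto simp: field_simps)
  define c where "c = complex_of_real (1 / norm r) *\<^sub>C r"
  have c1: "norm c = 1" using r0 by (simp add: c_def norm_scaleC norm_divide)
  have eq: "a - s *\<^sub>C 1 = (a - s' *\<^sub>C 1) - (s - s') *\<^sub>C 1"
    by (simp add: complex_vector.scale_left_diff_distrib)
  have *: "norm (complex_of_real (1 / norm r) *\<^sub>C (1::'a) - (s - s') *\<^sub>C c) < e"
  proof -
    have "norm (complex_of_real (1 / norm r) *\<^sub>C (1::'a) - (s - s') *\<^sub>C c)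
        \<le> 1 / norm r * norm (1::'a) + d * norm c"
      by (rule order_trans[OF norm_triangle_ineq4]) (simp add: norm_scaleC d_def norm_divide)
    also have "\<dots> \<le> d * 1 + d * 1"
      using norm_one_le[where 'a='a] r0 c1 \<open>0 < d\<close> by (intro add_mono mult_mono) auto
    finally show ?thesis using s' by (simp add: d_def)
  qed
  show thesis
  proof (rule that[OF c1])
    have "(a - s' *\<^sub>C 1) * c = complex_of_real (1 / norm r) *\<^sub>C 1"
      unfolding c_def scaleC_mult_right r ..
    then have "(a - s *\<^sub>C 1) * c = complex_of_real (1 / norm r) *\<^sub>C 1 - (s - s') *\<^sub>C c"
      unfolding eq by (simp only: left_diff_distrib[of "a - s' *\<^sub>C 1"] scaleC_mult_left mult_1_left)
    then show "norm ((a - s *\<^sub>C 1) * c) < e" using * by simp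
    have "c * (a - s' *\<^sub>C 1) = complex_of_real (1 / norm r) *\<^sub>C 1"
      unfolding c_def scaleC_mult_left r ..
    then have "c * (a - s *\<^sub>C 1) = complex_of_real (1 / norm r) *\<^sub>C 1 - (s - s') *\<^sub>C c"
      unfolding eq by (simp only: right_diff_distrib[of _ "a - s' *\<^sub>C 1"] scaleC_mult_right mult_1_right)
    then show "norm (c * (a - s *\<^sub>C 1)) < e" using * by simp
  qed
qed

subsection \<open>Commutative inverse-closed subalgebras and their ideals\<close>

text \<open>Closure under inverses is the essential axiom: it makes invertibility inside
  \<open>C\<close> the same as in the whole algebra, so that a proper ideal of \<open>C\<close>
  contains no invertible element at all.\<close>

locale comm_subalgebra =
  fixes C :: "'a::cbanach_algebra set"
  assumes one: "1 \<in> C"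
    and add: "x \<in> C \<Longrightarrow> y \<in> C \<Longrightarrow> x + y \<in> C"
    and mult: "x \<in> C \<Longrightarrow> y \<in> C \<Longrightarrow> x * y \<in> C"
    and scale: "x \<in> C \<Longrightarrow> c *\<^sub>C x \<in> C"
    and comm: "x \<in> C \<Longrightarrow> y \<in> C \<Longrightarrow> x * y = y * x"
    and inv: "x \<in> C \<Longrightarrow> x * y = 1 \<Longrightarrow> y * x = 1 \<Longrightarrow> y \<in> C"
begin

lemma uminus: "x \<in> C \<Longrightarrow> - x \<in> C"
  using scale[of x "-1"] by (simp add: scaleC_one)

lemma diff: "x \<in> C \<Longrightarrow> y \<in> C \<Longrightarrow> x - y \<in> C"
  using add[of x "- y"] uminus by simp

lemma power: "x \<in> C \<Longrightarrow> x ^ n \<in> C"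
  by (induction n) (auto intro: one mult)

lemma zero: "0 \<in> C"
  using diff[OF one one] by simp

lemma shift: "x \<in> C \<Longrightarrow> x - s *\<^sub>C 1 \<in> C"
  by (intro diff scale one)

definition ideal :: "'a set \<Rightarrow> bool" where
  "ideal I \<longleftrightarrow> I \<subseteq> C \<and> 0 \<in> I \<and> (\<forall>x\<in>I. \<forall>y\<in>I. x + y \<in> I) \<and> (\<forall>x\<in>I. \<forall>c\<in>C. c * x \<in> I)"

lemma idealD:
  assumes "ideal I"
  shows ideal_subset: "x \<in> I \<Longrightarrow> x \<in> C" and ideal_zero: "0 \<in> I"
    and ideal_add: "x \<in> I \<Longrightarrow> y \<in> I \<Longrightarrow> x + y \<in> I"
    and ideal_mult: "c \<in> C \<Longrightarrow> x \<in> I \<Longrightarrow> c * x \<in> I"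
  using assms by (auto simp: ideal_def)

lemma ideal_mult': "ideal I \<Longrightarrow> c \<in> C \<Longrightarrow> x \<in> I \<Longrightarrow> x * c \<in> I"
  using ideal_mult[of I c x] comm[of x c] ideal_subset[of I x] by simp

lemma ideal_scale: "ideal I \<Longrightarrow> x \<in> I \<Longrightarrow> c *\<^sub>C x \<in> I"
  using ideal_mult[of I "c *\<^sub>C 1" x] scale[OF one, of c] by (simp add: scaleC_mult_left)

lemma ideal_diff: "ideal I \<Longrightarrow> x \<in> I \<Longrightarrow> y \<in> I \<Longrightarrow> x - y \<in> I"
  using ideal_add[of I x "- y"] ideal_scale[of I y "-1"] by (simp add: scaleC_one)

lemma ideal_subspace: "ideal I \<Longrightarrow> complex_vector.subspace I"
  by (auto intro!: complex_vector.subspaceI ideal_scale ideal_add ideal_zero)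

lemma ideal_not_invertible:
  assumes I: "ideal I" "1 \<notin> I" and x: "x \<in> I"
  shows "\<not> invertible_elem x"
proof
  assume "invertible_elem x"
  then obtain y where y: "x * y = 1" "y * x = 1" by (auto simp: invertible_elem_def)
  then have "y \<in> C" using inv ideal_subset[OF I(1) x] by blast
  then show False using ideal_mult[OF I(1) _ x] y I(2) by metis
qed

text \<open>All elements at distance less than \<open>1\<close> from \<open>1\<close> are
  invertible, so a proper ideal stays away from them. Hence a bounded functional can vanish on the
  ideal, closed or not, without vanishing at \<open>1\<close>.\<close>

lemma ideal_infdist_one:
  assumes I: "ideal I" "1 \<notin> I"
  shows "infdist 1 I \<noteq> 0"
proof
  assume 0: "infdist 1 I = 0"
  have "I \<noteq> {}" using ideal_zero[OF I(1)] by auto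
  then have "1 \<in> closure I" using 0 by (simp add: in_closure_iff_infdist_zero)
  then obtain i where i: "i \<in> I" "dist i 1 < 1"
    using closure_approachable[of 1 I] by (auto intro: zero_less_one)
  then have "invertible_elem (1 - (1 - i))"
    by (intro invertible_elem_Neumann) (simp add: dist_norm norm_minus_commute)
  then show False using ideal_not_invertible[OF I i(1)] by simp
qed

text \<open>The Gelfand-Mazur argument: otherwise a functional vanishing on \<open>I\<close> but not at \<open>1\<close>, applied to
  the inverses of \<open>a - s\<close> modulo \<open>I\<close>, is an entire function of \<open>s\<close> that vanishes at infinity.\<close>

lemma not_invertible_mod_ideal:
  assumes I: "ideal I" "1 \<notin> I" and a: "a \<in> C"
  shows "\<exists>s. \<forall>u\<in>C. 1 - u * (a - s *\<^sub>C 1) \<notin> I"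
proof (rule ccontr)
  assume "\<not> ?thesis"
  then have "\<forall>s. \<exists>u. u \<in> C \<and> 1 - u * (a - s *\<^sub>C 1) \<in> I" by blast
  then obtain U where U: "\<And>s. U s \<in> C" "\<And>s. 1 - U s * (a - s *\<^sub>C 1) \<in> I" by metis
  obtain \<phi> :: "'a \<Rightarrow>\<^sub>C\<^sub>L complex" where \<phi>: "\<And>x. x \<in> I \<Longrightarrow> \<phi> x = 0"
    "\<phi> 1 = complex_of_real (infdist 1 I)"
    using Hahn_Banach_infdist[OF ideal_subspace[OF I(1)], of 1] by blast
  have \<phi>1: "\<phi> 1 \<noteq> 0" using ideal_infdist_one[OF I] \<phi>(2) by simp
  have \<phi>_add: "\<phi> (x + y) = \<phi> x + \<phi> y" for x y by (rule cblinfun_apply_add_right)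
  have \<phi>_scale: "\<phi> (c *\<^sub>C x) = c * \<phi> x" for c x
    by (simp add: cblinfun_apply_scaleC_right scaleC_complex_def)
  have \<phi>_diff: "\<phi> (x - y) = \<phi> x - \<phi> y" for x y
    using \<phi>_add[of "x - y" y] by simp
  define f where "f s = \<phi> (U s)" for s
  \<comment> \<open>Two inverses of \<open>a - s\<close> modulo \<open>I\<close> differ by an
    element of \<open>I\<close>, so \<open>f\<close> does not depend on the choice made in
    \<open>U\<close>. Any convenient inverse may be used below.\<close>
  have f_eq: "f s = \<phi> v" if v: "v \<in> C" "1 - v * (a - s *\<^sub>C 1) \<in> I" for s v
  proof -
    have as: "a - s *\<^sub>C 1 \<in> C" using a by (rule shift)
    have "v * (1 - U s * (a - s *\<^sub>C 1)) - U s * (1 - v * (a - s *\<^sub>C 1)) \<in> I"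
      by (intro ideal_diff[OF I(1)] ideal_mult[OF I(1)] U v)
    moreover have "v * (U s * (a - s *\<^sub>C 1)) = U s * (v * (a - s *\<^sub>C 1))"
      using comm[OF v(1) U(1)[of s]] by (metis mult.assoc)
    ultimately have "v - U s \<in> I" by (simp add: right_diff_distrib)
    then show ?thesis using \<phi>(1)[of "v - U s"] \<phi>_diff by (simp add: f_def)
  qed
  have deriv: "(f has_field_derivative \<phi> (U z * U z)) (at z)" for z
  proof -
    define u where "u = U z"
    have u: "u \<in> C" by (simp add: u_def U)
    \<comment> \<open>Bounds the value of \<open>\<phi>\<close> at the remainder
      \<open>u * (u * (u * w))\<close> of the expansion below, where
      \<open>norm w \<le> 2\<close>.\<close>
    define K where "K = norm \<phi> * (norm u * (norm u * (norm u * 2)))"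
    have quot: "cmod ((f (z + h) - f z) / h - \<phi> (u * u)) \<le> cmod h * K"
      if h: "h \<noteq> 0" "cmod h * norm u < 1 / 2" for h
    proof -
      have hu: "h *\<^sub>C u \<in> C" using u by (rule scale)
      have "norm (h *\<^sub>C u) < 1" using h by (simp add: norm_scaleC)
      \<comment> \<open>\<open>w\<close> is a genuine inverse of \<open>1 - h u\<close>; multiplied
        by the inverse \<open>u\<close> of \<open>a - z\<close> modulo \<open>I\<close> it gives an
        inverse of \<open>a - (z + h)\<close> modulo \<open>I\<close>.\<close>
      then obtain w where w: "(1 - h *\<^sub>C u) * w = 1" "w * (1 - h *\<^sub>C u) = 1"
        using invertible_elem_Neumann by (auto simp: invertible_elem_def)
      have wC: "w \<in> C" using w by (intro inv[OF diff[OF one hu]])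
      have w_eq: "w = 1 + h *\<^sub>C (u * w)"
        using w(1) by (simp add: left_diff_distrib scaleC_mult_left algebra_simps)
      have "norm w \<le> norm (1::'a) + norm (h *\<^sub>C (u * w))"
        by (subst w_eq) (rule norm_triangle_ineq)
      also have "norm (h *\<^sub>C (u * w)) \<le> (cmod h * norm u) * norm w"
        using norm_mult_le[of u w] by (simp add: norm_scaleC mult.assoc mult_left_mono)
      also have "\<dots> \<le> 1 / 2 * norm w" using h by (intro mult_right_mono) auto
      finally have w2: "norm w \<le> 2" using norm_one_le[where 'a='a] by simp
      have "f (z + h) = \<phi> (w * u)"
      proof (rule f_eq)
        show "w * u \<in> C" by (intro mult wC u)
        have "1 - w * u * (a - (z + h) *\<^sub>C 1)
            = w * ((1 - h *\<^sub>C u) - u * (a - (z + h) *\<^sub>C 1))"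
          by (simp only: right_diff_distrib[of w "1 - h *\<^sub>C u"] w mult.assoc)
        also have "(1 - h *\<^sub>C u) - u * (a - (z + h) *\<^sub>C 1) = 1 - u * (a - z *\<^sub>C 1)"
        proof -
          have "u * (a - (z + h) *\<^sub>C 1) = u * (a - z *\<^sub>C 1) - h *\<^sub>C u"
            by (simp only: scaleC_add_left right_diff_distrib distrib_left scaleC_mult_right mult_1_right diff_diff_eq)
          then show ?thesis by simp
        qed
        finally show "1 - w * u * (a - (z + h) *\<^sub>C 1) \<in> I"
          using ideal_mult[OF I(1) wC] U(2)[of z] by (simp add: u_def)
      qed
      also have "w * u = u + h *\<^sub>C (u * u) + h *\<^sub>C h *\<^sub>C (u * (u * (u * w)))"
      proof -
        have wu: "w * u = u * w" by (rule comm[OF wC u])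
        have "u * w = u + h *\<^sub>C (u * (u * w))"
          by (subst w_eq) (simp add: distrib_left scaleC_mult_right)
        also have "u * (u * w) = u * u + h *\<^sub>C (u * (u * (u * w)))"
          by (subst w_eq) (simp add: distrib_left scaleC_mult_right)
        finally show ?thesis by (simp add: wu scaleC_add_right add.assoc)
      qed
      finally have "f (z + h) = \<phi> u + h * \<phi> (u * u) + h * (h * \<phi> (u * (u * (u * w))))"
        by (simp only: \<phi>_add \<phi>_scale)
      then have "(f (z + h) - f z) / h - \<phi> (u * u) = h * \<phi> (u * (u * (u * w)))"
        using h by (simp add: f_def u_def[symmetric] field_simps)
      moreover have "cmod (\<phi> (u * (u * (u * w)))) \<le> K"
      proof -
        have "norm (u * (u * (u * w))) \<le> norm u * (norm u * (norm u * norm w))"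
          by (intro order_trans[OF norm_mult_le] mult_left_mono norm_mult_le norm_ge_zero order_refl)
        also have "\<dots> \<le> norm u * (norm u * (norm u * 2))"
          using w2 by (intro mult_left_mono) auto
        finally show ?thesis
          unfolding K_def by (intro order_trans[OF norm_cblinfun] mult_left_mono norm_ge_zero)
      qed
      ultimately show ?thesis by (simp add: norm_mult mult_left_mono)
    qed
    have ev: "\<forall>\<^sub>F h in at (0::complex). h \<noteq> 0 \<and> cmod h * norm u < 1 / 2"
    proof -
      have "((\<lambda>h. cmod h * norm u) \<longlongrightarrow> cmod 0 * norm u) (at 0)"
        by (intro tendsto_intros)
      then have "\<forall>\<^sub>F h in at (0::complex). cmod h * norm u < 1 / 2"
        by (rule order_tendstoD) simp
      then show ?thesis by (simp add: eventually_at_filter)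
    qed
    have "((\<lambda>h. cmod h * K) \<longlongrightarrow> cmod 0 * K) (at 0)" by (intro tendsto_intros)
    then have "((\<lambda>h. cmod h * K) \<longlongrightarrow> 0) (at 0)" by simp
    moreover have "\<forall>\<^sub>F h in at 0. cmod ((f (z + h) - f z) / h - \<phi> (u * u)) \<le> cmod h * K"
      using ev by (rule eventually_mono) (rule quot, simp_all)
    ultimately have "((\<lambda>h. (f (z + h) - f z) / h - \<phi> (u * u)) \<longlongrightarrow> 0) (at 0)"
      by (rule Lim_null_comparison[rotated])
    then show ?thesis
      unfolding DERIV_def u_def[symmetric] by (rule LIM_zero_cancel)
  qed
  have hol: "f holomorphic_on UNIV"
    using deriv by (auto simp: holomorphic_on_def field_differentiable_def intro: has_field_derivative_at_within)
  have res: "\<exists>v. f s = \<phi> v \<and> norm v \<le> 2 / cmod s \<and> a * v - s *\<^sub>C v = 1"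
    if s: "2 * norm a < cmod s" for s
  proof -
    obtain v where v: "(a - s *\<^sub>C 1) * v = 1" "v * (a - s *\<^sub>C 1) = 1" "norm v \<le> 2 / cmod s"
      using resolvent_bound[OF s] by blast
    have "v \<in> C" using v by (intro inv[OF shift[OF a]])
    then have "f s = \<phi> v" using v ideal_zero[OF I(1)] by (intro f_eq) simp_all
    then show ?thesis using v by (auto simp: left_diff_distrib scaleC_mult_left)
  qed
  have lim0: "((\<lambda>s::complex. K / cmod s) \<longlongrightarrow> 0) at_infinity" for K :: real
    by (intro tendsto_divide_0[OF tendsto_const] filterlim_at_top_imp_at_infinity filterlim_norm_at_top)
  have large: "\<forall>\<^sub>F s::complex in at_infinity. 2 * norm a < cmod s"
    using filterlim_norm_at_top[where 'a=complex] by (auto simp: filterlim_at_top_dense)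
  have flim: "(f \<longlongrightarrow> 0) at_infinity"
  proof (rule Lim_null_comparison[OF eventually_mono[OF large] lim0[of "norm \<phi> * 2"]])
    fix s assume "2 * norm a < cmod s"
    then obtain v where "f s = \<phi> v" "norm v \<le> 2 / cmod s" using res by blast
    then show "cmod (f s) \<le> norm \<phi> * 2 / cmod s"
      using norm_cblinfun[of \<phi> v] mult_left_mono[of "norm v" "2 / cmod s" "norm \<phi>"] by simp
  qed
  have f0: "f s = 0" for s by (rule Liouville_weak_0[OF hol flim])
  \<comment> \<open>With \<open>f = 0\<close> the identity \<open>a v - s v = 1\<close> gives
    \<open>\<phi> 1 = \<phi> (a v)\<close>, which tends to \<open>0\<close> as \<open>s\<close>
    grows.\<close>
  have bound: "cmod (\<phi> 1) \<le> norm \<phi> * norm a * 2 / cmod s" if s: "2 * norm a < cmod s" for s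
  proof -
    obtain v where v: "f s = \<phi> v" "norm v \<le> 2 / cmod s" "a * v - s *\<^sub>C v = 1" using res[OF s] by blast
    have "\<phi> 1 = \<phi> (a * v)"
      using arg_cong[OF v(3), of \<phi>] v(1) f0[of s] by (simp add: \<phi>_diff \<phi>_scale)
    also have "cmod \<dots> \<le> norm \<phi> * (norm a * norm v)"
      by (intro order_trans[OF norm_cblinfun] mult_left_mono norm_mult_le norm_ge_zero)
    also have "\<dots> \<le> norm \<phi> * (norm a * (2 / cmod s))"
      using v(2) by (intro mult_left_mono) auto
    finally show ?thesis by simp
  qed
  have "((\<lambda>s::complex. \<phi> 1) \<longlongrightarrow> 0) at_infinity"
    by (rule Lim_null_comparison[OF eventually_mono[OF large] lim0[of "norm \<phi> * norm a * 2"]]) (rule bound)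
  then have "\<phi> 1 = 0" by (rule tendsto_unique[OF trivial_limit_at_infinity tendsto_const])
  then show False using \<phi>1 by simp
qed

text \<open>The ideal generated by \<open>I\<close> and \<open>a - s\<close> is proper exactly when
  no \<open>u\<close> inverts \<open>a - s\<close> modulo \<open>I\<close>, which is how
  \<open>s\<close> is chosen. Making \<open>a\<close> scalar in this way is the substitute for
  evaluating a character at \<open>a\<close>.\<close>

lemma proper_ideal_extend:
  assumes I: "ideal I" "1 \<notin> I" and a: "a \<in> C"
  obtains s J where "ideal J" "1 \<notin> J" "I \<subseteq> J" "a - s *\<^sub>C 1 \<in> J"
proof -
  obtain s where s: "\<And>u. u \<in> C \<Longrightarrow> 1 - u * (a - s *\<^sub>C 1) \<notin> I"
    using not_invertible_mod_ideal[OF assms] by blast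
  have as: "a - s *\<^sub>C 1 \<in> C" using a by (rule shift)
  let ?J = "{i + u * (a - s *\<^sub>C 1) | i u. i \<in> I \<and> u \<in> C}"
  have JI: "i + u * (a - s *\<^sub>C 1) \<in> ?J" if "i \<in> I" "u \<in> C" for i u using that by auto
  show thesis
  proof
    show "ideal ?J"
      unfolding ideal_def
    proof (intro conjI ballI)
      show "?J \<subseteq> C" using ideal_subset[OF I(1)] as by (auto intro: add mult)
      show "0 \<in> ?J" using JI[OF ideal_zero[OF I(1)] zero] by simp
    next
      fix x y assume "x \<in> ?J" "y \<in> ?J"
      then obtain i u j v where x: "x = i + u * (a - s *\<^sub>C 1)" "i \<in> I" "u \<in> C"
        and y: "y = j + v * (a - s *\<^sub>C 1)" "j \<in> I" "v \<in> C" by auto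
      have "x + y = (i + j) + (u + v) * (a - s *\<^sub>C 1)"
        unfolding x y distrib_right by (simp add: ac_simps)
      then show "x + y \<in> ?J" using JI[OF ideal_add[OF I(1) x(2) y(2)] add[OF x(3) y(3)]] by simp
    next
      fix x c assume "x \<in> ?J" and c: "c \<in> C"
      then obtain i u where x: "x = i + u * (a - s *\<^sub>C 1)" "i \<in> I" "u \<in> C" by auto
      then have "c * x = c * i + (c * u) * (a - s *\<^sub>C 1)" by (simp add: distrib_left mult.assoc)
      then show "c * x \<in> ?J" using JI[OF ideal_mult[OF I(1) c x(2)] mult[OF c x(3)]] by simp
    qed
    show "1 \<notin> ?J"
    proof
      assume "1 \<in> ?J"
      then obtain i u where "1 = i + u * (a - s *\<^sub>C 1)" "i \<in> I" "u \<in> C" by auto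
      moreover from this have "1 - u * (a - s *\<^sub>C 1) = i" by (metis add_diff_cancel_right')
      ultimately show False using s[of u] by simp
    qed
    show "I \<subseteq> ?J" using JI[OF _ zero] by auto
    show "a - s *\<^sub>C 1 \<in> ?J" using JI[OF ideal_zero[OF I(1)] one] by simp
  qed
qed

lemma ideal_principal: "x \<in> C \<Longrightarrow> ideal {c * x | c. c \<in> C}"
  unfolding ideal_def
  by (auto intro: mult simp: mult.assoc[symmetric])
     (metis mult_zero_left zero, metis distrib_right add)

lemma principal_proper: "x \<in> C \<Longrightarrow> \<not> invertible_elem x \<Longrightarrow> 1 \<notin> {c * x | c. c \<in> C}"
  using comm by (fastforce simp: invertible_elem_def)

lemma proper_ideal_mult_cancel:
  assumes "ideal J" "1 \<notin> J" and r: "r *\<^sub>C 1 \<in> J"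
  shows "r = 0"
  using ideal_scale[OF assms(1) r, of "inverse r"] assms(2) by (cases "r = 0") (auto simp: scaleC_one)

end

section \<open>Bicommutants as commutative subalgebras\<close>

definition bicommutant :: "'a::monoid_mult set \<Rightarrow> 'a set" where
  "bicommutant S = {x. \<forall>y. (\<forall>z\<in>S. y * z = z * y) \<longrightarrow> x * y = y * x}"

lemma bicommutantI: "(\<And>y. (\<And>z. z \<in> S \<Longrightarrow> y * z = z * y) \<Longrightarrow> x * y = y * x) \<Longrightarrow> x \<in> bicommutant S"
  and bicommutantD: "x \<in> bicommutant S \<Longrightarrow> (\<And>z. z \<in> S \<Longrightarrow> y * z = z * y) \<Longrightarrow> x * y = y * x"
  and bicommutant_superset: "x \<in> S \<Longrightarrow> x \<in> bicommutant S"
  by (auto simp: bicommutant_def)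

text \<open>Commutativity of \<open>S\<close> puts \<open>S\<close> inside its commutant, hence the
  bicommutant inside the commutant as well, so its elements commute with each other. Anything that
  commutes with whatever its data commute with stays in a bicommutant: inverses here, spectral
  idempotents later.\<close>

lemma comm_subalgebra_bicommutant:
  fixes S :: "'a::cbanach_algebra set"
  assumes S: "\<And>x y. x \<in> S \<Longrightarrow> y \<in> S \<Longrightarrow> x * y = y * x"
  shows "comm_subalgebra (bicommutant S)"
proof
  fix x y :: 'a and c :: complex
  assume x: "x \<in> bicommutant S"
  show "c *\<^sub>C x \<in> bicommutant S"
    using bicommutantD[OF x] by (intro bicommutantI) (simp add: scaleC_mult_left scaleC_mult_right)
  show "y \<in> bicommutant S" if "x * y = 1" "y * x = 1"
  proof (rule bicommutantI)
    fix z assume "\<And>w. w \<in> S \<Longrightarrow> z * w = w * z"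
    then have xz: "x * z = z * x" using bicommutantD[OF x] by blast
    have "y * z = y * (z * x) * y" using that by (simp add: mult.assoc)
    also have "\<dots> = y * (x * z) * y" by (simp add: xz)
    also have "\<dots> = z * y" using that by (simp add: mult.assoc[symmetric])
    finally show "y * z = z * y" .
  qed
  assume y: "y \<in> bicommutant S"
  show "x + y \<in> bicommutant S"
    using bicommutantD[OF x] bicommutantD[OF y] by (intro bicommutantI) (simp add: distrib_left distrib_right)
  show "x * y \<in> bicommutant S"
  proof (rule bicommutantI)
    fix z assume z: "\<And>w. w \<in> S \<Longrightarrow> z * w = w * z"
    show "x * y * z = z * (x * y)"
      using bicommutantD[OF x z] bicommutantD[OF y z] by (metis mult.assoc)
  qed
  have "y * z = z * y" if "z \<in> S" for z
    using S that by (intro bicommutantD[OF y]) auto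
  then show "x * y = y * x" by (rule bicommutantD[OF x])
qed (auto intro: bicommutantI)

subsection \<open>Drazin invertible elements\<close>

text \<open>Drazin index at most \<open>p\<close>. The bound is kept as a parameter since
  \<open>p = 0\<close> means invertible, so that the same lower-bound arguments serve the spectrum
  and the Drazin spectrum.\<close>

definition drazin_elem :: "nat \<Rightarrow> 'a::monoid_mult \<Rightarrow> bool" where
  "drazin_elem p x \<longleftrightarrow> (\<exists>y. x * y = y * x \<and> x ^ p = x ^ Suc p * y)"

text \<open>\<open>e\<close> is the spectral idempotent of \<open>x\<close> at \<open>0\<close>:
  \<open>x\<close> is nilpotent on the part of \<open>e\<close> and invertible on the complementary
  part. Invertibility of \<open>x * (1 - e) + e\<close> expresses the latter without passing to a
  corner algebra.\<close>

definition drazin_idem :: "nat \<Rightarrow> 'a::{ring, monoid_mult} \<Rightarrow> 'a \<Rightarrow> bool" where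
  "drazin_idem p x e \<longleftrightarrow> e * e = e \<and> e * x = x * e \<and> x ^ p * e = 0 \<and> invertible_elem (x * (1 - e) + e)"

lemma power_mult_commuting:
  fixes x y :: "'a::monoid_mult"
  assumes "x * y = y * x"
  shows "(x * y) ^ n = x ^ n * y ^ n"
proof (induction n)
  case (Suc n)
  have "(x * y) ^ Suc n = x * (y * x ^ n) * y ^ n" by (simp add: Suc mult.assoc)
  also have "y * x ^ n = x ^ n * y" using power_commuting_commutes[OF assms] by simp
  finally show ?case by (simp add: mult.assoc)
qed simp

lemma drazin_idem_power:
  fixes x :: "'a::{ring, monoid_mult}"
  assumes "e * e = e" "e * x = x * e"
  shows "(x * (1 - e) + e) ^ n * (1 - e) = x ^ n * (1 - e)"
proof (induction n)
  case (Suc n)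
  have 1: "(1 - e) * (1 - e) = 1 - e" "e * (1 - e) = 0" using assms by (simp_all add: algebra_simps)
  have 2: "x * (1 - e) = (1 - e) * x" using assms by (simp add: algebra_simps)
  have "(x * (1 - e) + e) ^ Suc n * (1 - e) = (x * (1 - e) + e) * (x ^ n * (1 - e))"
    using Suc by (simp add: mult.assoc)
  also have "x ^ n * (1 - e) = (1 - e) * x ^ n" using power_commuting_commutes[OF 2] by simp
  also have "(x * (1 - e) + e) * ((1 - e) * x ^ n) = x * (1 - e) * x ^ n"
    by (simp add: distrib_right mult.assoc[symmetric] 1) (simp add: mult.assoc 1)
  also have "\<dots> = x ^ Suc n * (1 - e)"
    using power_commuting_commutes[OF 2] by (simp add: mult.assoc)
  finally show ?case .
qed simp

text \<open>The idempotent is \<open>1 - f\<close> with \<open>f = x ^ p * y ^ p\<close>, and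
  \<open>y * f + (1 - f)\<close> inverts \<open>x * f + (1 - f)\<close>. Iterating the defining
  equation to \<open>x ^ p = x ^ (p + k) * y ^ k\<close> yields \<open>x ^ p * f = x ^ p\<close>,
  from which \<open>f\<close> is idempotent.\<close>

lemma drazin_elem_imp_idem:
  fixes x :: "'a::{ring, monoid_mult}"
  assumes "drazin_elem p x"
  obtains e where "drazin_idem p x e"
proof -
  obtain y where xy: "x * y = y * x" "x ^ p = x ^ Suc p * y" using assms by (auto simp: drazin_elem_def)
  have xyk: "x ^ n * y ^ k = y ^ k * x ^ n" for n k
    by (metis xy(1) power_commuting_commutes)
  have xp: "x ^ p = x ^ (p + k) * y ^ k" for k
  proof (induction k)
    case (Suc k)
    have "x ^ p = x ^ k * x ^ p * y ^ k" using Suc by (metis add.commute power_add)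
    also have "\<dots> = x ^ k * (x ^ Suc p * y) * y ^ k" by (simp only: xy(2)[symmetric])
    also have "\<dots> = x ^ (k + Suc p) * y ^ Suc k" by (simp only: power_add power_Suc mult.assoc)
    finally show ?case by (simp add: add.commute)
  qed simp
  define f where "f = x ^ p * y ^ p"
  have xf: "x * f = f * x" and yf: "y * f = f * y"
    unfolding f_def by (metis mult.assoc power_commutes xyk power_one_right)+
  have xpf: "x ^ p * f = x ^ p"
    unfolding f_def using xp[of p] by (simp add: power_add mult.assoc)
  have ff: "f * f = f"
  proof -
    have "f * f = (x ^ p * f) * y ^ p" unfolding f_def by (metis mult.assoc xyk)
    then have "f * f = x ^ p * y ^ p" by (simp only: xpf)
    then show ?thesis by (simp only: f_def)
  qed
  have "x * y * f = x * (y * x ^ p) * y ^ p" by (simp add: f_def mult.assoc)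
  also have "y * x ^ p = x ^ p * y" using xyk[of p 1] by simp
  also have "x * (x ^ p * y) * y ^ p = (x ^ Suc p * y) * y ^ p" by (simp add: mult.assoc)
  also have "\<dots> = f" by (simp only: xy(2)[symmetric] f_def)
  finally have xyf: "x * y * f = f" .
  have f0: "f * (1 - f) = 0" "(1 - f) * f = 0" "(1 - f) * (1 - f) = 1 - f"
    using ff by (simp_all add: algebra_simps)
  have "(x * f + (1 - f)) * (y * f + (1 - f)) = x * (f * y) * f + x * (f * (1 - f)) + (1 - f) * y * f + (1 - f) * (1 - f)"
    by (simp only: distrib_left distrib_right mult.assoc add.assoc add.left_commute)
  also have "(1 - f) * y * f = 0" using yf f0 by (metis mult.assoc mult_zero_right mult_zero_left)
  also have "x * (f * y) * f = x * y * f" using yf ff by (metis mult.assoc)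
  finally have 1: "(x * f + (1 - f)) * (y * f + (1 - f)) = 1" by (simp add: f0 xyf)
  have "(y * f + (1 - f)) * (x * f + (1 - f)) = y * (f * x) * f + y * (f * (1 - f)) + (1 - f) * x * f + (1 - f) * (1 - f)"
    by (simp only: distrib_left distrib_right mult.assoc add.assoc add.left_commute)
  also have "(1 - f) * x * f = 0" using xf f0 by (metis mult.assoc mult_zero_right mult_zero_left)
  also have "y * (f * x) * f = x * y * f" using xf ff xy by (metis mult.assoc)
  finally have 2: "(y * f + (1 - f)) * (x * f + (1 - f)) = 1" by (simp add: f0 xyf)
  have "drazin_idem p x (1 - f)"
    unfolding drazin_idem_def using ff xf xpf invertible_elemI[OF 1 2] by (simp add: algebra_simps)
  then show thesis by (rule that)
qed

text \<open>On the complement of \<open>e\<close> every power of \<open>x\<close> is invertible, so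
  whatever a power of \<open>x\<close> kills lies in the part of \<open>e\<close>. The exponent
  \<open>q\<close> is unrelated to \<open>p\<close>.\<close>

lemma drazin_idem_annihilator:
  fixes x :: "'a::{ring, monoid_mult}"
  assumes e: "drazin_idem p x e"
  shows "x ^ q * z = 0 \<Longrightarrow> e * z = z" and "z * x ^ q = 0 \<Longrightarrow> z * e = z"
proof -
  have ee: "e * e = e" and ex: "e * x = x * e" using e by (auto simp: drazin_idem_def)
  let ?v = "x * (1 - e) + e"
  obtain w where w: "w * ?v = 1" "?v * w = 1"
    using e by (auto simp: drazin_idem_def invertible_elem_def)
  have wv: "w ^ n * ?v ^ n = 1" for n
    using power_mult_commuting[of w ?v n] w by simp
  have ex2: "(1 - e) * x = x * (1 - e)" using ex by (simp add: algebra_simps)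
  have pw: "?v ^ q * (1 - e) = x ^ q * (1 - e)" using ee ex by (rule drazin_idem_power)
  have comm: "(1 - e) * x ^ q = x ^ q * (1 - e)"
    by (metis ex2 power_commuting_commutes)
  have "(1 - e) * ?v = ?v * (1 - e)" using ee ex2 by (simp add: algebra_simps)
  then have commv: "(1 - e) * ?v ^ q = ?v ^ q * (1 - e)"
    by (metis power_commuting_commutes)
  {
    assume "x ^ q * z = 0"
    then have "?v ^ q * ((1 - e) * z) = 0"
      by (metis comm pw mult.assoc mult_zero_right)
    then have "(1 - e) * z = 0" by (metis wv mult.assoc mult_1_left mult_zero_right)
    then show "e * z = z" by (simp add: algebra_simps)
  }
  {
    assume "z * x ^ q = 0"
    have "z * (1 - e) * ?v ^ q = z * x ^ q * (1 - e)"
      by (metis comm pw commv mult.assoc)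
    then have "z * (1 - e) * ?v ^ q = 0" using \<open>z * x ^ q = 0\<close> by simp
    moreover have "?v ^ q * w ^ q = 1" using power_mult_commuting[of ?v w q] w by simp
    ultimately have "z * (1 - e) = 0" by (metis mult.assoc mult_1_right mult_zero_left)
    then show "z * e = z" by (simp add: algebra_simps)
  }
qed

lemma drazin_idem_power_left: "drazin_idem p x e \<Longrightarrow> e * x ^ p = 0"
  unfolding drazin_idem_def by (metis power_commuting_commutes)

text \<open>An element \<open>y\<close> commuting with \<open>x\<close> preserves the left and the
  right annihilator of \<open>x ^ p\<close>, so both \<open>y * e\<close> and \<open>e * y\<close>
  equal \<open>e * y * e\<close>.\<close>

lemma drazin_idem_bicommutant:
  fixes x :: "'a::{ring, monoid_mult}"
  assumes e: "drazin_idem p x e"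
  shows "e \<in> bicommutant {x}"
proof (rule bicommutantI)
  fix y assume "\<And>z. z \<in> {x} \<Longrightarrow> y * z = z * y"
  then have xy: "x ^ p * y = y * x ^ p" by (metis power_commuting_commutes singletonI)
  have "x ^ p * (y * e) = 0" using e xy by (metis drazin_idem_def mult.assoc mult_zero_right)
  then have 1: "e * (y * e) = y * e" by (rule drazin_idem_annihilator[OF e])
  have "e * y * x ^ p = 0"
    using xy drazin_idem_power_left[OF e] by (metis mult.assoc mult_zero_left)
  then have "e * y * e = e * y" by (rule drazin_idem_annihilator[OF e])
  then show "e * y = y * e" using 1 by (simp add: mult.assoc)
qed

lemma bicommutant_mono: "S \<subseteq> bicommutant T \<Longrightarrow> bicommutant S \<subseteq> bicommutant T"
  by (force intro!: bicommutantI dest: bicommutantD)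

lemma bicommutant_inverse:
  assumes "x \<in> bicommutant S" "x * y = 1" "y * x = 1"
  shows "y \<in> bicommutant S"
proof (rule bicommutantI)
  fix z assume "\<And>w. w \<in> S \<Longrightarrow> z * w = w * z"
  then have "x * z = z * x" by (rule bicommutantD[OF assms(1)])
  then show "y * z = z * y" using assms by (metis mult.assoc mult_1_left mult_1_right)
qed

lemma drazin_idem_imp_elem:
  fixes x :: "'a::{ring, monoid_mult}"
  assumes e: "drazin_idem p x e"
  obtains y where "y \<in> bicommutant {x}" "x ^ p = x ^ Suc p * y"
proof -
  have ee: "e * e = e" and ex: "e * x = x * e" and pe: "x ^ p * e = 0" using e by (auto simp: drazin_idem_def)
  let ?v = "x * (1 - e) + e"
  obtain w where w: "?v * w = 1" "w * ?v = 1"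
    using e by (auto simp: drazin_idem_def invertible_elem_def)
  have v: "?v \<in> bicommutant {x}"
  proof (rule bicommutantI)
    fix z assume z: "\<And>w. w \<in> {x} \<Longrightarrow> z * w = w * z"
    then have "e * z = z * e" by (rule bicommutantD[OF drazin_idem_bicommutant[OF e]])
    moreover have "x * z = z * x" using z by simp
    ultimately show "?v * z = z * ?v"
      by (simp add: distrib_left distrib_right left_diff_distrib right_diff_distrib mult.assoc) (metis mult.assoc)
  qed
  have w': "w \<in> bicommutant {x}" by (rule bicommutant_inverse[OF v w])
  have "(1 - e) * w \<in> bicommutant {x}"
  proof (rule bicommutantI)
    fix z assume z: "\<And>w. w \<in> {x} \<Longrightarrow> z * w = w * z"
    have "e * z = z * e" by (rule bicommutantD[OF drazin_idem_bicommutant[OF e] z])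
    moreover have "w * z = z * w" by (rule bicommutantD[OF w' z])
    ultimately show "(1 - e) * w * z = z * ((1 - e) * w)"
      by (simp add: left_diff_distrib right_diff_distrib mult.assoc) (metis mult.assoc)
  qed
  moreover have "x ^ p = x ^ Suc p * ((1 - e) * w)"
  proof -
    have "(1 - e) * ?v = x * (1 - e)"
      using ee ex by (simp add: algebra_simps mult.assoc[symmetric])
    then have "x * (1 - e) * w = 1 - e" using w by (metis mult.assoc mult_1_right)
    then have "x ^ p * (x * (1 - e) * w) = x ^ p" using pe by (simp only: right_diff_distrib mult_1_right diff_zero)
    moreover have "x ^ Suc p * ((1 - e) * w) = x ^ p * (x * (1 - e) * w)"
      by (simp only: power_Suc2 mult.assoc)
    ultimately show ?thesis by simp
  qed
  ultimately show thesis by (rule that)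
qed

lemma drazin_idem_elem:
  fixes x :: "'a::{ring, monoid_mult}"
  assumes "drazin_idem p x e"
  shows "drazin_elem p x"
proof -
  obtain y where y: "y \<in> bicommutant {x}" "x ^ p = x ^ Suc p * y"
    using drazin_idem_imp_elem[OF assms] by blast
  have "y * x = x * y" by (rule bicommutantD[OF y(1)]) simp
  then show ?thesis unfolding drazin_elem_def using y(2) by metis
qed

lemma drazin_idem_invertible_iff:
  assumes "drazin_idem p x e"
  shows "invertible_elem x \<longleftrightarrow> e = 0"
proof
  assume "invertible_elem x"
  then obtain y where "y * x = 1" "x * y = 1" by (auto simp: invertible_elem_def)
  then have "y ^ p * x ^ p = 1" using power_mult_commuting[of y x p] by simp
  then show "e = 0" using assms unfolding drazin_idem_def by (metis mult.assoc mult_1_left mult_zero_right)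
qed (use assms in \<open>simp add: drazin_idem_def\<close>)

lemma drazin_elem_0: "drazin_elem 0 x \<longleftrightarrow> invertible_elem x"
  by (simp add: drazin_elem_def invertible_elem_def) metis

lemma drazin_elem_mono:
  assumes "drazin_elem p x" "p \<le> q"
  shows "drazin_elem q x"
proof -
  obtain y where y: "x * y = y * x" "x ^ p = x ^ Suc p * y" using assms(1) by (auto simp: drazin_elem_def)
  have "x ^ q = x ^ (q - p) * x ^ p" using assms(2) by (simp add: power_add[symmetric])
  also have "\<dots> = x ^ (q - p) * (x ^ Suc p * y)" by (simp only: y(2)[symmetric])
  also have "\<dots> = x ^ (q - p + Suc p) * y" by (simp only: power_add mult.assoc)
  also have "q - p + Suc p = Suc q" using assms(2) by simp
  finally have "x ^ q = x ^ Suc q * y" .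
  then show ?thesis unfolding drazin_elem_def using y(1) by metis
qed

text \<open>\<open>d\<close> is the last nonzero element among \<open>e\<close>,
  \<open>x * e\<close>, \<open>x ^ 2 * e\<close> and so on, where \<open>e\<close> is the spectral
  idempotent.\<close>

lemma drazin_noninvertible_zero_divisor:
  fixes x :: "'a::{ring, monoid_mult}"
  assumes "drazin_elem p x" "\<not> invertible_elem x"
  obtains d where "d \<noteq> 0" "x * d = 0" "d * x = 0"
proof -
  obtain e where e: "drazin_idem p x e" using drazin_elem_imp_idem[OF assms(1)] by blast
  then have e0: "e \<noteq> 0" using assms(2) drazin_idem_invertible_iff by blast
  define k where "k = (LEAST k. x ^ k * e = 0)"
  have "x ^ p * e = 0" using e by (simp add: drazin_idem_def)
  then have k: "x ^ k * e = 0" unfolding k_def by (rule LeastI)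
  have "k \<noteq> 0"
  proof
    assume "k = 0"
    then show False using k e0 by simp
  qed
  then obtain j where j: "k = Suc j" by (cases k) auto
  then have "x ^ j * e \<noteq> 0" using not_less_Least[of j "\<lambda>k. x ^ k * e = 0"] k_def by auto
  moreover have xj: "x * (x ^ j * e) = 0" using k by (simp only: j power_Suc mult.assoc)
  moreover have "(x ^ j * e) * x = 0"
  proof -
    have "e * x = x * e" using e by (simp add: drazin_idem_def)
    then have "(x ^ j * e) * x = x ^ j * x * e" by (simp only: mult.assoc)
    also have "\<dots> = x * (x ^ j * e)" by (simp only: power_commutes mult.assoc)
    finally show ?thesis using xj by simp
  qed
  ultimately show thesis by (rule that)
qed

context comm_subalgebra
begin

lemma ideal_congruent_power:
  assumes I: "ideal I" and x: "x \<in> C" "x - s *\<^sub>C 1 \<in> I"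
  shows "x ^ n - (s ^ n) *\<^sub>C 1 \<in> I"
proof (induction n)
  case (Suc n)
  have "x * (x ^ n - (s ^ n) *\<^sub>C 1) + (s ^ n) *\<^sub>C (x - s *\<^sub>C 1) \<in> I"
    by (intro ideal_add[OF I] ideal_mult[OF I] ideal_scale[OF I] Suc x)
  then show ?case
    by (simp add: right_diff_distrib complex_vector.scale_right_diff_distrib scaleC_mult_right mult.commute)
qed (use ideal_zero[OF I] in \<open>simp add: scaleC_one\<close>)

text \<open>A binomial expansion in disguise: splitting off one factor \<open>n + m\<close> replaces
  \<open>z\<close> by \<open>n * z\<close> or \<open>m * z\<close> and lowers \<open>p\<close> or
  \<open>q\<close>, so the induction leaves \<open>z\<close> arbitrary.\<close>

lemma sum_power_annihilates:
  assumes "n \<in> C" "m \<in> C"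
  shows "n ^ p * z = 0 \<Longrightarrow> m ^ q * z = 0 \<Longrightarrow> (n + m) ^ (p + q) * z = 0"
proof (induction "p + q" arbitrary: p q z)
  case (Suc k)
  have nm: "n * m = m * n" using comm assms by blast
  show ?case
  proof (cases "p = 0 \<or> q = 0")
    case True
    then show ?thesis using Suc.prems by (auto simp del: power_Suc)
  next
    case False
    then obtain p' q' where p: "p = Suc p'" and q: "q = Suc q'" by (metis not0_implies_Suc)
    have mn: "m ^ q * n = n * m ^ q" "n ^ p * m = m * n ^ p"
      using power_commuting_commutes[of m n q] power_commuting_commutes[of n m p] nm by simp_all
    have "n ^ p' * (n * z) = 0"
      using Suc.prems(1) by (simp add: p power_commutes mult.assoc[symmetric])
    moreover have "m ^ q * (n * z) = n * (m ^ q * z)"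
      by (simp only: mn mult.assoc[symmetric])
    ultimately have 1: "(n + m) ^ (p' + q) * (n * z) = 0"
      using Suc.prems(2) Suc.hyps(2) by (intro Suc.hyps(1)) (simp_all add: p)
    have "m ^ q' * (m * z) = 0"
      using Suc.prems(2) by (simp add: q power_commutes mult.assoc[symmetric])
    moreover have "n ^ p * (m * z) = m * (n ^ p * z)"
      by (simp only: mn mult.assoc[symmetric])
    ultimately have 2: "(n + m) ^ (p + q') * (m * z) = 0"
      using Suc.prems(1) Suc.hyps(2) by (intro Suc.hyps(1)) (simp_all add: q)
    have "(n + m) ^ (p + q) * z = (n + m) ^ (p' + q) * ((n + m) * z)"
      by (simp add: p power_commutes mult.assoc[symmetric])
    also have "\<dots> = (n + m) ^ (p' + q) * (n * z) + (n + m) ^ (p + q') * (m * z)"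
      by (simp add: distrib_left distrib_right[of n m z] p q)
    finally show ?thesis by (simp only: 1 2 add_0_left)
  qed
qed simp

text \<open>Modulo an ideal containing \<open>x\<close> the invertible element
  \<open>x * (1 - e) + e\<close> is congruent to \<open>e\<close>, and an invertible idempotent is
  \<open>1\<close>.\<close>

lemma ideal_idem_mem:
  assumes I: "ideal I" "1 \<notin> I" and x: "x \<in> I" and e: "drazin_idem p x e" "e \<in> C"
  shows "1 - e \<in> I"
proof -
  have xC: "x \<in> C" using ideal_subset I(1) x by blast
  let ?v = "x * (1 - e) + e"
  obtain w where w: "?v * w = 1" "w * ?v = 1"
    using e by (auto simp: drazin_idem_def invertible_elem_def)
  have "?v \<in> C" by (intro add mult diff one xC e)
  then have wC: "w \<in> C" using w by (rule inv)
  have "(1 - e) * ?v = x * (1 - e)"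
    using e by (simp add: drazin_idem_def algebra_simps mult.assoc[symmetric])
  then have "1 - e = x * (1 - e) * w" using w by (metis mult.assoc mult_1_right)
  then show ?thesis
    using ideal_mult'[OF I(1) _ ideal_mult'[OF I(1) _ x]] wC e diff[OF one] by metis
qed

end

text \<open>Put \<open>x = a - s\<close>. At a small spectral point \<open>\<mu> \<noteq> 0\<close>
  of \<open>x\<close> there is a proper ideal modulo which \<open>x\<close> is \<open>\<mu>\<close>;
  then \<open>x ^ p * e = 0\<close> makes \<open>e\<close> vanish, and
  \<open>v = x * (1 - e) + e\<close> is \<open>\<mu>\<close> as well. But \<open>v\<close> is
  invertible, so its spectrum avoids a disc about \<open>0\<close>, and the radius of that disc is
  the \<open>d\<close> obtained.\<close>

lemma drazin_isolated:
  fixes a :: "'a::cbanach_algebra"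
  assumes "drazin_elem p (a - s *\<^sub>C 1)"
  obtains d where "0 < d" "\<And>s'. s' \<noteq> s \<Longrightarrow> cmod (s - s') < d \<Longrightarrow> s' \<notin> spec a"
proof -
  define x where "x = a - s *\<^sub>C 1"
  obtain e where e: "drazin_idem p x e" using drazin_elem_imp_idem assms x_def by metis
  interpret comm_subalgebra "bicommutant {x}" by (rule comm_subalgebra_bicommutant) simp
  have xC: "x \<in> bicommutant {x}" by (intro bicommutant_superset) simp
  have eC: "e \<in> bicommutant {x}" by (rule drazin_idem_bicommutant[OF e])
  define v where "v = x * (1 - e) + e"
  have "0 \<notin> spec v" using e by (simp add: drazin_idem_def v_def spec_def)
  then obtain d where d: "0 < d" "\<And>\<mu>. cmod (0 - \<mu>) < d \<Longrightarrow> \<mu> \<notin> spec v"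
    using spec_complement_open by blast
  show thesis
  proof (rule that[OF d(1)])
    fix s' assume s': "s' \<noteq> s" "cmod (s - s') < d"
    define \<mu> where "\<mu> = s' - s"
    show "s' \<notin> spec a"
    proof
      assume "s' \<in> spec a"
      moreover have "x - \<mu> *\<^sub>C 1 = a - s' *\<^sub>C 1"
        by (simp add: x_def \<mu>_def complex_vector.scale_left_diff_distrib)
      ultimately have ninv: "\<not> invertible_elem (x - \<mu> *\<^sub>C 1)" by (simp add: spec_def)
      let ?I = "{c * (x - \<mu> *\<^sub>C 1) | c. c \<in> bicommutant {x}}"
      have I: "ideal ?I" "1 \<notin> ?I"
        by (rule ideal_principal[OF shift[OF xC]], rule principal_proper[OF shift[OF xC] ninv])
      have xI: "x - \<mu> *\<^sub>C 1 \<in> ?I" using one by (intro CollectI exI[of _ 1]) simp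
      have "(x ^ p - (\<mu> ^ p) *\<^sub>C 1) * e \<in> ?I"
        by (intro ideal_mult'[OF I(1)] ideal_congruent_power[OF I(1)] xC xI eC)
      moreover have "(x ^ p - (\<mu> ^ p) *\<^sub>C 1) * e = - (\<mu> ^ p) *\<^sub>C e"
        using e by (simp add: drazin_idem_def left_diff_distrib scaleC_mult_left)
      ultimately have "- (\<mu> ^ p) *\<^sub>C e \<in> ?I" by simp
      then have "inverse (- (\<mu> ^ p)) *\<^sub>C - (\<mu> ^ p) *\<^sub>C e \<in> ?I"
        by (rule ideal_scale[OF I(1)])
      moreover have "\<mu> \<noteq> 0" using s' by (simp add: \<mu>_def)
      ultimately have eI: "e \<in> ?I" by (simp add: scaleC_one)
      have "v - \<mu> *\<^sub>C 1 = (x - \<mu> *\<^sub>C 1) + (1 - x) * e"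
        by (simp add: v_def algebra_simps)
      also have "\<dots> \<in> ?I"
        by (intro ideal_add[OF I(1)] ideal_mult[OF I(1)] xI eI diff one xC)
      finally have "\<not> invertible_elem (v - \<mu> *\<^sub>C 1)" using ideal_not_invertible[OF I] by blast
      then show False using d(2)[of \<mu>] s' by (simp add: spec_def \<mu>_def norm_minus_commute)
    qed
  qed
qed

definition two_sided_ideal :: "'a::ring set \<Rightarrow> bool" where
  "two_sided_ideal F \<longleftrightarrow> 0 \<in> F \<and> (\<forall>x\<in>F. \<forall>y\<in>F. x + y \<in> F) \<and> (\<forall>x\<in>F. \<forall>y. x * y \<in> F \<and> y * x \<in> F)"

text \<open>This ideal contains \<open>1\<close> exactly when \<open>E \<in> F\<close>, which is how
  a failure of \<open>E \<in> F\<close> becomes a proper ideal.\<close>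

lemma (in comm_subalgebra) ideal_transporter:
  assumes "two_sided_ideal F"
  shows "ideal {z \<in> C. z * E \<in> F}"
  using assms by (auto simp: ideal_def two_sided_ideal_def zero distrib_right mult.assoc intro: add mult)

text \<open>The elements annihilated by some product of factors \<open>a - s\<close> form an ideal.
  If it were proper, \<open>a\<close> would be some scalar \<open>s\<close> modulo a larger proper
  ideal \<open>J\<close>; the spectral idempotent of \<open>a - s\<close> is annihilated by a power
  of \<open>a - s\<close>, hence in \<open>J\<close>, and its complement is in \<open>J\<close> as
  well. So \<open>1\<close> is annihilated, which is a polynomial equation for
  \<open>a\<close>.\<close>

lemma drazin_all_algebraic:
  fixes a :: "'a::cbanach_algebra"
  assumes all: "\<And>s. \<exists>p. drazin_elem p (a - s *\<^sub>C 1)"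
  shows "\<exists>ss. prod_list (map (\<lambda>s. a - s *\<^sub>C 1) ss) = 0"
proof (rule ccontr)
  assume no: "\<not> ?thesis"
  interpret comm_subalgebra "bicommutant {a}" by (rule comm_subalgebra_bicommutant) simp
  have aC: "a \<in> bicommutant {a}" by (intro bicommutant_superset) simp
  let ?q = "\<lambda>ss. prod_list (map (\<lambda>s. a - s *\<^sub>C 1) ss)"
  have q: "?q ss \<in> bicommutant {a}" for ss by (induction ss) (auto intro: one mult shift aC)
  let ?I = "{z \<in> bicommutant {a}. \<exists>ss. ?q ss * z = 0}"
  have I: "ideal ?I"
    unfolding ideal_def
  proof (intro conjI ballI)
    fix x y assume "x \<in> ?I" "y \<in> ?I"
    then obtain ss rs where x: "x \<in> bicommutant {a}" "?q ss * x = 0"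
      and y: "y \<in> bicommutant {a}" "?q rs * y = 0" by auto
    have "?q ss * ?q rs * x = ?q rs * (?q ss * x)"
      by (simp only: mult.assoc[symmetric] comm[OF q[of ss] q[of rs]])
    then have "?q (ss @ rs) * (x + y) = 0" by (simp add: distrib_left x y mult.assoc)
    then show "x + y \<in> ?I" using add[OF x(1) y(1)] by blast
  next
    fix x c assume "x \<in> ?I" and c: "c \<in> bicommutant {a}"
    then obtain ss where x: "x \<in> bicommutant {a}" "?q ss * x = 0" by auto
    have "?q ss * (c * x) = c * (?q ss * x)"
      by (simp only: mult.assoc[symmetric] comm[OF q c])
    then show "c * x \<in> ?I" using mult[OF c x(1)] x(2) by auto
  qed (auto simp: zero)
  moreover have "1 \<notin> ?I" using no by simp
  ultimately obtain s J where J: "ideal J" "1 \<notin> J" "?I \<subseteq> J" "a - s *\<^sub>C 1 \<in> J"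
    using aC by (rule proper_ideal_extend)
  obtain p e where e: "drazin_idem p (a - s *\<^sub>C 1) e" using all drazin_elem_imp_idem by metis
  have "bicommutant {a - s *\<^sub>C 1} \<subseteq> bicommutant {a}" using shift[OF aC] by (intro bicommutant_mono) simp
  then have eC: "e \<in> bicommutant {a}" using drazin_idem_bicommutant[OF e(1)] by blast
  have "?q (replicate p s) * e = 0"
    using e by (simp add: drazin_idem_def prod_list_replicate)
  then have "e \<in> J" using J(3) eC by blast
  moreover have "1 - e \<in> J" by (rule ideal_idem_mem[OF J(1,2,4) e(1) eC])
  ultimately have "e + (1 - e) \<in> J" by (intro ideal_add[OF J(1)])
  then show False using J(2) by simp
qed

subsection \<open>Products of two commuting elements\<close>

locale commuting_pair =
  fixes L R :: "'a::cbanach_algebra"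
  assumes LR: "L * R = R * L"
begin

sublocale comm_subalgebra "bicommutant {L, R}"
  by (rule comm_subalgebra_bicommutant) (auto simp: LR)

lemma LC: "L \<in> bicommutant {L, R}" and RC: "R \<in> bicommutant {L, R}"
  by (auto intro: bicommutant_superset)

lemma idem_mem:
  assumes "drazin_idem p (x - s *\<^sub>C 1) e" "x \<in> bicommutant {L, R}"
  shows "e \<in> bicommutant {L, R}"
proof -
  have "bicommutant {x - s *\<^sub>C 1} \<subseteq> bicommutant {L, R}"
    using shift assms(2) by (intro bicommutant_mono) simp
  then show ?thesis using drazin_idem_bicommutant[OF assms(1)] by blast
qed

text \<open>The pair \<open>(s, r)\<close> acts as a point of the joint spectrum of \<open>L\<close>
  and \<open>R\<close>; it lies in the two spectra because proper ideals contain no invertible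
  elements. Properties of \<open>L * R\<close> enter through the choice of \<open>I\<close>.\<close>

lemma joint_spectrum:
  assumes I: "ideal I" "1 \<notin> I"
  obtains s r J where "ideal J" "1 \<notin> J" "I \<subseteq> J" "L - s *\<^sub>C 1 \<in> J" "R - r *\<^sub>C 1 \<in> J"
    "s \<in> spec L" "r \<in> spec R" "L * R - (s * r) *\<^sub>C 1 \<in> J"
proof -
  obtain s J0 where J0: "ideal J0" "1 \<notin> J0" "I \<subseteq> J0" "L - s *\<^sub>C 1 \<in> J0"
    by (rule proper_ideal_extend[OF I LC])
  obtain r J where J: "ideal J" "1 \<notin> J" "J0 \<subseteq> J" "R - r *\<^sub>C 1 \<in> J"
    by (rule proper_ideal_extend[OF J0(1,2) RC])
  have LJ: "L - s *\<^sub>C 1 \<in> J" using J0 J by auto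
  have "(L - s *\<^sub>C 1) * R + s *\<^sub>C (R - r *\<^sub>C 1) \<in> J"
    by (intro ideal_add[OF J(1)] ideal_mult'[OF J(1)] ideal_scale[OF J(1)] RC LJ J(4))
  then have LRJ: "L * R - (s * r) *\<^sub>C 1 \<in> J"
    by (simp add: left_diff_distrib complex_vector.scale_right_diff_distrib scaleC_mult_left)
  have "s \<in> spec L" "r \<in> spec R"
    using ideal_not_invertible[OF J(1,2)] LJ J(4) by (auto simp: spec_def)
  then show thesis using that[OF J(1,2) _ LJ J(4) _ _ LRJ] J0(3) J(3) by blast
qed

lemma congruent_eq:
  assumes J: "ideal J" "1 \<notin> J" and "x - s *\<^sub>C 1 \<in> J" "x - r *\<^sub>C 1 \<in> J"
  shows "s = r"
proof -
  have "(x - r *\<^sub>C 1) - (x - s *\<^sub>C 1) \<in> J" by (intro ideal_diff assms)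
  then have "(s - r) *\<^sub>C 1 \<in> J" by (simp add: complex_vector.scale_left_diff_distrib)
  then show ?thesis using proper_ideal_mult_cancel[OF J] by fastforce
qed

lemma idem_product_congruent:
  assumes J: "ideal J" "1 \<notin> J" "L - s *\<^sub>C 1 \<in> J" "R - r *\<^sub>C 1 \<in> J"
    and e: "drazin_idem p (L - s *\<^sub>C 1) e" and f: "drazin_idem q (R - r *\<^sub>C 1) f"
  shows "e * f \<in> bicommutant {L, R}" "1 - e * f \<in> J"
proof -
  have eC: "e \<in> bicommutant {L, R}" and fC: "f \<in> bicommutant {L, R}"
    using idem_mem e f LC RC by blast+
  show "e * f \<in> bicommutant {L, R}" by (intro mult eC fC)
  have "(1 - e) * f + (1 - f) \<in> J"
    by (intro ideal_add[OF J(1)] ideal_mult'[OF J(1) fC] ideal_idem_mem[OF J(1,2,3) e eC]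
        ideal_idem_mem[OF J(1,2,4) f fC])
  then show "1 - e * f \<in> J" by (simp add: algebra_simps)
qed

lemma spec_product:
  assumes "\<mu> \<in> spec (L * R)"
  obtains s r where "s \<in> spec L" "r \<in> spec R" "s * r = \<mu>"
proof -
  let ?x = "L * R - \<mu> *\<^sub>C 1"
  have xC: "?x \<in> bicommutant {L, R}" by (intro shift mult LC RC)
  have ninv: "\<not> invertible_elem ?x" using assms by (simp add: spec_def)
  let ?I = "{c * ?x | c. c \<in> bicommutant {L, R}}"
  obtain s r J where J: "ideal J" "1 \<notin> J" "?I \<subseteq> J" "L - s *\<^sub>C 1 \<in> J" "R - r *\<^sub>C 1 \<in> J"
    "s \<in> spec L" "r \<in> spec R" "L * R - (s * r) *\<^sub>C 1 \<in> J"
    by (rule joint_spectrum[OF ideal_principal[OF xC] principal_proper[OF xC ninv]])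
  have "?x \<in> ?I" using one by (intro CollectI exI[of _ 1]) simp
  then have "s * r = \<mu>" using congruent_eq[OF J(1,2,8)] J(3) by blast
  then show thesis using that J by blast
qed

lemma product_minus_eq:
  "L * R - (s * r) *\<^sub>C 1 = (L - s *\<^sub>C 1) * R + s *\<^sub>C (R - r *\<^sub>C 1)"
  by (simp add: left_diff_distrib complex_vector.scale_right_diff_distrib scaleC_mult_left)

text \<open>In \<open>L R - s r = (L - s) R + s (R - r)\<close> a power of either summand kills
  \<open>e * f\<close>, and the summands commute.\<close>

lemma idem_product_annihilates:
  assumes e: "drazin_idem p (L - s *\<^sub>C 1) e" and f: "drazin_idem q (R - r *\<^sub>C 1) f"
  shows "(L * R - (s * r) *\<^sub>C 1) ^ (p + q) * (e * f) = 0"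
proof -
  have eC: "e \<in> bicommutant {L, R}" and fC: "f \<in> bicommutant {L, R}"
    using idem_mem[OF e LC] idem_mem[OF f RC] by blast+
  define n where "n = (L - s *\<^sub>C 1) * R"
  define m where "m = s *\<^sub>C (R - r *\<^sub>C 1)"
  have nC: "n \<in> bicommutant {L, R}" and mC: "m \<in> bicommutant {L, R}"
    unfolding n_def m_def by (intro mult shift scale LC RC)+
  have "n ^ p = R ^ p * (L - s *\<^sub>C 1) ^ p"
    unfolding n_def by (metis comm[OF shift[OF LC] RC] power_mult_commuting)
  then have "n ^ p * (e * f) = R ^ p * ((L - s *\<^sub>C 1) ^ p * e) * f" by (simp only: mult.assoc)
  then have ne: "n ^ p * (e * f) = 0" using e by (simp add: drazin_idem_def)
  have m: "m = (s *\<^sub>C 1) * (R - r *\<^sub>C 1)" by (simp add: m_def scaleC_mult_left)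
  have "(s *\<^sub>C 1) * (R - r *\<^sub>C 1) = (R - r *\<^sub>C 1) * (s *\<^sub>C 1)"
    by (simp add: scaleC_mult_left scaleC_mult_right)
  then have "m ^ q = (s *\<^sub>C 1) ^ q * (R - r *\<^sub>C 1) ^ q" unfolding m by (rule power_mult_commuting)
  then have "m ^ q * (e * f) = (s *\<^sub>C 1) ^ q * ((R - r *\<^sub>C 1) ^ q * f) * e"
    by (simp only: mult.assoc comm[OF eC fC])
  then have mf: "m ^ q * (e * f) = 0" using f by (simp add: drazin_idem_def)
  have "(n + m) ^ (p + q) * (e * f) = 0" by (rule sum_power_annihilates[OF nC mC ne mf])
  then show ?thesis unfolding product_minus_eq n_def m_def .
qed

text \<open>The set \<open>I\<close> consists of the \<open>z\<close> for which the Drazin equation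
  of \<open>x\<close> holds after multiplying its left side by \<open>z\<close>; thus
  \<open>1 \<in> I\<close> is the claim. If \<open>I\<close> is proper, a joint spectral point over
  it has \<open>s r = \<mu>\<close>, and the hypothesis on such pairs supplies an element of
  \<open>I\<close> that is \<open>1\<close> modulo the larger ideal.\<close>

lemma drazin_product:
  assumes pairs: "\<And>s r. s \<in> spec L \<Longrightarrow> r \<in> spec R \<Longrightarrow> s * r = \<mu> \<Longrightarrow>
    \<exists>p q. drazin_elem p (L - s *\<^sub>C 1) \<and> drazin_elem q (R - r *\<^sub>C 1)"
  shows "\<exists>p. drazin_elem p (L * R - \<mu> *\<^sub>C 1)"
proof -
  let ?C = "bicommutant {L, R}"
  define x where "x = L * R - \<mu> *\<^sub>C 1"
  have xC: "x \<in> ?C" unfolding x_def by (intro shift mult LC RC)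
  define I where "I = {z \<in> ?C. \<exists>p. \<exists>y\<in>?C. z * x ^ p = x ^ Suc p * y}"
  \<comment> \<open>The exponent can be raised, so two members of \<open>I\<close> may be compared
    at the common exponent \<open>p + q\<close>.\<close>
  have step: "z * x ^ (p + k) = x ^ Suc (p + k) * y" if "z * x ^ p = x ^ Suc p * y" "y \<in> ?C" for z p k y
  proof -
    have "z * x ^ (p + k) = x ^ Suc p * (y * x ^ k)" using that by (simp add: power_add mult.assoc[symmetric])
    also have "y * x ^ k = x ^ k * y" by (intro comm that power xC)
    finally show ?thesis by (simp add: power_add mult.assoc)
  qed
  have I: "ideal I"
    unfolding ideal_def
  proof (intro conjI ballI)
    show "I \<subseteq> ?C" by (auto simp: I_def)
    show "0 \<in> I" unfolding I_def using zero by (auto intro!: exI[of _ 0] bexI[of _ 0])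
  next
    fix u v assume "u \<in> I" "v \<in> I"
    then obtain p y q z where u: "u \<in> ?C" "y \<in> ?C" "u * x ^ p = x ^ Suc p * y"
      and v: "v \<in> ?C" "z \<in> ?C" "v * x ^ q = x ^ Suc q * z" by (auto simp: I_def)
    have "u * x ^ (p + q) = x ^ Suc (p + q) * y" "v * x ^ (p + q) = x ^ Suc (p + q) * z"
      using step[OF u(3,2), of q] step[OF v(3,2), of p] by (simp_all add: add.commute)
    then have "(u + v) * x ^ (p + q) = x ^ Suc (p + q) * (y + z)"
      by (simp add: distrib_left distrib_right del: power_Suc)
    then show "u + v \<in> I" using add u v by (auto simp: I_def)
  next
    fix u c assume "u \<in> I" and c: "c \<in> ?C"
    then obtain p y where u: "u \<in> ?C" "y \<in> ?C" "u * x ^ p = x ^ Suc p * y" by (auto simp: I_def)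
    have "c * u * x ^ p = c * (x ^ Suc p * y)" by (simp add: u mult.assoc)
    also have "\<dots> = x ^ Suc p * (c * y)"
      by (simp only: mult.assoc[symmetric] comm[OF c power[OF xC]])
    finally show "c * u \<in> I" using mult c u by (auto simp: I_def)
  qed
  have "1 \<in> I"
  proof (rule ccontr)
    assume "1 \<notin> I"
    from joint_spectrum[OF I this] obtain s r J
      where J: "ideal J" "1 \<notin> J" "I \<subseteq> J" "L - s *\<^sub>C 1 \<in> J" "R - r *\<^sub>C 1 \<in> J"
        and sr: "s \<in> spec L" "r \<in> spec R" "L * R - (s * r) *\<^sub>C 1 \<in> J" .
    \<comment> \<open>Exponent \<open>0\<close> and \<open>y = 1\<close>. With \<open>x\<close> in
      the ideal, its scalar value \<open>s r - \<mu>\<close> must be \<open>0\<close>.\<close>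
    have "x \<in> I" unfolding I_def using xC one
      by (auto intro!: exI[of _ 0] bexI[of _ 1])
    then have "s * r = \<mu>" using congruent_eq[OF J(1,2) sr(3)] J(3) by (auto simp: x_def)
    then obtain p q where "drazin_elem p (L - s *\<^sub>C 1)" "drazin_elem q (R - r *\<^sub>C 1)"
      using pairs sr by blast
    then obtain e f where e: "drazin_idem p (L - s *\<^sub>C 1) e" and f: "drazin_idem q (R - r *\<^sub>C 1) f"
      using drazin_elem_imp_idem by metis
    note ef = idem_product_congruent[OF J(1,2,4,5) e f]
    have "x ^ (p + q) * (e * f) = 0"
      using idem_product_annihilates[OF e f] \<open>s * r = \<mu>\<close> by (simp add: x_def)
    then have "e * f * x ^ (p + q) = x ^ Suc (p + q) * 0"
      using comm[OF ef(1) power[OF xC]] by simp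
    then have "e * f \<in> I" unfolding I_def using ef(1) zero by blast
    then have "e * f + (1 - e * f) \<in> J" using J(3) ef(2) by (intro ideal_add[OF J(1)]) auto
    then show False using J(2) by simp
  qed
  then obtain p y where y: "y \<in> ?C" "x ^ p = x ^ Suc p * y" by (auto simp: I_def)
  moreover have "x * y = y * x" by (intro comm xC y)
  ultimately show ?thesis unfolding x_def drazin_elem_def by blast
qed

end

text \<open>If \<open>E\<close> were outside \<open>F\<close>, the transporter of \<open>E\<close>
  into \<open>F\<close> would be a proper ideal. But it contains \<open>e * f\<close>, which lies in
  \<open>F\<close> and is \<open>1\<close> modulo the ideal of a joint spectral point.\<close>

lemma (in commuting_pair) browder_product:
  assumes F: "two_sided_ideal F" and E: "drazin_idem p (L * R - \<mu> *\<^sub>C 1) E"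
    and pairs: "\<And>s r. s \<in> spec L \<Longrightarrow> r \<in> spec R \<Longrightarrow> s * r = \<mu> \<Longrightarrow>
      \<exists>p q e f. drazin_idem p (L - s *\<^sub>C 1) e \<and> drazin_idem q (R - r *\<^sub>C 1) f \<and> e * f \<in> F"
  shows "E \<in> F"
proof (rule ccontr)
  let ?C = "bicommutant {L, R}"
  let ?I = "{z \<in> ?C. z * E \<in> F}"
  assume "E \<notin> F"
  then have "1 \<notin> ?I" by simp
  with ideal_transporter[OF F] obtain s r J
    where J: "ideal J" "1 \<notin> J" "?I \<subseteq> J" "L - s *\<^sub>C 1 \<in> J" "R - r *\<^sub>C 1 \<in> J"
      and sr: "s \<in> spec L" "r \<in> spec R" "L * R - (s * r) *\<^sub>C 1 \<in> J"
    by (rule joint_spectrum)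
  have LRC: "L * R \<in> ?C" by (intro mult LC RC)
  have EE: "E * E = E" "(L * R - \<mu> *\<^sub>C 1) ^ p * E = 0" using E by (simp_all add: drazin_idem_def)
  let ?x = "L * R - \<mu> *\<^sub>C 1"
  have xJ: "?x - (s * r - \<mu>) *\<^sub>C 1 \<in> J" using sr(3) by (simp add: complex_vector.scale_left_diff_distrib)
  have xC: "?x \<in> ?C" by (rule shift[OF LRC])
  \<comment> \<open>\<open>?x ^ p * E = 0\<close> puts \<open>?x ^ p\<close> into the ideal, where
    it equals the scalar \<open>(s r - \<mu>) ^ p\<close>; so that scalar is
    \<open>0\<close>.\<close>
  have "?x ^ p \<in> ?I" using power[OF xC] EE(2) F by (simp add: two_sided_ideal_def)
  then have "?x ^ p - (?x ^ p - ((s * r - \<mu>) ^ p) *\<^sub>C 1) \<in> J"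
    using J(3) by (intro ideal_diff[OF J(1)] ideal_congruent_power[OF J(1) xC xJ]) auto
  then have "((s * r - \<mu>) ^ p) *\<^sub>C 1 \<in> J" by simp
  then have "(s * r - \<mu>) ^ p = 0" by (rule proper_ideal_mult_cancel[OF J(1,2)])
  then have "s * r = \<mu>" by simp
  then obtain p q e f where e: "drazin_idem p (L - s *\<^sub>C 1) e" and f: "drazin_idem q (R - r *\<^sub>C 1) f"
    and ef: "e * f \<in> F" using pairs[OF sr(1,2)] by blast
  note ef' = idem_product_congruent[OF J(1,2,4,5) e f]
  have "e * f \<in> ?I" using ef ef'(1) F by (auto simp: two_sided_ideal_def)
  then have "e * f + (1 - e * f) \<in> J" using J(3) ef'(2) by (intro ideal_add[OF J(1)]) auto
  then show False using J(2) by simp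
qed

section \<open>Drazin and Browder spectra of a multiplicative pairing\<close>

lemma power_scaleC: "(c *\<^sub>C x) ^ n = (c ^ n) *\<^sub>C x ^ n" for x :: "'a::cbanach_algebra"
  by (induction n) (simp_all add: scaleC_one scaleC_mult_left scaleC_mult_right mult.commute)

lemma drazin_elem_scaleC:
  fixes x :: "'a::cbanach_algebra"
  assumes "drazin_elem p (c *\<^sub>C x)" "c \<noteq> 0"
  shows "drazin_elem p x"
proof -
  obtain y where y: "c *\<^sub>C x * y = y * c *\<^sub>C x" "(c *\<^sub>C x) ^ p = (c *\<^sub>C x) ^ Suc p * y"
    using assms(1) by (auto simp: drazin_elem_def)
  have 1: "x * (c *\<^sub>C y) = (c *\<^sub>C y) * x" using y(1) by (simp add: scaleC_mult_left scaleC_mult_right)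
  have "(c ^ p) *\<^sub>C x ^ p = (c ^ p) *\<^sub>C (x ^ Suc p * (c *\<^sub>C y))"
    using y(2) by (simp add: power_scaleC scaleC_mult_left scaleC_mult_right mult.commute del: power_Suc)
       (simp add: mult.commute scaleC_mult_left)
  then have "x ^ p = x ^ Suc p * (c *\<^sub>C y)" using assms(2) by simp
  with 1 show ?thesis unfolding drazin_elem_def by blast
qed

definition drazin_spec :: "'a::cbanach_algebra \<Rightarrow> complex set" where
  "drazin_spec x = {s. \<forall>p. \<not> drazin_elem p (x - s *\<^sub>C 1)}"

text \<open>With \<open>F\<close> the finite-rank operators this is the Browder spectrum. The ideal
  is a parameter so that the opposite algebra fits the same theory.\<close>

definition browder_spec :: "'a::cbanach_algebra set \<Rightarrow> 'a \<Rightarrow> complex set" where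
  "browder_spec F x = {s. \<forall>p e. drazin_idem p (x - s *\<^sub>C 1) e \<longrightarrow> e \<notin> F}"

lemma drazin_spec_subset: "drazin_spec x \<subseteq> spec x"
  by (auto simp: drazin_spec_def spec_def drazin_elem_0[symmetric])

text \<open>\<open>bounds_left\<close> and \<open>bounds_right\<close> hold in algebras of all
  bounded operators but not in general Banach algebras: in the disc algebra the coordinate function
  satisfies both inequalities with \<open>p = 0\<close> and is not invertible. They are what brings
  Drazin invertibility down from \<open>'w\<close> to the factors.\<close>

locale algebra_tensor =
  fixes tens :: "'a::cbanach_algebra \<Rightarrow> 'b::cbanach_algebra \<Rightarrow> 'w::cbanach_algebra"  (infixl \<open>\<odot>\<close> 75)
  assumes add_left: "(a + a') \<odot> b = a \<odot> b + a' \<odot> b"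
    and add_right: "a \<odot> (b + b') = a \<odot> b + a \<odot> b'"
    and scale_left: "(c *\<^sub>C a) \<odot> b = c *\<^sub>C (a \<odot> b)"
    and scale_right: "a \<odot> (c *\<^sub>C b) = c *\<^sub>C (a \<odot> b)"
    and mult_tens: "(a \<odot> b) * (a' \<odot> b') = (a * a') \<odot> (b * b')"
    and one_tens: "1 \<odot> 1 = 1"
    and norm_tens: "norm (a \<odot> b) = norm a * norm b"
    and nontrivial: "(1::'a) \<noteq> 0" "(1::'b) \<noteq> 0"
    and bounds_left: "\<And>p K (x::'a). (\<And>c. norm (x ^ p * c) \<le> K * norm (x ^ Suc p * c)) \<Longrightarrow>
        (\<And>c. norm (c * x ^ p) \<le> K * norm (c * x ^ Suc p)) \<Longrightarrow> drazin_elem p x"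
    and bounds_right: "\<And>p K (x::'b). (\<And>c. norm (x ^ p * c) \<le> K * norm (x ^ Suc p * c)) \<Longrightarrow>
        (\<And>c. norm (c * x ^ p) \<le> K * norm (c * x ^ Suc p)) \<Longrightarrow> drazin_elem p x"
begin

text \<open>The axioms are symmetric in the two factors, so every statement about the left factor
  transfers to the right one.\<close>

lemma flip: "algebra_tensor (\<lambda>b a. a \<odot> b)"
proof (unfold_locales, goal_cases)
  case (7 a b)
  show ?case by (simp add: norm_tens mult.commute)
next
  case (10 p K x)
  then show ?case by (rule bounds_right)
next
  case (11 p K x)
  then show ?case by (rule bounds_left)
qed (simp_all add: add_left add_right scale_left scale_right mult_tens one_tens nontrivial)

lemma zero_left: "0 \<odot> b = 0" and zero_right: "a \<odot> 0 = 0"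
  using norm_tens[of 0 b] norm_tens[of a 0] by simp_all

lemma diff_left: "(a - a') \<odot> b = a \<odot> b - a' \<odot> b"
  using add_left[of "a - a'" a' b] by simp

lemma diff_right: "a \<odot> (b - b') = a \<odot> b - a \<odot> b'"
  using add_right[of a "b - b'" b'] by simp

lemma power_tens: "(a \<odot> b) ^ n = (a ^ n) \<odot> (b ^ n)"
  by (induction n) (simp_all add: one_tens mult_tens)

lemma shift_left: "(a - s *\<^sub>C 1) \<odot> 1 = a \<odot> 1 - s *\<^sub>C 1"
  by (simp add: diff_left scale_left one_tens)

lemma shift_right: "1 \<odot> (b - s *\<^sub>C 1) = 1 \<odot> b - s *\<^sub>C 1"
  by (simp add: diff_right scale_right one_tens)

lemma commuting_pair: "commuting_pair (a \<odot> 1) (1 \<odot> b)"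
  by unfold_locales (simp add: mult_tens)

lemma tens_eq: "a \<odot> b = (a \<odot> 1) * (1 \<odot> b)"
  by (simp add: mult_tens)

lemma invertible_left: "invertible_elem a \<Longrightarrow> invertible_elem (a \<odot> 1)"
  unfolding invertible_elem_def by (metis mult_tens one_tens mult_1_left)

lemma spec_left: "spec (a \<odot> 1) \<subseteq> spec a"
  using invertible_left by (auto simp: spec_def shift_left[symmetric])

lemma drazin_idem_left: "drazin_idem p x e \<Longrightarrow> drazin_idem p (x \<odot> 1) (e \<odot> 1)"
proof -
  assume e: "drazin_idem p x e"
  have "1 - e \<odot> 1 = (1 - e) \<odot> 1" by (simp add: diff_left one_tens)
  then have "(x \<odot> 1) * (1 - e \<odot> 1) + e \<odot> 1 = (x * (1 - e) + e) \<odot> 1"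
    by (simp add: mult_tens add_left)
  then show ?thesis
    using e invertible_left[of "x * (1 - e) + e"]
    by (simp add: drazin_idem_def mult_tens power_tens zero_left)
qed

lemma drazin_elem_left: "drazin_elem p x \<Longrightarrow> drazin_elem p (x \<odot> 1)"
  by (metis drazin_elem_imp_idem drazin_idem_left drazin_idem_elem)

lemmas spec_right = algebra_tensor.spec_left[OF flip]
  and drazin_idem_right = algebra_tensor.drazin_idem_left[OF flip]
  and drazin_elem_right = algebra_tensor.drazin_elem_left[OF flip]

lemma drazin_elem_norm_bound:
  fixes x :: "'c::cbanach_algebra"
  assumes "drazin_elem p x"
  obtains K where "0 \<le> K" "\<And>w. norm (x ^ p * w) \<le> K * norm (x ^ Suc p * w)"
    "\<And>w. norm (w * x ^ p) \<le> K * norm (w * x ^ Suc p)"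
proof -
  obtain y where y: "x * y = y * x" "x ^ p = x ^ Suc p * y" using assms by (auto simp: drazin_elem_def)
  have "x ^ Suc p * y = y * x ^ Suc p" using y(1) by (rule power_commuting_commutes)
  with y(2) have y2: "x ^ p = y * x ^ Suc p" by (rule trans)
  show thesis
  proof (rule that[of "norm y"])
    fix w
    have "norm (x ^ p * w) = norm (y * (x ^ Suc p * w))" by (simp only: y2 mult.assoc)
    then show "norm (x ^ p * w) \<le> norm y * norm (x ^ Suc p * w)" by (simp only: norm_mult_le)
    have "norm (w * x ^ p) = norm ((w * x ^ Suc p) * y)" by (simp only: y(2)[symmetric] mult.assoc)
    then show "norm (w * x ^ p) \<le> norm y * norm (w * x ^ Suc p)"
      using norm_mult_le[of "w * x ^ Suc p" y] by (simp only: mult.commute)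
  qed simp
qed

text \<open>The norm bounds for \<open>a \<odot> b\<close> are tested on \<open>c \<odot> 1\<close>,
  where the norms of the powers of \<open>b\<close> split off as constants. The one on the smaller
  side has to be cancelled, hence \<open>b ^ p \<noteq> 0\<close>.\<close>

lemma drazin_left_of_tens:
  assumes T: "drazin_elem p (a \<odot> b)" and b: "b ^ p \<noteq> 0"
  shows "drazin_elem p a"
proof -
  obtain K where K: "0 \<le> K" "\<And>w. norm ((a \<odot> b) ^ p * w) \<le> K * norm ((a \<odot> b) ^ Suc p * w)"
    "\<And>w. norm (w * (a \<odot> b) ^ p) \<le> K * norm (w * (a \<odot> b) ^ Suc p)"
    by (rule drazin_elem_norm_bound[OF T]) blast
  let ?K = "K * norm (b ^ Suc p) / norm (b ^ p)"
  have 1: "norm (a ^ p * c) \<le> ?K * norm (a ^ Suc p * c)" for c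
    using K(2)[of "c \<odot> 1"] b
    by (simp add: power_tens mult_tens norm_tens field_simps del: power_Suc)
  have 2: "norm (c * a ^ p) \<le> ?K * norm (c * a ^ Suc p)" for c
    using K(3)[of "c \<odot> 1"] b
    by (simp add: power_tens mult_tens norm_tens field_simps del: power_Suc)
  show ?thesis using 1 2 by (rule bounds_left)
qed

lemma drazin_tens:
  assumes "drazin_elem p a" "drazin_elem q b"
  shows "drazin_elem (p + q) (a \<odot> b)"
proof -
  have "drazin_elem (p + q) a" "drazin_elem (p + q) b"
    using assms by (auto intro: drazin_elem_mono)
  then obtain y z where "a * y = y * a" "a ^ (p + q) = a ^ Suc (p + q) * y"
    "b * z = z * b" "b ^ (p + q) = b ^ Suc (p + q) * z"
    unfolding drazin_elem_def by blast
  then have "(a \<odot> b) * (y \<odot> z) = (y \<odot> z) * (a \<odot> b)"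
    "(a \<odot> b) ^ (p + q) = (a \<odot> b) ^ Suc (p + q) * (y \<odot> z)"
    by (simp_all only: power_tens mult_tens)
  then show ?thesis unfolding drazin_elem_def by blast
qed

text \<open>At a boundary point \<open>\<alpha>\<close> there are unit elements \<open>c\<close>
  with \<open>(a - \<alpha>) c\<close> and \<open>c (a - \<alpha>)\<close> arbitrarily small. On
  \<open>c \<odot> d\<close> the element \<open>a \<odot> b - \<alpha> \<beta>\<close> then acts
  almost like \<open>1 \<odot> u\<close> with \<open>u = \<alpha> (b - \<beta>)\<close>, so its norm
  bounds become norm bounds for \<open>u\<close> in the limit, and \<open>bounds_right\<close>
  applies.\<close>

lemma drazin_right_factor:
  assumes T: "drazin_elem p (a \<odot> b - (\<alpha> * \<beta>) *\<^sub>C 1)"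
    and \<alpha>: "\<alpha> \<in> spec a" "\<And>d. 0 < d \<Longrightarrow> \<exists>s'. s' \<notin> spec a \<and> cmod (\<alpha> - s') < d" "\<alpha> \<noteq> 0"
  shows "drazin_elem p (b - \<beta> *\<^sub>C 1)"
proof -
  interpret commuting_pair "a \<odot> 1" "1 \<odot> b" by (rule commuting_pair)
  let ?C = "bicommutant {a \<odot> 1, 1 \<odot> b}"
  define x where "x = a \<odot> b - (\<alpha> * \<beta>) *\<^sub>C 1"
  define N where "N = (a - \<alpha> *\<^sub>C 1) \<odot> 1"
  define u where "u = \<alpha> *\<^sub>C (b - \<beta> *\<^sub>C 1)"
  define m where "m = 1 \<odot> u"
  have x_eq: "x = N * (1 \<odot> b) + m"
    unfolding x_def N_def m_def u_def shift_left scale_right shift_right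
    using product_minus_eq[of \<alpha> \<beta>] by (simp only: tens_eq[symmetric])
  have NC: "N \<in> ?C" unfolding N_def shift_left by (intro shift LC)
  have mC: "m \<in> ?C" unfolding m_def u_def scale_right shift_right by (intro scale shift RC)
  have xC: "x \<in> ?C" unfolding x_eq by (intro add mult NC mC RC)
  \<comment> \<open>Everything except \<open>m ^ k\<close> carries the factor \<open>N\<close>,
    which is small on \<open>c \<odot> d\<close>. The cofactor stays in the commutative algebra so
    that \<open>N\<close> can be moved to either side.\<close>
  have "\<exists>y\<in>?C. x ^ k = m ^ k + N * y" for k
  proof (induction k)
    case 0
    show ?case using zero by (intro bexI[of _ 0]) auto
  next
    case (Suc k)
    then obtain y where y: "y \<in> ?C" "x ^ k = m ^ k + N * y" by blast
    have "x ^ Suc k = N * ((1 \<odot> b) * x ^ k) + m * x ^ k"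
      by (simp add: x_eq distrib_right mult.assoc)
    also have "m * x ^ k = m ^ Suc k + m * N * y" by (simp add: y(2) distrib_left mult.assoc)
    also have "m * N = N * m" by (rule comm[OF mC NC])
    finally have "x ^ Suc k = m ^ Suc k + N * ((1 \<odot> b) * x ^ k + m * y)"
      by (simp add: distrib_left mult.assoc add_ac)
    moreover have "(1 \<odot> b) * x ^ k + m * y \<in> ?C" by (intro add mult RC power xC mC y)
    ultimately show ?case by blast
  qed
  then obtain Y where Y: "\<And>k. Y k \<in> ?C" "\<And>k. x ^ k = m ^ k + N * Y k" by metis
  have Y': "x ^ k = m ^ k + Y k * N" for k using Y(2)[of k] comm[OF NC Y(1)] by simp
  obtain K where K: "0 \<le> K" "\<And>w. norm (x ^ p * w) \<le> K * norm (x ^ Suc p * w)"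
    "\<And>w. norm (w * x ^ p) \<le> K * norm (w * x ^ Suc p)"
    by (rule drazin_elem_norm_bound[OF T[folded x_def]]) blast
  \<comment> \<open>\<open>D\<close> is independent of \<open>e\<close>, so the error term
    disappears in the limit.\<close>
  have eps: "A \<le> B" if "\<And>e. 0 < e \<Longrightarrow> A \<le> B + e * D" for A B D :: real
  proof (rule field_le_epsilon)
    fix e :: real assume "0 < e"
    have "A \<le> B + e / (\<bar>D\<bar> + 1) * D" using \<open>0 < e\<close> by (intro that) (simp add: add_nonneg_pos)
    also have "e / (\<bar>D\<bar> + 1) * D \<le> e / (\<bar>D\<bar> + 1) * (\<bar>D\<bar> + 1)"
      using \<open>0 < e\<close> by (intro mult_left_mono) (auto simp: add_nonneg_pos)
    finally show "A \<le> B + e" by (simp add: add_nonneg_eq_0_iff)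
  qed
  have combine: "A \<le> K * D + e * (K * M + L)"
    if "0 \<le> K" "A \<le> B + r" "B \<le> K * C" "C \<le> D + t" "r \<le> e * L" "t \<le> e * M"
    for A B C D r t e K L M :: real
  proof -
    have "K * C \<le> K * (D + e * M)" using that by (intro mult_left_mono) auto
    then show ?thesis using that by (simp add: algebra_simps)
  qed
  have 1: "norm (u ^ p * d) \<le> K * norm (u ^ Suc p * d)" for d
  proof (rule eps[where D = "K * (norm (Y (Suc p)) * norm d) + norm (Y p) * norm d"])
    fix e :: real assume "0 < e"
    obtain c where c: "norm c = 1" "norm ((a - \<alpha> *\<^sub>C 1) * c) < e"
      "norm (c * (a - \<alpha> *\<^sub>C 1)) < e"
      by (rule spec_boundary_approx[OF \<alpha>(1,2) \<open>0 < e\<close>])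
    have mk: "norm (m ^ k * (c \<odot> d)) = norm (u ^ k * d)" for k
      by (simp add: m_def power_tens mult_tens norm_tens c)
    have Nk: "norm (Y k * N * (c \<odot> d)) \<le> e * (norm (Y k) * norm d)" for k
    proof -
      have "norm (Y k * N * (c \<odot> d)) \<le> norm (Y k) * norm (N * (c \<odot> d))"
        using norm_mult_le[of "Y k" "N * (c \<odot> d)"] by (simp add: mult.assoc)
      also have "\<dots> \<le> norm (Y k) * (e * norm d)"
        using c by (intro mult_left_mono) (simp_all add: N_def mult_tens norm_tens mult_right_mono)
      finally show ?thesis by (simp only: mult_ac)
    qed
    have "norm (u ^ p * d) \<le> norm (x ^ p * (c \<odot> d)) + norm (Y p * N * (c \<odot> d))"
      using norm_triangle_ineq4[of "x ^ p * (c \<odot> d)" "Y p * N * (c \<odot> d)"] mk[of p]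
      by (simp add: Y'[of p] distrib_right)
    moreover have "norm (x ^ p * (c \<odot> d)) \<le> K * norm (x ^ Suc p * (c \<odot> d))" by (rule K)
    moreover have "norm (x ^ Suc p * (c \<odot> d)) \<le> norm (u ^ Suc p * d) + norm (Y (Suc p) * N * (c \<odot> d))"
      using norm_triangle_ineq[of "m ^ Suc p * (c \<odot> d)" "Y (Suc p) * N * (c \<odot> d)"] mk[of "Suc p"]
      by (simp add: Y'[of "Suc p"] distrib_right del: power_Suc)
    ultimately show "norm (u ^ p * d) \<le> K * norm (u ^ Suc p * d)
        + e * (K * (norm (Y (Suc p)) * norm d) + norm (Y p) * norm d)"
      using Nk[of p] Nk[of "Suc p"] by (intro combine[OF K(1)])
  qed
  have 2: "norm (d * u ^ p) \<le> K * norm (d * u ^ Suc p)" for d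
  proof (rule eps[where D = "K * (norm (Y (Suc p)) * norm d) + norm (Y p) * norm d"])
    fix e :: real assume "0 < e"
    obtain c where c: "norm c = 1" "norm ((a - \<alpha> *\<^sub>C 1) * c) < e"
      "norm (c * (a - \<alpha> *\<^sub>C 1)) < e"
      by (rule spec_boundary_approx[OF \<alpha>(1,2) \<open>0 < e\<close>])
    have mk: "norm ((c \<odot> d) * m ^ k) = norm (d * u ^ k)" for k
      by (simp add: m_def power_tens mult_tens norm_tens c)
    have Nk: "norm ((c \<odot> d) * N * Y k) \<le> e * (norm (Y k) * norm d)" for k
    proof -
      have "norm ((c \<odot> d) * N * Y k) \<le> norm ((c \<odot> d) * N) * norm (Y k)"
        by (rule norm_mult_le)
      also have "\<dots> \<le> (e * norm d) * norm (Y k)"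
        using c by (intro mult_right_mono) (simp_all add: N_def mult_tens norm_tens mult_right_mono)
      finally show ?thesis by (simp only: mult_ac)
    qed
    have "norm (d * u ^ p) \<le> norm ((c \<odot> d) * x ^ p) + norm ((c \<odot> d) * N * Y p)"
      using norm_triangle_ineq4[of "(c \<odot> d) * x ^ p" "(c \<odot> d) * N * Y p"] mk[of p]
      by (simp add: Y(2)[of p] distrib_left mult.assoc)
    moreover have "norm ((c \<odot> d) * x ^ p) \<le> K * norm ((c \<odot> d) * x ^ Suc p)" by (rule K)
    moreover have "norm ((c \<odot> d) * x ^ Suc p) \<le> norm (d * u ^ Suc p) + norm ((c \<odot> d) * N * Y (Suc p))"
      using norm_triangle_ineq[of "(c \<odot> d) * m ^ Suc p" "(c \<odot> d) * N * Y (Suc p)"] mk[of "Suc p"]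
      by (simp add: Y(2)[of "Suc p"] distrib_left mult.assoc del: power_Suc)
    ultimately show "norm (d * u ^ p) \<le> K * norm (d * u ^ Suc p)
        + e * (K * (norm (Y (Suc p)) * norm d) + norm (Y p) * norm d)"
      using Nk[of p] Nk[of "Suc p"] by (intro combine[OF K(1)])
  qed
  have "drazin_elem p u" using 1 2 by (rule bounds_right)
  then show ?thesis unfolding u_def using \<alpha>(3) by (rule drazin_elem_scaleC)
qed

lemmas drazin_right_of_tens = algebra_tensor.drazin_left_of_tens[OF flip]
  and drazin_left_factor = algebra_tensor.drazin_right_factor[OF flip]

text \<open>For \<open>\<alpha> \<beta> \<noteq> 0\<close>, follow the curve \<open>(t \<alpha>, \<beta> / t)\<close> from \<open>t = 1\<close> until one of the two components
  leaves its spectrum; there this component is a boundary point, which forces the other one out of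
  its spectrum if \<open>a \<odot> b - \<alpha> \<beta>\<close> is invertible.\<close>

lemma spec_tens_nonzero:
  assumes \<alpha>: "\<alpha> \<in> spec a" "\<alpha> \<noteq> 0" and \<beta>: "\<beta> \<in> spec b" "\<beta> \<noteq> 0"
  shows "\<alpha> * \<beta> \<in> spec (a \<odot> b)"
proof (rule ccontr)
  assume "\<alpha> * \<beta> \<notin> spec (a \<odot> b)"
  then have T: "drazin_elem 0 (a \<odot> b - (\<alpha> * \<beta>) *\<^sub>C 1)" by (simp add: spec_def drazin_elem_0)
  define f where "f t = complex_of_real t * \<alpha>" for t
  define g where "g t = \<beta> / complex_of_real t" for t
  \<comment> \<open>The parameters at which the curve has left; \<open>t0\<close> below is the exit
    point. There is one because \<open>spec a\<close> is bounded and \<open>f\<close> is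
    not.\<close>
  define G where "G = {t. 1 \<le> t \<and> \<not> (f t \<in> spec a \<and> g t \<in> spec b)}"
  obtain M where M: "\<And>s. s \<in> spec a \<Longrightarrow> cmod s \<le> M"
    using bounded_spec[of a] by (auto simp: bounded_iff)
  have "0 \<le> M" using M[OF \<alpha>(1)] norm_ge_zero order_trans by blast
  define t1 where "t1 = (M + 1) / cmod \<alpha> + 1"
  have t1: "1 \<le> t1" using \<open>0 \<le> M\<close> by (simp add: t1_def)
  then have "cmod (f t1) = t1 * cmod \<alpha>" by (simp add: f_def norm_mult)
  also have "\<dots> = M + 1 + cmod \<alpha>" using \<alpha>(2) by (simp add: t1_def field_simps)
  finally have "M < cmod (f t1)" by (smt (verit) norm_ge_zero)
  then have "t1 \<in> G" using M[of "f t1"] t1 by (auto simp: G_def)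
  then have ne: "G \<noteq> {}" by auto
  have bdd: "bdd_below G" by (rule bdd_belowI[of _ 1]) (simp add: G_def)
  define t0 where "t0 = Inf G"
  have t0: "1 \<le> t0" unfolding t0_def using ne by (intro cInf_greatest) (auto simp: G_def)
  have below: "f t \<in> spec a \<and> g t \<in> spec b" if "1 \<le> t" "t < t0" for t
    using that cInf_lower[OF _ bdd, of t] by (force simp: G_def t0_def)
  have cont: "continuous_on {1..t0} f" "continuous_on {1..t0} g"
    unfolding f_def g_def by (intro continuous_intros; simp)+
  \<comment> \<open>The spectra are closed, so at the infimum itself both components are still
    inside.\<close>
  have at0: "f t0 \<in> spec a \<and> g t0 \<in> spec b"
  proof (cases "t0 = 1")
    case True
    then show ?thesis using \<alpha> \<beta> by (simp add: f_def g_def)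
  next
    case False
    then have lt: "1 < t0" using t0 by simp
    have closure: "t0 \<in> closure {1..<t0}" using lt by simp
    have "f ` closure {1..<t0} \<subseteq> spec a" "g ` closure {1..<t0} \<subseteq> spec b"
      using lt cont below by (intro image_closure_subset closed_spec; auto)+
    then show ?thesis using closure by blast
  qed
  have near: "\<exists>t. t \<in> G \<and> t0 < t \<and> t < t0 + d" if "0 < d" for d
  proof -
    have "Inf G < t0 + d" using that by (simp add: t0_def)
    then obtain t where t: "t \<in> G" "t < t0 + d" using cInf_lessD[OF ne] by blast
    moreover have "t0 \<le> t" unfolding t0_def by (rule cInf_lower[OF t(1) bdd])
    moreover have "t \<noteq> t0" using t(1) at0 by (auto simp: G_def)
    ultimately show ?thesis by force
  qed
  have fg: "f t0 * g t0 = \<alpha> * \<beta>" using t0 by (simp add: f_def g_def)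
  have f_close: "\<exists>d>0. \<forall>t. t0 < t \<and> t < t0 + d \<longrightarrow> cmod (f t0 - f t) < e" if "0 < e" for e
  proof (intro exI[of _ "e / cmod \<alpha>"] conjI allI impI)
    fix t assume t: "t0 < t \<and> t < t0 + e / cmod \<alpha>"
    have "cmod (f t0 - f t) = (t - t0) * cmod \<alpha>"
      using t by (simp add: f_def left_diff_distrib[symmetric] norm_mult of_real_diff[symmetric] del: of_real_diff)
    then show "cmod (f t0 - f t) < e" using t \<alpha>(2) by (simp add: field_simps)
  qed (use that \<alpha> in simp)
  have g_close: "\<exists>d>0. \<forall>t. t0 < t \<and> t < t0 + d \<longrightarrow> cmod (g t0 - g t) < e" if "0 < e" for e
  proof -
    have "isCont g t0" unfolding g_def using t0 by (intro continuous_intros) simp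
    then have "\<exists>d>0. \<forall>t. dist t t0 < d \<longrightarrow> dist (g t) (g t0) < e"
      using that by (simp add: continuous_at_eps_delta)
    then obtain d where d: "0 < d" "\<And>t. dist t t0 < d \<Longrightarrow> dist (g t) (g t0) < e"
      by metis
    have "cmod (g t0 - g t) < e" if "t0 < t" "t < t0 + d" for t
      using d(2)[of t] that by (simp add: dist_norm norm_minus_commute)
    then show ?thesis using d(1) by blast
  qed
  show False
  proof (cases "\<forall>d>0. \<exists>s'. s' \<notin> spec a \<and> cmod (f t0 - s') < d")
    case True
    have "f t0 \<noteq> 0" using t0 \<alpha> by (simp add: f_def)
    then have "drazin_elem 0 (b - g t0 *\<^sub>C 1)"
      using True at0 T by (intro drazin_right_factor[where a = a and \<alpha> = "f t0"]) (auto simp: fg)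
    then show False using at0 by (simp add: spec_def drazin_elem_0)
  next
    case False
    \<comment> \<open>Here \<open>f t\<close> remains in \<open>spec a\<close> for \<open>t\<close>
      slightly larger than \<open>t0\<close>, so at exit parameters near \<open>t0\<close> it is
      \<open>g\<close> that has left; \<open>g t0\<close> is then a boundary point of
      \<open>spec b\<close>.\<close>
    then obtain e where e: "0 < e" "\<And>s'. cmod (f t0 - s') < e \<Longrightarrow> s' \<in> spec a" by blast
    obtain d1 where d1: "0 < d1" "\<And>t. t0 < t \<Longrightarrow> t < t0 + d1 \<Longrightarrow> cmod (f t0 - f t) < e"
      using f_close[OF e(1)] by blast
    have bd: "\<exists>s'. s' \<notin> spec b \<and> cmod (g t0 - s') < d" if d: "0 < d" for d
    proof -
      obtain d2 where d2: "0 < d2" "\<And>t. t0 < t \<Longrightarrow> t < t0 + d2 \<Longrightarrow> cmod (g t0 - g t) < d"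
        using g_close[OF d] by blast
      obtain t where t: "t \<in> G" "t0 < t" "t < t0 + min d1 d2"
        using near[of "min d1 d2"] d1(1) d2(1) by auto
      then have "f t \<in> spec a" using e(2) d1(2)[of t] by auto
      then have "g t \<notin> spec b" using t(1) by (simp add: G_def)
      then show ?thesis using d2(2)[of t] t by auto
    qed
    have "g t0 \<noteq> 0" using t0 \<beta> by (simp add: g_def)
    then have "drazin_elem 0 (a - f t0 *\<^sub>C 1)"
      using bd at0 T by (intro drazin_left_factor[where a = b and \<alpha> = "g t0"]) (auto simp: fg mult.commute[of "g t0"])
    then show False using at0 by (simp add: spec_def drazin_elem_0)
  qed
qed

lemma zero_spec_left: "0 \<in> spec a \<Longrightarrow> 0 \<in> spec (a \<odot> b)"
  using drazin_left_of_tens[of 0 a b] nontrivial by (auto simp: spec_def drazin_elem_0)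

lemma zero_spec_right: "0 \<in> spec b \<Longrightarrow> 0 \<in> spec (a \<odot> b)"
  using drazin_right_of_tens[of 0 a b] nontrivial by (auto simp: spec_def drazin_elem_0)

lemma spec_tens_pair:
  assumes "\<mu> \<in> spec (a \<odot> b)"
  obtains \<alpha> \<beta> where "\<alpha> \<in> spec a" "\<beta> \<in> spec b" "\<alpha> * \<beta> = \<mu>"
proof -
  interpret commuting_pair "a \<odot> 1" "1 \<odot> b" by (rule commuting_pair)
  obtain s r where "s \<in> spec (a \<odot> 1)" "r \<in> spec (1 \<odot> b)" "s * r = \<mu>"
    using assms unfolding tens_eq[of a b] by (rule spec_product)
  then show thesis using that spec_left spec_right by blast
qed

lemma spec_tens_mult:
  assumes "\<alpha> \<in> spec a" "\<beta> \<in> spec b"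
  shows "\<alpha> * \<beta> \<in> spec (a \<odot> b)"
  using spec_tens_nonzero[of \<alpha> a \<beta> b] zero_spec_left[of a b] zero_spec_right[of b a] assms
  by (cases "\<alpha> = 0 \<or> \<beta> = 0") auto

theorem spec_tens: "spec (a \<odot> b) = spec a * spec b"
proof
  show "spec (a \<odot> b) \<subseteq> spec a * spec b"
    by (rule subsetI, erule spec_tens_pair) (auto intro: set_times_intro)
  show "spec a * spec b \<subseteq> spec (a \<odot> b)"
    using spec_tens_mult by (auto elim!: set_times_elim)
qed

lemma drazin_spec_tens_subset:
  "drazin_spec (a \<odot> b) \<subseteq> spec a * drazin_spec b \<union> drazin_spec a * spec b"
proof
  fix \<mu> assume \<mu>: "\<mu> \<in> drazin_spec (a \<odot> b)"
  interpret commuting_pair "a \<odot> 1" "1 \<odot> b" by (rule commuting_pair)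
  show "\<mu> \<in> spec a * drazin_spec b \<union> drazin_spec a * spec b"
  proof (rule ccontr)
    assume no: "\<mu> \<notin> spec a * drazin_spec b \<union> drazin_spec a * spec b"
    have "\<exists>p. drazin_elem p ((a \<odot> 1) * (1 \<odot> b) - \<mu> *\<^sub>C 1)"
    proof (rule drazin_product)
      fix s r assume "s \<in> spec (a \<odot> 1)" "r \<in> spec (1 \<odot> b)" and sr: "s * r = \<mu>"
      then have "s \<in> spec a" "r \<in> spec b" using spec_left spec_right by auto
      then have "s \<notin> drazin_spec a" "r \<notin> drazin_spec b" using no sr by (auto intro: set_times_intro)
      then obtain p q where "drazin_elem p (a - s *\<^sub>C 1)" "drazin_elem q (b - r *\<^sub>C 1)"
        by (auto simp: drazin_spec_def)
      then show "\<exists>p q. drazin_elem p (a \<odot> 1 - s *\<^sub>C 1) \<and> drazin_elem q (1 \<odot> b - r *\<^sub>C 1)"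
        unfolding shift_left[symmetric] shift_right[symmetric]
        using drazin_elem_left drazin_elem_right by blast
    qed
    then show False using \<mu> by (simp add: drazin_spec_def tens_eq[symmetric])
  qed
qed

text \<open>Outside its Drazin spectrum, \<open>a \<odot> b\<close> has at most isolated spectral
  points. Moving \<open>\<alpha>\<close> slightly moves \<open>\<alpha> \<beta>\<close> off the
  spectrum because \<open>\<beta> \<noteq> 0\<close>, so \<open>\<alpha>\<close> is a boundary point
  of \<open>spec a\<close> and the boundary argument applies.\<close>

lemma drazin_right_nonzero:
  assumes T: "\<alpha> * \<beta> \<notin> drazin_spec (a \<odot> b)" and \<alpha>: "\<alpha> \<in> spec a" and \<beta>: "\<beta> \<in> spec b" and nz: "\<alpha> * \<beta> \<noteq> 0"
  shows "\<beta> \<notin> drazin_spec b"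
proof -
  obtain p where p: "drazin_elem p (a \<odot> b - (\<alpha> * \<beta>) *\<^sub>C 1)" using T by (auto simp: drazin_spec_def)
  then obtain d where d: "0 < d" "\<And>s'. s' \<noteq> \<alpha> * \<beta> \<Longrightarrow> cmod (\<alpha> * \<beta> - s') < d \<Longrightarrow> s' \<notin> spec (a \<odot> b)"
    by (rule drazin_isolated) blast
  have "\<exists>s'. s' \<notin> spec a \<and> cmod (\<alpha> - s') < e" if e: "0 < e" for e
  proof -
    define \<delta> where "\<delta> = min e (d / cmod \<beta>) / 2"
    have \<delta>: "0 < \<delta>" "\<delta> < e" "\<delta> * cmod \<beta> < d"
      using e d(1) nz by (auto simp: \<delta>_def min_def field_simps)
    define s' where "s' = \<alpha> + complex_of_real \<delta>"
    have c: "cmod (\<alpha> - s') = \<delta>" using \<delta> by (simp add: s'_def)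
    have "cmod (\<alpha> * \<beta> - s' * \<beta>) < d"
      using c \<delta>(3) by (simp add: left_diff_distrib[symmetric] norm_mult)
    moreover have "s' * \<beta> \<noteq> \<alpha> * \<beta>" using \<delta>(1) nz by (simp add: s'_def)
    ultimately have "s' * \<beta> \<notin> spec (a \<odot> b)" using d(2) by blast
    then have "s' \<notin> spec a" using spec_tens_mult \<beta> by blast
    then show ?thesis using c \<delta>(2) by auto
  qed
  then have "drazin_elem p (b - \<beta> *\<^sub>C 1)"
    using nz by (intro drazin_right_factor[OF p \<alpha>]) auto
  then show ?thesis by (auto simp: drazin_spec_def)
qed

lemma drazin_left_nonzero:
  assumes T: "\<alpha> * \<beta> \<notin> drazin_spec (a \<odot> b)" and \<alpha>: "\<alpha> \<in> spec a" and \<beta>: "\<beta> \<in> spec b" and nz: "\<alpha> * \<beta> \<noteq> 0"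
  shows "\<alpha> \<notin> drazin_spec a"
  using algebra_tensor.drazin_right_nonzero[OF flip, of \<beta> \<alpha> a b] assms by (simp add: mult.commute)

lemma drazin_spec_tens_nonzero:
  assumes "\<mu> \<noteq> 0"
  shows "\<mu> \<in> drazin_spec (a \<odot> b) \<longleftrightarrow> \<mu> \<in> spec a * drazin_spec b \<union> drazin_spec a * spec b"
proof
  assume "\<mu> \<in> spec a * drazin_spec b \<union> drazin_spec a * spec b"
  then obtain \<alpha> \<beta> where "\<mu> = \<alpha> * \<beta>" "\<alpha> \<in> spec a" "\<beta> \<in> spec b" "\<alpha> \<in> drazin_spec a \<or> \<beta> \<in> drazin_spec b"
    using drazin_spec_subset[of a] drazin_spec_subset[of b] unfolding set_times_def by blast
  then show "\<mu> \<in> drazin_spec (a \<odot> b)"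
    using drazin_right_nonzero[of \<alpha> \<beta> a b] drazin_left_nonzero[of \<alpha> \<beta> a b] assms by auto
qed (use drazin_spec_tens_subset in blast)

text \<open>This replaces the product formula at \<open>0\<close>. The powers must not vanish,
  because a nilpotent factor makes the product Drazin invertible whatever the other factor
  is.\<close>

lemma zero_drazin_spec_tens:
  assumes "\<And>n. a ^ n \<noteq> 0" "\<And>n. b ^ n \<noteq> 0"
  shows "0 \<in> drazin_spec (a \<odot> b) \<longleftrightarrow> 0 \<in> drazin_spec a \<or> 0 \<in> drazin_spec b"
  using drazin_left_of_tens drazin_right_of_tens drazin_tens assms
  by (simp add: drazin_spec_def) metis

end

text \<open>The three ideals stand for the finite-rank operators. Zero factors are excluded in
  \<open>tens_mem_iff\<close> since a product with \<open>0\<close> lies in \<open>Fw\<close>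
  whatever the other factor is; properness of \<open>Fa\<close> and \<open>Fb\<close> encodes
  infinite dimension.\<close>

locale algebra_tensor_ideals = algebra_tensor tens
  for tens :: "'a::cbanach_algebra \<Rightarrow> 'b::cbanach_algebra \<Rightarrow> 'w::cbanach_algebra"  (infixl \<open>\<odot>\<close> 75) +
  fixes Fa :: "'a set" and Fb :: "'b set" and Fw :: "'w set"
  assumes ideals: "two_sided_ideal Fa" "two_sided_ideal Fb" "two_sided_ideal Fw"
    and tens_mem_iff: "c \<noteq> 0 \<Longrightarrow> d \<noteq> 0 \<Longrightarrow> c \<odot> d \<in> Fw \<longleftrightarrow> c \<in> Fa \<and> d \<in> Fb"
    and proper: "1 \<notin> Fa" "1 \<notin> Fb"
begin

lemma tens_mem: "c \<in> Fa \<Longrightarrow> d \<in> Fb \<Longrightarrow> c \<odot> d \<in> Fw"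
  using tens_mem_iff[of c d] ideals(3) by (cases "c = 0 \<or> d = 0") (auto simp: zero_left zero_right two_sided_ideal_def)

lemma browder_spec_tens_subset:
  "browder_spec Fw (a \<odot> b) \<subseteq> spec a * browder_spec Fb b \<union> browder_spec Fa a * spec b"
proof
  fix \<mu> assume \<mu>: "\<mu> \<in> browder_spec Fw (a \<odot> b)"
  interpret commuting_pair "a \<odot> 1" "1 \<odot> b" by (rule commuting_pair)
  show "\<mu> \<in> spec a * browder_spec Fb b \<union> browder_spec Fa a * spec b"
  proof (rule ccontr)
    assume no: "\<mu> \<notin> spec a * browder_spec Fb b \<union> browder_spec Fa a * spec b"
    have pairs: "\<exists>p q e f. drazin_idem p (a \<odot> 1 - s *\<^sub>C 1) e \<and> drazin_idem q (1 \<odot> b - r *\<^sub>C 1) f \<and> e * f \<in> Fw"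
      if "s \<in> spec (a \<odot> 1)" "r \<in> spec (1 \<odot> b)" and sr: "s * r = \<mu>" for s r
    proof -
      have "s \<in> spec a" "r \<in> spec b" using spec_left spec_right that by auto
      then have "s \<notin> browder_spec Fa a" "r \<notin> browder_spec Fb b" using no sr by (auto intro: set_times_intro)
      then obtain p q e f where "drazin_idem p (a - s *\<^sub>C 1) e" "e \<in> Fa"
        "drazin_idem q (b - r *\<^sub>C 1) f" "f \<in> Fb"
        by (auto simp: browder_spec_def)
      moreover from this have "(e \<odot> 1) * (1 \<odot> f) \<in> Fw" using tens_mem by (simp add: mult_tens)
      ultimately show ?thesis
        using drazin_idem_left drazin_idem_right unfolding shift_left[symmetric] shift_right[symmetric] by blast
    qed
    have "\<exists>p. drazin_elem p (a \<odot> b - \<mu> *\<^sub>C 1)"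
      unfolding tens_eq[of a b]
      by (rule drazin_product) (use pairs drazin_idem_elem in blast)
    then obtain p E where E: "drazin_idem p (a \<odot> b - \<mu> *\<^sub>C 1) E" using drazin_elem_imp_idem by blast
    then have "E \<in> Fw" using browder_product[OF ideals(3) _ pairs] unfolding tens_eq[of a b] by blast
    then show False using E \<mu> by (auto simp: browder_spec_def)
  qed
qed

lemma annihilated_mem:
  assumes "drazin_idem p x E" "E \<in> Fw" "x ^ n * z = 0"
  shows "z \<in> Fw"
  using drazin_idem_annihilator(1)[OF assms(1,3)] assms(2) ideals(3) by (metis two_sided_ideal_def)

text \<open>If the spectral idempotent were in \<open>Fw\<close>, so would be every element
  annihilated by \<open>a \<odot> b\<close>. A zero divisor \<open>c\<close> of \<open>a\<close>
  gives such an element \<open>c \<odot> 1\<close>, which is not in \<open>Fw\<close> because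
  \<open>1 \<notin> Fb\<close>; if \<open>b ^ p = 0\<close>, a zero divisor of \<open>b\<close>
  serves instead. So \<open>0\<close> needs no case distinction in the Browder formula.\<close>

lemma zero_browder_spec_left:
  assumes a: "0 \<in> spec a"
  shows "0 \<in> browder_spec Fw (a \<odot> b)"
proof (rule ccontr)
  assume "0 \<notin> browder_spec Fw (a \<odot> b)"
  then obtain p E where E: "drazin_idem p (a \<odot> b) E" "E \<in> Fw" by (auto simp: browder_spec_def)
  have T: "drazin_elem p (a \<odot> b)" by (rule drazin_idem_elem[OF E(1)])
  show False
  proof (cases "b ^ p = 0")
    case False
    have "drazin_elem p a" by (rule drazin_left_of_tens[OF T False])
    moreover have "\<not> invertible_elem a" using a by (simp add: spec_def)
    ultimately obtain c where c: "c \<noteq> 0" "a * c = 0" by (rule drazin_noninvertible_zero_divisor)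
    have "(a \<odot> b) ^ 1 * (c \<odot> 1) = 0" using c by (simp add: mult_tens zero_left)
    then have "c \<odot> 1 \<in> Fw" by (rule annihilated_mem[OF E])
    then show False using tens_mem_iff[OF c(1) nontrivial(2)] proper by simp
  next
    case True
    then have "drazin_elem p b" by (auto simp: drazin_elem_def intro: exI[of _ 1])
    moreover have "\<not> invertible_elem b"
    proof
      assume "invertible_elem b"
      then obtain y where "b * y = 1" "y * b = 1" by (auto simp: invertible_elem_def)
      then have "b ^ p * y ^ p = 1" using power_mult_commuting[of b y p] by simp
      then show False using True nontrivial by simp
    qed
    ultimately obtain d where d: "d \<noteq> 0" "b * d = 0" by (rule drazin_noninvertible_zero_divisor)
    have "(a \<odot> b) ^ 1 * (1 \<odot> d) = 0" using d by (simp add: mult_tens zero_right)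
    then have "1 \<odot> d \<in> Fw" by (rule annihilated_mem[OF E])
    then show False using tens_mem_iff[OF nontrivial(1) d(1)] proper by simp
  qed
qed

lemma flip_ideals: "algebra_tensor_ideals (\<lambda>b a. a \<odot> b) Fb Fa Fw"
  by (intro algebra_tensor_ideals.intro flip algebra_tensor_ideals_axioms.intro)
     (use ideals tens_mem_iff proper in auto)

lemmas zero_browder_spec_right = algebra_tensor_ideals.zero_browder_spec_left[OF flip_ideals]

text \<open>\<open>e \<odot> f\<close> is annihilated by a power of
  \<open>a \<odot> b - \<alpha> \<beta>\<close>, so it lies in the part of the idempotent
  \<open>E\<close> and hence in \<open>Fw\<close>. As \<open>e\<close> and \<open>f\<close> are
  nonzero, each must lie in its own ideal.\<close>

lemma browder_factors:
  assumes T: "\<alpha> * \<beta> \<notin> browder_spec Fw (a \<odot> b)" and \<alpha>: "\<alpha> \<in> spec a" and \<beta>: "\<beta> \<in> spec b"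
  shows "\<alpha> \<notin> browder_spec Fa a \<and> \<beta> \<notin> browder_spec Fb b"
proof -
  interpret commuting_pair "a \<odot> 1" "1 \<odot> b" by (rule commuting_pair)
  have nz: "\<alpha> * \<beta> \<noteq> 0"
    using zero_browder_spec_left[of a b] zero_browder_spec_right[of b a] assms by auto
  obtain p E where E: "drazin_idem p (a \<odot> b - (\<alpha> * \<beta>) *\<^sub>C 1) E" "E \<in> Fw"
    using T by (auto simp: browder_spec_def)
  then have "\<alpha> * \<beta> \<notin> drazin_spec (a \<odot> b)" using drazin_idem_elem by (auto simp: drazin_spec_def)
  then have "\<alpha> \<notin> drazin_spec a" "\<beta> \<notin> drazin_spec b"
    using drazin_left_nonzero drazin_right_nonzero \<alpha> \<beta> nz by blast+
  then obtain p q where "drazin_elem p (a - \<alpha> *\<^sub>C 1)" "drazin_elem q (b - \<beta> *\<^sub>C 1)"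
    by (auto simp: drazin_spec_def)
  then obtain e f where e: "drazin_idem p (a - \<alpha> *\<^sub>C 1) e" and f: "drazin_idem q (b - \<beta> *\<^sub>C 1) f"
    using drazin_elem_imp_idem[of p "a - \<alpha> *\<^sub>C 1"] drazin_elem_imp_idem[of q "b - \<beta> *\<^sub>C 1"] by metis
  have "e \<noteq> 0" "f \<noteq> 0"
    using drazin_idem_invertible_iff[OF e] drazin_idem_invertible_iff[OF f] \<alpha> \<beta> by (auto simp: spec_def)
  have "(a \<odot> b - (\<alpha> * \<beta>) *\<^sub>C 1) ^ (p + q) * (e \<odot> f) = 0"
    using idem_product_annihilates[of p \<alpha> "e \<odot> 1" q \<beta> "1 \<odot> f"] drazin_idem_left[OF e] drazin_idem_right[OF f]
    by (simp only: shift_left shift_right mult_tens mult_1_left mult_1_right)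
  then have "e \<odot> f \<in> Fw" by (rule annihilated_mem[OF E])
  then have "e \<in> Fa" "f \<in> Fb" using tens_mem_iff \<open>e \<noteq> 0\<close> \<open>f \<noteq> 0\<close> by blast+
  then show ?thesis using e f by (auto simp: browder_spec_def)
qed

lemma browder_spec_subset:
  fixes x :: "'c::cbanach_algebra"
  assumes "two_sided_ideal F"
  shows "browder_spec F x \<subseteq> spec x"
proof
  fix s assume s: "s \<in> browder_spec F x"
  show "s \<in> spec x"
  proof (rule ccontr)
    assume "s \<notin> spec x"
    then have "drazin_idem 0 (x - s *\<^sub>C 1) 0" by (simp add: spec_def drazin_idem_def)
    then show False using s assms by (auto simp: browder_spec_def two_sided_ideal_def)
  qed
qed

theorem browder_spec_tens:
  "browder_spec Fw (a \<odot> b) = spec a * browder_spec Fb b \<union> browder_spec Fa a * spec b"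
proof
  show "spec a * browder_spec Fb b \<union> browder_spec Fa a * spec b \<subseteq> browder_spec Fw (a \<odot> b)"
  proof
    fix \<mu> assume "\<mu> \<in> spec a * browder_spec Fb b \<union> browder_spec Fa a * spec b"
    then obtain \<alpha> \<beta> where "\<mu> = \<alpha> * \<beta>" "\<alpha> \<in> spec a" "\<beta> \<in> spec b"
      "\<alpha> \<in> browder_spec Fa a \<or> \<beta> \<in> browder_spec Fb b"
      using browder_spec_subset[OF ideals(1), of a] browder_spec_subset[OF ideals(2), of b]
      unfolding set_times_def by blast
    then show "\<mu> \<in> browder_spec Fw (a \<odot> b)" using browder_factors by blast
  qed
qed (rule browder_spec_tens_subset)

end

section \<open>The open mapping theorem\<close>

text \<open>Stated for a map between closed subspaces and as a bound on preimages, since it is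
  applied to restrictions of operators and to sums \<open>T x + g\<close> on closed subspaces of
  product spaces.\<close>

theorem open_mapping_subspace:
  fixes f :: "'a::banach \<Rightarrow> 'b::banach"
  assumes f: "bounded_linear f"
    and M: "subspace M" "closed M" and N: "subspace N" "closed N" and fM: "f ` M = N"
  obtains C where "0 < C" "\<And>y. y \<in> N \<Longrightarrow> \<exists>x\<in>M. f x = y \<and> norm x \<le> C * norm y"
proof -
  interpret f: bounded_linear f by (rule f)
  define T where "T n = closure (f ` (M \<inter> cball 0 (real n)))" for n
  have "f ` (M \<inter> cball 0 (real n)) \<subseteq> N" for n using fM by auto
  then have TN: "T n \<subseteq> N" for n unfolding T_def using N(2) by (rule closure_minimal)
  have N_Un: "N \<subseteq> (\<Union>n. T n)"
  proof
    fix y assume "y \<in> N"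
    then obtain x where x: "x \<in> M" "f x = y" using fM by auto
    obtain n where "norm x \<le> real n" using real_arch_simple by blast
    then have "y \<in> f ` (M \<inter> cball 0 (real n))" using x by auto
    then have "y \<in> T n" unfolding T_def by (rule subsetD[OF closure_subset])
    then show "y \<in> (\<Union>n. T n)" by blast
  qed
  obtain n where n: "top_of_set N interior_of T n \<noteq> {}"
  proof (rule ccontr)
    assume "\<not> thesis"
    then have *: "\<And>n. top_of_set N interior_of T n = {}" using that by blast
    have "top_of_set N interior_of \<Union>(range T) = {}"
    proof (rule Baire_category_alt)
      show "completely_metrizable_space (top_of_set N) \<or> locally_compact_space (top_of_set N) \<and> regular_space (top_of_set N)"
        using N(2) closed_closedin completely_metrizable_space_closedin completely_metrizable_space_euclidean by blast
      show "closedin (top_of_set N) S \<and> top_of_set N interior_of S = {}" if "S \<in> range T" for S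
        using that * TN by (auto simp: T_def intro!: closed_subset)
    qed simp
    moreover have "\<Union>(range T) = N" using N_Un TN by auto
    ultimately have "N = {}" using interior_of_topspace[of "top_of_set N"] by simp
    then show False using subspace_0[OF N(1)] by simp
  qed
  then obtain U y0 where U: "openin (top_of_set N) U" "U \<subseteq> T n" "y0 \<in> U"
    by (auto simp: interior_of_def)
  then obtain r0 where r0: "0 < r0" "ball y0 r0 \<inter> N \<subseteq> U"
    by (meson openin_contains_ball)
  define r where "r = r0 / 2"
  have r: "0 < r" using r0 by (simp add: r_def)
  have y0: "y0 \<in> N" using U openin_imp_subset by blast
  \<comment> \<open>The ball found by Baire's theorem is centred at \<open>y0\<close>. Subtracting
    an approximate preimage of \<open>y0\<close> moves it to \<open>0\<close> and doubles the bound
    to \<open>2 * real n\<close>.\<close>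
  have approx1: "\<exists>x\<in>M. norm x \<le> 2 * real n \<and> norm (y - f x) < e" if y: "y \<in> N" "norm y \<le> r" and e: "0 < e" for y e
  proof -
    have "y0 + y \<in> T n"
      using U r0 r y y0 subspace_add[OF N(1) y0 y(1)] by (auto simp: dist_norm r_def subset_iff)
    then obtain x1 where x1: "x1 \<in> M" "norm x1 \<le> real n" "dist (f x1) (y0 + y) < e / 2"
      using closure_approachable[of "y0 + y"] e unfolding T_def by (fastforce dest!: spec[of _ "e / 2"])
    have "y0 \<in> T n" using U by auto
    then obtain x2 where x2: "x2 \<in> M" "norm x2 \<le> real n" "dist (f x2) y0 < e / 2"
      using closure_approachable[of y0] e unfolding T_def by (fastforce dest!: spec[of _ "e / 2"])
    have "norm (y - f (x1 - x2)) = norm ((y0 + y - f x1) - (y0 - f x2))" by (simp add: f.diff algebra_simps)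
    also have "\<dots> \<le> norm (y0 + y - f x1) + norm (y0 - f x2)" by (rule norm_triangle_ineq4)
    also have "\<dots> < e" using x1 x2 by (simp add: dist_norm norm_minus_commute)
    finally have "norm (y - f (x1 - x2)) < e" .
    moreover have "norm (x1 - x2) \<le> 2 * real n" using norm_triangle_ineq4[of x1 x2] x1 x2 by simp
    ultimately show ?thesis using subspace_diff[OF M(1) x1(1) x2(1)] by blast
  qed
  define K where "K = 2 * real n / r"
  have K: "0 \<le> K" using r by (simp add: K_def)
  have "\<exists>x\<in>M. norm x \<le> K * norm y \<and> norm (y - f x) \<le> norm y / 2" if y: "y \<in> N" for y
  proof (cases "y = 0")
    case True
    then show ?thesis using subspace_0[OF M(1)] by (intro bexI[of _ 0]) (auto simp: f.zero)
  next
    case False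
    define c where "c = r / norm y"
    have c: "0 < c" using r False by (simp add: c_def)
    have "norm (c *\<^sub>R y) \<le> r" using r False by (simp add: c_def)
    then obtain x where x: "x \<in> M" "norm x \<le> 2 * real n" "norm (c *\<^sub>R y - f x) < c * (norm y / 2)"
      using approx1[OF subspace_scale[OF N(1) y], of c "c * (norm y / 2)"] c False by auto
    have "norm (y - f (inverse c *\<^sub>R x)) = inverse c * norm (c *\<^sub>R y - f x)"
    proof -
      have "y - f (inverse c *\<^sub>R x) = inverse c *\<^sub>R (c *\<^sub>R y - f x)"
        using c by (simp add: f.scaleR scaleR_diff_right)
      then show ?thesis using c by simp
    qed
    also have "\<dots> \<le> inverse c * (c * (norm y / 2))" using x c by (intro mult_left_mono) auto
    also have "\<dots> = norm y / 2" using c by (simp add: field_simps)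
    finally have "norm (y - f (inverse c *\<^sub>R x)) \<le> norm y / 2" .
    moreover have "norm (inverse c *\<^sub>R x) \<le> K * norm y"
      using x(2) c r False by (simp add: K_def c_def field_simps mult_right_mono)
    ultimately show ?thesis using subspace_scale[OF M(1) x(1)] by blast
  qed
  then obtain g where g: "\<And>y. y \<in> N \<Longrightarrow> g y \<in> M" "\<And>y. y \<in> N \<Longrightarrow> norm (g y) \<le> K * norm y"
    "\<And>y. y \<in> N \<Longrightarrow> norm (y - f (g y)) \<le> norm y / 2" by metis
  show thesis
  proof (rule that[of "2 * K + 1"])
    show "0 < 2 * K + 1" using K by simp
    fix y assume y: "y \<in> N"
    \<comment> \<open>The residuals \<open>Y k\<close> halve in norm; summing the approximate
      preimages \<open>g (Y k)\<close> gives an exact one of norm at most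
      \<open>2 * K * norm y\<close>. The extra \<open>1\<close> in the constant makes it
      positive.\<close>
    define Y where "Y k = ((\<lambda>z. z - f (g z)) ^^ k) y" for k
    have Y_Suc: "Y (Suc k) = Y k - f (g (Y k))" for k by (simp add: Y_def)
    have YN: "Y k \<in> N" for k
    proof (induction k)
      case (Suc k)
      then have "f (g (Y k)) \<in> N" using g(1) fM by blast
      then show ?case unfolding Y_Suc by (intro subspace_diff[OF N(1)] Suc)
    qed (simp add: Y_def y)
    have Yn: "norm (Y k) \<le> norm y * (1 / 2) ^ k" for k
    proof (induction k)
      case (Suc k)
      have "norm (Y (Suc k)) \<le> norm (Y k) / 2" unfolding Y_Suc by (rule g(3)[OF YN])
      then show ?case using Suc by simp
    qed (simp add: Y_def)
    have gn: "norm (g (Y k)) \<le> K * norm y * (1 / 2) ^ k" for k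
      using g(2)[OF YN[of k]] mult_left_mono[OF Yn[of k] K] by simp
    have sums: "(\<lambda>k. K * norm y * (1 / 2) ^ k) sums (K * norm y * 2)"
      using sums_mult[OF geometric_sums[of "1/2::real"]] by simp
    have summ: "summable (\<lambda>k. norm (g (Y k)))"
      by (rule summable_comparison_test'[OF sums_summable[OF sums], of 0]) (simp add: gn)
    then have sg: "summable (\<lambda>k. g (Y k))" by (rule summable_norm_cancel)
    define x where "x = (\<Sum>k. g (Y k))"
    have lim: "(\<lambda>n. \<Sum>k<n. g (Y k)) \<longlonglongrightarrow> x" unfolding x_def by (rule summable_LIMSEQ[OF sg])
    have "(\<Sum>k<n. g (Y k)) \<in> M" for n by (intro subspace_sum[OF M(1)] g YN)
    then have xM: "x \<in> M" using closed_sequentially[OF M(2) _ lim] by blast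
    have "f (\<Sum>k<n. g (Y k)) = y - Y n" for n
      by (induction n) (simp_all add: f.zero f.add Y_Suc, simp add: Y_def)
    then have "(\<lambda>n. y - Y n) \<longlonglongrightarrow> f x" using f.tendsto[OF lim] by simp
    moreover have "Y \<longlonglongrightarrow> 0"
    proof (rule Lim_null_comparison)
      show "(\<lambda>k. norm y * (1 / 2) ^ k) \<longlonglongrightarrow> 0"
        by (intro tendsto_mult_right_zero LIMSEQ_realpow_zero) simp_all
    qed (simp add: Yn)
    then have "(\<lambda>n. y - Y n) \<longlonglongrightarrow> y - 0" by (intro tendsto_diff tendsto_const)
    ultimately have fx: "f x = y" using LIMSEQ_unique by fastforce
    have "norm x \<le> (\<Sum>k. norm (g (Y k)))" unfolding x_def by (rule summable_norm[OF summ])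
    also have "\<dots> \<le> (\<Sum>k. K * norm y * (1 / 2) ^ k)"
      by (rule suminf_le[OF gn summ sums_summable[OF sums]])
    also have "\<dots> = K * norm y * 2" using sums by (simp add: sums_iff)
    also have "\<dots> \<le> (2 * K + 1) * norm y" by (simp add: algebra_simps)
    finally have "norm x \<le> (2 * K + 1) * norm y" .
    then show "\<exists>x\<in>M. f x = y \<and> norm x \<le> (2 * K + 1) * norm y" using xM fx by blast
  qed
qed

section \<open>Kernels, ranges and bounded inverses of operators\<close>

lemma csubspace_imp_subspace: "complex_vector.subspace M \<Longrightarrow> subspace M"
  unfolding complex_vector.subspace_def subspace_def by (simp add: scaleR_scaleC)

lemma cblinfun_zero [simp]: "cblinfun_apply f 0 = 0"
  by (simp add: linear_0 bounded_linear.linear[OF bounded_linear_cblinfun_apply])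

lemma cblinfun_diff_right: "cblinfun_apply f (x - y) = cblinfun_apply f x - cblinfun_apply f y"
  by (simp add: linear_diff bounded_linear.linear[OF bounded_linear_cblinfun_apply])

lemma cblinfun_sum_right: "cblinfun_apply f (\<Sum>i\<in>I. g i) = (\<Sum>i\<in>I. cblinfun_apply f (g i))"
  by (simp add: linear_sum bounded_linear.linear[OF bounded_linear_cblinfun_apply])

lemma closed_null_space: "closed (null_space T)"
  unfolding null_space_def
  by (intro closed_Collect_eq linear_continuous_on bounded_linear_cblinfun_apply continuous_on_const)

lemma csubspace_null_space: "complex_vector.subspace (null_space T)"
  by (auto intro!: complex_vector.subspaceI simp: null_space_def cblinfun_apply_add_right cblinfun_apply_scaleC_right)

lemma csubspace_image: "complex_vector.subspace M \<Longrightarrow> complex_vector.subspace (cblinfun_apply T ` M)"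
proof (rule complex_vector.subspaceI)
  assume M: "complex_vector.subspace M"
  show "0 \<in> cblinfun_apply T ` M" using complex_vector.subspace_0[OF M] by (force intro: rev_image_eqI)
  fix x y c assume "x \<in> cblinfun_apply T ` M"
  then obtain u where u: "u \<in> M" "x = T u" by auto
  show "c *\<^sub>C x \<in> cblinfun_apply T ` M"
    using complex_vector.subspace_scale[OF M u(1), of c] u(2) by (force simp: cblinfun_apply_scaleC_right)
  assume "y \<in> cblinfun_apply T ` M"
  then obtain v where v: "v \<in> M" "y = T v" by auto
  show "x + y \<in> cblinfun_apply T ` M"
    using complex_vector.subspace_add[OF M u(1) v(1)] u(2) v(2) by (force simp: cblinfun_apply_add_right)
qed

lemma csubspace_range: "complex_vector.subspace (range (cblinfun_apply T))"
  by (rule csubspace_image[OF complex_vector.subspace_UNIV])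

lemma bij_cblinfun_inverse:
  fixes T :: "'a::cbanach \<Rightarrow>\<^sub>C\<^sub>L 'a"
  assumes "bij (cblinfun_apply T)"
  obtains S where "T o\<^sub>C S = id_cblinfun" "S o\<^sub>C T = id_cblinfun"
proof -
  let ?g = "inv (cblinfun_apply T)"
  have Tg: "T (?g y) = y" for y using assms by (simp add: bij_def surj_f_inv_f)
  have gT: "?g (T x) = x" for x using assms by (simp add: bij_def)
  obtain C where C: "0 < C" "\<And>y. \<exists>x. T x = y \<and> norm x \<le> C * norm y"
    using open_mapping_subspace[OF bounded_linear_cblinfun_apply[of T], of UNIV UNIV] bij_is_surj[OF assms]
    by (metis UNIV_I closed_UNIV subspace_UNIV)
  have "norm (?g y) \<le> C * norm y" for y using C(2)[of y] gT by metis
  moreover have "?g (x + y) = ?g x + ?g y" for x y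
    using gT[of "?g x + ?g y"] by (simp add: cblinfun_apply_add_right Tg)
  moreover have "?g (c *\<^sub>C x) = c *\<^sub>C ?g x" for c x
    using gT[of "c *\<^sub>C ?g x"] by (simp add: cblinfun_apply_scaleC_right Tg)
  ultimately obtain S where S: "\<And>x. cblinfun_apply S x = ?g x" using cblinfun_exists by blast
  show thesis
    by (rule that[of S]; rule cblinfun_eqI) (simp_all add: S Tg gT)
qed

section \<open>The Banach algebra of bounded operators\<close>

text \<open>The algebra structure needs a type of its own, because a type class instance of \<open>('a, 'b) cblinfun\<close>
  cannot require \<open>'a = 'b\<close>.\<close>

typedef (overloaded) 'a endo = "UNIV :: ('a::cbanach \<Rightarrow>\<^sub>C\<^sub>L 'a) set"
  morphisms of_endo Endo by simp

setup_lifting type_definition_endo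

instantiation endo :: (cbanach) "{complex_normed_vector, ring, monoid_mult}"
begin

lift_definition norm_endo :: "'a endo \<Rightarrow> real" is norm .
lift_definition minus_endo :: "'a endo \<Rightarrow> 'a endo \<Rightarrow> 'a endo" is "(-)" .
lift_definition uminus_endo :: "'a endo \<Rightarrow> 'a endo" is uminus .
lift_definition zero_endo :: "'a endo" is 0 .
lift_definition one_endo :: "'a endo" is id_cblinfun .
lift_definition plus_endo :: "'a endo \<Rightarrow> 'a endo \<Rightarrow> 'a endo" is "(+)" .
lift_definition times_endo :: "'a endo \<Rightarrow> 'a endo \<Rightarrow> 'a endo" is "(o\<^sub>C)" .
lift_definition scaleC_endo :: "complex \<Rightarrow> 'a endo \<Rightarrow> 'a endo" is "(*\<^sub>C)" .
lift_definition scaleR_endo :: "real \<Rightarrow> 'a endo \<Rightarrow> 'a endo" is "(*\<^sub>R)" .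

definition dist_endo :: "'a endo \<Rightarrow> 'a endo \<Rightarrow> real"
  where "dist_endo a b = norm (a - b)"

definition "(uniformity :: ('a endo \<times> 'a endo) filter) =
  (INF e\<in>{0 <..}. principal {(x, y). dist x y < e})"

definition open_endo :: "'a endo set \<Rightarrow> bool"
  where "open_endo S = (\<forall>x\<in>S. \<forall>\<^sub>F (x', y) in uniformity. x' = x \<longrightarrow> y \<in> S)"

definition sgn_endo :: "'a endo \<Rightarrow> 'a endo"
  where "sgn_endo x = scaleR (inverse (norm x)) x"

instance
proof
  fix f g h :: "'a endo" and a b :: real and c d :: complex
  show "f + g + h = f + (g + h)" "f + g = g + f" "0 + f = f" "- f + f = 0" "f - g = f + - g"
    by (transfer, simp add: add.assoc add.commute)+
  show "a *\<^sub>R (f + g) = a *\<^sub>R f + a *\<^sub>R g" "(a + b) *\<^sub>R f = a *\<^sub>R f + b *\<^sub>R f"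
    "a *\<^sub>R b *\<^sub>R f = (a * b) *\<^sub>R f" "1 *\<^sub>R f = f"
    by (transfer, simp add: scaleR_add_left scaleR_add_right)+
  show "dist f g = norm (f - g)" "sgn f = inverse (norm f) *\<^sub>R f"
    by (rule dist_endo_def, rule sgn_endo_def)
  show "(uniformity :: ('a endo \<times> 'a endo) filter) = (INF e\<in>{0 <..}. principal {(x, y). dist x y < e})"
    by (rule uniformity_endo_def)
  show "open U = (\<forall>x\<in>U. \<forall>\<^sub>F (x', y) in uniformity. x' = x \<longrightarrow> y \<in> U)" for U :: "'a endo set"
    by (rule open_endo_def)
  show "(norm f = 0) = (f = 0)" by transfer simp
  show "norm (f + g) \<le> norm f + norm g" by transfer (rule norm_triangle_ineq)
  show "norm (a *\<^sub>R f) = \<bar>a\<bar> * norm f" by transfer simp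
  show "c *\<^sub>C (f + g) = c *\<^sub>C f + c *\<^sub>C g" by transfer (rule scaleC_add_right)
  show "(c + d) *\<^sub>C f = c *\<^sub>C f + d *\<^sub>C f" by transfer (rule scaleC_add_left)
  show "c *\<^sub>C d *\<^sub>C f = (c * d) *\<^sub>C f" by transfer (rule scaleC_scaleC)
  show "1 *\<^sub>C f = f" by transfer (rule scaleC_one)
  show "a *\<^sub>R f = complex_of_real a *\<^sub>C f" by transfer (rule scaleR_scaleC)
  show "norm (c *\<^sub>C f) = cmod c * norm f" by transfer (rule norm_scaleC)
  show "(f + g) * h = f * h + g * h" "f * (g + h) = f * g + f * h" "f * g * h = f * (g * h)"
    "1 * f = f" "f * 1 = f"
    by (transfer, rule cblinfun_eqI, simp add: cblinfun_apply_add_left cblinfun_apply_add_right)+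
qed

end

instance endo :: (cbanach) cbanach_algebra
proof
  fix f g :: "'a endo" and c :: complex
  show "(c *\<^sub>C f) * g = c *\<^sub>C (f * g)" "f * (c *\<^sub>C g) = c *\<^sub>C (f * g)"
    by (transfer, rule cblinfun_eqI, simp add: cblinfun_apply_scaleC_left cblinfun_apply_scaleC_right)+
  show "norm (f * g) \<le> norm f * norm g" by transfer (rule norm_cblinfun_compose)
  show "norm (1 :: 'a endo) \<le> 1" by transfer (rule norm_cblinfun_bound, simp_all)
next
  fix X :: "nat \<Rightarrow> 'a endo"
  have dist: "dist x y = dist (of_endo x) (of_endo y)" for x y :: "'a endo"
    by (simp add: dist_endo_def dist_norm norm_endo.rep_eq minus_endo.rep_eq)
  assume "Cauchy X"
  then have "Cauchy (\<lambda>n. of_endo (X n))" by (simp add: Cauchy_def dist)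
  then obtain L where "(\<lambda>n. of_endo (X n)) \<longlonglongrightarrow> L" using Cauchy_convergent convergent_def by blast
  then have "X \<longlonglongrightarrow> Endo L" by (simp add: LIMSEQ_def dist Endo_inverse)
  then show "convergent X" by (rule convergentI)
qed

lemma Endo_power: "Endo T ^ n = Endo (T ^\<^sub>C n)"
proof (induction n)
  case 0
  show ?case by (simp add: one_endo_def)
next
  case (Suc n)
  then show ?case by (simp add: times_endo.abs_eq eq_onp_def)
qed

lemma Endo_shift: "Endo T - \<mu> *\<^sub>C 1 = Endo (T - \<mu> *\<^sub>C id_cblinfun)"
  by (simp add: one_endo_def scaleC_endo.abs_eq minus_endo.abs_eq eq_onp_def)

lemma Endo_eq_iff: "Endo S = Endo T \<longleftrightarrow> S = T"
  by (simp add: Endo_inject)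

lemma invertible_Endo_iff:
  "invertible_elem (Endo T) \<longleftrightarrow> (\<exists>S. T o\<^sub>C S = id_cblinfun \<and> S o\<^sub>C T = id_cblinfun)"
  unfolding invertible_elem_def one_endo_def
  by (metis Endo_cases Endo_eq_iff times_endo.abs_eq eq_onp_same_args UNIV_I)

lemma spectrum_eq_spec: "spectrum T = spec (Endo T)"
  by (simp add: spectrum_def spec_def Endo_shift invertible_Endo_iff)

text \<open>The opposite algebra: right multiplications \<open>U \<mapsto> U B\<close> depend on \<open>B\<close> antimultiplicatively.\<close>

typedef (overloaded) 'a opp = "UNIV :: 'a::cbanach_algebra set"
  morphisms of_opp Opp by simp

setup_lifting type_definition_opp

instantiation opp :: (cbanach_algebra) "{complex_normed_vector, ring, monoid_mult}"
begin

lift_definition norm_opp :: "'a opp \<Rightarrow> real" is norm .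
lift_definition minus_opp :: "'a opp \<Rightarrow> 'a opp \<Rightarrow> 'a opp" is "(-)" .
lift_definition uminus_opp :: "'a opp \<Rightarrow> 'a opp" is uminus .
lift_definition zero_opp :: "'a opp" is 0 .
lift_definition one_opp :: "'a opp" is 1 .
lift_definition plus_opp :: "'a opp \<Rightarrow> 'a opp \<Rightarrow> 'a opp" is "(+)" .
lift_definition times_opp :: "'a opp \<Rightarrow> 'a opp \<Rightarrow> 'a opp" is "\<lambda>x y. y * x" .
lift_definition scaleC_opp :: "complex \<Rightarrow> 'a opp \<Rightarrow> 'a opp" is "(*\<^sub>C)" .
lift_definition scaleR_opp :: "real \<Rightarrow> 'a opp \<Rightarrow> 'a opp" is "(*\<^sub>R)" .

definition dist_opp :: "'a opp \<Rightarrow> 'a opp \<Rightarrow> real"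
  where "dist_opp a b = norm (a - b)"

definition "(uniformity :: ('a opp \<times> 'a opp) filter) =
  (INF e\<in>{0 <..}. principal {(x, y). dist x y < e})"

definition open_opp :: "'a opp set \<Rightarrow> bool"
  where "open_opp S = (\<forall>x\<in>S. \<forall>\<^sub>F (x', y) in uniformity. x' = x \<longrightarrow> y \<in> S)"

definition sgn_opp :: "'a opp \<Rightarrow> 'a opp"
  where "sgn_opp x = scaleR (inverse (norm x)) x"

instance
proof
  fix f g h :: "'a opp" and a b :: real and c d :: complex
  show "f + g + h = f + (g + h)" "f + g = g + f" "0 + f = f" "- f + f = 0" "f - g = f + - g"
    by (transfer, simp add: add.assoc add.commute)+
  show "a *\<^sub>R (f + g) = a *\<^sub>R f + a *\<^sub>R g" "(a + b) *\<^sub>R f = a *\<^sub>R f + b *\<^sub>R f"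
    "a *\<^sub>R b *\<^sub>R f = (a * b) *\<^sub>R f" "1 *\<^sub>R f = f"
    by (transfer, simp add: scaleR_add_left scaleR_add_right)+
  show "dist f g = norm (f - g)" "sgn f = inverse (norm f) *\<^sub>R f"
    by (rule dist_opp_def, rule sgn_opp_def)
  show "(uniformity :: ('a opp \<times> 'a opp) filter) = (INF e\<in>{0 <..}. principal {(x, y). dist x y < e})"
    by (rule uniformity_opp_def)
  show "open U = (\<forall>x\<in>U. \<forall>\<^sub>F (x', y) in uniformity. x' = x \<longrightarrow> y \<in> U)" for U :: "'a opp set"
    by (rule open_opp_def)
  show "(norm f = 0) = (f = 0)" by transfer simp
  show "norm (f + g) \<le> norm f + norm g" by transfer (rule norm_triangle_ineq)
  show "norm (a *\<^sub>R f) = \<bar>a\<bar> * norm f" by transfer simp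
  show "c *\<^sub>C (f + g) = c *\<^sub>C f + c *\<^sub>C g" by transfer (rule scaleC_add_right)
  show "(c + d) *\<^sub>C f = c *\<^sub>C f + d *\<^sub>C f" by transfer (rule scaleC_add_left)
  show "c *\<^sub>C d *\<^sub>C f = (c * d) *\<^sub>C f" by transfer (rule scaleC_scaleC)
  show "1 *\<^sub>C f = f" by transfer (rule scaleC_one)
  show "a *\<^sub>R f = complex_of_real a *\<^sub>C f" by transfer (rule scaleR_scaleC)
  show "norm (c *\<^sub>C f) = cmod c * norm f" by transfer (rule norm_scaleC)
  show "(f + g) * h = f * h + g * h" "f * (g + h) = f * g + f * h"
    by (transfer, simp add: distrib_left distrib_right)+
  show "f * g * h = f * (g * h)" by transfer (simp add: mult.assoc)
  show "1 * f = f" "f * 1 = f" by (transfer, simp)+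
qed

end

instance opp :: (cbanach_algebra) cbanach_algebra
proof
  fix f g :: "'a opp" and c :: complex
  show "(c *\<^sub>C f) * g = c *\<^sub>C (f * g)" by transfer (rule scaleC_mult_right)
  show "f * (c *\<^sub>C g) = c *\<^sub>C (f * g)" by transfer (rule scaleC_mult_left)
  show "norm (f * g) \<le> norm f * norm g" by transfer (subst mult.commute, rule norm_mult_le)
  show "norm (1 :: 'a opp) \<le> 1" by transfer (rule norm_one_le)
next
  fix X :: "nat \<Rightarrow> 'a opp"
  have dist: "dist x y = dist (of_opp x) (of_opp y)" for x y :: "'a opp"
    by (simp add: dist_opp_def dist_norm norm_opp.rep_eq minus_opp.rep_eq)
  assume "Cauchy X"
  then have "Cauchy (\<lambda>n. of_opp (X n))" by (simp add: Cauchy_def dist)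
  then obtain L where "(\<lambda>n. of_opp (X n)) \<longlonglongrightarrow> L" using Cauchy_convergent convergent_def by blast
  then have "X \<longlonglongrightarrow> Opp L" by (simp add: LIMSEQ_def dist Opp_inverse)
  then show "convergent X" by (rule convergentI)
qed

lemma Opp_power: "Opp x ^ n = Opp (x ^ n)"
proof (induction n)
  case 0
  show ?case by (simp add: one_opp_def)
next
  case (Suc n)
  then show ?case by (simp add: times_opp.abs_eq eq_onp_def power_commutes)
qed

lemma Opp_shift: "Opp x - \<mu> *\<^sub>C 1 = Opp (x - \<mu> *\<^sub>C 1)"
  by (simp add: one_opp_def scaleC_opp.abs_eq minus_opp.abs_eq eq_onp_def)

lemma invertible_Opp_iff: "invertible_elem (Opp x) \<longleftrightarrow> invertible_elem x"
  unfolding invertible_elem_def one_opp_def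
  by (metis Opp_cases Opp_inject times_opp.abs_eq eq_onp_same_args UNIV_I)

lemma spec_Opp: "spec (Opp x) = spec x"
  by (simp add: spec_def Opp_shift invertible_Opp_iff)

lemma drazin_elem_Opp: "drazin_elem p (Opp x) \<longleftrightarrow> drazin_elem p x"
proof -
  have "drazin_elem p (Opp x) \<longleftrightarrow> (\<exists>y. Opp x * Opp y = Opp y * Opp x \<and> Opp x ^ p = Opp x ^ Suc p * Opp y)"
    unfolding drazin_elem_def by (metis Opp_cases)
  also have "\<dots> \<longleftrightarrow> (\<exists>y. x * y = y * x \<and> x ^ p = y * x ^ Suc p)"
    unfolding Opp_power by (simp add: times_opp.abs_eq eq_onp_def Opp_inject eq_commute del: power_Suc)
  also have "\<dots> \<longleftrightarrow> drazin_elem p x"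
    unfolding drazin_elem_def by (metis power_commuting_commutes)
  finally show ?thesis .
qed

lemma drazin_spec_Opp: "drazin_spec (Opp x) = drazin_spec x"
  by (simp add: drazin_spec_def Opp_shift drazin_elem_Opp)

lemma drazin_idem_Opp: "drazin_idem p (Opp x) (Opp e) \<longleftrightarrow> drazin_idem p x e"
proof -
  have "Opp x * (1 - Opp e) + Opp e = Opp ((1 - e) * x + e)"
    by (simp add: one_opp_def times_opp.abs_eq minus_opp.abs_eq plus_opp.abs_eq eq_onp_def)
  moreover have "(1 - e) * x + e = x * (1 - e) + e" if "e * x = x * e"
    using that by (simp add: algebra_simps)
  moreover have "e * x ^ p = x ^ p * e" if "e * x = x * e"
    using that by (metis power_commuting_commutes)
  ultimately show ?thesis
    unfolding drazin_idem_def Opp_power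
    by (auto simp: times_opp.abs_eq eq_onp_def zero_opp_def Opp_inject invertible_Opp_iff)
qed

lemma browder_spec_Opp: "browder_spec (Opp ` F) (Opp x) = browder_spec F x"
proof -
  have "(\<forall>p e. drazin_idem p (Opp y) e \<longrightarrow> e \<notin> Opp ` F) \<longleftrightarrow> (\<forall>p e. drazin_idem p y e \<longrightarrow> e \<notin> F)" for y
    using drazin_idem_Opp by (metis (mono_tags, lifting) Opp_cases Opp_inject UNIV_I image_iff)
  then show ?thesis by (simp add: browder_spec_def Opp_shift)
qed

section \<open>Ascent, descent and Drazin invertibility of operators\<close>

lemma Endo_mult: "Endo S * Endo T = Endo (S o\<^sub>C T)"
  by (simp add: times_endo.abs_eq eq_onp_def)

lemma cblinfun_power_apply: "cblinfun_apply (T ^\<^sub>C n) x = (cblinfun_apply T ^^ n) x"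
  by (induction n) simp_all

lemma cblinfun_power_add_apply: "cblinfun_apply (T ^\<^sub>C (m + n)) x = (T ^\<^sub>C m) ((T ^\<^sub>C n) x)"
  by (simp add: cblinfun_power_apply funpow_add)

lemma cblinfun_power_commute_apply: "cblinfun_apply (T ^\<^sub>C n) (T x) = T ((T ^\<^sub>C n) x)"
  using cblinfun_power_add_apply[of T n 1 x] cblinfun_power_add_apply[of T 1 n x] by (simp add: add.commute)

lemma range_power_Suc: "range (cblinfun_apply (T ^\<^sub>C Suc n)) = cblinfun_apply T ` range (cblinfun_apply (T ^\<^sub>C n))"
  by (auto simp: image_comp)

lemma range_power_antimono: "m \<le> n \<Longrightarrow> range (cblinfun_apply (T ^\<^sub>C n)) \<subseteq> range (cblinfun_apply (T ^\<^sub>C m))"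
  using cblinfun_power_add_apply[of T m "n - m"] by auto

lemma null_power_mono: "m \<le> n \<Longrightarrow> null_space (T ^\<^sub>C m) \<subseteq> null_space (T ^\<^sub>C n)"
  using cblinfun_power_add_apply[of T "n - m" m] by (auto simp: null_space_def)

lemma null_power_stable:
  assumes "null_space (T ^\<^sub>C n) = null_space (T ^\<^sub>C Suc n)"
  shows "null_space (T ^\<^sub>C (n + k)) = null_space (T ^\<^sub>C n)"
proof (induction k)
  case (Suc k)
  have "x \<in> null_space (T ^\<^sub>C n)" if "x \<in> null_space (T ^\<^sub>C (n + Suc k))" for x
  proof -
    have "(T ^\<^sub>C (n + k)) (T x) = 0"
      using that by (simp add: null_space_def cblinfun_power_commute_apply)
    then have "T x \<in> null_space (T ^\<^sub>C n)" using Suc by (simp add: null_space_def set_eq_iff)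
    then have "x \<in> null_space (T ^\<^sub>C Suc n)" by (simp add: null_space_def cblinfun_power_commute_apply)
    then show ?thesis using assms by simp
  qed
  then show ?case using null_power_mono[of n "n + Suc k" T] by auto
qed simp

lemma range_power_stable:
  assumes "range (cblinfun_apply (T ^\<^sub>C n)) = range (cblinfun_apply (T ^\<^sub>C Suc n))"
  shows "range (cblinfun_apply (T ^\<^sub>C (n + k))) = range (cblinfun_apply (T ^\<^sub>C n))"
proof (induction k)
  case (Suc k)
  then show ?case
    using assms range_power_Suc[of T "n + k"] range_power_Suc[of T n] by simp
qed simp

text \<open>Stability at \<open>n\<close> makes the space the direct sum of \<open>N(T^n)\<close>
  and \<open>R(T^n)\<close>, and the idempotent is the projection onto the kernel along the range.
  Its continuity is the issue, as the range is not known to be closed; it comes from the open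
  mapping theorem for \<open>(x, k) \<mapsto> T^n x + k\<close> on the product of the space with
  \<open>N(T^n)\<close>.\<close>

lemma drazin_idem_of_stable:
  fixes T :: "'a::cbanach \<Rightarrow>\<^sub>C\<^sub>L 'a"
  assumes N: "null_space (T ^\<^sub>C n) = null_space (T ^\<^sub>C Suc n)"
    and R: "range (cblinfun_apply (T ^\<^sub>C n)) = range (cblinfun_apply (T ^\<^sub>C Suc n))"
  obtains e where "drazin_idem n (Endo T) e"
proof -
  let ?N = "null_space (T ^\<^sub>C n)" and ?R = "range (cblinfun_apply (T ^\<^sub>C n))"
  have sN: "complex_vector.subspace ?N" and sR: "complex_vector.subspace ?R"
    by (rule csubspace_null_space, rule csubspace_range)
  have TN: "T x \<in> ?N" if "x \<in> ?N" for x
    using that by (simp add: null_space_def cblinfun_power_commute_apply)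
  have TR: "T x \<in> ?R" if "x \<in> ?R" for x
    using that R range_power_Suc[of T n] by blast
  have NR: "x = 0" if xN: "x \<in> ?N" and xR: "x \<in> ?R" for x
  proof -
    obtain u where u: "x = (T ^\<^sub>C n) u" using xR by auto
    then have "u \<in> null_space (T ^\<^sub>C (n + n))"
      using xN by (simp add: null_space_def cblinfun_power_add_apply)
    then show ?thesis using null_power_stable[OF N] u by (simp add: null_space_def set_eq_iff)
  qed
  have sum: "\<exists>x k. k \<in> ?N \<and> (T ^\<^sub>C n) x + k = z" for z
  proof -
    have "(T ^\<^sub>C n) z \<in> range (cblinfun_apply (T ^\<^sub>C (n + n)))" using range_power_stable[OF R, of n] by auto
    then obtain w where "(T ^\<^sub>C n) z = (T ^\<^sub>C n) ((T ^\<^sub>C n) w)" by (auto simp: cblinfun_power_add_apply)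
    then have "z - (T ^\<^sub>C n) w \<in> ?N" by (simp add: null_space_def cblinfun_diff_right)
    then show ?thesis by (intro exI[of _ w] exI[of _ "z - (T ^\<^sub>C n) w"]) simp
  qed
  define M where "M = {p::'a \<times> 'a. snd p \<in> ?N}"
  define F where "F p = (T ^\<^sub>C n) (fst p) + snd p" for p :: "'a \<times> 'a"
  have M: "M = snd -` ?N" by (auto simp: M_def)
  have bF: "bounded_linear F"
    unfolding F_def by (intro bounded_linear_add bounded_linear_compose[OF bounded_linear_cblinfun_apply]
        bounded_linear_fst bounded_linear_snd)
  have sM: "subspace M"
    using csubspace_imp_subspace[OF sN] unfolding M_def subspace_def by auto
  have cM: "closed M"
    unfolding M by (intro closed_vimage closed_null_space continuous_on_snd continuous_on_id)
  have FM: "F ` M = UNIV"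
  proof -
    have "z \<in> F ` M" for z
    proof -
      obtain x k where "k \<in> ?N" "(T ^\<^sub>C n) x + k = z" using sum by blast
      then show ?thesis by (intro image_eqI[of _ _ "(x, k)"]) (simp_all add: F_def M_def)
    qed
    then show ?thesis by blast
  qed
  obtain C where C: "0 < C" "\<And>y. y \<in> UNIV \<Longrightarrow> \<exists>x\<in>M. F x = y \<and> norm x \<le> C * norm y"
    by (rule open_mapping_subspace[OF bF sM cM subspace_UNIV closed_UNIV FM]) blast
  have "\<exists>k. k \<in> ?N \<and> z - k \<in> ?R \<and> norm k \<le> C * norm z" for z
  proof -
    obtain x where x: "x \<in> M" "F x = z" "norm x \<le> C * norm z" using C(2) by blast
    have "norm (snd x) \<le> C * norm z" using norm_snd_le[of "snd x" "fst x"] x(3) by simp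
    moreover have "z - snd x \<in> ?R" using x(2) by (auto simp: F_def)
    ultimately show ?thesis using x(1) by (auto simp: M_def)
  qed
  then obtain P where P: "\<And>z. P z \<in> ?N" "\<And>z. z - P z \<in> ?R" "\<And>z. norm (P z) \<le> C * norm z"
    by metis
  \<comment> \<open>\<open>P\<close> was obtained by choice; uniqueness of the decomposition makes
    it linear and idempotent and makes it commute with \<open>T\<close>.\<close>
  have P_eq: "P z = k" if "k \<in> ?N" "z - k \<in> ?R" for z k
  proof -
    have "P z - k \<in> ?N" using complex_vector.subspace_diff[OF sN P(1) that(1)] .
    moreover have "(z - k) - (z - P z) \<in> ?R" by (rule complex_vector.subspace_diff[OF sR that(2) P(2)])
    ultimately have "P z - k = 0" by (intro NR) simp_all
    then show ?thesis by simp
  qed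
  have P_add: "P (x + y) = P x + P y" for x y
  proof (rule P_eq)
    show "P x + P y \<in> ?N" by (intro complex_vector.subspace_add[OF sN] P)
    have "(x - P x) + (y - P y) \<in> ?R" by (intro complex_vector.subspace_add[OF sR] P)
    then show "x + y - (P x + P y) \<in> ?R" by (simp add: algebra_simps)
  qed
  have P_scale: "P (c *\<^sub>C x) = c *\<^sub>C P x" for c x
  proof (rule P_eq)
    show "c *\<^sub>C P x \<in> ?N" by (intro complex_vector.subspace_scale[OF sN] P)
    have "c *\<^sub>C (x - P x) \<in> ?R" by (intro complex_vector.subspace_scale[OF sR] P)
    then show "c *\<^sub>C x - c *\<^sub>C P x \<in> ?R" by (simp add: complex_vector.scale_right_diff_distrib)
  qed
  obtain E where E: "\<And>x. cblinfun_apply E x = P x"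
    using cblinfun_exists[of P, OF P_add P_scale P(3)] by blast
  have "P (P x) = P x" for x
    by (rule P_eq[OF P(1)]) (simp only: diff_self complex_vector.subspace_0[OF sR])
  then have EE: "E o\<^sub>C E = E" by (intro cblinfun_eqI) (simp only: cblinfun_apply_compose E)
  have ET: "E o\<^sub>C T = T o\<^sub>C E"
  proof (rule cblinfun_eqI)
    fix x
    have "P (T x) = T (P x)"
      using TR[OF P(2)[of x]] by (intro P_eq TN P) (simp add: cblinfun_diff_right)
    then show "(E o\<^sub>C T) x = (T o\<^sub>C E) x" by (simp add: E)
  qed
  have TnE: "(T ^\<^sub>C n) o\<^sub>C E = 0"
    using P(1) by (intro cblinfun_eqI) (simp add: E null_space_def)
  \<comment> \<open>\<open>V\<close> is \<open>T\<close> on the range part and the identity on the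
    kernel part, the invertible element that \<open>drazin_idem\<close> asks for.\<close>
  define V where "V = T o\<^sub>C (id_cblinfun - E) + E"
  have V: "cblinfun_apply V x = T (x - P x) + P x" for x
    by (simp add: V_def cblinfun_apply_add_left cblinfun_apply_diff_left E)
  have PR: "P x = 0" if "x \<in> ?R" for x
    using that complex_vector.subspace_0[OF sN] by (intro P_eq) simp_all
  have PN: "P x = x" if "x \<in> ?N" for x
    using that complex_vector.subspace_0[OF sR] by (intro P_eq) simp_all
  have "inj (cblinfun_apply V)"
  proof (rule injI)
    fix x y assume "cblinfun_apply V x = cblinfun_apply V y"
    then have "V (x - y) = 0" by (simp add: cblinfun_diff_right)
    then have 0: "T (x - y - P (x - y)) + P (x - y) = 0" by (simp add: V)
    have "P (T (x - y - P (x - y)) + P (x - y)) = P (x - y)"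
      unfolding P_add by (simp add: PR[OF TR[OF P(2)]] PN[OF P(1)])
    then have Pz: "P (x - y) = 0" unfolding 0 using PR[OF complex_vector.subspace_0[OF sR]] by simp
    then have "x - y \<in> null_space (T ^\<^sub>C Suc n)"
      using 0 cblinfun_power_commute_apply[of T n "x - y"] by (simp add: null_space_def)
    then have "P (x - y) = x - y" using N by (intro PN) simp
    then show "x = y" using Pz by simp
  qed
  moreover have "surj (cblinfun_apply V)"
  proof (rule surjI)
    fix z
    have "\<exists>x. cblinfun_apply V x = z"
    proof -
      have "z - P z \<in> cblinfun_apply T ` ?R" using P(2)[of z] R range_power_Suc[of T n] by blast
      then obtain r where r: "r \<in> ?R" "z - P z = T r" by auto
      have "V (r + P z) = z"
        by (simp add: V P_add PR[OF r(1)] PN[OF P(1)] r(2)[symmetric])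
      then show ?thesis by blast
    qed
    then show "V (SOME x. V x = z) = z" by (rule someI_ex)
  qed
  ultimately have "bij (cblinfun_apply V)" by (rule bijI)
  then have "invertible_elem (Endo V)"
    unfolding invertible_Endo_iff using bij_cblinfun_inverse by metis
  moreover have "Endo V = Endo T * (1 - Endo E) + Endo E"
    by (simp add: V_def one_endo_def times_endo.abs_eq minus_endo.abs_eq plus_endo.abs_eq eq_onp_def)
  ultimately have "drazin_idem n (Endo T) (Endo E)"
    unfolding drazin_idem_def Endo_power
    by (simp add: times_endo.abs_eq eq_onp_def EE ET TnE zero_endo_def)
  then show thesis by (rule that)
qed

lemma drazin_elem_Endo_iff:
  fixes T :: "'a::cbanach \<Rightarrow>\<^sub>C\<^sub>L 'a"
  shows "drazin_elem n (Endo T) \<longleftrightarrow> null_space (T ^\<^sub>C n) = null_space (T ^\<^sub>C Suc n) \<and>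
    range (cblinfun_apply (T ^\<^sub>C n)) = range (cblinfun_apply (T ^\<^sub>C Suc n))"
proof
  assume "drazin_elem n (Endo T)"
  then obtain y where y: "Endo T * y = y * Endo T" "Endo T ^ n = Endo T ^ Suc n * y"
    by (auto simp: drazin_elem_def)
  have y': "Endo T ^ Suc n * y = y * Endo T ^ Suc n" using y(1) by (rule power_commuting_commutes)
  obtain S where S: "y = Endo S" by (cases y)
  note E = y(2) trans[OF y(2) y']
  note * = E[unfolded S Endo_power Endo_mult Endo_eq_iff]
  have "(T ^\<^sub>C n) x = S ((T ^\<^sub>C Suc n) x)" for x
    using arg_cong[OF *(2), of "\<lambda>U. cblinfun_apply U x"] by (simp only: cblinfun_apply_compose)
  then have n1: "null_space (T ^\<^sub>C Suc n) \<subseteq> null_space (T ^\<^sub>C n)"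
    by (auto simp: null_space_def simp del: cblinfun_power.simps)
  have "(T ^\<^sub>C n) x = (T ^\<^sub>C Suc n) (S x)" for x
    using arg_cong[OF *(1), of "\<lambda>U. cblinfun_apply U x"] by (simp only: cblinfun_apply_compose)
  then have r1: "range (cblinfun_apply (T ^\<^sub>C n)) \<subseteq> range (cblinfun_apply (T ^\<^sub>C Suc n))" by blast
  show "null_space (T ^\<^sub>C n) = null_space (T ^\<^sub>C Suc n) \<and>
      range (cblinfun_apply (T ^\<^sub>C n)) = range (cblinfun_apply (T ^\<^sub>C Suc n))"
    by (intro conjI equalityI n1 r1 null_power_mono range_power_antimono le_SucI order_refl)
next
  assume "null_space (T ^\<^sub>C n) = null_space (T ^\<^sub>C Suc n) \<and>
      range (cblinfun_apply (T ^\<^sub>C n)) = range (cblinfun_apply (T ^\<^sub>C Suc n))"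
  then show "drazin_elem n (Endo T)" by (metis drazin_idem_of_stable drazin_idem_elem)
qed

lemma ascent_descent_finite_iff:
  fixes T :: "'a::cbanach \<Rightarrow>\<^sub>C\<^sub>L 'a"
  shows "ascent T < \<infinity> \<and> descent T < \<infinity> \<longleftrightarrow> (\<exists>n. drazin_elem n (Endo T))"
proof
  assume "ascent T < \<infinity> \<and> descent T < \<infinity>"
  then obtain m n where m: "null_space (T ^\<^sub>C m) = null_space (T ^\<^sub>C Suc m)"
    and n: "range (cblinfun_apply (T ^\<^sub>C n)) = range (cblinfun_apply (T ^\<^sub>C Suc n))"
    unfolding ascent_def descent_def INF_less_iff by blast
  have "drazin_elem (m + n) (Endo T)"
    unfolding drazin_elem_Endo_iff
    using null_power_stable[OF m, of n] null_power_stable[OF m, of "Suc n"]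
      range_power_stable[OF n, of m] range_power_stable[OF n, of "Suc m"]
    by (simp add: add.commute[of m n] del: cblinfun_power.simps)
  then show "\<exists>n. drazin_elem n (Endo T)" ..
next
  assume "\<exists>n. drazin_elem n (Endo T)"
  then show "ascent T < \<infinity> \<and> descent T < \<infinity>"
    unfolding drazin_elem_Endo_iff ascent_def descent_def INF_less_iff
    by (auto simp del: cblinfun_power.simps)
qed

lemma poles_eq: "poles T = spectrum T - drazin_spec (Endo T)"
  unfolding poles_def drazin_spec_def Endo_shift ascent_descent_finite_iff by blast

lemma drazin_spec_subset_spectrum: "drazin_spec (Endo T) \<subseteq> spectrum T"
  unfolding spectrum_eq_spec by (rule drazin_spec_subset)

lemma drazin_elem_imp_drazin_invertible:
  fixes T :: "'a::cbanach \<Rightarrow>\<^sub>C\<^sub>L 'a"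
  assumes "drazin_elem p (Endo T)"
  shows "drazin_invertible T"
proof -
  obtain e where e: "drazin_idem p (Endo T) e" using drazin_elem_imp_idem[OF assms] by blast
  obtain E where E: "e = Endo E" by (cases e)
  let ?x = "Endo T"
  define v where "v = ?x * (1 - e) + e"
  obtain w where w: "v * w = 1" "w * v = 1"
    using e by (auto simp: drazin_idem_def invertible_elem_def v_def)
  have ee: "e * e = e" and ex: "e * ?x = ?x * e" and pe: "?x ^ p * e = 0"
    using e by (simp_all add: drazin_idem_def)
  have e0: "(1 - e) * e = 0" "e * (1 - e) = 0" "(1 - e) * (1 - e) = 1 - e"
    using ee by (simp_all add: algebra_simps)
  have xe: "(1 - e) * ?x = ?x * (1 - e)" using ex by (simp add: algebra_simps)
  have xv: "v * (1 - e) = ?x * (1 - e)"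
    unfolding v_def distrib_right mult.assoc e0 by simp
  have ev: "(1 - e) * v = v * (1 - e)"
    unfolding xv unfolding v_def distrib_left mult.assoc[symmetric] xe e0 unfolding mult.assoc e0 by simp
  \<comment> \<open>\<open>s\<close> inverts \<open>?x\<close> on the complement of \<open>e\<close>
    and vanishes on the part of \<open>e\<close>; this choice gives \<open>s * ?x * s = s\<close> in
    addition to the equation for \<open>?x ^ p\<close>.\<close>
  define s where "s = (1 - e) * w"
  have ew: "(1 - e) * w = w * (1 - e)"
  proof -
    have "w * (1 - e) = w * ((1 - e) * v) * w" by (simp only: mult.assoc w mult_1_right)
    also have "\<dots> = (w * v) * (1 - e) * w" by (simp only: ev mult.assoc)
    finally show ?thesis by (simp only: w mult_1_left)
  qed
  have "?x * s = (?x * (1 - e)) * w" by (simp only: s_def mult.assoc)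
  also have "\<dots> = v * (w * (1 - e))" by (simp only: xv[symmetric] ew mult.assoc)
  also have "\<dots> = (v * w) * (1 - e)" by (simp only: mult.assoc)
  finally have xs: "?x * s = 1 - e" by (simp only: w mult_1_left)
  have "s * ?x = w * ((1 - e) * ?x)" by (simp only: s_def ew mult.assoc)
  also have "\<dots> = (w * v) * (1 - e)" by (simp only: xe xv[symmetric] mult.assoc)
  finally have sx: "s * ?x = 1 - e" by (simp only: w mult_1_left)
  have "s * ?x * s = (1 - e) * s" by (simp only: sx)
  then have sxs: "s * ?x * s = s" by (simp only: s_def mult.assoc[symmetric] e0)
  have pxs: "?x ^ p * s * ?x = ?x ^ p" using pe by (simp only: mult.assoc sx right_diff_distrib mult_1_right diff_zero)
  obtain S where S: "s = Endo S" by (cases s)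
  have "T ^\<^sub>C p = (T ^\<^sub>C p) o\<^sub>C S o\<^sub>C T" "S o\<^sub>C T o\<^sub>C S = S" "T o\<^sub>C S = S o\<^sub>C T"
    using pxs sxs trans[OF xs sx[symmetric]] unfolding S Endo_power Endo_mult Endo_eq_iff by simp_all
  then show ?thesis unfolding drazin_invertible_def by blast
qed

section \<open>Lower bounds detect Drazin invertibility\<close>

lemma exists_rank_one:
  fixes v :: "'b::complex_normed_vector" and f :: "'a::complex_normed_vector \<Rightarrow>\<^sub>C\<^sub>L complex"
  shows "\<exists>U :: 'a \<Rightarrow>\<^sub>C\<^sub>L 'b. \<forall>x. cblinfun_apply U x = cblinfun_apply f x *\<^sub>C v"
proof -
  have "norm (cblinfun_apply f x *\<^sub>C v) \<le> norm f * norm v * norm x" for x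
    using mult_right_mono[OF norm_cblinfun[of f x], of "norm v"] by (simp add: norm_scaleC mult_ac)
  moreover have "cblinfun_apply f (x + y) *\<^sub>C v = cblinfun_apply f x *\<^sub>C v + cblinfun_apply f y *\<^sub>C v"
    "cblinfun_apply f (c *\<^sub>C x) *\<^sub>C v = c *\<^sub>C cblinfun_apply f x *\<^sub>C v" for x y c
    by (simp_all add: cblinfun_apply_add_right scaleC_add_left cblinfun_apply_scaleC_right scaleC_complex_def)
  ultimately show ?thesis
    using cblinfun_exists[of "\<lambda>x. cblinfun_apply f x *\<^sub>C v" "norm f * norm v"] by metis
qed

definition rank_one :: "'b::complex_normed_vector \<Rightarrow> ('a::complex_normed_vector \<Rightarrow>\<^sub>C\<^sub>L complex) \<Rightarrow> 'a \<Rightarrow>\<^sub>C\<^sub>L 'b" where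
  "rank_one v f = (SOME U. \<forall>x. cblinfun_apply U x = cblinfun_apply f x *\<^sub>C v)"

lemma rank_one_apply [simp]: "cblinfun_apply (rank_one v f) x = cblinfun_apply f x *\<^sub>C v"
  unfolding rank_one_def using someI_ex[OF exists_rank_one[of f v]] by blast

lemma compose_rank_one: "S o\<^sub>C rank_one v f = rank_one (S v) f"
  by (rule cblinfun_eqI) (simp add: cblinfun_apply_scaleC_right)

lemma rank_one_compose: "rank_one v f o\<^sub>C S = rank_one v (f o\<^sub>C S)"
  by (rule cblinfun_eqI) simp

lemma norm_rank_one: "norm (rank_one v f) = norm f * norm v"
proof (rule antisym)
  show "norm (rank_one v f) \<le> norm f * norm v"
  proof (rule norm_cblinfun_bound)
    show "norm (rank_one v f x) \<le> norm f * norm v * norm x" for x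
      using mult_right_mono[OF norm_cblinfun[of f x], of "norm v"] by (simp add: norm_scaleC mult_ac)
  qed simp
  show "norm f * norm v \<le> norm (rank_one v f)"
  proof (cases "v = 0")
    case False
    have "norm f \<le> norm (rank_one v f) / norm v"
    proof (rule norm_cblinfun_bound)
      show "norm (f x) \<le> norm (rank_one v f) / norm v * norm x" for x
        using norm_cblinfun[of "rank_one v f" x] False by (simp add: norm_scaleC field_simps)
    qed simp
    then show ?thesis using False by (simp add: field_simps)
  qed simp
qed

lemma exists_functional_nonzero:
  fixes v :: "'a::complex_normed_vector"
  assumes "v \<noteq> 0"
  obtains f :: "'a \<Rightarrow>\<^sub>C\<^sub>L complex" where "f v \<noteq> 0"
  using Hahn_Banach_norm[of v] assms by (metis norm_eq_zero of_real_eq_0_iff)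

lemma csubspace_closure:
  fixes S :: "'a::complex_normed_vector set"
  assumes S: "complex_vector.subspace S"
  shows "complex_vector.subspace (closure S)"
proof (rule complex_vector.subspaceI)
  show "0 \<in> closure S" by (rule subsetD[OF closure_subset complex_vector.subspace_0[OF S]])
  fix c x y assume "x \<in> closure S"
  then obtain X where X: "\<forall>n. X n \<in> S" "X \<longlonglongrightarrow> x" unfolding closure_sequential by auto
  then have "(\<forall>n. c *\<^sub>C X n \<in> S) \<and> (\<lambda>n. c *\<^sub>C X n) \<longlonglongrightarrow> c *\<^sub>C x"
    using complex_vector.subspace_scale[OF S] bounded_linear.tendsto[OF bounded_linear_scaleC X(2)] by simp
  then show "c *\<^sub>C x \<in> closure S" unfolding closure_sequential by (rule exI[of _ "\<lambda>n. c *\<^sub>C X n"])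
  assume "y \<in> closure S"
  then obtain Y where Y: "\<forall>n. Y n \<in> S" "Y \<longlonglongrightarrow> y" unfolding closure_sequential by auto
  then have "(\<forall>n. X n + Y n \<in> S) \<and> (\<lambda>n. X n + Y n) \<longlonglongrightarrow> x + y"
    using complex_vector.subspace_add[OF S] X tendsto_add[OF X(2) Y(2)] by simp
  then show "x + y \<in> closure S" unfolding closure_sequential by (rule exI[of _ "\<lambda>n. X n + Y n"])
qed

text \<open>On rank-one \<open>c\<close> the left inequality bounds \<open>T\<close> from below on
  the range of \<open>T^p\<close>, so the kernels are stable. The right one, tested on a rank-one
  operator whose functional vanishes on the range of \<open>T^(p+1)\<close>, shows that this range
  is dense in that of \<open>T^p\<close>. On the closure \<open>M\<close> of the latter,
  \<open>T\<close> is bounded below, so its image of \<open>M\<close> is closed and by density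
  contains \<open>M\<close>.\<close>

lemma endo_drazin_bounds:
  fixes x :: "'a::cbanach endo"
  assumes left: "\<And>c. norm (x ^ p * c) \<le> K * norm (x ^ Suc p * c)"
    and right: "\<And>c. norm (c * x ^ p) \<le> K * norm (c * x ^ Suc p)"
  shows "drazin_elem p x"
proof -
  obtain T where x: "x = Endo T" by (cases x)
  have left': "norm ((T ^\<^sub>C p) o\<^sub>C U) \<le> K * norm ((T ^\<^sub>C Suc p) o\<^sub>C U)" for U :: "'a \<Rightarrow>\<^sub>C\<^sub>L 'a"
    using left[of "Endo U"] unfolding x Endo_power
    by (simp add: times_endo.abs_eq norm_endo.abs_eq eq_onp_def del: cblinfun_power.simps)
  have right': "norm (U o\<^sub>C (T ^\<^sub>C p)) \<le> K * norm (U o\<^sub>C (T ^\<^sub>C Suc p))" for U :: "'a \<Rightarrow>\<^sub>C\<^sub>L 'a"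
    using right[of "Endo U"] unfolding x Endo_power
    by (simp add: times_endo.abs_eq norm_endo.abs_eq eq_onp_def del: cblinfun_power.simps)
  have low: "norm ((T ^\<^sub>C p) v) \<le> K * norm ((T ^\<^sub>C Suc p) v)" for v
  proof (cases "v = 0")
    case False
    then obtain f :: "'a \<Rightarrow>\<^sub>C\<^sub>L complex" where "f v \<noteq> 0" by (rule exists_functional_nonzero)
    then have f: "0 < norm f" by auto
    have "norm f * norm ((T ^\<^sub>C p) v) \<le> norm f * (K * norm ((T ^\<^sub>C Suc p) v))"
      using left'[of "rank_one v f"] unfolding compose_rank_one norm_rank_one by (simp only: mult_ac)
    then show ?thesis using f by simp
  qed simp
  let ?R = "\<lambda>n. range (cblinfun_apply (T ^\<^sub>C n))"
  have dense: "?R p \<subseteq> closure (?R (Suc p))"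
  proof
    fix y assume "y \<in> ?R p"
    then obtain v where v: "y = (T ^\<^sub>C p) v" by auto
    show "y \<in> closure (?R (Suc p))"
    proof (rule ccontr)
      assume y: "y \<notin> closure (?R (Suc p))"
      obtain f :: "'a \<Rightarrow>\<^sub>C\<^sub>L complex" where f: "\<And>z. z \<in> ?R (Suc p) \<Longrightarrow> f z = 0"
        "f y = complex_of_real (infdist y (?R (Suc p)))"
        using Hahn_Banach_infdist[OF csubspace_range, of "T ^\<^sub>C Suc p" y] by metis
      have "f y \<noteq> 0" using y f(2) in_closure_iff_infdist_zero[of "?R (Suc p)" y] by simp
      have "y \<noteq> 0" using \<open>f y \<noteq> 0\<close> by auto
      have "rank_one y f o\<^sub>C (T ^\<^sub>C Suc p) = 0"
        using f(1) by (intro cblinfun_eqI) (simp del: cblinfun_power.simps)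
      then have "rank_one y f o\<^sub>C (T ^\<^sub>C p) = 0" using right'[of "rank_one y f"] by simp
      then have "(rank_one y f o\<^sub>C (T ^\<^sub>C p)) v = 0" by simp
      then show False using \<open>f y \<noteq> 0\<close> \<open>y \<noteq> 0\<close> v by simp
    qed
  qed
  define M where "M = closure (?R p)"
  have M_low: "norm m \<le> K * norm (T m)" if "m \<in> M" for m
  proof -
    have "M \<subseteq> {m. norm m \<le> K * norm (T m)}"
      unfolding M_def
    proof (rule closure_minimal)
      show "?R p \<subseteq> {m. norm m \<le> K * norm (T m)}" using low by auto
      show "closed {m. norm m \<le> K * norm (T m)}"
        by (intro closed_Collect_le continuous_intros linear_continuous_on bounded_linear_cblinfun_apply)
    qed
    then show ?thesis using that by auto
  qed
  have TM: "T m \<in> M" if "m \<in> M" for m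
  proof -
    have "cblinfun_apply T ` ?R p \<subseteq> ?R p"
      using range_power_Suc[of T p] range_power_antimono[of p "Suc p" T] by auto
    then have "cblinfun_apply T ` ?R p \<subseteq> closure (?R p)" using closure_subset by (rule subset_trans)
    then have "cblinfun_apply T ` closure (?R p) \<subseteq> closure (?R p)"
      by (intro image_closure_subset linear_continuous_on bounded_linear_cblinfun_apply closed_closure)
    then show ?thesis using that by (auto simp: M_def)
  qed
  have sM: "complex_vector.subspace M"
    unfolding M_def by (intro csubspace_closure csubspace_range)
  have closed_TM: "closed (cblinfun_apply T ` M)"
    unfolding closed_sequential_limits
  proof (intro allI impI, elim conjE)
    fix Y y assume Y: "\<forall>n. Y n \<in> cblinfun_apply T ` M" "Y \<longlonglongrightarrow> y"
    then have "\<forall>n. \<exists>m\<in>M. Y n = T m" by auto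
    then obtain X where X: "\<And>n. X n \<in> M" "\<And>n. Y n = T (X n)" by metis
    have le: "dist (X m) (X n) \<le> K * dist (Y m) (Y n)" for m n
      using M_low[OF complex_vector.subspace_diff[OF sM X(1)[of m] X(1)[of n]]]
      by (simp add: dist_norm X(2) cblinfun_diff_right)
    have "Cauchy X"
    proof (rule metric_CauchyI)
      fix e :: real assume e: "0 < e"
      then have "0 < e / (\<bar>K\<bar> + 1)" by (simp add: add_nonneg_pos)
      then obtain N where N: "\<And>m n. m \<ge> N \<Longrightarrow> n \<ge> N \<Longrightarrow> dist (Y m) (Y n) < e / (\<bar>K\<bar> + 1)"
        using LIMSEQ_imp_Cauchy[OF Y(2)] unfolding Cauchy_def by blast
      have "dist (X m) (X n) < e" if mn: "m \<ge> N" "n \<ge> N" for m n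
      proof -
        have "dist (X m) (X n) \<le> K * dist (Y m) (Y n)" by (rule le)
        also have "\<dots> \<le> (\<bar>K\<bar> + 1) * dist (Y m) (Y n)" by (intro mult_right_mono) auto
        also have "\<dots> < e" using N[OF mn] by (simp add: field_simps add_nonneg_pos)
        finally show ?thesis .
      qed
      then show "\<exists>M. \<forall>m\<ge>M. \<forall>n\<ge>M. dist (X m) (X n) < e" by blast
    qed
    then obtain l where l: "X \<longlonglongrightarrow> l" using Cauchy_convergent convergent_def by blast
    have "l \<in> M" using closed_sequentially[of M X l] X(1) l by (simp add: M_def)
    moreover have "Y = (\<lambda>n. T (X n))" using X(2) by blast
    then have "Y \<longlonglongrightarrow> T l" using bounded_linear.tendsto[OF bounded_linear_cblinfun_apply l, of T] by simp
    ultimately show "y \<in> cblinfun_apply T ` M" using LIMSEQ_unique[OF Y(2)] by blast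
  qed
  have "?R (Suc p) \<subseteq> cblinfun_apply T ` M"
    unfolding range_power_Suc M_def by (rule image_mono[OF closure_subset])
  then have "closure (?R (Suc p)) \<subseteq> cblinfun_apply T ` M" using closed_TM by (rule closure_minimal)
  with dense have "?R p \<subseteq> cblinfun_apply T ` M" by (rule subset_trans)
  then have "closure (?R p) \<subseteq> cblinfun_apply T ` M" using closed_TM by (rule closure_minimal)
  then have MT: "M \<subseteq> cblinfun_apply T ` M" by (simp only: M_def)
  \<comment> \<open>\<open>M \<subseteq> T M\<close> iterates to \<open>M \<subseteq> T^n M\<close>,
    which lies in the range of \<open>T^n\<close>; at \<open>n = Suc p\<close> this removes the
    closure.\<close>
  have "M \<subseteq> ?R n" for n
  proof (induction n)
    case (Suc n)
    then have "cblinfun_apply T ` M \<subseteq> ?R (Suc n)" unfolding range_power_Suc by (rule image_mono)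
    with MT show ?case by (rule subset_trans)
  qed simp
  then have r1: "?R p \<subseteq> ?R (Suc p)" unfolding M_def using closure_subset by (rule subset_trans[rotated])
  have n1: "null_space (T ^\<^sub>C Suc p) \<subseteq> null_space (T ^\<^sub>C p)"
  proof
    fix v assume "v \<in> null_space (T ^\<^sub>C Suc p)"
    then have "(T ^\<^sub>C Suc p) v = 0" by (simp only: null_space_def mem_Collect_eq)
    then have "norm ((T ^\<^sub>C p) v) \<le> 0" using low[of v] by (simp only: norm_zero mult_zero_right)
    then show "v \<in> null_space (T ^\<^sub>C p)" by (simp add: null_space_def)
  qed
  show ?thesis
    unfolding x drazin_elem_Endo_iff
    by (intro conjI equalityI n1 r1 null_power_mono range_power_antimono le_SucI order_refl)
qed

text \<open>Reversing the multiplication interchanges the two inequalities.\<close>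

lemma opp_drazin_bounds:
  fixes x :: "'a::cbanach endo opp"
  assumes left: "\<And>c. norm (x ^ p * c) \<le> K * norm (x ^ Suc p * c)"
    and right: "\<And>c. norm (c * x ^ p) \<le> K * norm (c * x ^ Suc p)"
  shows "drazin_elem p x"
proof -
  obtain y where x: "x = Opp y" by (cases x)
  have "norm (y ^ p * c) \<le> K * norm (y ^ Suc p * c)" for c
    using right[of "Opp c"] unfolding x Opp_power
    by (simp add: times_opp.abs_eq norm_opp.abs_eq eq_onp_def del: power_Suc)
  moreover have "norm (c * y ^ p) \<le> K * norm (c * y ^ Suc p)" for c
    using left[of "Opp c"] unfolding x Opp_power
    by (simp add: times_opp.abs_eq norm_opp.abs_eq eq_onp_def del: power_Suc)
  ultimately show ?thesis unfolding x drazin_elem_Opp by (rule endo_drazin_bounds)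
qed

section \<open>Dimensions of quotients\<close>

definition indep_mod :: "'a::complex_normed_vector set \<Rightarrow> 'a set \<Rightarrow> bool" where
  "indep_mod N B \<longleftrightarrow> finite B \<and> (\<forall>c. (\<Sum>b\<in>B. c b *\<^sub>C b) \<in> N \<longrightarrow> (\<forall>b\<in>B. c b = 0))"

definition span_mod :: "'a::complex_normed_vector set \<Rightarrow> 'a set \<Rightarrow> 'a set" where
  "span_mod N B = {x. \<exists>c. x - (\<Sum>b\<in>B. c b *\<^sub>C b) \<in> N}"

lemma quotient_basis_iff: "quotient_basis M N B \<longleftrightarrow> indep_mod N B \<and> B \<subseteq> M \<and> M \<subseteq> span_mod N B"
  by (auto simp: quotient_basis_def indep_mod_def span_mod_def)

text \<open>A relation, so that finiteness and the value of a dimension are carried together. With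
  \<open>N = {0}\<close> it gives ordinary dimensions.\<close>

definition qdim :: "'a::complex_normed_vector set \<Rightarrow> 'a set \<Rightarrow> nat \<Rightarrow> bool" where
  "qdim M N k \<longleftrightarrow> (\<exists>B. quotient_basis M N B \<and> card B = k)"

lemma qdimI: "quotient_basis M N B \<Longrightarrow> qdim M N (card B)"
  by (auto simp: qdim_def)

lemma span_modI: "x - (\<Sum>b\<in>B. c b *\<^sub>C b) \<in> N \<Longrightarrow> x \<in> span_mod N B"
  by (auto simp: span_mod_def)

lemma sum_mem_span: "(\<Sum>b\<in>B. c b *\<^sub>C b) \<in> complex_vector.span B"
  by (intro complex_vector.span_sum complex_vector.span_scale complex_vector.span_base)

text \<open>Replacing each \<open>a\<close> by an element \<open>s a\<close> of the span of
  \<open>C\<close> congruent to it modulo \<open>N\<close> keeps independence, and ordinary linear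
  algebra in that span bounds the number.\<close>

lemma indep_mod_card_le:
  fixes N :: "'a::complex_normed_vector set"
  assumes N: "complex_vector.subspace N" and A: "indep_mod N A" "A \<subseteq> span_mod N C" and C: "finite C"
  shows "card A \<le> card C"
proof -
  have "\<forall>a\<in>A. \<exists>s\<in>complex_vector.span C. a - s \<in> N"
    using A(2) sum_mem_span unfolding span_mod_def by blast
  then obtain s where s: "\<And>a. a \<in> A \<Longrightarrow> s a \<in> complex_vector.span C" "\<And>a. a \<in> A \<Longrightarrow> a - s a \<in> N"
    by metis
  have finA: "finite A" using A(1) by (simp add: indep_mod_def)
  have zero: "c a = 0" if "(\<Sum>b\<in>A. c b *\<^sub>C s b) = 0" "a \<in> A" for c a
  proof -
    have "(\<Sum>b\<in>A. c b *\<^sub>C b) - (\<Sum>b\<in>A. c b *\<^sub>C s b) = (\<Sum>b\<in>A. c b *\<^sub>C (b - s b))"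
      by (simp add: sum_subtractf complex_vector.scale_right_diff_distrib)
    also have "\<dots> \<in> N"
      by (intro complex_vector.subspace_sum[OF N] complex_vector.subspace_scale[OF N] s)
    finally have "(\<Sum>b\<in>A. c b *\<^sub>C b) \<in> N" using that(1) by simp
    then show ?thesis using A(1) that(2) by (auto simp: indep_mod_def)
  qed
  have inj: "inj_on s A"
  proof (rule inj_onI, rule ccontr)
    fix a b assume ab: "a \<in> A" "b \<in> A" "s a = s b" "a \<noteq> b"
    define c where "c x = (if x = a then 1 else if x = b then -1 else 0 :: complex)" for x
    have "(\<Sum>x\<in>A. c x *\<^sub>C s x) = (\<Sum>x\<in>{a, b}. c x *\<^sub>C s x)"
      using ab finA by (intro sum.mono_neutral_right) (auto simp: c_def)
    also have "\<dots> = 0" using ab by (simp add: c_def scaleC_one)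
    finally have "c a = 0" using ab by (intro zero)
    then show False by (simp add: c_def)
  qed
  have "complex_vector.independent (s ` A)"
    unfolding complex_vector.dependent_finite[OF finite_imageI[OF finA]]
  proof
    assume "\<exists>u. (\<exists>v\<in>s ` A. u v \<noteq> 0) \<and> (\<Sum>v\<in>s ` A. u v *\<^sub>C v) = 0"
    then obtain u a where u: "a \<in> A" "u (s a) \<noteq> 0" "(\<Sum>v\<in>s ` A. u v *\<^sub>C v) = 0" by auto
    then have "(\<Sum>b\<in>A. u (s b) *\<^sub>C s b) = 0" by (simp add: sum.reindex[OF inj])
    then have "u (s a) = 0" using zero[of "\<lambda>b. u (s b)"] u(1) by blast
    then show False using u by simp
  qed
  moreover have "s ` A \<subseteq> complex_vector.span C" using s by auto
  ultimately have "card (s ` A) \<le> card C" using complex_vector.independent_span_bound[OF C] by blast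
  then show ?thesis by (simp add: card_image[OF inj])
qed

lemma qdim_unique:
  fixes N :: "'a::complex_normed_vector set"
  assumes N: "complex_vector.subspace N" and "qdim M N j" "qdim M N k"
  shows "j = k"
proof -
  obtain A B where A: "quotient_basis M N A" "card A = j" and B: "quotient_basis M N B" "card B = k"
    using assms by (auto simp: qdim_def)
  have "finite A" "finite B" using A B by (auto simp: quotient_basis_def)
  then have "card A \<le> card B" "card B \<le> card A"
    using indep_mod_card_le[OF N, of A B] indep_mod_card_le[OF N, of B A] A(1) B(1)
    unfolding quotient_basis_iff by blast+
  then show ?thesis using A B by simp
qed

lemma indep_mod_insert:
  fixes N :: "'a::complex_normed_vector set"
  assumes N: "complex_vector.subspace N" and B: "indep_mod N B" and x: "x \<notin> span_mod N B"
  shows "indep_mod N (insert x B)" "x \<notin> B"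
proof -
  have fin: "finite B" using B by (simp add: indep_mod_def)
  show xB: "x \<notin> B"
  proof
    assume "x \<in> B"
    define c where "c b = (if b = x then 1 else 0 :: complex)" for b
    have "(\<Sum>b\<in>B. c b *\<^sub>C b) = (\<Sum>b\<in>{x}. c b *\<^sub>C b)"
      using \<open>x \<in> B\<close> fin by (intro sum.mono_neutral_right) (auto simp: c_def)
    then have "(\<Sum>b\<in>B. c b *\<^sub>C b) = x" by (simp add: c_def scaleC_one)
    then have "x - (\<Sum>b\<in>B. c b *\<^sub>C b) \<in> N" using complex_vector.subspace_0[OF N] by simp
    then have "x \<in> span_mod N B" by (rule span_modI)
    then show False using x by simp
  qed
  show "indep_mod N (insert x B)"
    unfolding indep_mod_def
  proof (intro conjI allI impI)
    fix c assume c: "(\<Sum>b\<in>insert x B. c b *\<^sub>C b) \<in> N"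
    then have c': "c x *\<^sub>C x + (\<Sum>b\<in>B. c b *\<^sub>C b) \<in> N" using fin xB by simp
    have cx: "c x = 0"
    proof (rule ccontr)
      assume nz: "c x \<noteq> 0"
      have "inverse (c x) *\<^sub>C (c x *\<^sub>C x + (\<Sum>b\<in>B. c b *\<^sub>C b)) \<in> N"
        by (rule complex_vector.subspace_scale[OF N c'])
      also have "inverse (c x) *\<^sub>C (c x *\<^sub>C x + (\<Sum>b\<in>B. c b *\<^sub>C b))
          = x - (\<Sum>b\<in>B. (- inverse (c x) * c b) *\<^sub>C b)"
        using nz by (simp add: scaleC_add_right complex_vector.scale_sum_right sum_negf scaleC_one)
      finally have "x \<in> span_mod N B" by (rule span_modI)
      then show False using x by simp
    qed
    then have "(\<Sum>b\<in>B. c b *\<^sub>C b) \<in> N" using c' by simp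
    then show "\<forall>b\<in>insert x B. c b = 0" using B cx by (auto simp: indep_mod_def)
  qed (use fin in simp)
qed

lemma qdim_exists:
  fixes N :: "'a::complex_normed_vector set"
  assumes N: "complex_vector.subspace N" and bound: "\<And>A. A \<subseteq> M \<Longrightarrow> indep_mod N A \<Longrightarrow> card A \<le> c"
  obtains k where "qdim M N k"
proof -
  let ?P = "\<lambda>k. \<exists>A\<subseteq>M. indep_mod N A \<and> card A = k"
  have "?P 0" by (intro exI[of _ "{}"]) (simp add: indep_mod_def)
  moreover have "k \<le> c" if "?P k" for k using that bound by auto
  ultimately obtain k where k: "?P k" "\<And>j. ?P j \<Longrightarrow> j \<le> k"
    using GreatestI_nat[of ?P 0 c] Greatest_le_nat[of ?P _ c] by blast
  then obtain A where A: "A \<subseteq> M" "indep_mod N A" "card A = k" by blast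
  have fin: "finite A" using A by (simp add: indep_mod_def)
  have "M \<subseteq> span_mod N A"
  proof (rule subsetI, rule ccontr)
    fix x assume x: "x \<in> M" "x \<notin> span_mod N A"
    have "?P (Suc k)"
      using indep_mod_insert[OF N A(2) x(2)] A x(1) fin by (intro exI[of _ "insert x A"]) auto
    then show False using k(2)[of "Suc k"] by simp
  qed
  then have "quotient_basis M N A" using A by (simp add: quotient_basis_iff)
  then show thesis using that qdimI by blast
qed

lemma indep_mod_mono: "indep_mod N B \<Longrightarrow> L \<subseteq> N \<Longrightarrow> indep_mod L B"
  unfolding indep_mod_def by blast

lemma span_mod_mono: "L \<subseteq> N \<Longrightarrow> span_mod L B \<subseteq> span_mod N B"
  unfolding span_mod_def by blast

lemma indep_mod_inter: "complex_vector.subspace M \<Longrightarrow> B \<subseteq> M \<Longrightarrow> indep_mod (N \<inter> M) B \<longleftrightarrow> indep_mod N B"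
proof -
  assume M: "complex_vector.subspace M" "B \<subseteq> M"
  have "(\<Sum>b\<in>B. c b *\<^sub>C b) \<in> M" for c
    using M by (intro complex_vector.subspace_sum complex_vector.subspace_scale) auto
  then show ?thesis by (simp add: indep_mod_def)
qed

lemma qdim_sub_exists:
  fixes L :: "'a::complex_normed_vector set"
  assumes L: "complex_vector.subspace L" and M: "qdim M L c" and "N \<subseteq> M"
  obtains b where "qdim N L b" "b \<le> c"
proof -
  obtain C where C: "quotient_basis M L C" "card C = c" using M by (auto simp: qdim_def)
  have fin: "finite C" using C by (simp add: quotient_basis_def)
  have bound: "card A \<le> c" if "A \<subseteq> N" "indep_mod L A" for A
    using indep_mod_card_le[OF L that(2) _ fin] that C assms(3) unfolding quotient_basis_iff by blast
  obtain b where b: "qdim N L b" by (rule qdim_exists[OF L bound])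
  moreover from b obtain B where "B \<subseteq> N" "indep_mod L B" "card B = b"
    by (auto simp: qdim_def quotient_basis_iff)
  ultimately show thesis using that bound by blast
qed

lemma qdim_quot_exists:
  fixes N :: "'a::complex_normed_vector set"
  assumes N: "complex_vector.subspace N" and M: "qdim M L c" and LN: "L \<subseteq> N"
  obtains a where "qdim M N a" "a \<le> c"
proof -
  obtain C where C: "quotient_basis M L C" "card C = c" using M by (auto simp: qdim_def)
  have fin: "finite C" using C by (simp add: quotient_basis_def)
  have MC: "M \<subseteq> span_mod N C" using C span_mod_mono[OF LN] unfolding quotient_basis_iff by blast
  have bound: "card A \<le> c" if "A \<subseteq> M" "indep_mod N A" for A
    using indep_mod_card_le[OF N that(2) _ fin] that C(2) MC by blast
  obtain a where a: "qdim M N a" by (rule qdim_exists[OF N bound])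
  moreover from a obtain A where "A \<subseteq> M" "indep_mod N A" "card A = a"
    by (auto simp: qdim_def quotient_basis_iff)
  ultimately show thesis using that bound by blast
qed

lemma qdim_add:
  fixes N :: "'a::complex_normed_vector set"
  assumes N: "complex_vector.subspace N" and LN: "L \<subseteq> N" and NM: "N \<subseteq> M"
    and "qdim M N a" "qdim N L b"
  shows "qdim M L (a + b)"
proof -
  obtain B C where B: "quotient_basis M N B" "card B = a" and C: "quotient_basis N L C" "card C = b"
    using assms by (auto simp: qdim_def)
  have fin: "finite B" "finite C" using B C by (auto simp: quotient_basis_def)
  have CN: "(\<Sum>x\<in>C. c x *\<^sub>C x) \<in> N" for c
    using C by (intro complex_vector.subspace_sum[OF N] complex_vector.subspace_scale[OF N]) (auto simp: quotient_basis_def)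
  have disj: "B \<inter> C = {}"
  proof (rule ccontr)
    assume "B \<inter> C \<noteq> {}"
    then obtain x where x: "x \<in> B" "x \<in> C" by auto
    define c where "c b = (if b = x then 1 else 0 :: complex)" for b
    have "(\<Sum>b\<in>B. c b *\<^sub>C b) = (\<Sum>b\<in>{x}. c b *\<^sub>C b)"
      using x fin by (intro sum.mono_neutral_right) (auto simp: c_def)
    then have "(\<Sum>b\<in>B. c b *\<^sub>C b) = x" by (simp add: c_def scaleC_one)
    moreover have "x \<in> N" using x C by (auto simp: quotient_basis_def)
    ultimately have "c x = 0" using B x by (auto simp: quotient_basis_def)
    then show False by (simp add: c_def)
  qed
  have "quotient_basis M L (B \<union> C)"
    unfolding quotient_basis_def
  proof (intro conjI allI impI ballI)
    show "finite (B \<union> C)" using fin by simp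
    show "B \<union> C \<subseteq> M" using B C NM by (auto simp: quotient_basis_def)
  next
    fix c v assume "(\<Sum>x\<in>B \<union> C. c x *\<^sub>C x) \<in> L" and v: "v \<in> B \<union> C"
    then have sum: "(\<Sum>x\<in>B. c x *\<^sub>C x) + (\<Sum>x\<in>C. c x *\<^sub>C x) \<in> L"
      using fin disj by (simp add: sum.union_disjoint)
    then have "((\<Sum>x\<in>B. c x *\<^sub>C x) + (\<Sum>x\<in>C. c x *\<^sub>C x)) - (\<Sum>x\<in>C. c x *\<^sub>C x) \<in> N"
      using LN CN by (intro complex_vector.subspace_diff[OF N]) auto
    then have "(\<Sum>x\<in>B. c x *\<^sub>C x) \<in> N" by simp
    then have cB: "\<forall>x\<in>B. c x = 0" using B by (simp add: quotient_basis_def)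
    then have "(\<Sum>x\<in>C. c x *\<^sub>C x) \<in> L" using sum by simp
    then have "\<forall>x\<in>C. c x = 0" using C by (simp add: quotient_basis_def)
    then show "c v = 0" using cB v by auto
  next
    fix x assume "x \<in> M"
    then obtain c where c: "x - (\<Sum>b\<in>B. c b *\<^sub>C b) \<in> N" using B by (auto simp: quotient_basis_def)
    then obtain d where d: "x - (\<Sum>b\<in>B. c b *\<^sub>C b) - (\<Sum>b\<in>C. d b *\<^sub>C b) \<in> L"
      using C by (auto simp: quotient_basis_def)
    let ?c = "\<lambda>b. if b \<in> B then c b else d b"
    have "(\<Sum>b\<in>B \<union> C. ?c b *\<^sub>C b) = (\<Sum>b\<in>B. c b *\<^sub>C b) + (\<Sum>b\<in>C. d b *\<^sub>C b)"
      using fin disj by (simp add: sum.union_disjoint) (intro arg_cong2[where f = "(+)"] sum.cong; force)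
    then show "\<exists>c. x - (\<Sum>b\<in>B \<union> C. c b *\<^sub>C b) \<in> L"
      using d by (intro exI[of _ ?c]) (simp add: algebra_simps)
  qed
  moreover have "card (B \<union> C) = a + b" using fin disj B C by (simp add: card_Un_disjoint)
  ultimately show ?thesis using qdimI by metis
qed

text \<open>\<open>T\<close> induces an isomorphism from \<open>M / N\<close> to
  \<open>T M / T N\<close> because the kernel of \<open>T\<close> on \<open>M\<close> lies in
  \<open>N\<close>.\<close>

lemma qdim_image:
  assumes M: "complex_vector.subspace M" and N: "complex_vector.subspace N" "N \<subseteq> M"
    and ker: "null_space T \<inter> M \<subseteq> N" and MN: "qdim M N k"
  shows "qdim (cblinfun_apply T ` M) (cblinfun_apply T ` N) k"
proof -
  obtain B where B: "quotient_basis M N B" "card B = k" using MN by (auto simp: qdim_def)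
  have fin: "finite B" and BM: "B \<subseteq> M" using B by (auto simp: quotient_basis_def)
  have sumM: "(\<Sum>b\<in>B. c b *\<^sub>C b) \<in> M" for c
    using BM by (intro complex_vector.subspace_sum[OF M] complex_vector.subspace_scale[OF M]) auto
  have Tsum: "(\<Sum>b\<in>B. c b *\<^sub>C T b) = T (\<Sum>b\<in>B. c b *\<^sub>C b)" for c
    by (simp add: cblinfun_sum_right cblinfun_apply_scaleC_right)
  have zero: "\<forall>b\<in>B. c b = 0" if Tc: "(\<Sum>b\<in>B. c b *\<^sub>C T b) \<in> cblinfun_apply T ` N" for c
  proof -
    obtain n where n: "n \<in> N" "T (\<Sum>b\<in>B. c b *\<^sub>C b) = T n" using Tc unfolding Tsum by auto
    then have "(\<Sum>b\<in>B. c b *\<^sub>C b) - n \<in> null_space T \<inter> M"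
      using complex_vector.subspace_diff[OF M sumM] N(2) by (auto simp: null_space_def cblinfun_diff_right)
    then have "(\<Sum>b\<in>B. c b *\<^sub>C b) - n + n \<in> N" using ker n by (intro complex_vector.subspace_add[OF N(1)]) auto
    then show ?thesis using B by (simp add: quotient_basis_def)
  qed
  have T0: "0 \<in> cblinfun_apply T ` N"
    using complex_vector.subspace_0[OF csubspace_image[OF N(1)]] .
  have inj: "inj_on (cblinfun_apply T) B"
  proof (rule inj_onI, rule ccontr)
    fix a b assume ab: "a \<in> B" "b \<in> B" "T a = T b" "a \<noteq> b"
    define c where "c x = (if x = a then 1 else if x = b then -1 else 0 :: complex)" for x
    have "(\<Sum>x\<in>B. c x *\<^sub>C T x) = (\<Sum>x\<in>{a, b}. c x *\<^sub>C T x)"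
      using ab fin by (intro sum.mono_neutral_right) (auto simp: c_def)
    also have "\<dots> = 0" using ab by (simp add: c_def scaleC_one)
    finally have "(\<Sum>x\<in>B. c x *\<^sub>C T x) \<in> cblinfun_apply T ` N" using T0 by (rule ssubst)
    then have "c a = 0" using zero ab(1) by blast
    then show False by (simp add: c_def)
  qed
  have "quotient_basis (cblinfun_apply T ` M) (cblinfun_apply T ` N) (cblinfun_apply T ` B)"
    unfolding quotient_basis_def
  proof (intro conjI allI impI ballI)
    show "finite (cblinfun_apply T ` B)" using fin by simp
    show "cblinfun_apply T ` B \<subseteq> cblinfun_apply T ` M" using BM by auto
  next
    fix c v assume "(\<Sum>b\<in>cblinfun_apply T ` B. c b *\<^sub>C b) \<in> cblinfun_apply T ` N" and v: "v \<in> cblinfun_apply T ` B"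
    then have "(\<Sum>b\<in>B. c (T b) *\<^sub>C T b) \<in> cblinfun_apply T ` N" by (simp add: sum.reindex[OF inj])
    then have "\<forall>b\<in>B. c (T b) = 0" by (rule zero)
    then show "c v = 0" using v by auto
  next
    fix y assume "y \<in> cblinfun_apply T ` M"
    then obtain x where x: "x \<in> M" "y = T x" by auto
    then obtain c where c: "x - (\<Sum>b\<in>B. c b *\<^sub>C b) \<in> N" using B by (auto simp: quotient_basis_def)
    let ?c = "\<lambda>z. c (the_inv_into B (cblinfun_apply T) z)"
    have "(\<Sum>b\<in>cblinfun_apply T ` B. ?c b *\<^sub>C b) = (\<Sum>b\<in>B. c b *\<^sub>C T b)"
      by (simp add: sum.reindex[OF inj] the_inv_into_f_f[OF inj] cong: sum.cong)
    then have "y - (\<Sum>b\<in>cblinfun_apply T ` B. ?c b *\<^sub>C b) = T (x - (\<Sum>b\<in>B. c b *\<^sub>C b))"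
      by (simp add: x Tsum cblinfun_diff_right)
    then show "\<exists>c. y - (\<Sum>b\<in>cblinfun_apply T ` B. c b *\<^sub>C b) \<in> cblinfun_apply T ` N" using c by (intro exI[of _ ?c]) auto
  qed
  moreover have "card (cblinfun_apply T ` B) = k" using B by (simp add: card_image[OF inj])
  ultimately show ?thesis using qdimI by metis
qed

definition ssum :: "'a::complex_normed_vector set \<Rightarrow> 'a set \<Rightarrow> 'a set" where
  "ssum A B = {a + b | a b. a \<in> A \<and> b \<in> B}"

lemma csubspace_ssum: "complex_vector.subspace A \<Longrightarrow> complex_vector.subspace B \<Longrightarrow> complex_vector.subspace (ssum A B)"
  unfolding ssum_def by (rule complex_vector.subspace_sums)

text \<open>The second isomorphism theorem: \<open>(A + B) / B\<close> is
  \<open>A / (A \<inter> B)\<close>.\<close>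

lemma qdim_ssum:
  assumes A: "complex_vector.subspace A" and B: "complex_vector.subspace B" and k: "qdim A (A \<inter> B) k"
  shows "qdim (ssum A B) B k"
proof -
  obtain C where C: "quotient_basis A (A \<inter> B) C" "card C = k" using k by (auto simp: qdim_def)
  have "C \<subseteq> A" using C by (simp add: quotient_basis_iff)
  then have "indep_mod B C" using C indep_mod_inter[OF A, of C B] by (simp add: quotient_basis_iff Int_commute)
  moreover have "C \<subseteq> ssum A B"
    using \<open>C \<subseteq> A\<close> complex_vector.subspace_0[OF B] unfolding ssum_def by force
  moreover have "ssum A B \<subseteq> span_mod B C"
  proof
    fix x assume "x \<in> ssum A B"
    then obtain a b where x: "x = a + b" "a \<in> A" "b \<in> B" by (auto simp: ssum_def)
    then obtain c where "a - (\<Sum>b\<in>C. c b *\<^sub>C b) \<in> A \<inter> B"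
      using C unfolding quotient_basis_iff span_mod_def by blast
    then have "(a - (\<Sum>b\<in>C. c b *\<^sub>C b)) + b \<in> B" using x by (intro complex_vector.subspace_add[OF B]) auto
    then have "x - (\<Sum>b\<in>C. c b *\<^sub>C b) \<in> B" by (simp add: x algebra_simps)
    then show "x \<in> span_mod B C" by (rule span_modI)
  qed
  ultimately have "quotient_basis (ssum A B) B C" by (simp add: quotient_basis_iff)
  then show ?thesis using qdimI C(2) by metis
qed

lemma qdim_0_iff: "qdim M N 0 \<longleftrightarrow> M \<subseteq> N"
proof
  assume "qdim M N 0"
  then obtain B where B: "quotient_basis M N B" "card B = 0" by (auto simp: qdim_def)
  then have "B = {}" by (simp add: quotient_basis_def)
  then show "M \<subseteq> N" using B by (auto simp: quotient_basis_def)
next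
  assume "M \<subseteq> N"
  then have "quotient_basis M N {}" by (auto simp: quotient_basis_def)
  then show "qdim M N 0" using qdimI[of M N "{}"] by simp
qed

section \<open>Finite dimensions, and Weyl operators in terms of them\<close>

lemma subspace_zero: "complex_vector.subspace {0}"
  by (rule complex_vector.subspace_single_0)

lemma qdim_zero_basis:
  assumes "quotient_basis M {0} B"
  shows "complex_vector.independent B" "M \<subseteq> complex_vector.span B" "finite B" "B \<subseteq> M"
proof -
  show fin: "finite B" and "B \<subseteq> M" using assms by (auto simp: quotient_basis_def)
  show "complex_vector.independent B"
    unfolding complex_vector.dependent_finite[OF fin] using assms by (auto simp: quotient_basis_def)
  show "M \<subseteq> complex_vector.span B"
  proof
    fix x assume "x \<in> M"
    then obtain c where "x = (\<Sum>b\<in>B. c b *\<^sub>C b)" using assms by (auto simp: quotient_basis_def)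
    then show "x \<in> complex_vector.span B" using sum_mem_span by simp
  qed
qed

lemma qdim_zero_finite:
  assumes "finite B" "M \<subseteq> complex_vector.span B"
  obtains k where "qdim M {0} k"
proof -
  have "complex_vector.span B \<subseteq> span_mod {0} B"
  proof
    fix x assume "x \<in> complex_vector.span B"
    then obtain u where "x = (\<Sum>b\<in>B. u b *\<^sub>C b)" unfolding complex_vector.span_finite[OF assms(1)] by auto
    then have "x - (\<Sum>b\<in>B. u b *\<^sub>C b) \<in> {0}" by simp
    then show "x \<in> span_mod {0} B" by (rule span_modI)
  qed
  then have "card A \<le> card B" if "A \<subseteq> M" "indep_mod {0} A" for A
    using indep_mod_card_le[OF subspace_zero that(2) _ assms(1)] that(1) assms(2) by blast
  then show thesis using qdim_exists[OF subspace_zero] that by metis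
qed

lemma cdim_eq_iff: "cdim M = enat k \<longleftrightarrow> qdim M {0} k"
proof -
  have *: "cdim M = enat k" if k: "qdim M {0} k" for k
  proof -
    obtain B where B: "quotient_basis M {0} B" "card B = k" using k by (auto simp: qdim_def)
    note b = qdim_zero_basis[OF B(1)]
    then have "complex_vector.dim M = k" using complex_vector.basis_card_eq_dim[OF b(4,2,1)] B(2) by simp
    then show ?thesis using b by (auto simp: cdim_def)
  qed
  moreover have "qdim M {0} k" if k: "cdim M = enat k"
  proof -
    obtain B where "finite B" "M \<subseteq> complex_vector.span B" using k by (auto simp: cdim_def split: if_splits)
    then obtain j where "qdim M {0} j" by (rule qdim_zero_finite)
    then show ?thesis using *[of j] k by simp
  qed
  ultimately show ?thesis by blast
qed

lemma quotient_cdim_eq_iff: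
  assumes "complex_vector.subspace N"
  shows "quotient_cdim M N = enat k \<longleftrightarrow> qdim M N k"
proof -
  have *: "quotient_cdim M N = enat k" if "qdim M N k" for k
  proof -
    have ex: "\<exists>B. quotient_basis M N B" using that by (auto simp: qdim_def)
    then have "quotient_basis M N (SOME B. quotient_basis M N B)" by (rule someI_ex)
    then have "card (SOME B. quotient_basis M N B) = k" using qdim_unique[OF assms qdimI that] by blast
    then show ?thesis using ex by (simp add: quotient_cdim_def)
  qed
  moreover have "qdim M N k" if k: "quotient_cdim M N = enat k"
  proof -
    obtain B where "quotient_basis M N B" using k by (auto simp: quotient_cdim_def split: if_splits)
    then have "qdim M N (card B)" by (rule qdimI)
    then show ?thesis using *[of "card B"] k by simp
  qed
  ultimately show ?thesis by blast
qed

lemma weyl_on_iff: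
  assumes "complex_vector.subspace M"
  shows "weyl_on M T \<longleftrightarrow> (\<exists>k. qdim (null_space T \<inter> M) {0} k \<and> qdim M (cblinfun_apply T ` M) k)"
proof -
  have "weyl_on M T \<longleftrightarrow> (\<exists>k. cdim (null_space T \<inter> M) = enat k \<and> quotient_cdim M (cblinfun_apply T ` M) = enat k)"
    unfolding weyl_on_def by (cases "cdim (null_space T \<inter> M)") auto
  then show ?thesis by (simp add: cdim_eq_iff quotient_cdim_eq_iff[OF csubspace_image[OF assms]])
qed

text \<open>Let \<open>N\<close> be the kernel of \<open>T\<close> on \<open>M\<close>,
  \<open>k\<close> its dimension and \<open>k'\<close> that of its intersection with
  \<open>T M\<close>. Then \<open>N + T M\<close> has dimension \<open>k - k'\<close> over
  \<open>T M\<close>, hence codimension \<open>k'\<close> in \<open>M\<close>. As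
  \<open>N + T M\<close> contains the kernel, \<open>T\<close> carries \<open>M / (N + T M)\<close>
  isomorphically to \<open>T M / T (T M)\<close>, whose dimension is therefore \<open>k'\<close>
  too.\<close>

lemma weyl_on_image:
  assumes M: "complex_vector.subspace M" and TM: "cblinfun_apply T ` M \<subseteq> M" and w: "weyl_on M T"
  shows "weyl_on (cblinfun_apply T ` M) T"
proof -
  let ?N = "null_space T \<inter> M" and ?M' = "cblinfun_apply T ` M"
  have N: "complex_vector.subspace ?N" by (intro complex_vector.subspace_inter csubspace_null_space M)
  have M': "complex_vector.subspace ?M'" by (rule csubspace_image[OF M])
  have NM': "complex_vector.subspace (?N \<inter> ?M')" by (intro complex_vector.subspace_inter N M')
  obtain k where k: "qdim ?N {0} k" "qdim M ?M' k" using w weyl_on_iff[OF M] by blast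
  obtain a where a: "qdim ?N (?N \<inter> ?M') a"
    using qdim_quot_exists[OF NM' k(1)] complex_vector.subspace_0[OF NM'] by blast
  obtain k' where k': "qdim (?N \<inter> ?M') {0} k'"
    using qdim_sub_exists[OF subspace_zero k(1), of "?N \<inter> ?M'"] by blast
  have "qdim ?N {0} (a + k')"
    using complex_vector.subspace_0[OF NM'] by (intro qdim_add[OF NM' _ _ a k']) auto
  then have kk: "k = a + k'" using qdim_unique[OF subspace_zero k(1)] by blast
  let ?S = "ssum ?N ?M'"
  have S: "complex_vector.subspace ?S" by (rule csubspace_ssum[OF N M'])
  have NS: "?N \<subseteq> ?S" and M'S: "?M' \<subseteq> ?S"
    unfolding ssum_def using complex_vector.subspace_0[OF N] complex_vector.subspace_0[OF M'] by force+
  have SM: "?S \<subseteq> M" unfolding ssum_def using TM complex_vector.subspace_add[OF M] by auto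
  have SM': "qdim ?S ?M' a" by (rule qdim_ssum[OF N M' a])
  obtain b where b: "qdim M ?S b"
    using qdim_quot_exists[OF S k(2) M'S] by blast
  have "qdim M ?M' (b + a)" by (rule qdim_add[OF S M'S SM b SM'])
  then have "k = b + a" using qdim_unique[OF M' k(2)] by blast
  then have "b = k'" using kk by simp
  have "qdim ?M' (cblinfun_apply T ` ?S) b"
    using NS by (intro qdim_image[OF M S SM _ b])
  also have "cblinfun_apply T ` ?S = cblinfun_apply T ` ?M'"
  proof
    show "cblinfun_apply T ` ?S \<subseteq> cblinfun_apply T ` ?M'"
      by (auto simp: ssum_def null_space_def cblinfun_apply_add_right)
  qed (use M'S in blast)
  finally have "qdim ?M' (cblinfun_apply T ` ?M') k'" unfolding \<open>b = k'\<close> .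
  moreover have "null_space T \<inter> ?M' = ?N \<inter> ?M'" using TM by auto
  ultimately show ?thesis using k' weyl_on_iff[OF M'] by auto
qed

text \<open>The codimension of a kernel is at most the rank: \<open>F\<close> maps vectors
  independent modulo its kernel to independent vectors.\<close>

lemma indep_mod_null_card_le:
  assumes M: "complex_vector.subspace M" and A: "A \<subseteq> M" "indep_mod (null_space F \<inter> M) A"
    and fin: "finite B" "cblinfun_apply F ` M \<subseteq> complex_vector.span B"
  shows "card A \<le> card B"
proof -
  have finA: "finite A" using A by (simp add: indep_mod_def)
  have sumM: "(\<Sum>a\<in>A. c a *\<^sub>C a) \<in> M" for c
    using A(1) by (intro complex_vector.subspace_sum[OF M] complex_vector.subspace_scale[OF M]) auto
  have zero: "\<forall>a\<in>A. c a = 0" if "(\<Sum>a\<in>A. c a *\<^sub>C F a) = 0" for c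
  proof -
    have "(\<Sum>a\<in>A. c a *\<^sub>C a) \<in> (null_space F \<inter> M)"
      using that sumM by (simp add: null_space_def cblinfun_sum_right cblinfun_apply_scaleC_right)
    then show ?thesis using A(2) by (simp add: indep_mod_def)
  qed
  have inj: "inj_on (cblinfun_apply F) A"
  proof (rule inj_onI, rule ccontr)
    fix a b assume ab: "a \<in> A" "b \<in> A" "F a = F b" "a \<noteq> b"
    define c where "c x = (if x = a then 1 else if x = b then -1 else 0 :: complex)" for x
    have "(\<Sum>x\<in>A. c x *\<^sub>C F x) = (\<Sum>x\<in>{a, b}. c x *\<^sub>C F x)"
      using ab finA by (intro sum.mono_neutral_right) (auto simp: c_def)
    also have "\<dots> = 0" using ab by (simp add: c_def scaleC_one)
    finally have "c a = 0" using zero[of c] ab by auto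
    then show False by (simp add: c_def)
  qed
  have "complex_vector.independent (cblinfun_apply F ` A)"
    unfolding complex_vector.dependent_finite[OF finite_imageI[OF finA]]
  proof
    assume "\<exists>u. (\<exists>v\<in>cblinfun_apply F ` A. u v \<noteq> 0) \<and> (\<Sum>v\<in>cblinfun_apply F ` A. u v *\<^sub>C v) = 0"
    then obtain u a where u: "a \<in> A" "u (F a) \<noteq> 0" "(\<Sum>v\<in>cblinfun_apply F ` A. u v *\<^sub>C v) = 0" by auto
    then have "(\<Sum>b\<in>A. u (F b) *\<^sub>C F b) = 0" by (simp add: sum.reindex[OF inj])
    then show False using zero[of "\<lambda>b. u (F b)"] u by auto
  qed
  moreover have "cblinfun_apply F ` A \<subseteq> complex_vector.span B" using A(1) fin(2) by blast
  ultimately have "card (cblinfun_apply F ` A) \<le> card B" using complex_vector.independent_span_bound[OF fin(1)] by blast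
  then show ?thesis by (simp add: card_image[OF inj])
qed

text \<open>On the kernel \<open>M0\<close> of \<open>F\<close> in \<open>M\<close> the operators
  \<open>V - F\<close> and \<open>V\<close> agree, and \<open>V\<close> is bijective, so the image
  of \<open>M0\<close> has the same codimension \<open>r\<close> in \<open>M\<close> as
  \<open>M0\<close>. The kernel of \<open>V - F\<close>, of dimension \<open>j\<close>, meets
  \<open>M0\<close> only in \<open>0\<close>; the image of \<open>M\<close> therefore has dimension
  \<open>r - j\<close> over the image of \<open>M0\<close>, which leaves codimension
  \<open>j\<close>.\<close>

lemma weyl_on_finite_rank_perturbation:
  assumes M: "complex_vector.subspace M" and VM: "cblinfun_apply V ` M = M" and V0: "null_space V \<inter> M = {0}"
    and FM: "cblinfun_apply F ` M \<subseteq> M" and fin: "finite B" "cblinfun_apply F ` M \<subseteq> complex_vector.span B"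
  shows "weyl_on M (V - F)"
proof -
  let ?S = "V - F"
  let ?M0 = "null_space F \<inter> M" and ?N = "null_space ?S \<inter> M"
  have M0: "complex_vector.subspace ?M0" and N: "complex_vector.subspace ?N"
    by (intro complex_vector.subspace_inter csubspace_null_space M)+
  have SM: "cblinfun_apply ?S ` M \<subseteq> M"
    using VM FM complex_vector.subspace_diff[OF M] by (auto simp: cblinfun_apply_diff_left image_subset_iff)
  obtain r where r: "qdim M ?M0 r"
    using qdim_exists[OF M0 indep_mod_null_card_le[OF M _ _ fin]] by blast
  have NM0: "?N \<inter> ?M0 = {0}"
  proof -
    have "x = 0" if "x \<in> ?N \<inter> ?M0" for x
    proof -
      have "x \<in> null_space V \<inter> M" using that by (simp add: null_space_def cblinfun_apply_diff_left)
      then show ?thesis using V0 by simp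
    qed
    then show ?thesis using complex_vector.subspace_0[OF N] complex_vector.subspace_0[OF M0] by blast
  qed
  obtain j where j: "qdim ?N ?M0 j" using qdim_sub_exists[OF M0 r, of ?N] by blast
  obtain C where C: "quotient_basis ?N ?M0 C" "card C = j" using j by (auto simp: qdim_def)
  have CN: "C \<subseteq> ?N" using C by (simp add: quotient_basis_def)
  have "quotient_basis ?N {0} C"
    unfolding quotient_basis_iff
  proof (intro conjI CN)
    show "indep_mod {0} C" using C complex_vector.subspace_0[OF M0]
      unfolding quotient_basis_iff by (auto intro: indep_mod_mono)
    show "?N \<subseteq> span_mod {0} C"
    proof
      fix x assume x: "x \<in> ?N"
      then obtain c where c: "x - (\<Sum>b\<in>C. c b *\<^sub>C b) \<in> ?M0" using C unfolding quotient_basis_def by blast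
      have "x - (\<Sum>b\<in>C. c b *\<^sub>C b) \<in> ?N"
        using CN by (intro complex_vector.subspace_diff[OF N x] complex_vector.subspace_sum[OF N] complex_vector.subspace_scale[OF N]) auto
      then have "x - (\<Sum>b\<in>C. c b *\<^sub>C b) \<in> {0}" using c NM0 by blast
      then show "x \<in> span_mod {0} C" by (rule span_modI)
    qed
  qed
  then have N0: "qdim ?N {0} j" using C(2) qdimI by metis
  let ?Q = "ssum ?N ?M0"
  have S0: "complex_vector.subspace ?Q" by (rule csubspace_ssum[OF N M0])
  have S0M: "?Q \<subseteq> M" unfolding ssum_def using complex_vector.subspace_add[OF M] by auto
  have NS0: "?N \<subseteq> ?Q" and M0S0: "?M0 \<subseteq> ?Q"
    unfolding ssum_def using complex_vector.subspace_0[OF N] complex_vector.subspace_0[OF M0] by force+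
  have "qdim ?Q ?M0 j" using N0 NM0 by (intro qdim_ssum[OF N M0]) simp
  moreover obtain i where i: "qdim M ?Q i" using qdim_quot_exists[OF S0 r M0S0] by blast
  ultimately have "qdim M ?M0 (i + j)" by (intro qdim_add[OF S0 M0S0 S0M])
  then have ri: "r = i + j" using qdim_unique[OF M0 r] by blast
  have "qdim (cblinfun_apply ?S ` M) (cblinfun_apply ?S ` ?Q) i"
    using NS0 by (intro qdim_image[OF M S0 S0M _ i])
  also have "cblinfun_apply ?S ` ?Q = cblinfun_apply ?S ` ?M0"
  proof
    show "cblinfun_apply ?S ` ?Q \<subseteq> cblinfun_apply ?S ` ?M0"
      by (auto simp: ssum_def null_space_def cblinfun_apply_add_right)
  qed (use M0S0 in blast)
  finally have SS: "qdim (cblinfun_apply ?S ` M) (cblinfun_apply ?S ` ?M0) i" .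
  have SV: "cblinfun_apply ?S ` ?M0 = cblinfun_apply V ` ?M0"
    by (intro image_cong) (auto simp: null_space_def cblinfun_apply_diff_left)
  have "qdim (cblinfun_apply V ` M) (cblinfun_apply V ` ?M0) r"
    using V0 complex_vector.subspace_0[OF M0] by (intro qdim_image[OF M M0 _ _ r]) auto
  then have Mr: "qdim M (cblinfun_apply ?S ` ?M0) r" unfolding VM SV .
  have SM_sub: "complex_vector.subspace (cblinfun_apply ?S ` M)" by (rule csubspace_image[OF M])
  obtain l where l: "qdim M (cblinfun_apply ?S ` M) l"
    using qdim_quot_exists[OF SM_sub Mr] by blast
  have "qdim M (cblinfun_apply ?S ` ?M0) (l + i)"
    by (rule qdim_add[OF SM_sub _ SM l SS]) blast
  then have "r = l + i" using qdim_unique[OF csubspace_image[OF M0] Mr] by blast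
  then have "l = j" using ri by simp
  then show ?thesis using N0 l weyl_on_iff[OF M] by blast
qed

section \<open>Weyl operators and generalized Browder's theorem\<close>

text \<open>The span with one more vector \<open>b\<close> is the preimage of the old, closed one
  under the continuous map \<open>x \<mapsto> x - (f x / f b) b\<close>, where \<open>f\<close>
  vanishes on the old span but not at \<open>b\<close>.\<close>

lemma closed_span_finite:
  fixes B :: "'a::complex_normed_vector set"
  assumes "finite B"
  shows "closed (complex_vector.span B)"
  using assms
proof (induction B rule: finite_induct)
  case empty
  then show ?case by simp
next
  case (insert b B)
  let ?S = "complex_vector.span B"
  show ?case
  proof (cases "b \<in> ?S")
    case True
    then show ?thesis using insert.IH by (simp add: complex_vector.span_redundant)
  next
    case False
    have "infdist b ?S \<noteq> 0"
      using False insert.IH in_closed_iff_infdist_zero[of ?S b] complex_vector.span_zero by blast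
    then obtain f :: "'a \<Rightarrow>\<^sub>C\<^sub>L complex" where f: "\<And>x. x \<in> ?S \<Longrightarrow> f x = 0" "f b \<noteq> 0"
      using Hahn_Banach_infdist[OF complex_vector.subspace_span, of B b] by (metis of_real_eq_0_iff)
    define G where "G = id_cblinfun - rank_one (inverse (f b) *\<^sub>C b) f"
    have G: "G x = x - (f x * inverse (f b)) *\<^sub>C b" for x
      by (simp add: G_def cblinfun_apply_diff_left)
    have "complex_vector.span (insert b B) = cblinfun_apply G -` ?S"
    proof (intro equalityI subsetI)
      fix x assume "x \<in> complex_vector.span (insert b B)"
      then obtain k where k: "x - k *\<^sub>C b \<in> ?S" using complex_vector.span_breakdown_eq by blast
      have "f x - k * f b = f (x - k *\<^sub>C b)"
        by (simp add: cblinfun_diff_right cblinfun_apply_scaleC_right scaleC_complex_def)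
      then have "f x = k * f b" using f(1)[OF k] by simp
      then have "f x * inverse (f b) = k" using f(2) by simp
      then show "x \<in> cblinfun_apply G -` ?S" using k by (simp only: vimage_eq G)
    next
      fix x assume "x \<in> cblinfun_apply G -` ?S"
      then show "x \<in> complex_vector.span (insert b B)"
        unfolding complex_vector.span_breakdown_eq by (auto simp: G)
    qed
    then show ?thesis
      using insert.IH by (simp add: closed_vimage linear_continuous_on bounded_linear_cblinfun_apply)
  qed
qed

lemma span_Int_zero:
  assumes "indep_mod N B" "g \<in> complex_vector.span B" "g \<in> N"
  shows "g = 0"
proof -
  have "finite B" using assms by (simp add: indep_mod_def)
  then obtain u where "g = (\<Sum>b\<in>B. u b *\<^sub>C b)"
    using assms(2) complex_vector.span_finite by fastforce
  moreover from this have "\<forall>b\<in>B. u b = 0" using assms(1,3) unfolding indep_mod_def by blast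
  ultimately show ?thesis by simp
qed

text \<open>A finite-dimensional complement of \<open>T M\<close> in \<open>M\<close> turns
  \<open>T\<close> into a surjection \<open>(x, g) \<mapsto> T x + g\<close> onto \<open>M\<close>.
  The component \<open>g\<close> is unique, since the complement meets \<open>T M\<close> only in
  \<open>0\<close>, and the open mapping theorem bounds it; so it vanishes at limits of points of
  \<open>T M\<close>.\<close>

lemma closed_image_finite_codim:
  fixes T :: "'a::cbanach \<Rightarrow>\<^sub>C\<^sub>L 'a"
  assumes M: "complex_vector.subspace M" "closed M" and TM: "cblinfun_apply T ` M \<subseteq> M"
    and k: "qdim M (cblinfun_apply T ` M) k"
  shows "closed (cblinfun_apply T ` M)"
proof -
  obtain B where B: "quotient_basis M (cblinfun_apply T ` M) B" using k by (auto simp: qdim_def)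
  then have ind: "indep_mod (cblinfun_apply T ` M) B" and fin: "finite B" and BM: "B \<subseteq> M"
    by (auto simp: quotient_basis_iff indep_mod_def)
  let ?G = "complex_vector.span B"
  have GM: "?G \<subseteq> M" using BM M(1) by (rule complex_vector.span_minimal)
  have TMs: "complex_vector.subspace (cblinfun_apply T ` M)" by (rule csubspace_image[OF M(1)])
  define D where "D = {p::'a \<times> 'a. fst p \<in> M \<and> snd p \<in> ?G}"
  define F where "F p = T (fst p) + snd p" for p :: "'a \<times> 'a"
  have bF: "bounded_linear F"
    unfolding F_def by (intro bounded_linear_add bounded_linear_compose[OF bounded_linear_cblinfun_apply]
        bounded_linear_fst bounded_linear_snd)
  have sD: "subspace D"
    using csubspace_imp_subspace[OF M(1)] csubspace_imp_subspace[OF complex_vector.subspace_span[of B]]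
    unfolding D_def subspace_def by auto
  have "D = M \<times> ?G" by (auto simp: D_def)
  then have cD: "closed D" using M(2) closed_span_finite[OF fin] by (simp add: closed_Times)
  have FD: "F ` D = M"
  proof
    show "F ` D \<subseteq> M"
      using TM GM complex_vector.subspace_add[OF M(1)] by (auto simp: F_def D_def image_subset_iff subset_iff)
    show "M \<subseteq> F ` D"
    proof
      fix y assume "y \<in> M"
      then obtain c where "y - (\<Sum>b\<in>B. c b *\<^sub>C b) \<in> cblinfun_apply T ` M"
        using B unfolding quotient_basis_def by blast
      then obtain x where "x \<in> M" "y - (\<Sum>b\<in>B. c b *\<^sub>C b) = T x" by auto
      then show "y \<in> F ` D"
        using sum_mem_span[of c B] by (intro image_eqI[of _ _ "(x, \<Sum>b\<in>B. c b *\<^sub>C b)"]) (simp_all add: F_def D_def algebra_simps)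
    qed
  qed
  obtain C where C: "0 < C" "\<And>y. y \<in> M \<Longrightarrow> \<exists>x\<in>D. F x = y \<and> norm x \<le> C * norm y"
    by (rule open_mapping_subspace[OF bF sD cD csubspace_imp_subspace[OF M(1)] M(2) FD]) blast
  show ?thesis
    unfolding closed_sequential_limits
  proof (intro allI impI, elim conjE)
    fix Y y assume Y: "\<forall>n. Y n \<in> cblinfun_apply T ` M" "Y \<longlonglongrightarrow> y"
    then have "\<And>n. Y n \<in> M" using TM by blast
    then have yM: "y \<in> M" using closed_sequentially[OF M(2) _ Y(2)] by blast
    then obtain p where p: "p \<in> D" "F p = y" using FD by auto
    have bound: "norm (snd p) \<le> C * norm (y - Y n)" for n
    proof -
      have "y - Y n \<in> M" using yM \<open>\<And>n. Y n \<in> M\<close> complex_vector.subspace_diff[OF M(1)] by blast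
      then obtain q where q: "q \<in> D" "F q = y - Y n" "norm q \<le> C * norm (y - Y n)" using C(2) by blast
      have "snd p - snd q = (Y n - T (fst p)) + T (fst q)"
        using p(2) q(2) by (simp add: F_def algebra_simps)
      also have "\<dots> \<in> cblinfun_apply T ` M"
        using Y(1) p(1) q(1) by (intro complex_vector.subspace_add[OF TMs] complex_vector.subspace_diff[OF TMs]) (auto simp: D_def)
      finally have "snd p - snd q = 0"
        using p(1) q(1) by (intro span_Int_zero[OF ind]) (auto simp: D_def intro: complex_vector.span_diff)
      then show ?thesis using norm_snd_le[of "snd q" "fst q"] q(3) by simp
    qed
    have "(\<lambda>n. C * norm (y - Y n)) \<longlonglongrightarrow> C * norm (y - y)"
      by (intro tendsto_intros Y(2))
    then have "norm (snd p) \<le> C * norm (y - y)"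
      by (rule LIMSEQ_le_const) (use bound in blast)
    then have "y = T (fst p)" using p(2) by (simp add: F_def)
    then show "y \<in> cblinfun_apply T ` M" using p(1) by (simp add: D_def)
  qed
qed

lemma shift_apply: "cblinfun_apply (T - \<mu> *\<^sub>C id_cblinfun) x = T x - \<mu> *\<^sub>C x"
  by (simp add: cblinfun_apply_diff_left cblinfun_apply_scaleC_left)

text \<open>\<open>x\<close> is the power series in \<open>\<mu>\<close> whose coefficients are iterated preimages of \<open>x0\<close>.\<close>

lemma perturbed_preimage:
  fixes T :: "'a::cbanach \<Rightarrow>\<^sub>C\<^sub>L 'a"
  assumes M: "complex_vector.subspace M" "closed M"
    and C: "0 < C" "\<And>y. y \<in> M \<Longrightarrow> \<exists>x\<in>M. T x = y \<and> norm x \<le> C * norm y"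
    and x0: "x0 \<in> M" and \<mu>: "cmod \<mu> * C \<le> 1 / 3"
  obtains x where "x \<in> M" "T x - \<mu> *\<^sub>C x = T x0" "norm (x - x0) \<le> norm x0 / 2"
proof -
  obtain g where g: "\<And>y. y \<in> M \<Longrightarrow> g y \<in> M" "\<And>y. y \<in> M \<Longrightarrow> T (g y) = y" "\<And>y. y \<in> M \<Longrightarrow> norm (g y) \<le> C * norm y"
    using C(2) by metis
  define X where "X n = (g ^^ n) x0" for n
  have XM: "X n \<in> M" for n unfolding X_def by (induction n) (auto intro: g x0)
  have X0: "X 0 = x0" and XS: "T (X (Suc n)) = X n" for n
    using g(2)[OF XM[of n]] by (simp_all add: X_def)
  have Xn: "norm (X n) \<le> C ^ n * norm x0" for n
  proof (induction n)
    case (Suc n)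
    have "norm (X (Suc n)) \<le> C * norm (X n)" using g(3)[OF XM[of n]] by (simp add: X_def)
    also have "\<dots> \<le> C * (C ^ n * norm x0)" using Suc C(1) by (intro mult_left_mono) auto
    finally show ?case by simp
  qed (simp add: X0)
  define Y where "Y n = \<mu> ^ n *\<^sub>C X n" for n
  have Yn: "norm (Y n) \<le> norm x0 * (1 / 3) ^ n" for n
  proof -
    have "norm (Y n) \<le> cmod \<mu> ^ n * (C ^ n * norm x0)"
      using Xn[of n] by (simp add: Y_def norm_scaleC norm_power mult_left_mono)
    also have "\<dots> = (cmod \<mu> * C) ^ n * norm x0" by (simp add: power_mult_distrib mult.assoc)
    also have "\<dots> \<le> (1 / 3) ^ n * norm x0" using \<mu> C(1) by (intro mult_right_mono power_mono) auto
    finally show ?thesis by (simp add: mult.commute)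
  qed
  have geo: "(\<lambda>n. norm x0 * (1 / 3) ^ n) sums (norm x0 * (3 / 2))"
    using sums_mult[OF geometric_sums[of "1 / 3 :: real"], of "norm x0"] by simp
  have sn: "summable (\<lambda>n. norm (Y n))"
    by (rule summable_comparison_test'[OF sums_summable[OF geo], of 0]) (simp add: Yn)
  have sY: "summable Y" using sn by (rule summable_norm_cancel)
  define x where "x = suminf Y"
  have partial: "(\<Sum>k<n. Y k) \<in> M" for n
    unfolding Y_def by (intro complex_vector.subspace_sum[OF M(1)] complex_vector.subspace_scale[OF M(1)] XM)
  have xM: "x \<in> M"
    unfolding x_def by (rule closed_sequentially[OF M(2) partial summable_LIMSEQ[OF sY]])
  have sYS: "summable (\<lambda>n. Y (Suc n))" using sY by (simp add: summable_Suc_iff)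
  have split: "x = x0 + (\<Sum>n. Y (Suc n))"
    using suminf_split_head[OF sY] by (simp add: x_def Y_def X0 scaleC_one)
  have "T x = T x0 + T (\<Sum>n. Y (Suc n))" by (subst split) (rule cblinfun_apply_add_right)
  also have "T (\<Sum>n. Y (Suc n)) = (\<Sum>n. T (Y (Suc n)))"
    using bounded_linear.suminf[OF bounded_linear_cblinfun_apply sYS, of T] by simp
  also have "(\<lambda>n. T (Y (Suc n))) = (\<lambda>n. \<mu> *\<^sub>C Y n)"
    by (rule ext) (simp only: Y_def cblinfun_apply_scaleC_right XS scaleC_scaleC power_Suc)
  also have "(\<Sum>n. \<mu> *\<^sub>C Y n) = \<mu> *\<^sub>C x"
    unfolding x_def using bounded_linear.suminf[OF bounded_linear_scaleC sY, of \<mu>] by simp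
  finally have eq: "T x - \<mu> *\<^sub>C x = T x0" by simp
  \<comment> \<open>The bound \<open>1 / 3\<close> makes the tail at most half of
    \<open>norm x0\<close>, so that \<open>x\<close> is nonzero whenever \<open>x0\<close>
    is.\<close>
  have geoS: "(\<lambda>n. norm x0 * (1 / 3) ^ Suc n) sums (norm x0 / 2)"
    using sums_mult[OF geometric_sums[of "1 / 3 :: real"], of "norm x0 / 3"] by simp
  have "norm (x - x0) = norm (\<Sum>n. Y (Suc n))" using split by simp
  also have "\<dots> \<le> (\<Sum>n. norm (Y (Suc n)))"
    using sn by (intro summable_norm) (simp add: summable_Suc_iff[of "\<lambda>n. norm (Y n)"])
  also have "\<dots> \<le> (\<Sum>n. norm x0 * (1 / 3) ^ Suc n)"
    using sn by (intro suminf_le Yn sums_summable[OF geoS]) (simp add: summable_Suc_iff[of "\<lambda>n. norm (Y n)"])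
  also have "\<dots> = norm x0 / 2" using geoS by (simp add: sums_iff)
  finally show thesis using that[OF xM eq] by blast
qed

lemma dual_functional:
  fixes B :: "'a::complex_normed_vector set"
  assumes "finite B" "complex_vector.independent B" "b \<in> B"
  obtains f :: "'a \<Rightarrow>\<^sub>C\<^sub>L complex" where "f b = 1" "\<And>b'. b' \<in> B \<Longrightarrow> b' \<noteq> b \<Longrightarrow> f b' = 0"
proof -
  let ?S = "complex_vector.span (B - {b})"
  have "b \<notin> ?S" using assms(2,3) by (auto simp: complex_vector.dependent_def)
  moreover have "closed ?S" using assms(1) by (intro closed_span_finite) simp
  ultimately have d: "infdist b ?S \<noteq> 0"
    using in_closed_iff_infdist_zero[of ?S b] complex_vector.span_zero by blast
  obtain f :: "'a \<Rightarrow>\<^sub>C\<^sub>L complex" where f: "\<And>x. x \<in> ?S \<Longrightarrow> f x = 0" "f b = complex_of_real (infdist b ?S)"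
    by (rule Hahn_Banach_infdist[OF complex_vector.subspace_span, of "B - {b}" b]) blast
  let ?g = "inverse (f b) *\<^sub>C f"
  show thesis
  proof (rule that[of ?g])
    show "?g b = 1" using d f(2) by (simp add: cblinfun_apply_scaleC_left scaleC_complex_def)
    fix b' assume "b' \<in> B" "b' \<noteq> b"
    then have "f b' = 0" by (intro f(1) complex_vector.span_base) simp
    then show "?g b' = 0" by (simp add: cblinfun_apply_scaleC_left)
  qed
qed

lemma cblinfun_sum_left: "cblinfun_apply (\<Sum>i\<in>I. f i) x = (\<Sum>i\<in>I. cblinfun_apply (f i) x)"
  by (induction I rule: infinite_finite_induct) (simp_all add: cblinfun_apply_add_left)

text \<open>Kernel and cokernel have equal dimension, so an operator \<open>F\<close> of finite rank
  can map a basis of one bijectively to a basis of the other; then \<open>V = T + F\<close> is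
  bijective on \<open>M\<close>. Bijectivity survives a small shift, and \<open>T - \<mu>\<close> is
  \<open>V - \<mu>\<close> perturbed by finite rank.\<close>

lemma weyl_on_nearby:
  fixes T :: "'a::cbanach \<Rightarrow>\<^sub>C\<^sub>L 'a"
  assumes M: "complex_vector.subspace M" "closed M" and TM: "cblinfun_apply T ` M \<subseteq> M" and w: "weyl_on M T"
  obtains \<delta> where "0 < \<delta>" "\<And>\<mu>. cmod \<mu> < \<delta> \<Longrightarrow> weyl_on M (T - \<mu> *\<^sub>C id_cblinfun)"
proof -
  let ?N = "null_space T \<inter> M"
  obtain k where k: "qdim ?N {0} k" "qdim M (cblinfun_apply T ` M) k" using w weyl_on_iff[OF M(1)] by blast
  obtain A where A: "quotient_basis ?N {0} A" "card A = k" using k(1) by (auto simp: qdim_def)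
  obtain B where B: "quotient_basis M (cblinfun_apply T ` M) B" "card B = k" using k(2) by (auto simp: qdim_def)
  note a = qdim_zero_basis[OF A(1)]
  have finB: "finite B" and BM: "B \<subseteq> M" using B by (auto simp: quotient_basis_def)
  have indB: "\<And>c. (\<Sum>b\<in>B. c b *\<^sub>C b) \<in> cblinfun_apply T ` M \<Longrightarrow> \<forall>b\<in>B. c b = 0"
    using B(1) unfolding quotient_basis_def by blast
  obtain h where h: "bij_betw h A B" using finite_same_card_bij[OF a(3) finB] A(2) B(2) by auto
  have "\<forall>b\<in>A. \<exists>f :: 'a \<Rightarrow>\<^sub>C\<^sub>L complex. f b = 1 \<and> (\<forall>b'\<in>A. b' \<noteq> b \<longrightarrow> f b' = 0)"
    using dual_functional[OF a(3,1)] by metis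
  then obtain f :: "'a \<Rightarrow> 'a \<Rightarrow>\<^sub>C\<^sub>L complex" where f1: "\<And>b. b \<in> A \<Longrightarrow> f b b = 1"
    and f0: "\<And>b b'. b \<in> A \<Longrightarrow> b' \<in> A \<Longrightarrow> b' \<noteq> b \<Longrightarrow> f b b' = 0" by metis
  have fsum: "f b (\<Sum>b'\<in>A. c b' *\<^sub>C b') = c b" if "b \<in> A" for b c
  proof -
    have "f b (\<Sum>b'\<in>A. c b' *\<^sub>C b') = (\<Sum>b'\<in>A. c b' * f b b')"
      by (simp add: cblinfun_sum_right cblinfun_apply_scaleC_right scaleC_complex_def)
    also have "\<dots> = (\<Sum>b'\<in>{b}. c b' * f b b')"
      using that a(3) f0 by (intro sum.mono_neutral_right) auto
    finally show ?thesis using f1[OF that] by simp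
  qed
  define F where "F = (\<Sum>b\<in>A. rank_one (h b) (f b))"
  have F: "F x = (\<Sum>b\<in>A. f b x *\<^sub>C h b)" for x by (simp add: F_def cblinfun_sum_left)
  have hA: "h b \<in> B" if "b \<in> A" for b using h that by (auto simp: bij_betw_def)
  have F_span: "F x \<in> complex_vector.span B" for x
    unfolding F by (intro complex_vector.span_sum complex_vector.span_scale complex_vector.span_base hA)
  have FM: "F x \<in> M" for x using F_span complex_vector.span_minimal[OF BM M(1)] by blast
  define V where "V = T + F"
  have V: "V x = T x + F x" for x by (simp add: V_def cblinfun_apply_add_left)
  have V_sub: "cblinfun_apply V ` M \<subseteq> M"
    using TM FM complex_vector.subspace_add[OF M(1)] by (auto simp: V)
  have V_onto: "M \<subseteq> cblinfun_apply V ` M"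
  proof
    fix y assume "y \<in> M"
    then obtain c where "y - (\<Sum>b\<in>B. c b *\<^sub>C b) \<in> cblinfun_apply T ` M"
      using B unfolding quotient_basis_def by blast
    then obtain x where x: "x \<in> M" "y - (\<Sum>b\<in>B. c b *\<^sub>C b) = T x" by auto
    \<comment> \<open>A kernel element: it leaves \<open>T x\<close> unchanged and corrects the
      values of the functionals \<open>f b\<close> to the required coefficients.\<close>
    define n where "n = (\<Sum>b\<in>A. (c (h b) - f b x) *\<^sub>C b)"
    have n: "n \<in> ?N"
      unfolding n_def using a(4)
      by (intro complex_vector.subspace_sum complex_vector.subspace_scale complex_vector.subspace_inter csubspace_null_space M(1)) auto
    have "F (x + n) = (\<Sum>b\<in>A. c (h b) *\<^sub>C h b)"
      unfolding F by (intro sum.cong refl) (simp add: cblinfun_apply_add_right n_def fsum)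
    also have "\<dots> = (\<Sum>b\<in>B. c b *\<^sub>C b)" using sum.reindex_bij_betw[OF h, of "\<lambda>b. c b *\<^sub>C b"] .
    finally have "V (x + n) = T x + (\<Sum>b\<in>B. c b *\<^sub>C b)"
      using n by (simp add: V cblinfun_apply_add_right null_space_def)
    then have "y = V (x + n)" using x(2) by (simp add: algebra_simps)
    moreover have "x + n \<in> M" using x n complex_vector.subspace_add[OF M(1)] by auto
    ultimately show "y \<in> cblinfun_apply V ` M" by blast
  qed
  have V_inj: "x = 0" if x: "x \<in> M" "V x = 0" for x
  proof -
    have "F x = T (- x)" using x(2) by (simp add: V eq_neg_iff_add_eq_0 add.commute cblinfun_diff_right[of T 0 x, simplified])
    then have "(\<Sum>b\<in>A. f b x *\<^sub>C h b) \<in> cblinfun_apply T ` M"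
      using complex_vector.subspace_neg[OF M(1) x(1)] by (simp add: F)
    moreover have "(\<Sum>b\<in>A. f b x *\<^sub>C h b) = (\<Sum>b\<in>B. f (the_inv_into A h b) x *\<^sub>C b)"
      using sum.reindex_bij_betw[OF h, of "\<lambda>b. f (the_inv_into A h b) x *\<^sub>C b"] h
      by (simp add: the_inv_into_f_f bij_betw_def cong: sum.cong)
    ultimately have "(\<Sum>b\<in>B. f (the_inv_into A h b) x *\<^sub>C b) \<in> cblinfun_apply T ` M" by simp
    then have z: "\<forall>b\<in>B. f (the_inv_into A h b) x = 0" by (rule indB)
    have fz: "f b x = 0" if "b \<in> A" for b
      using bspec[OF z hA[OF that]] h that by (simp add: the_inv_into_f_f bij_betw_def)
    then have "F x = 0" by (simp add: F)
    then have "x \<in> ?N" using x by (simp add: V null_space_def)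
    then obtain c where "x - (\<Sum>b\<in>A. c b *\<^sub>C b) \<in> {0}" using A(1) unfolding quotient_basis_def by blast
    then have c: "x = (\<Sum>b\<in>A. c b *\<^sub>C b)" by simp
    have "c b = 0" if "b \<in> A" for b
      using fsum[OF that, of c] fz[OF that] unfolding c[symmetric] by simp
    then have "(\<Sum>b\<in>A. c b *\<^sub>C b) = 0" by simp
    then show "x = 0" using c by (rule trans[rotated])
  qed
  have VM: "cblinfun_apply V ` M = M" using V_sub V_onto by blast
  obtain C where C: "0 < C" "\<And>y. y \<in> M \<Longrightarrow> \<exists>x\<in>M. V x = y \<and> norm x \<le> C * norm y"
    by (rule open_mapping_subspace[OF bounded_linear_cblinfun_apply csubspace_imp_subspace[OF M(1)] M(2)
          csubspace_imp_subspace[OF M(1)] M(2) VM]) blast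
  have V_low: "norm x \<le> C * norm (V x)" if x: "x \<in> M" for x
  proof -
    have "V x \<in> M" using V_sub x by blast
    then obtain x' where x': "x' \<in> M" "V x' = V x" "norm x' \<le> C * norm (V x)" using C(2) by blast
    have "V (x - x') = 0" by (simp only: cblinfun_diff_right x'(2) diff_self)
    then have "x - x' = 0" by (rule V_inj[OF complex_vector.subspace_diff[OF M(1) x x'(1)]])
    then show ?thesis using x'(3) by simp
  qed
  show thesis
  proof (rule that[of "1 / (3 * C)"])
    fix \<mu> assume "cmod \<mu> < 1 / (3 * C)"
    then have \<mu>: "cmod \<mu> * C \<le> 1 / 3" using C(1) by (simp add: field_simps)
    let ?W = "V - \<mu> *\<^sub>C id_cblinfun"
    have W: "?W x = V x - \<mu> *\<^sub>C x" for x by (rule shift_apply)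
    have "cblinfun_apply ?W ` M = M"
    proof
      show "cblinfun_apply ?W ` M \<subseteq> M"
        using V_sub complex_vector.subspace_diff[OF M(1)] complex_vector.subspace_scale[OF M(1)] by (auto simp: W image_subset_iff)
      show "M \<subseteq> cblinfun_apply ?W ` M"
      proof
        fix y assume "y \<in> M"
        then obtain x0 where x0: "x0 \<in> M" "V x0 = y" using V_onto by auto
        obtain x where "x \<in> M" "V x - \<mu> *\<^sub>C x = V x0"
          by (rule perturbed_preimage[OF M C x0(1) \<mu>])
        then show "y \<in> cblinfun_apply ?W ` M" using x0 W by force
      qed
    qed
    moreover have "null_space ?W \<inter> M = {0}"
    proof -
      have "x = 0" if x: "x \<in> M" "?W x = 0" for x
      proof -
        have "V x = \<mu> *\<^sub>C x" using x(2) by (simp add: W)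
        then have "norm x \<le> (cmod \<mu> * C) * norm x" using V_low[OF x(1)] by (simp add: norm_scaleC mult_ac)
        also have "\<dots> \<le> 1 / 3 * norm x" using \<mu> by (intro mult_right_mono) auto
        finally show ?thesis by simp
      qed
      then show ?thesis using complex_vector.subspace_0[OF M(1)] by (auto simp: null_space_def)
    qed
    ultimately have "weyl_on M (?W - F)"
      using FM F_span finB by (intro weyl_on_finite_rank_perturbation[OF M(1), of _ _ B]) auto
    moreover have "?W - F = T - \<mu> *\<^sub>C id_cblinfun" by (simp add: V_def)
    ultimately show "weyl_on M (T - \<mu> *\<^sub>C id_cblinfun)" by simp
  qed (use C in simp)
qed

section \<open>Passing from the range of a power to the whole space\<close>

lemma power_eigen: "cblinfun_apply T x = \<mu> *\<^sub>C x \<Longrightarrow> cblinfun_apply (T ^\<^sub>C n) x = \<mu> ^ n *\<^sub>C x"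
  by (induction n) (simp_all add: scaleC_one cblinfun_apply_scaleC_right mult.commute)

lemma shift_power_decomposition:
  fixes T :: "'a::cbanach \<Rightarrow>\<^sub>C\<^sub>L 'a"
  shows "\<exists>y. (T ^\<^sub>C n) x - \<mu> ^ n *\<^sub>C x = (T - \<mu> *\<^sub>C id_cblinfun) y"
proof (induction n)
  case 0
  show ?case by (intro exI[of _ 0]) (simp add: scaleC_one)
next
  case (Suc n)
  then obtain y where y: "(T ^\<^sub>C n) x - \<mu> ^ n *\<^sub>C x = (T - \<mu> *\<^sub>C id_cblinfun) y" by blast
  have "(T ^\<^sub>C Suc n) x - \<mu> ^ Suc n *\<^sub>C x
      = (T ((T ^\<^sub>C n) x) - \<mu> *\<^sub>C (T ^\<^sub>C n) x) + \<mu> *\<^sub>C ((T ^\<^sub>C n) x - \<mu> ^ n *\<^sub>C x)"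
    by (simp add: complex_vector.scale_right_diff_distrib)
  also have "\<dots> = (T - \<mu> *\<^sub>C id_cblinfun) ((T ^\<^sub>C n) x + \<mu> *\<^sub>C y)"
    unfolding y by (simp only: shift_apply cblinfun_apply_add_right cblinfun_apply_scaleC_right scaleC_add_right
        complex_vector.scale_right_diff_distrib)
  finally show ?case by blast
qed

text \<open>For \<open>\<mu> \<noteq> 0\<close> the kernel of \<open>T - \<mu>\<close> lies in the
  range \<open>M\<close> of \<open>T^n\<close>. Also \<open>M\<close> and the range of
  \<open>T - \<mu>\<close> span the whole space and intersect in \<open>(T - \<mu>) M\<close>, so
  the second isomorphism theorem identifies the two cokernels.\<close>

lemma weyl_of_weyl_on_range:
  fixes T :: "'a::cbanach \<Rightarrow>\<^sub>C\<^sub>L 'a"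
  assumes \<mu>: "\<mu> \<noteq> 0" and w: "weyl_on (range (cblinfun_apply (T ^\<^sub>C n))) (T - \<mu> *\<^sub>C id_cblinfun)"
  shows "weyl (T - \<mu> *\<^sub>C id_cblinfun)"
proof -
  let ?S = "T - \<mu> *\<^sub>C id_cblinfun" and ?M = "range (cblinfun_apply (T ^\<^sub>C n))"
  have M: "complex_vector.subspace ?M" by (rule csubspace_range)
  have R: "complex_vector.subspace (range (cblinfun_apply ?S))" by (rule csubspace_range)
  obtain k where k: "qdim (null_space ?S \<inter> ?M) {0} k" "qdim ?M (cblinfun_apply ?S ` ?M) k"
    using w weyl_on_iff[OF M] by blast
  have memM: "x \<in> ?M" if "\<mu> ^ n *\<^sub>C x \<in> ?M" for x
  proof -
    have "inverse (\<mu> ^ n) *\<^sub>C \<mu> ^ n *\<^sub>C x \<in> ?M" by (rule complex_vector.subspace_scale[OF M that])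
    then show ?thesis using \<mu> by (simp add: scaleC_one)
  qed
  have "null_space ?S \<subseteq> ?M"
  proof
    fix x assume "x \<in> null_space ?S"
    then have "T x = \<mu> *\<^sub>C x" by (simp add: null_space_def shift_apply)
    then have eq: "(T ^\<^sub>C n) x = \<mu> ^ n *\<^sub>C x" by (rule power_eigen)
    show "x \<in> ?M" by (rule memM) (unfold eq[symmetric], rule rangeI)
  qed
  then have N: "null_space ?S \<inter> ?M = null_space ?S" by blast
  have int: "?M \<inter> range (cblinfun_apply ?S) = cblinfun_apply ?S ` ?M"
  proof
    show "?M \<inter> range (cblinfun_apply ?S) \<subseteq> cblinfun_apply ?S ` ?M"
    proof
      fix y assume y: "y \<in> ?M \<inter> range (cblinfun_apply ?S)"
      then obtain x where x: "y = ?S x" by auto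
      \<comment> \<open>Each \<open>T^j x\<close> agrees with \<open>\<mu>^j x\<close> modulo
        \<open>?M\<close>; at \<open>j = n\<close> this puts \<open>x\<close> itself into
        \<open>?M\<close>.\<close>
      have step: "(T ^\<^sub>C j) x - \<mu> ^ j *\<^sub>C x \<in> ?M" for j
      proof (induction j)
        case 0
        show ?case using complex_vector.subspace_0[OF M] by (simp add: scaleC_one)
      next
        case (Suc j)
        have "cblinfun_apply T ` ?M \<subseteq> ?M"
          using range_power_Suc[of T n] range_power_antimono[of n "Suc n" T] by auto
        then have TM: "T ((T ^\<^sub>C j) x - \<mu> ^ j *\<^sub>C x) \<in> ?M" using Suc by blast
        have "\<mu> ^ j *\<^sub>C y \<in> ?M" using y by (intro complex_vector.subspace_scale[OF M]) simp
        then have "T ((T ^\<^sub>C j) x - \<mu> ^ j *\<^sub>C x) + \<mu> ^ j *\<^sub>C y \<in> ?M"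
          by (rule complex_vector.subspace_add[OF M TM])
        also have "T ((T ^\<^sub>C j) x - \<mu> ^ j *\<^sub>C x) + \<mu> ^ j *\<^sub>C y = (T ^\<^sub>C Suc j) x - \<mu> ^ Suc j *\<^sub>C x"
          by (simp add: x shift_apply cblinfun_diff_right cblinfun_apply_scaleC_right
              complex_vector.scale_right_diff_distrib mult.commute)
        finally show ?case .
      qed
      have "(T ^\<^sub>C n) x - ((T ^\<^sub>C n) x - \<mu> ^ n *\<^sub>C x) \<in> ?M"
        by (rule complex_vector.subspace_diff[OF M _ step]) simp
      then have "\<mu> ^ n *\<^sub>C x \<in> ?M" by simp
      then have "x \<in> ?M" by (rule memM)
      then show "y \<in> cblinfun_apply ?S ` ?M" using x by blast
    qed
    show "cblinfun_apply ?S ` ?M \<subseteq> ?M \<inter> range (cblinfun_apply ?S)"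
    proof -
      have "cblinfun_apply T ` ?M \<subseteq> ?M"
        using range_power_Suc[of T n] range_power_antimono[of n "Suc n" T] by auto
      then have "?S x \<in> ?M" if "x \<in> ?M" for x
        unfolding shift_apply using that
        by (intro complex_vector.subspace_diff[OF M] complex_vector.subspace_scale[OF M]) blast+
      then show ?thesis by blast
    qed
  qed
  have "ssum ?M (range (cblinfun_apply ?S)) = UNIV"
  proof -
    have "x \<in> ssum ?M (range (cblinfun_apply ?S))" for x
    proof -
      obtain y where y: "(T ^\<^sub>C n) x - \<mu> ^ n *\<^sub>C x = ?S y" using shift_power_decomposition by blast
      have 1: "inverse (\<mu> ^ n) *\<^sub>C (T ^\<^sub>C n) x \<in> ?M" by (rule complex_vector.subspace_scale[OF M]) simp
      have 2: "(- inverse (\<mu> ^ n)) *\<^sub>C ?S y \<in> range (cblinfun_apply ?S)"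
        by (rule complex_vector.subspace_scale[OF R]) simp
      have "inverse (\<mu> ^ n) *\<^sub>C (T ^\<^sub>C n) x + (- inverse (\<mu> ^ n)) *\<^sub>C ?S y = x"
        unfolding y[symmetric] using \<mu> by (simp add: complex_vector.scale_right_diff_distrib scaleC_one)
      then show ?thesis unfolding ssum_def using 1 2 by (metis (mono_tags, lifting) mem_Collect_eq)
    qed
    then show ?thesis by blast
  qed
  then have "qdim UNIV (range (cblinfun_apply ?S)) k"
    using qdim_ssum[OF M R] k(2) unfolding int by simp
  then show ?thesis
    unfolding weyl_def weyl_on_iff[OF complex_vector.subspace_UNIV] using k(1) N by auto
qed

text \<open>If \<open>T\<close> is B-Weyl, then either the kernels \<open>N(T) \<inter> R(T^j)\<close> become trivial and \<open>T\<close> is Drazin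
  invertible, or they stabilise at a nonzero space. In the latter case \<open>T\<close> maps the intersection of
  the ranges onto itself with a nonzero kernel, so all nearby points are eigenvalues.\<close>

lemma b_weyl_dichotomy:
  fixes T :: "'a::cbanach \<Rightarrow>\<^sub>C\<^sub>L 'a"
  assumes bw: "b_weyl T" and nd: "\<And>p. \<not> drazin_elem p (Endo T)"
  obtains \<delta> where "0 < \<delta>" "\<And>\<mu>. cmod \<mu> < \<delta> \<Longrightarrow> \<mu> \<noteq> 0 \<Longrightarrow> weyl (T - \<mu> *\<^sub>C id_cblinfun)"
    "\<And>\<mu>. cmod \<mu> < \<delta> \<Longrightarrow> \<mu> \<in> spectrum T"
proof -
  obtain n where n: "closed (range (cblinfun_apply (T ^\<^sub>C n)))" "weyl_on (range (cblinfun_apply (T ^\<^sub>C n))) T"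
    using bw by (auto simp: b_weyl_def)
  define R where "R j = range (cblinfun_apply (T ^\<^sub>C (n + j)))" for j
  have Rs: "complex_vector.subspace (R j)" for j unfolding R_def by (rule csubspace_range)
  have RS: "R (Suc j) = cblinfun_apply T ` R j" for j
    unfolding R_def using range_power_Suc[of T "n + j"] by simp
  have Ranti: "R j \<subseteq> R i" if "i \<le> j" for i j unfolding R_def using that by (intro range_power_antimono) simp
  have TR: "cblinfun_apply T ` R j \<subseteq> R j" for j using RS Ranti[of j "Suc j"] by simp
  have cw: "closed (R j) \<and> weyl_on (R j) T" for j
  proof (induction j)
    case 0
    then show ?case using n by (simp add: R_def)
  next
    case (Suc j)
    then obtain k where "qdim (R j) (cblinfun_apply T ` R j) k" using weyl_on_iff[OF Rs] by blast
    then have "closed (R (Suc j))" unfolding RS using closed_image_finite_codim[OF Rs _ TR] Suc by blast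
    moreover have "weyl_on (R (Suc j)) T" unfolding RS using Suc by (intro weyl_on_image[OF Rs TR]) simp
    ultimately show ?case ..
  qed
  have "\<exists>k. qdim (null_space T \<inter> R j) {0} k \<and> qdim (R j) (R (Suc j)) k" for j
    using cw[of j] weyl_on_iff[OF Rs] unfolding RS by blast
  then obtain k where k: "\<And>j. qdim (null_space T \<inter> R j) {0} (k j)" "\<And>j. qdim (R j) (R (Suc j)) (k j)" by metis
  have Ns: "complex_vector.subspace (null_space T \<inter> R j)" for j
    by (intro complex_vector.subspace_inter csubspace_null_space Rs)
  \<comment> \<open>The spaces \<open>null_space T \<inter> R j\<close> decrease with
    \<open>j\<close>, so from a place of least dimension on they are constant.\<close>
  obtain m where m: "\<And>j. k m \<le> k j" using ex_has_least_nat[of "\<lambda>_. True" undefined k] by auto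
  have Nm: "null_space T \<inter> R j = null_space T \<inter> R m" if j: "m \<le> j" for j
  proof -
    have sub: "null_space T \<inter> R j \<subseteq> null_space T \<inter> R m" using Ranti[OF j] by blast
    have "{0} \<subseteq> null_space T \<inter> R j" using complex_vector.subspace_0[OF Ns] by simp
    then obtain a where a: "qdim (null_space T \<inter> R m) (null_space T \<inter> R j) a"
      using qdim_quot_exists[OF Ns k(1)[of m]] by blast
    have "qdim (null_space T \<inter> R m) {0} (a + k j)"
      by (rule qdim_add[OF Ns _ sub a k(1)]) (use complex_vector.subspace_0[OF Ns] in simp)
    then have "k m = a + k j" using qdim_unique[OF subspace_zero k(1)] by blast
    then have "a = 0" using m[of j] by simp
    then have "null_space T \<inter> R m \<subseteq> null_space T \<inter> R j" using a by (simp only: qdim_0_iff)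
    with sub show ?thesis by (rule equalityI)
  qed
  have "null_space T \<inter> R m \<noteq> {0}"
  proof
    assume N0: "null_space T \<inter> R m = {0}"
    have "qdim ({0} :: 'a set) {0} (k m)" using k(1)[of m] unfolding N0 .
    then have "k m = 0" using qdim_unique[OF subspace_zero _ iffD2[OF qdim_0_iff]] by blast
    then have "qdim (R m) (R (Suc m)) 0" using k(2)[of m] by simp
    then have "R m \<subseteq> R (Suc m)" by (simp only: qdim_0_iff)
    then have R1: "R m = R (Suc m)" using Ranti[of m "Suc m"] by simp
    have N1: "null_space (T ^\<^sub>C Suc (n + m)) \<subseteq> null_space (T ^\<^sub>C (n + m))"
    proof
      fix x assume "x \<in> null_space (T ^\<^sub>C Suc (n + m))"
      then have "(T ^\<^sub>C (n + m)) x \<in> null_space T \<inter> R m" by (simp add: null_space_def R_def)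
      then show "x \<in> null_space (T ^\<^sub>C (n + m))" unfolding N0 by (simp add: null_space_def)
    qed
    have "drazin_elem (n + m) (Endo T)"
      unfolding drazin_elem_Endo_iff
      using R1 N1 null_power_mono[of "n + m" "Suc (n + m)" T] by (simp add: R_def del: cblinfun_power.simps)
    then show False using nd by simp
  qed
  then obtain x0 where x0: "x0 \<in> null_space T \<inter> R m" "x0 \<noteq> 0"
    using complex_vector.subspace_0[OF Ns] by blast
  \<comment> \<open>The intersection of the ranges of all powers of \<open>T\<close>. It is closed
    and \<open>T\<close> maps it onto itself, so the series for perturbed preimages can be run
    inside it.\<close>
  define W where "W = (\<Inter>j\<in>{m..}. R j)"
  have Ws: "complex_vector.subspace W" unfolding W_def by (intro complex_vector.subspace_Inter) (use Rs in auto)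
  have Wc: "closed W" unfolding W_def using cw by (intro closed_INT) auto
  have x0W: "x0 \<in> W" unfolding W_def using x0(1) Nm by blast
  have "cblinfun_apply T ` W = W"
  proof
    show "cblinfun_apply T ` W \<subseteq> W" unfolding W_def using TR by blast
    show "W \<subseteq> cblinfun_apply T ` W"
    proof
      fix y assume y: "y \<in> W"
      have pre: "\<exists>x\<in>R j. y = T x" if "m \<le> j" for j
      proof -
        have "y \<in> R (Suc j)" using y that by (simp add: W_def)
        then show ?thesis unfolding RS by auto
      qed
      obtain x where x: "x \<in> R m" "y = T x" using pre[of m] by auto
      \<comment> \<open>Preimages of \<open>y\<close> in \<open>R m\<close> and \<open>R j\<close>
        differ by a kernel element, which already lies in \<open>R j\<close> by the choice of
        \<open>m\<close>.\<close>
      have "x \<in> R j" if j: "m \<le> j" for j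
      proof -
        obtain x' where x': "x' \<in> R j" "y = T x'" using pre[OF j] by auto
        then have "x - x' \<in> null_space T \<inter> R m"
          using x Ranti[OF j] complex_vector.subspace_diff[OF Rs] by (auto simp: null_space_def cblinfun_diff_right)
        then have "x - x' \<in> R j" using Nm[OF j] by blast
        then have "(x - x') + x' \<in> R j" using x'(1) by (rule complex_vector.subspace_add[OF Rs])
        then show ?thesis by simp
      qed
      then have "x \<in> W" by (simp add: W_def)
      then show "y \<in> cblinfun_apply T ` W" using x(2) by blast
    qed
  qed
  then obtain C where C: "0 < C" "\<And>y. y \<in> W \<Longrightarrow> \<exists>x\<in>W. T x = y \<and> norm x \<le> C * norm y"
    by (rule open_mapping_subspace[OF bounded_linear_cblinfun_apply csubspace_imp_subspace[OF Ws] Wc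
          csubspace_imp_subspace[OF Ws] Wc]) blast
  \<comment> \<open>The series started at the kernel vector \<open>x0\<close> yields an eigenvector,
    since \<open>T x0 = 0\<close>.\<close>
  have eig: "\<mu> \<in> spectrum T" if "cmod \<mu> < 1 / (3 * C)" for \<mu>
  proof -
    have "cmod \<mu> * C \<le> 1 / 3" using that C(1) by (simp add: field_simps)
    then obtain x where x: "T x - \<mu> *\<^sub>C x = T x0" "norm (x - x0) \<le> norm x0 / 2"
      using perturbed_preimage[OF Ws Wc C x0W] by metis
    have "x \<noteq> 0" using x(2) x0(2) by auto
    moreover have "(T - \<mu> *\<^sub>C id_cblinfun) x = 0" using x(1) x0(1) by (simp add: shift_apply null_space_def)
    ultimately show ?thesis
      unfolding spectrum_def using cblinfun_zero
      by (auto dest!: arg_cong[of _ id_cblinfun "\<lambda>U. cblinfun_apply U x"])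
  qed
  have "cblinfun_apply T ` range (cblinfun_apply (T ^\<^sub>C n)) \<subseteq> range (cblinfun_apply (T ^\<^sub>C n))"
    using TR[of 0] by (simp add: R_def)
  then obtain \<delta> where \<delta>: "0 < \<delta>"
    "\<And>\<mu>. cmod \<mu> < \<delta> \<Longrightarrow> weyl_on (range (cblinfun_apply (T ^\<^sub>C n))) (T - \<mu> *\<^sub>C id_cblinfun)"
    using weyl_on_nearby[OF csubspace_range n(1) _ n(2)] by metis
  show thesis
  proof (rule that[of "min \<delta> (1 / (3 * C))"])
    show "0 < min \<delta> (1 / (3 * C))" using \<delta>(1) C(1) by simp
    show "weyl (T - \<mu> *\<^sub>C id_cblinfun)" if "cmod \<mu> < min \<delta> (1 / (3 * C))" "\<mu> \<noteq> 0" for \<mu>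
      using that \<delta>(2) by (intro weyl_of_weyl_on_range) auto
    show "\<mu> \<in> spectrum T" if "cmod \<mu> < min \<delta> (1 / (3 * C))" for \<mu>
      using that eig by simp
  qed
qed

section \<open>Finite-rank operators and Browder's theorem\<close>

definition finite_dim :: "'a::complex_normed_vector set \<Rightarrow> bool" where
  "finite_dim M \<longleftrightarrow> (\<exists>B. finite B \<and> M \<subseteq> complex_vector.span B)"

lemma finite_dimI: "finite B \<Longrightarrow> M \<subseteq> complex_vector.span B \<Longrightarrow> finite_dim M"
  by (auto simp: finite_dim_def)

lemma finite_dim_subset: "finite_dim N \<Longrightarrow> M \<subseteq> N \<Longrightarrow> finite_dim M"
  unfolding finite_dim_def by blast

lemma finite_dim_iff_qdim: "finite_dim M \<longleftrightarrow> (\<exists>k. qdim M {0} k)"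
proof
  assume "finite_dim M"
  then show "\<exists>k. qdim M {0} k" unfolding finite_dim_def using qdim_zero_finite by metis
next
  assume "\<exists>k. qdim M {0} k"
  then obtain B where "quotient_basis M {0} B" by (auto simp: qdim_def)
  then show "finite_dim M" using qdim_zero_basis[of M B] by (intro finite_dimI) auto
qed

lemma cdim_finite_iff: "cdim M < \<infinity> \<longleftrightarrow> finite_dim M"
  by (simp add: cdim_def finite_dim_def)

lemma linear_map_span:
  assumes "\<And>x y. f (x + y) = f x + f y" "\<And>c x. f (c *\<^sub>C x) = c *\<^sub>C f x"
    and N: "complex_vector.subspace N" and B: "f ` B \<subseteq> N"
  shows "f ` complex_vector.span B \<subseteq> N"
proof -
  have "f 0 = 0" using assms(2)[of 0 0] by simp
  then have "complex_vector.subspace (f -` N)"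
    using complex_vector.subspace_0[OF N] complex_vector.subspace_add[OF N] complex_vector.subspace_scale[OF N]
    by (intro complex_vector.subspaceI) (auto simp: assms)
  then have "complex_vector.span B \<subseteq> f -` N" using B by (intro complex_vector.span_minimal) auto
  then show ?thesis by auto
qed

lemma finite_dim_image: "finite_dim M \<Longrightarrow> finite_dim (cblinfun_apply T ` M)"
proof -
  assume "finite_dim M"
  then obtain B where B: "finite B" "M \<subseteq> complex_vector.span B" by (auto simp: finite_dim_def)
  have "cblinfun_apply T ` complex_vector.span B \<subseteq> complex_vector.span (cblinfun_apply T ` B)"
    by (intro linear_map_span complex_vector.subspace_span complex_vector.span_superset
        cblinfun_apply_add_right cblinfun_apply_scaleC_right)
  then show ?thesis using B by (intro finite_dimI[of "cblinfun_apply T ` B"]) auto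
qed

lemma finite_dim_of_image:
  assumes M: "complex_vector.subspace M" and TM: "finite_dim (cblinfun_apply T ` M)"
    and N: "finite_dim (null_space T \<inter> M)"
  shows "finite_dim M"
proof -
  obtain B where B: "finite B" "cblinfun_apply T ` M \<subseteq> complex_vector.span B"
    using TM by (auto simp: finite_dim_def)
  have Ns: "complex_vector.subspace (null_space T \<inter> M)"
    by (intro complex_vector.subspace_inter csubspace_null_space M)
  obtain r where r: "qdim M (null_space T \<inter> M) r"
    using qdim_exists[OF Ns indep_mod_null_card_le[OF M _ _ B]] by blast
  obtain k where k: "qdim (null_space T \<inter> M) {0} k" using N finite_dim_iff_qdim by blast
  have "qdim M {0} (r + k)"
    using complex_vector.subspace_0[OF Ns] by (intro qdim_add[OF Ns _ _ r k]) auto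
  then show ?thesis using finite_dim_iff_qdim by blast
qed

definition fin_rank :: "'a::cbanach endo set" where
  "fin_rank = {x. finite_dim (range (cblinfun_apply (of_endo x)))}"

lemma Endo_fin_rank: "Endo T \<in> fin_rank \<longleftrightarrow> finite_dim (range (cblinfun_apply T))"
  by (simp add: fin_rank_def Endo_inverse)

lemma two_sided_ideal_fin_rank: "two_sided_ideal (fin_rank :: 'a::cbanach endo set)"
  unfolding two_sided_ideal_def
proof (intro conjI ballI allI)
  have "range (cblinfun_apply (0 :: 'a \<Rightarrow>\<^sub>C\<^sub>L 'a)) \<subseteq> complex_vector.span {}" by auto
  then show "0 \<in> (fin_rank :: 'a endo set)"
    unfolding zero_endo_def Endo_fin_rank by (intro finite_dimI[of "{}"]) simp_all
next
  fix x y :: "'a endo" assume x: "x \<in> fin_rank"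
  obtain S where S: "x = Endo S" by (cases x)
  obtain T where T: "y = Endo T" by (cases y)
  have fS: "finite_dim (range (cblinfun_apply S))" using x by (simp add: S Endo_fin_rank)
  show "x * y \<in> fin_rank" unfolding S T Endo_mult Endo_fin_rank
    by (rule finite_dim_subset[OF fS]) auto
  have "range (cblinfun_apply (T o\<^sub>C S)) = cblinfun_apply T ` range (cblinfun_apply S)" by auto
  then show "y * x \<in> fin_rank" unfolding S T Endo_mult Endo_fin_rank using finite_dim_image[OF fS] by simp
next
  fix x y :: "'a endo" assume xy: "x \<in> fin_rank" "y \<in> fin_rank"
  obtain S where S: "x = Endo S" by (cases x)
  obtain T where T: "y = Endo T" by (cases y)
  obtain B C where B: "finite B" "range (cblinfun_apply S) \<subseteq> complex_vector.span B"
    and C: "finite C" "range (cblinfun_apply T) \<subseteq> complex_vector.span C"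
    using xy unfolding S T Endo_fin_rank finite_dim_def by blast
  have "range (cblinfun_apply (S + T)) \<subseteq> complex_vector.span (B \<union> C)"
  proof
    fix z assume "z \<in> range (cblinfun_apply (S + T))"
    then obtain u where "z = S u + T u" by (auto simp: cblinfun_apply_add_left)
    moreover have "S u \<in> complex_vector.span (B \<union> C)"
      using B(2) complex_vector.span_mono[of B "B \<union> C"] by blast
    moreover have "T u \<in> complex_vector.span (B \<union> C)"
      using C(2) complex_vector.span_mono[of C "B \<union> C"] by blast
    ultimately show "z \<in> complex_vector.span (B \<union> C)" by (simp add: complex_vector.span_add)
  qed
  then have "finite_dim (range (cblinfun_apply (S + T)))" using B C by (intro finite_dimI[of "B \<union> C"]) simp_all
  then show "x + y \<in> fin_rank" by (simp add: S T plus_endo.abs_eq eq_onp_def Endo_fin_rank)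
qed

lemma one_not_fin_rank:
  assumes "cdim (UNIV :: 'a::cbanach set) = \<infinity>"
  shows "(1 :: 'a endo) \<notin> fin_rank"
proof -
  have "range (cblinfun_apply (id_cblinfun :: 'a \<Rightarrow>\<^sub>C\<^sub>L 'a)) = UNIV" by auto
  then show ?thesis using assms cdim_finite_iff[of "UNIV :: 'a set"] by (simp add: one_endo_def Endo_fin_rank)
qed

text \<open>The range of the idempotent lies between \<open>N(S)\<close> and \<open>N(S^p)\<close>.
  Finite dimension passes from the former to the latter because \<open>S\<close> maps each
  \<open>N(S^(n+1))\<close> into \<open>N(S^n)\<close> with kernel in \<open>N(S)\<close>.\<close>

lemma drazin_idem_fin_rank_iff:
  assumes e: "drazin_idem p (Endo S) e"
  shows "e \<in> fin_rank \<longleftrightarrow> finite_dim (null_space S)"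
proof -
  obtain E where E: "e = Endo E" by (cases e)
  have "null_space S \<subseteq> range (cblinfun_apply E)"
  proof
    fix x assume x: "x \<in> null_space S"
    show "x \<in> range (cblinfun_apply E)"
    proof (cases "x = 0")
      case True
      then show ?thesis using complex_vector.subspace_0[OF csubspace_range] by simp
    next
      case False
      then obtain f :: "'a \<Rightarrow>\<^sub>C\<^sub>L complex" where f: "f x \<noteq> 0" by (rule exists_functional_nonzero)
      \<comment> \<open>The annihilator property of the idempotent concerns operators; a rank-one
        operator with range spanned by \<open>x\<close> transfers it to the vector
        \<open>x\<close>.\<close>
      have "S o\<^sub>C rank_one x f = 0"
        using x by (intro cblinfun_eqI) (simp add: null_space_def cblinfun_apply_scaleC_right)
      then have "Endo S ^ 1 * Endo (rank_one x f) = 0" by (simp add: Endo_mult zero_endo_def)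
      then have "e * Endo (rank_one x f) = Endo (rank_one x f)" by (rule drazin_idem_annihilator(1)[OF e])
      then have "E o\<^sub>C rank_one x f = rank_one x f" by (simp add: E Endo_mult Endo_eq_iff)
      then have "E (rank_one x f (inverse (f x) *\<^sub>C x)) = rank_one x f (inverse (f x) *\<^sub>C x)"
        by (metis cblinfun_apply_compose)
      then have "E x = x" using f by (simp add: cblinfun_apply_scaleC_right scaleC_complex_def scaleC_one)
      then show ?thesis by (metis rangeI)
    qed
  qed
  moreover have "range (cblinfun_apply E) \<subseteq> null_space (S ^\<^sub>C p)"
  proof -
    have "(S ^\<^sub>C p) o\<^sub>C E = 0"
      using e by (simp add: drazin_idem_def E Endo_power Endo_mult zero_endo_def Endo_eq_iff)
    then have "(S ^\<^sub>C p) (E x) = 0" for x by (metis cblinfun_apply_compose cblinfun_apply_zero_left)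
    then show ?thesis by (auto simp: null_space_def)
  qed
  moreover have "finite_dim (null_space (S ^\<^sub>C n))" if "finite_dim (null_space S)" for n
  proof (induction n)
    case 0
    have "null_space (S ^\<^sub>C 0) \<subseteq> complex_vector.span {}" by (auto simp: null_space_def)
    then show ?case by (intro finite_dimI[of "{}"]) simp_all
  next
    case (Suc n)
    show ?case
    proof (rule finite_dim_of_image[where T = S])
      have "cblinfun_apply S ` null_space (S ^\<^sub>C Suc n) \<subseteq> null_space (S ^\<^sub>C n)"
        by (auto simp: null_space_def cblinfun_power_commute_apply)
      then show "finite_dim (cblinfun_apply S ` null_space (S ^\<^sub>C Suc n))" using Suc finite_dim_subset by blast
      show "finite_dim (null_space S \<inter> null_space (S ^\<^sub>C Suc n))" using that finite_dim_subset by blast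
    qed (rule csubspace_null_space)
  qed
  ultimately show ?thesis unfolding E Endo_fin_rank using finite_dim_subset by blast
qed

text \<open>Off the Drazin spectrum there are only poles and resolvent points, and at the latter the
  kernel is \<open>0\<close>. So this is the spectrum without the poles with finite-dimensional
  kernel, as in Browder's theorem.\<close>

lemma not_in_browder_spec_iff:
  "\<mu> \<notin> browder_spec fin_rank (Endo T) \<longleftrightarrow>
    \<mu> \<notin> drazin_spec (Endo T) \<and> finite_dim (null_space (T - \<mu> *\<^sub>C id_cblinfun))"
proof
  assume "\<mu> \<notin> browder_spec fin_rank (Endo T)"
  then obtain p e where e: "drazin_idem p (Endo (T - \<mu> *\<^sub>C id_cblinfun)) e" "e \<in> fin_rank"
    by (auto simp: browder_spec_def Endo_shift)
  then show "\<mu> \<notin> drazin_spec (Endo T) \<and> finite_dim (null_space (T - \<mu> *\<^sub>C id_cblinfun))"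
    using drazin_idem_fin_rank_iff[OF e(1)] drazin_idem_elem[OF e(1)] by (auto simp: drazin_spec_def Endo_shift)
next
  assume r: "\<mu> \<notin> drazin_spec (Endo T) \<and> finite_dim (null_space (T - \<mu> *\<^sub>C id_cblinfun))"
  then obtain p where "drazin_elem p (Endo (T - \<mu> *\<^sub>C id_cblinfun))" by (auto simp: drazin_spec_def Endo_shift)
  then obtain e where e: "drazin_idem p (Endo (T - \<mu> *\<^sub>C id_cblinfun)) e" by (rule drazin_elem_imp_idem)
  then have "e \<in> fin_rank" using drazin_idem_fin_rank_iff[OF e] r by simp
  then show "\<mu> \<notin> browder_spec fin_rank (Endo T)" using e by (auto simp: browder_spec_def Endo_shift)
qed

text \<open>\<open>S\<close> is the invertible operator \<open>V = S (1 - E) + E\<close> minus the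
  finite-rank operator \<open>(1 - S) E\<close>.\<close>

lemma weyl_of_fin_rank_idem:
  assumes e: "drazin_idem p (Endo S) e" "e \<in> fin_rank"
  shows "weyl S"
proof -
  obtain E where E: "e = Endo E" by (cases e)
  define V where "V = S o\<^sub>C (id_cblinfun - E) + E"
  have "Endo V = Endo S * (1 - e) + e"
    by (simp add: V_def E one_endo_def Endo_mult minus_endo.abs_eq plus_endo.abs_eq eq_onp_def)
  then have "invertible_elem (Endo V)" using e by (simp add: drazin_idem_def)
  then obtain W where W: "V o\<^sub>C W = id_cblinfun" "W o\<^sub>C V = id_cblinfun" by (auto simp: invertible_Endo_iff)
  have VW: "V (W x) = x" "W (V x) = x" for x
    using arg_cong[OF W(1), of "\<lambda>U. cblinfun_apply U x"] arg_cong[OF W(2), of "\<lambda>U. cblinfun_apply U x"] by simp_all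
  define F where "F = (id_cblinfun - S) o\<^sub>C E"
  have "range (cblinfun_apply F) = cblinfun_apply (id_cblinfun - S) ` range (cblinfun_apply E)"
    by (auto simp: F_def)
  then have "finite_dim (range (cblinfun_apply F))"
    using e(2) finite_dim_image by (simp add: E Endo_fin_rank)
  then obtain B where B: "finite B" "range (cblinfun_apply F) \<subseteq> complex_vector.span B"
    by (auto simp: finite_dim_def)
  have "S = V - F"
    by (rule cblinfun_eqI) (simp add: V_def F_def cblinfun_apply_diff_left cblinfun_apply_add_left cblinfun_diff_right)
  moreover have "weyl_on UNIV (V - F)"
  proof (rule weyl_on_finite_rank_perturbation[OF complex_vector.subspace_UNIV _ _ _ B])
    show "range (cblinfun_apply V) = UNIV" using VW(1) by (metis surjI)
    have "x = 0" if "V x = 0" for x using VW(2)[of x] that by simp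
    then show "null_space V \<inter> UNIV = {0}" by (auto simp: null_space_def)
  qed simp
  ultimately show ?thesis by (simp add: weyl_def)
qed

lemma weyl_spectrum_subset: "weyl_spectrum T \<subseteq> browder_spec fin_rank (Endo T)"
  using weyl_of_fin_rank_idem by (fastforce simp: weyl_spectrum_def browder_spec_def Endo_shift)

text \<open>\<open>T\<close> is bijective on the range of \<open>T^p\<close>, and this range is
  closed because it is the kernel of the continuous idempotent \<open>E\<close>.\<close>

lemma b_weyl_of_drazin:
  fixes T :: "'a::cbanach \<Rightarrow>\<^sub>C\<^sub>L 'a"
  assumes "drazin_elem p (Endo T)"
  shows "b_weyl T"
proof -
  obtain e where e: "drazin_idem p (Endo T) e" using assms by (rule drazin_elem_imp_idem)
  obtain E where E: "e = Endo E" by (cases e)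
  let ?R = "range (cblinfun_apply (T ^\<^sub>C p))"
  have Rs: "complex_vector.subspace ?R" by (rule csubspace_range)
  have NR: "null_space (T ^\<^sub>C p) = null_space (T ^\<^sub>C Suc p)" "?R = range (cblinfun_apply (T ^\<^sub>C Suc p))"
    using assms unfolding drazin_elem_Endo_iff by blast+
  have RT: "cblinfun_apply T ` ?R = ?R" using range_power_Suc[of T p] NR(2) by simp
  have N0: "null_space T \<inter> ?R = {0}"
  proof -
    have "x = 0" if xN: "x \<in> null_space T" and xR: "x \<in> ?R" for x
    proof -
      obtain u where u: "x = (T ^\<^sub>C p) u" using xR by auto
      then have "u \<in> null_space (T ^\<^sub>C Suc p)" using xN by (simp add: null_space_def)
      then show ?thesis using NR(1) u by (simp add: null_space_def set_eq_iff)
    qed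
    then show ?thesis using complex_vector.subspace_0[OF Rs] by (auto simp: null_space_def)
  qed
  have "e * Endo T ^ p = 0" by (rule drazin_idem_power_left[OF e])
  then have ET: "E o\<^sub>C (T ^\<^sub>C p) = 0" by (simp add: E Endo_power Endo_mult zero_endo_def Endo_eq_iff)
  have "null_space E \<subseteq> ?R"
  proof -
    have v: "(Endo T * (1 - e) + e) ^ p * (1 - e) = Endo T ^ p * (1 - e)"
      using e by (intro drazin_idem_power) (auto simp: drazin_idem_def)
    have comm: "(1 - e) * Endo T = Endo T * (1 - e)" using e by (simp add: drazin_idem_def algebra_simps)
    obtain w where w: "(Endo T * (1 - e) + e) * w = 1" "w * (Endo T * (1 - e) + e) = 1"
      using e by (auto simp: drazin_idem_def invertible_elem_def)
    have wv: "w ^ p * (Endo T * (1 - e) + e) ^ p = 1"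
      using power_mult_commuting[of w "Endo T * (1 - e) + e" p] w by simp
    have "1 - e = w ^ p * ((Endo T * (1 - e) + e) ^ p * (1 - e))"
      by (simp only: mult.assoc[symmetric] wv mult_1_left)
    also have "\<dots> = w ^ p * (Endo T ^ p * (1 - e))" by (simp only: v)
    also have "\<dots> = Endo T ^ p * (w ^ p * (1 - e))"
    proof -
      let ?v = "Endo T * (1 - e) + e"
      have vT: "?v * Endo T = Endo T * ?v"
        using e by (simp add: drazin_idem_def distrib_left distrib_right mult.assoc comm)
      have "w * Endo T = w * (Endo T * ?v) * w" using w by (simp add: mult.assoc)
      also have "\<dots> = w * (?v * Endo T) * w" by (simp only: vT)
      also have "\<dots> = Endo T * w" using w by (simp add: mult.assoc[symmetric])
      finally have "w ^ p * Endo T ^ p = Endo T ^ p * w ^ p"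
        by (metis power_commuting_commutes)
      then show ?thesis by (simp add: mult.assoc[symmetric])
    qed
    finally have eq: "1 - e = Endo T ^ p * (w ^ p * (1 - e))" .
    obtain Z where Z: "w ^ p * (1 - e) = Endo Z" by (cases "w ^ p * (1 - e)")
    have "id_cblinfun - E = (T ^\<^sub>C p) o\<^sub>C Z"
      using eq[unfolded Z] unfolding E by (simp add: one_endo_def minus_endo.abs_eq eq_onp_def Endo_power Endo_mult Endo_eq_iff)
    then have "x - E x = (T ^\<^sub>C p) (Z x)" for x
      by (metis cblinfun_apply_compose cblinfun_apply_diff_left cblinfun_apply_id)
    then show ?thesis by (auto simp: null_space_def) (metis diff_zero rangeI)
  qed
  moreover have "?R \<subseteq> null_space E"
  proof -
    have "E ((T ^\<^sub>C p) x) = 0" for x using arg_cong[OF ET, of "\<lambda>U. cblinfun_apply U x"] by simp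
    then show ?thesis by (auto simp: null_space_def)
  qed
  ultimately have "closed ?R" using closed_null_space[of E] by (metis subset_antisym)
  moreover have "weyl_on ?R T"
    unfolding weyl_on_iff[OF Rs]
  proof (intro exI conjI)
    show "qdim (null_space T \<inter> ?R) {0} 0" by (simp only: qdim_0_iff N0)
    show "qdim ?R (cblinfun_apply T ` ?R) 0" by (simp only: qdim_0_iff RT)
  qed
  ultimately show ?thesis unfolding b_weyl_def by blast
qed

lemma b_weyl_spectrum_subset: "b_weyl_spectrum T \<subseteq> drazin_spec (Endo T)"
  using b_weyl_of_drazin by (auto simp: b_weyl_spectrum_def drazin_spec_def Endo_shift)

lemma generalized_browder_iff: "generalized_browder T \<longleftrightarrow> b_weyl_spectrum T = drazin_spec (Endo T)"
  unfolding generalized_browder_def poles_eq using drazin_spec_subset_spectrum[of T] by auto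

theorem generalized_browder_iff_browder:
  "generalized_browder T \<longleftrightarrow> weyl_spectrum T = browder_spec fin_rank (Endo T)"
proof
  assume "generalized_browder T"
  then have gb: "b_weyl_spectrum T = drazin_spec (Endo T)" by (simp add: generalized_browder_iff)
  have "\<mu> \<notin> browder_spec fin_rank (Endo T)" if "\<mu> \<notin> weyl_spectrum T" for \<mu>
  proof -
    let ?S = "T - \<mu> *\<^sub>C id_cblinfun"
    have w: "weyl ?S" using that by (simp add: weyl_spectrum_def)
    \<comment> \<open>A Weyl operator is B-Weyl with exponent \<open>0\<close>.\<close>
    have "range (cblinfun_apply (?S ^\<^sub>C 0)) = UNIV" by auto
    then have "b_weyl ?S" using w unfolding b_weyl_def weyl_def by (metis closed_UNIV)
    then have "\<mu> \<notin> drazin_spec (Endo T)" using gb by (auto simp: b_weyl_spectrum_def)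
    moreover have "finite_dim (null_space ?S)"
      using w unfolding weyl_def weyl_on_def cdim_finite_iff by simp
    ultimately show ?thesis by (simp add: not_in_browder_spec_iff)
  qed
  then show "weyl_spectrum T = browder_spec fin_rank (Endo T)" using weyl_spectrum_subset by blast
next
  assume B: "weyl_spectrum T = browder_spec fin_rank (Endo T)"
  have "\<mu> \<notin> drazin_spec (Endo T)" if "\<mu> \<notin> b_weyl_spectrum T" for \<mu>
  proof
    assume \<mu>: "\<mu> \<in> drazin_spec (Endo T)"
    let ?S = "T - \<mu> *\<^sub>C id_cblinfun"
    have "b_weyl ?S" using that by (simp add: b_weyl_spectrum_def)
    moreover have "\<And>p. \<not> drazin_elem p (Endo ?S)" using \<mu> by (simp add: drazin_spec_def Endo_shift)
    ultimately obtain \<delta> where \<delta>: "0 < \<delta>"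
      "\<And>\<nu>. cmod \<nu> < \<delta> \<Longrightarrow> \<nu> \<noteq> 0 \<Longrightarrow> weyl (?S - \<nu> *\<^sub>C id_cblinfun)"
      "\<And>\<nu>. cmod \<nu> < \<delta> \<Longrightarrow> \<nu> \<in> spectrum ?S"
      using b_weyl_dichotomy by metis
    have S\<nu>: "?S - \<nu> *\<^sub>C id_cblinfun = T - (\<mu> + \<nu>) *\<^sub>C id_cblinfun" for \<nu>
      by (simp add: scaleC_add_left)
    have spec: "\<mu> + \<nu> \<in> spec (Endo T)" if "cmod \<nu> < \<delta>" for \<nu>
      using \<delta>(3)[OF that] unfolding spectrum_def spectrum_eq_spec[symmetric] S\<nu> by simp
    \<comment> \<open>The whole disc of radius \<open>\<delta>\<close> about \<open>\<mu>\<close>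
      consists of spectral points. At \<open>\<mu> + \<nu>\<close> the shifted operator is Weyl, so
      by assumption this point is off the Drazin spectrum and isolated in the spectrum;
      \<open>\<mu> + \<nu>'\<close> is a nearby second point of the disc that contradicts
      this.\<close>
    define \<nu> where "\<nu> = complex_of_real (\<delta> / 2)"
    have \<nu>: "cmod \<nu> = \<delta> / 2" "\<nu> \<noteq> 0" using \<delta>(1) by (simp_all add: \<nu>_def)
    have "weyl (T - (\<mu> + \<nu>) *\<^sub>C id_cblinfun)" using \<delta>(2)[of \<nu>] \<nu> \<delta>(1) by (simp add: S\<nu>)
    then have "\<mu> + \<nu> \<notin> browder_spec fin_rank (Endo T)" unfolding B[symmetric] by (simp add: weyl_spectrum_def)
    then have "\<mu> + \<nu> \<notin> drazin_spec (Endo T)" by (simp add: not_in_browder_spec_iff)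
    then obtain p where "drazin_elem p (Endo T - (\<mu> + \<nu>) *\<^sub>C 1)" by (auto simp: drazin_spec_def)
    then obtain d where d: "0 < d" "\<And>s'. s' \<noteq> \<mu> + \<nu> \<Longrightarrow> cmod (\<mu> + \<nu> - s') < d \<Longrightarrow> s' \<notin> spec (Endo T)"
      by (rule drazin_isolated) blast
    define h where "h = min d \<delta> / 4"
    have h: "0 < h" "h < d" "h < \<delta> / 2" using d(1) \<delta>(1) by (auto simp: h_def min_def)
    define \<nu>' where "\<nu>' = \<nu> + complex_of_real h"
    have "cmod \<nu>' \<le> cmod \<nu> + h" using norm_triangle_ineq[of \<nu> "complex_of_real h"] h(1) by (simp add: \<nu>'_def)
    then have "\<mu> + \<nu>' \<in> spec (Endo T)" using \<nu> h by (intro spec) simp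
    moreover have "\<mu> + \<nu>' \<notin> spec (Endo T)"
      using h by (intro d(2)) (simp_all add: \<nu>'_def)
    ultimately show False by simp
  qed
  then show "generalized_browder T"
    using b_weyl_spectrum_subset[of T] unfolding generalized_browder_iff by blast
qed

section \<open>Algebraic operators\<close>

lemma poly_cblinfun_le:
  assumes "degree P \<le> n"
  shows "poly_cblinfun P T = (\<Sum>i\<le>n. coeff P i *\<^sub>C (T ^\<^sub>C i))"
  unfolding poly_cblinfun_def using assms
  by (intro sum.mono_neutral_left) (auto simp: coeff_eq_0)

lemma Endo_sum: "Endo (\<Sum>i\<in>I. f i) = (\<Sum>i\<in>I. Endo (f i))"
proof (induction I rule: infinite_finite_induct)
  case (insert i I)
  then show ?case by (simp add: plus_endo.abs_eq[symmetric] eq_onp_def)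
qed (simp_all add: zero_endo_def)

lemma Endo_poly_linear_factor:
  "Endo (poly_cblinfun ([:- s, 1:] * P) T) = (Endo T - s *\<^sub>C 1) * Endo (poly_cblinfun P T)"
proof -
  let ?n = "degree P" and ?x = "Endo T"
  have deg: "degree ([:- s, 1:] * P) \<le> Suc ?n"
    using degree_mult_le[of "[:- s, 1:]" P] by simp
  have co: "coeff ([:- s, 1:] * P) 0 = - s * coeff P 0"
    "coeff ([:- s, 1:] * P) (Suc i) = coeff P i - s * coeff P (Suc i)" for i
    by (simp_all add: mult_pCons_left)
  have E: "Endo (poly_cblinfun Q T) = (\<Sum>i\<le>m. coeff Q i *\<^sub>C ?x ^ i)" if "degree Q \<le> m" for Q m
    unfolding poly_cblinfun_le[OF that] Endo_sum Endo_power by (simp add: scaleC_endo.abs_eq)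
  have "Endo (poly_cblinfun ([:- s, 1:] * P) T)
      = (- s * coeff P 0) *\<^sub>C 1 + (\<Sum>i\<le>?n. (coeff P i - s * coeff P (Suc i)) *\<^sub>C ?x ^ Suc i)"
    unfolding E[OF deg] sum.atMost_Suc_shift co by simp
  also have "\<dots> = (\<Sum>i\<le>?n. coeff P i *\<^sub>C ?x ^ Suc i)
      - s *\<^sub>C (coeff P 0 *\<^sub>C 1 + (\<Sum>i\<le>?n. coeff P (Suc i) *\<^sub>C ?x ^ Suc i))"
    by (simp add: complex_vector.scale_left_diff_distrib sum_subtractf complex_vector.scale_sum_right
        scaleC_add_right del: power_Suc)
  also have "coeff P 0 *\<^sub>C 1 + (\<Sum>i\<le>?n. coeff P (Suc i) *\<^sub>C ?x ^ Suc i) = (\<Sum>i\<le>Suc ?n. coeff P i *\<^sub>C ?x ^ i)"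
    unfolding sum.atMost_Suc_shift by simp
  also have "\<dots> = Endo (poly_cblinfun P T)" by (rule E[symmetric]) simp
  also have "(\<Sum>i\<le>?n. coeff P i *\<^sub>C ?x ^ Suc i) = ?x * Endo (poly_cblinfun P T)"
    unfolding E[OF order_refl] by (simp add: sum_distrib_left scaleC_mult_right)
  finally show ?thesis by (simp add: left_diff_distrib scaleC_mult_left)
qed

lemma algebraic_of_product:
  assumes "prod_list (map (\<lambda>s. Endo A - s *\<^sub>C 1) ss) = 0"
  shows "algebraic_op A"
proof -
  define P where "P ss = prod_list (map (\<lambda>s. [:- s, 1:]) ss)" for ss :: "complex list"
  have "Endo (poly_cblinfun (P ss) A) = prod_list (map (\<lambda>s. Endo A - s *\<^sub>C 1) ss)" for ss
  proof (induction ss)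
    case Nil
    show ?case by (simp add: P_def poly_cblinfun_def one_endo_def scaleC_one)
  next
    case (Cons s ss)
    have "P (s # ss) = [:- s, 1:] * P ss" by (simp add: P_def)
    then show ?case using Cons Endo_poly_linear_factor[of s "P ss" A] by simp
  qed
  \<comment> \<open>The additional root \<open>0\<close> makes the polynomial non-constant even for
    the empty list.\<close>
  then have "Endo (poly_cblinfun (P (0 # ss)) A) = 0" using assms by simp
  then have "poly_cblinfun (P (0 # ss)) A = 0" by (simp add: zero_endo_def Endo_eq_iff)
  moreover have "degree (P ss) = length ss \<and> P ss \<noteq> 0" for ss
    by (induction ss) (auto simp: P_def degree_mult_eq simp del: mult_pCons_left)
  then have "degree (P (0 # ss)) > 0" by simp
  ultimately show ?thesis unfolding algebraic_op_def by blast
qed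

lemma not_algebraic_drazin_spec:
  assumes "\<not> algebraic_op A"
  shows "drazin_spec (Endo A) \<noteq> {}"
proof
  assume "drazin_spec (Endo A) = {}"
  then have "\<And>s. \<exists>p. drazin_elem p (Endo A - s *\<^sub>C 1)" by (auto simp: drazin_spec_def)
  then show False using drazin_all_algebraic algebraic_of_product assms by metis
qed

lemma not_algebraic_power:
  assumes "\<not> algebraic_op A"
  shows "Endo A ^ n \<noteq> 0"
proof
  assume "Endo A ^ n = 0"
  then have "prod_list (map (\<lambda>s. Endo A - s *\<^sub>C 1) (replicate n 0)) = 0" by simp
  then show False using algebraic_of_product assms by blast
qed

lemma not_nilpotent_power: "\<not> nilpotent_op A \<Longrightarrow> Endo A ^ n \<noteq> 0"
  by (auto simp: nilpotent_op_def Endo_power zero_endo_def Endo_eq_iff)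

section \<open>Tensor product operators\<close>

lemma norm_mult_bound:
  fixes A :: "'a::complex_normed_vector \<Rightarrow>\<^sub>C\<^sub>L 'b::complex_normed_vector"
    and B :: "'c::complex_normed_vector \<Rightarrow>\<^sub>C\<^sub>L 'd::complex_normed_vector"
  assumes K: "0 \<le> K" and le: "\<And>x y. norm (A x) * norm (B y) \<le> K * norm x * norm y"
  shows "norm A * norm B \<le> K"
proof -
  have 1: "norm A * norm (B y) \<le> K * norm y" for y
  proof (cases "B y = 0")
    case False
    have "norm A \<le> K * norm y / norm (B y)"
    proof (rule norm_cblinfun_bound)
      show "norm (A x) \<le> K * norm y / norm (B y) * norm x" for x
        using le[of x y] False by (simp add: field_simps)
    qed (use K in simp)
    then show ?thesis using False by (simp add: field_simps)
  qed (use K in simp)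
  show ?thesis
  proof (cases "A = 0")
    case True
    then show ?thesis using K by simp
  next
    case False
    have "norm B \<le> K / norm A"
    proof (rule norm_cblinfun_bound)
      show "norm (B y) \<le> K / norm A * norm y" for y
        using 1[of y] False by (simp add: field_simps)
    qed (use K in simp)
    then show ?thesis using False by (simp add: field_simps)
  qed
qed

lemma cblinfun_nonzero_apply: "T \<noteq> 0 \<Longrightarrow> \<exists>x. cblinfun_apply T x \<noteq> 0"
  using cblinfun_eqI[of T 0] by auto

context
  fixes t :: "'x::cbanach \<Rightarrow> 'y::cbanach \<Rightarrow> 'z::cbanach"
  assumes t: "tensor_completion t"
begin

lemma t_add_left: "t (x + x') y = t x y + t x' y" and t_scale_left: "t (c *\<^sub>C x) y = c *\<^sub>C t x y"
  and t_add_right: "t x (y + y') = t x y + t x y'" and t_scale_right: "t x (c *\<^sub>C y) = c *\<^sub>C t x y"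
proof -
  have "\<forall>y. Vector_Spaces.linear scaleC scaleC (\<lambda>x. t x y)"
    using t unfolding tensor_completion_def by (elim conjE)
  then have L: "Vector_Spaces.linear scaleC scaleC (\<lambda>x. t x y)" ..
  have "\<forall>x. Vector_Spaces.linear scaleC scaleC (\<lambda>y. t x y)"
    using t unfolding tensor_completion_def by (elim conjE)
  then have R: "Vector_Spaces.linear scaleC scaleC (\<lambda>y. t x y)" ..
  show "t (x + x') y = t x y + t x' y" "t (c *\<^sub>C x) y = c *\<^sub>C t x y"
    using L by (simp_all add: Vector_Spaces.linear_iff)
  show "t x (y + y') = t x y + t x y'" "t x (c *\<^sub>C y) = c *\<^sub>C t x y"
    using R by (simp_all add: Vector_Spaces.linear_iff)
qed

lemma t_norm: "norm (t x y) = norm x * norm y"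
  using t unfolding tensor_completion_def by (elim conjE allE)

lemma t_dense_mem:
  assumes S: "complex_vector.subspace S" "closed S" and mem: "\<And>x y. t x y \<in> S"
  shows "z \<in> S"
proof -
  have "complex_vector.span {t x y | x y. True} \<subseteq> S"
    using mem by (intro complex_vector.span_minimal S(1)) auto
  then have "closure (complex_vector.span {t x y | x y. True}) \<subseteq> S" using S(2) by (rule closure_minimal)
  moreover have "closure (complex_vector.span {t x y | x y. True}) = UNIV"
    using t unfolding tensor_completion_def by (elim conjE)
  ultimately show ?thesis by auto
qed

lemma t_ext:
  fixes S T :: "'z \<Rightarrow>\<^sub>C\<^sub>L 'w::complex_normed_vector"
  assumes "\<And>x y. S (t x y) = T (t x y)"
  shows "S = T"
proof -
  have "z \<in> null_space (S - T)" for z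
    by (rule t_dense_mem[OF csubspace_null_space closed_null_space])
      (simp add: null_space_def cblinfun_apply_diff_left assms)
  then show ?thesis by (intro cblinfun_eqI) (simp add: null_space_def cblinfun_apply_diff_left)
qed

lemmas t_op = tensor_op_apply[OF t]

text \<open>Uniformity bounds some operator with the right values on elementary tensors, and by
  density it is this one; elementary tensors give the lower bound through the cross-norm
  property.\<close>

lemma tensor_op_norm: "norm (tensor_op t A B) = norm A * norm B"
proof (rule antisym)
  have "\<exists>T. (\<forall>x y. cblinfun_apply T (t x y) = t (A x) (B y)) \<and> norm T \<le> norm A * norm B"
    using t unfolding tensor_completion_def by (elim conjE allE)
  then obtain T where T: "\<And>x y. cblinfun_apply T (t x y) = t (A x) (B y)" "norm T \<le> norm A * norm B" by blast
  have "tensor_op t A B = T" by (rule t_ext) (simp add: T t_op)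
  then show "norm (tensor_op t A B) \<le> norm A * norm B" using T by simp
  show "norm A * norm B \<le> norm (tensor_op t A B)"
  proof (rule norm_mult_bound)
    show "norm (A x) * norm (B y) \<le> norm (tensor_op t A B) * norm x * norm y" for x y
      using norm_cblinfun[of "tensor_op t A B" "t x y"] by (simp add: t_op t_norm mult.assoc)
  qed simp
qed

text \<open>The injective map \<open>x \<mapsto> t x (D y0)\<close> with
  \<open>D y0 \<noteq> 0\<close> carries the range of \<open>C\<close> into that of the product, and
  symmetrically for \<open>D\<close>. Conversely the range lies in the span of products of two
  finite spanning sets: this is clear on elementary tensors and extends to the completion since a
  finite-dimensional span is closed.\<close>

lemma tensor_fin_rank_iff:
  assumes C: "C \<noteq> 0" and D: "D \<noteq> 0"
  shows "Endo (tensor_op t C D) \<in> fin_rank \<longleftrightarrow> Endo C \<in> fin_rank \<and> Endo D \<in> fin_rank"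
  unfolding Endo_fin_rank
proof (intro iffI conjI)
  let ?R = "range (cblinfun_apply (tensor_op t C D))"
  assume R: "finite_dim ?R"
  obtain y0 where y0: "D y0 \<noteq> 0" using D cblinfun_nonzero_apply by blast
  have "norm (t x (D y0)) \<le> norm (D y0) * norm x" for x by (simp add: t_norm mult.commute)
  then obtain J :: "'x \<Rightarrow>\<^sub>C\<^sub>L 'z" where J: "\<And>x. cblinfun_apply J x = t x (D y0)"
    using cblinfun_exists[of "\<lambda>x. t x (D y0)", OF t_add_left t_scale_left] by blast
  show "finite_dim (range (cblinfun_apply C))"
  proof (rule finite_dim_of_image[OF csubspace_range, where T = J])
    have "J (C x) \<in> ?R" for x unfolding J t_op[symmetric] by simp
    then show "finite_dim (cblinfun_apply J ` range (cblinfun_apply C))"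
      by (intro finite_dim_subset[OF R]) auto
    have "x = 0" if "cblinfun_apply J x = 0" for x
      using that y0 t_norm[of x "D y0"] by (simp add: J)
    then have "null_space J \<inter> range (cblinfun_apply C) \<subseteq> {0}" by (auto simp: null_space_def)
    then show "finite_dim (null_space J \<inter> range (cblinfun_apply C))" by (intro finite_dimI[of "{}"]) auto
  qed
  obtain x0 where x0: "C x0 \<noteq> 0" using C cblinfun_nonzero_apply by blast
  have "norm (t (C x0) y) \<le> norm (C x0) * norm y" for y by (simp add: t_norm)
  then obtain J' :: "'y \<Rightarrow>\<^sub>C\<^sub>L 'z" where J': "\<And>y. cblinfun_apply J' y = t (C x0) y"
    using cblinfun_exists[of "\<lambda>y. t (C x0) y", OF t_add_right t_scale_right] by blast
  show "finite_dim (range (cblinfun_apply D))"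
  proof (rule finite_dim_of_image[OF csubspace_range, where T = J'])
    have "J' (D y) \<in> ?R" for y unfolding J' t_op[symmetric] by simp
    then show "finite_dim (cblinfun_apply J' ` range (cblinfun_apply D))"
      by (intro finite_dim_subset[OF R]) auto
    have "y = 0" if "cblinfun_apply J' y = 0" for y
      using that x0 t_norm[of "C x0" y] by (simp add: J')
    then have "null_space J' \<inter> range (cblinfun_apply D) \<subseteq> {0}" by (auto simp: null_space_def)
    then show "finite_dim (null_space J' \<inter> range (cblinfun_apply D))" by (intro finite_dimI[of "{}"]) auto
  qed
next
  assume "finite_dim (range (cblinfun_apply C)) \<and> finite_dim (range (cblinfun_apply D))"
  then obtain P Q where P: "finite P" "range (cblinfun_apply C) \<subseteq> complex_vector.span P"
    and Q: "finite Q" "range (cblinfun_apply D) \<subseteq> complex_vector.span Q"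
    unfolding finite_dim_def by blast
  define E where "E = (\<lambda>(p, q). t p q) ` (P \<times> Q)"
  have E: "finite E" using P Q by (simp add: E_def)
  let ?S = "complex_vector.span E"
  have "t v w \<in> ?S" if v: "v \<in> complex_vector.span P" and w: "w \<in> complex_vector.span Q" for v w
  proof -
    have "t v q \<in> ?S" if q: "q \<in> Q" for q
    proof -
      have "(\<lambda>v. t v q) ` complex_vector.span P \<subseteq> ?S"
        using q by (intro linear_map_span t_add_left t_scale_left complex_vector.subspace_span)
          (auto simp: E_def intro!: complex_vector.span_base)
      then show ?thesis using v by auto
    qed
    then have "t v ` complex_vector.span Q \<subseteq> ?S"
      by (intro linear_map_span t_add_right t_scale_right complex_vector.subspace_span) auto
    then show ?thesis using w by auto
  qed
  then have mem: "tensor_op t C D (t x y) \<in> ?S" for x y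
    unfolding t_op using P(2) Q(2) by blast
  have "z \<in> cblinfun_apply (tensor_op t C D) -` ?S" for z
  proof (rule t_dense_mem)
    show "complex_vector.subspace (cblinfun_apply (tensor_op t C D) -` ?S)"
      by (intro complex_vector.subspaceI)
        (auto simp: cblinfun_apply_add_right cblinfun_apply_scaleC_right
          intro: complex_vector.span_zero complex_vector.span_add complex_vector.span_scale)
    show "closed (cblinfun_apply (tensor_op t C D) -` ?S)"
      by (intro closed_vimage closed_span_finite E linear_continuous_on bounded_linear_cblinfun_apply)
  qed (use mem in simp)
  then show "finite_dim (range (cblinfun_apply (tensor_op t C D)))"
    using E by (intro finite_dimI[of E]) auto
qed

end

lemma of_endo_simps:
  "of_endo (x + y) = of_endo x + of_endo y" "of_endo (c *\<^sub>C x) = c *\<^sub>C of_endo x"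
  "of_endo (x * y) = of_endo x o\<^sub>C of_endo y" "of_endo 1 = id_cblinfun"
  by (rule plus_endo.rep_eq scaleC_endo.rep_eq times_endo.rep_eq one_endo.rep_eq)+

lemma of_endo_eq_0_iff: "of_endo x = 0 \<longleftrightarrow> x = 0"
  by (metis of_endo_inverse zero_endo.rep_eq)

lemma Endo_plus: "Endo S + Endo T = Endo (S + T)" and Endo_scaleC: "c *\<^sub>C Endo S = Endo (c *\<^sub>C S)"
  and norm_Endo: "norm (Endo S) = norm S"
  by (simp_all add: plus_endo.abs_eq scaleC_endo.abs_eq norm_endo.abs_eq eq_onp_def)

lemma norm_of_endo: "norm (of_endo x) = norm x"
  by (rule norm_endo.rep_eq[symmetric])

lemma one_endo_nonzero:
  assumes "cdim (UNIV :: 'a::cbanach set) = \<infinity>"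
  shows "(1 :: 'a endo) \<noteq> 0"
  using one_not_fin_rank[OF assms] two_sided_ideal_fin_rank by (metis two_sided_ideal_def)

lemma tensor_algebra:
  fixes t :: "'x::cbanach \<Rightarrow> 'y::cbanach \<Rightarrow> 'z::cbanach"
  assumes t: "tensor_completion t"
    and X: "cdim (UNIV :: 'x set) = \<infinity>" and Y: "cdim (UNIV :: 'y set) = \<infinity>"
  shows "algebra_tensor_ideals (\<lambda>a b. Endo (tensor_op t (of_endo a) (of_endo b))) fin_rank fin_rank fin_rank"
proof (unfold_locales, goal_cases)
  case (1 a a' b)
  show ?case unfolding Endo_plus Endo_eq_iff
    by (rule t_ext[OF t]) (simp add: t_op[OF t] of_endo_simps cblinfun_apply_add_left t_add_left[OF t])
next
  case (2 a b b')
  show ?case unfolding Endo_plus Endo_eq_iff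
    by (rule t_ext[OF t]) (simp add: t_op[OF t] of_endo_simps cblinfun_apply_add_left t_add_right[OF t])
next
  case (3 c a b)
  show ?case unfolding Endo_scaleC Endo_eq_iff
    by (rule t_ext[OF t]) (simp add: t_op[OF t] of_endo_simps cblinfun_apply_scaleC_left t_scale_left[OF t])
next
  case (4 a c b)
  show ?case unfolding Endo_scaleC Endo_eq_iff
    by (rule t_ext[OF t]) (simp add: t_op[OF t] of_endo_simps cblinfun_apply_scaleC_left t_scale_right[OF t])
next
  case (5 a b a' b')
  show ?case unfolding Endo_mult Endo_eq_iff
    by (rule t_ext[OF t]) (simp add: t_op[OF t] of_endo_simps)
next
  case 6
  show ?case unfolding one_endo_def[where 'a='z] Endo_eq_iff
    by (rule t_ext[OF t]) (simp add: t_op[OF t] of_endo_simps)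
next
  case (7 a b)
  show ?case by (simp only: norm_Endo tensor_op_norm[OF t] norm_of_endo)
next
  case 8
  show ?case by (rule one_endo_nonzero[OF X])
next
  case 9
  show ?case by (rule one_endo_nonzero[OF Y])
next
  case (10 p K x)
  then show ?case by (rule endo_drazin_bounds)
next
  case (11 p K x)
  then show ?case by (rule endo_drazin_bounds)
next
  case (15 c d)
  then show ?case using tensor_fin_rank_iff[OF t, of "of_endo c" "of_endo d"]
    by (simp add: of_endo_eq_0_iff of_endo_inverse)
qed (use one_not_fin_rank[OF X] one_not_fin_rank[OF Y] two_sided_ideal_fin_rank in auto)

section \<open>Multiplication operators\<close>

lemma rank_one_add: "rank_one (v + w) f = rank_one v f + rank_one w f"
  by (rule cblinfun_eqI) (simp add: cblinfun_apply_add_left scaleC_add_right)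

lemma rank_one_scaleC: "rank_one (c *\<^sub>C v) f = c *\<^sub>C rank_one v f"
  by (rule cblinfun_eqI) (simp add: cblinfun_apply_scaleC_left scaleC_scaleC mult.commute)

lemma mult_op_rank_one: "mult_op A B (rank_one x f) = rank_one (A x) (f o\<^sub>C B)"
  by (simp add: mult_op_apply compose_rank_one rank_one_compose)

text \<open>The lower bound is seen on operators \<open>rank_one x f\<close>, whose image is
  \<open>rank_one (A x) (f o\<^sub>C B)\<close>; choosing \<open>f\<close> by the Hahn-Banach
  theorem to norm \<open>B y\<close> brings out \<open>norm (A x) * norm (B y)\<close>.\<close>

lemma mult_op_norm:
  fixes A :: "'x::cbanach \<Rightarrow>\<^sub>C\<^sub>L 'x" and B :: "'y::cbanach \<Rightarrow>\<^sub>C\<^sub>L 'y"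
  shows "norm (mult_op A B) = norm A * norm B"
proof (rule antisym)
  show "norm (mult_op A B) \<le> norm A * norm B"
  proof (rule norm_cblinfun_bound)
    fix U
    have "norm (A o\<^sub>C U o\<^sub>C B) \<le> norm A * norm U * norm B"
      by (meson norm_cblinfun_compose order_trans mult_right_mono norm_ge_zero)
    then show "norm (mult_op A B U) \<le> norm A * norm B * norm U" by (simp add: mult_op_apply mult_ac)
  qed simp
  show "norm A * norm B \<le> norm (mult_op A B)"
  proof (rule norm_mult_bound)
    fix x y
    obtain f :: "'y \<Rightarrow>\<^sub>C\<^sub>L complex" where f: "norm f \<le> 1" "f (B y) = complex_of_real (norm (B y))"
      by (rule Hahn_Banach_norm)
    have "norm (B y) = cmod ((f o\<^sub>C B) y)" using f(2) by simp
    also have "\<dots> \<le> norm (f o\<^sub>C B) * norm y" by (rule norm_cblinfun)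
    finally have "norm (A x) * norm (B y) \<le> norm (A x) * (norm (f o\<^sub>C B) * norm y)" by (intro mult_left_mono) auto
    also have "\<dots> = norm (mult_op A B (rank_one x f)) * norm y"
      by (simp add: mult_op_rank_one norm_rank_one)
    also have "\<dots> \<le> (norm (mult_op A B) * norm (rank_one x f)) * norm y"
      by (intro mult_right_mono norm_cblinfun) simp
    also have "\<dots> \<le> (norm (mult_op A B) * norm x) * norm y"
      using f(1) by (intro mult_right_mono mult_left_mono) (simp_all add: norm_rank_one mult_left_le_one_le)
    finally show "norm (A x) * norm (B y) \<le> norm (mult_op A B) * norm x * norm y" .
  qed simp
qed

text \<open>Finite rank of \<open>C\<close> is read off by evaluating images at a vector. For
  \<open>D\<close> only the functionals \<open>f o\<^sub>C D\<close> are accessible; they lie in a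
  finite-dimensional space, which bounds the rank of \<open>D\<close> because independent vectors in
  its range have dual functionals.\<close>

lemma mult_fin_rank_iff:
  fixes C :: "'x::cbanach \<Rightarrow>\<^sub>C\<^sub>L 'x" and D :: "'y::cbanach \<Rightarrow>\<^sub>C\<^sub>L 'y"
  assumes C: "C \<noteq> 0" and D: "D \<noteq> 0"
  shows "Endo (mult_op C D) \<in> fin_rank \<longleftrightarrow> Endo C \<in> fin_rank \<and> Endo D \<in> fin_rank"
  unfolding Endo_fin_rank
proof (intro iffI conjI)
  let ?R = "range (cblinfun_apply (mult_op C D))"
  assume R: "finite_dim ?R"
  obtain y0 where y0: "D y0 \<noteq> 0" using D cblinfun_nonzero_apply by blast
  obtain f :: "'y \<Rightarrow>\<^sub>C\<^sub>L complex" where f: "f (D y0) \<noteq> 0" using y0 by (rule exists_functional_nonzero)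
  have "norm (cblinfun_apply W y0) \<le> norm y0 * norm W" for W :: "'y \<Rightarrow>\<^sub>C\<^sub>L 'x"
    using norm_cblinfun[of W y0] by (simp add: mult.commute)
  then obtain J :: "('y \<Rightarrow>\<^sub>C\<^sub>L 'x) \<Rightarrow>\<^sub>C\<^sub>L 'x" where J: "\<And>W. cblinfun_apply J W = cblinfun_apply W y0"
    using cblinfun_exists[of "\<lambda>W :: 'y \<Rightarrow>\<^sub>C\<^sub>L 'x. cblinfun_apply W y0",
        OF cblinfun_apply_add_left cblinfun_apply_scaleC_left] by blast
  have "range (cblinfun_apply C) \<subseteq> cblinfun_apply J ` ?R"
  proof
    fix v assume "v \<in> range (cblinfun_apply C)"
    then obtain x where x: "v = C x" by auto
    have "J (mult_op C D (rank_one (inverse (f (D y0)) *\<^sub>C x) f)) = v"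
      using f by (simp add: J mult_op_rank_one cblinfun_apply_scaleC_right x scaleC_one)
    then show "v \<in> cblinfun_apply J ` ?R" by blast
  qed
  then show "finite_dim (range (cblinfun_apply C))" using finite_dim_image[OF R] finite_dim_subset by blast
  obtain x0 where x0: "C x0 \<noteq> 0" using C cblinfun_nonzero_apply by blast
  obtain g :: "'x \<Rightarrow>\<^sub>C\<^sub>L complex" where g: "g (C x0) \<noteq> 0" using x0 by (rule exists_functional_nonzero)
  have H_add: "g o\<^sub>C (V + W) = g o\<^sub>C V + g o\<^sub>C W" and H_scale: "g o\<^sub>C (c *\<^sub>C W) = c *\<^sub>C (g o\<^sub>C W)"
    for V W :: "'y \<Rightarrow>\<^sub>C\<^sub>L 'x" and c
    by (rule cblinfun_eqI, simp add: cblinfun_apply_add_left cblinfun_apply_add_right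
        cblinfun_apply_scaleC_left cblinfun_apply_scaleC_right)+
  obtain H :: "('y \<Rightarrow>\<^sub>C\<^sub>L 'x) \<Rightarrow>\<^sub>C\<^sub>L ('y \<Rightarrow>\<^sub>C\<^sub>L complex)" where H: "\<And>W. cblinfun_apply H W = g o\<^sub>C W"
    using cblinfun_exists[of "\<lambda>W :: 'y \<Rightarrow>\<^sub>C\<^sub>L 'x. g o\<^sub>C W", OF H_add H_scale norm_cblinfun_compose] by blast
  obtain B where B: "finite B" "cblinfun_apply H ` ?R \<subseteq> complex_vector.span B"
    using finite_dim_image[OF R, of H] by (auto simp: finite_dim_def)
  have fD: "f o\<^sub>C D \<in> complex_vector.span B" for f :: "'y \<Rightarrow>\<^sub>C\<^sub>L complex"
  proof -
    have "H (mult_op C D (rank_one (inverse (g (C x0)) *\<^sub>C x0) f)) = f o\<^sub>C D"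
      using g by (intro cblinfun_eqI)
        (simp add: H mult_op_rank_one cblinfun_apply_scaleC_right scaleC_complex_def)
    then show ?thesis using B(2) by (metis image_subset_iff rangeI)
  qed
  \<comment> \<open>Dual functionals of an independent set in the range of \<open>D\<close>,
    composed with \<open>D\<close>, are independent, as evaluation at the preimages
    \<open>y b\<close> shows; all of them lie in the span of \<open>B\<close>.\<close>
  have bound: "card A \<le> card B" if A: "A \<subseteq> range (cblinfun_apply D)" "indep_mod {0} A" for A
  proof -
    have fin: "finite A" using A(2) by (simp add: indep_mod_def)
    have "complex_vector.independent A"
      using A(2) unfolding complex_vector.dependent_finite[OF fin] by (auto simp: indep_mod_def)
    then have "\<forall>b\<in>A. \<exists>f :: 'y \<Rightarrow>\<^sub>C\<^sub>L complex. f b = 1 \<and> (\<forall>b'\<in>A. b' \<noteq> b \<longrightarrow> f b' = 0)"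
      using dual_functional[OF fin] by metis
    then obtain \<phi> :: "'y \<Rightarrow> 'y \<Rightarrow>\<^sub>C\<^sub>L complex" where \<phi>1: "\<And>b. b \<in> A \<Longrightarrow> \<phi> b b = 1"
      and \<phi>0: "\<And>b b'. b \<in> A \<Longrightarrow> b' \<in> A \<Longrightarrow> b' \<noteq> b \<Longrightarrow> \<phi> b b' = 0" by metis
    define \<psi> where "\<psi> b = \<phi> b o\<^sub>C D" for b
    define y where "y = inv_into UNIV (cblinfun_apply D)"
    have y: "D (y b) = b" if "b \<in> A" for b
      using A(1) that unfolding y_def by (intro f_inv_into_f) blast
    have \<psi>: "\<psi> b (y b') = (if b = b' then 1 else 0)" if "b \<in> A" "b' \<in> A" for b b'
      using \<phi>1 \<phi>0[of b b'] that by (simp add: \<psi>_def y)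
    have inj: "inj_on \<psi> A"
      by (rule inj_onI) (metis \<psi> zero_neq_one)
    have "complex_vector.independent (\<psi> ` A)"
      unfolding complex_vector.dependent_finite[OF finite_imageI[OF fin]]
    proof
      assume "\<exists>u. (\<exists>v\<in>\<psi> ` A. u v \<noteq> 0) \<and> (\<Sum>v\<in>\<psi> ` A. u v *\<^sub>C v) = 0"
      then obtain u a where u: "a \<in> A" "u (\<psi> a) \<noteq> 0" "(\<Sum>v\<in>\<psi> ` A. u v *\<^sub>C v) = 0" by auto
      then have "(\<Sum>b\<in>A. u (\<psi> b) *\<^sub>C \<psi> b) = 0" by (simp add: sum.reindex[OF inj])
      then have "(\<Sum>b\<in>A. u (\<psi> b) *\<^sub>C \<psi> b) (y a) = 0" by simp
      then have "(\<Sum>b\<in>A. u (\<psi> b) * \<psi> b (y a)) = 0"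
        by (simp add: cblinfun_sum_left cblinfun_apply_scaleC_left scaleC_complex_def)
      moreover have "(\<Sum>b\<in>A. u (\<psi> b) * \<psi> b (y a)) = (\<Sum>b\<in>{a}. u (\<psi> b) * \<psi> b (y a))"
        using u(1) fin \<psi> by (intro sum.mono_neutral_right) auto
      ultimately show False using u \<psi>[of a a] by simp
    qed
    moreover have "\<psi> ` A \<subseteq> complex_vector.span B" using fD by (auto simp: \<psi>_def)
    ultimately have "card (\<psi> ` A) \<le> card B" using complex_vector.independent_span_bound[OF B(1)] by blast
    then show ?thesis by (simp add: card_image[OF inj])
  qed
  show "finite_dim (range (cblinfun_apply D))"
    unfolding finite_dim_iff_qdim using qdim_exists[OF subspace_zero bound] by blast
next
  assume "finite_dim (range (cblinfun_apply C)) \<and> finite_dim (range (cblinfun_apply D))"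
  then obtain P k where P: "finite P" "range (cblinfun_apply C) \<subseteq> complex_vector.span P"
    and k: "qdim (range (cblinfun_apply D)) {0} k"
    unfolding finite_dim_iff_qdim[of "range (cblinfun_apply D)"] unfolding finite_dim_def by blast
  obtain Q where Q: "quotient_basis (range (cblinfun_apply D)) {0} Q" using k by (auto simp: qdim_def)
  note q = qdim_zero_basis[OF Q]
  have "\<forall>b\<in>Q. \<exists>f :: 'y \<Rightarrow>\<^sub>C\<^sub>L complex. f b = 1 \<and> (\<forall>b'\<in>Q. b' \<noteq> b \<longrightarrow> f b' = 0)"
    using dual_functional[OF q(3,1)] by metis
  then obtain \<phi> :: "'y \<Rightarrow> 'y \<Rightarrow>\<^sub>C\<^sub>L complex" where \<phi>1: "\<And>b. b \<in> Q \<Longrightarrow> \<phi> b b = 1"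
    and \<phi>0: "\<And>b b'. b \<in> Q \<Longrightarrow> b' \<in> Q \<Longrightarrow> b' \<noteq> b \<Longrightarrow> \<phi> b b' = 0" by metis
  \<comment> \<open>Expanding \<open>D y\<close> in the basis \<open>Q\<close> writes
    \<open>C U D\<close> as a sum of rank-one operators with vectors \<open>C (U b)\<close>, so the
    span of these finitely many operators contains the range.\<close>
  define E where "E = (\<lambda>(p, b). rank_one p (\<phi> b o\<^sub>C D)) ` (P \<times> Q)"
  have E: "finite E" using P q by (simp add: E_def)
  let ?S = "complex_vector.span E"
  have expand: "D y = (\<Sum>b\<in>Q. \<phi> b (D y) *\<^sub>C b)" for y
  proof -
    have "D y \<in> complex_vector.span Q" using q(2) by auto
    then obtain u where u: "D y = (\<Sum>b\<in>Q. u b *\<^sub>C b)" unfolding complex_vector.span_finite[OF q(3)] by auto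
    have "\<phi> b (D y) = u b" if b: "b \<in> Q" for b
    proof -
      have "\<phi> b (D y) = (\<Sum>b'\<in>Q. u b' * \<phi> b b')"
        by (simp add: u cblinfun_sum_right cblinfun_apply_scaleC_right scaleC_complex_def)
      also have "\<dots> = (\<Sum>b'\<in>{b}. u b' * \<phi> b b')"
        using b q(3) \<phi>0 by (intro sum.mono_neutral_right) auto
      finally show ?thesis using \<phi>1[OF b] by simp
    qed
    then show ?thesis using u by (simp cong: sum.cong)
  qed
  have "mult_op C D U \<in> ?S" for U
  proof -
    have "mult_op C D U = (\<Sum>b\<in>Q. rank_one (C (U b)) (\<phi> b o\<^sub>C D))"
    proof (rule cblinfun_eqI)
      fix y
      have "C (U (D y)) = (\<Sum>b\<in>Q. \<phi> b (D y) *\<^sub>C C (U b))"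
        by (subst expand) (simp add: cblinfun_sum_right cblinfun_apply_scaleC_right)
      then show "mult_op C D U y = (\<Sum>b\<in>Q. rank_one (C (U b)) (\<phi> b o\<^sub>C D)) y"
        by (simp add: mult_op_apply cblinfun_sum_left)
    qed
    moreover have "rank_one v (\<phi> b o\<^sub>C D) \<in> ?S" if b: "b \<in> Q" and v: "v \<in> complex_vector.span P" for b v
    proof -
      have "(\<lambda>v. rank_one v (\<phi> b o\<^sub>C D)) ` complex_vector.span P \<subseteq> ?S"
        using b by (intro linear_map_span rank_one_add rank_one_scaleC complex_vector.subspace_span)
          (auto simp: E_def intro!: complex_vector.span_base)
      then show ?thesis using v by auto
    qed
    moreover have "C (U b) \<in> complex_vector.span P" for b using P(2) by blast
    ultimately show ?thesis by (simp add: complex_vector.span_sum)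
  qed
  then show "finite_dim (range (cblinfun_apply (mult_op C D)))" using E by (intro finite_dimI[of E]) auto
qed

lemma of_opp_simps:
  "of_opp (x + y) = of_opp x + of_opp y" "of_opp (c *\<^sub>C x) = c *\<^sub>C of_opp x"
  "of_opp (x * y) = of_opp y * of_opp x" "of_opp 1 = 1"
  by (rule plus_opp.rep_eq scaleC_opp.rep_eq times_opp.rep_eq one_opp.rep_eq)+

lemma of_opp_eq_0_iff: "of_opp x = 0 \<longleftrightarrow> x = 0"
  by (metis of_opp_inverse zero_opp.rep_eq)

lemma Opp_mem_iff: "x \<in> Opp ` F \<longleftrightarrow> of_opp x \<in> F"
  by (metis Opp_inverse UNIV_I image_iff of_opp_inverse)

lemma two_sided_ideal_Opp: "two_sided_ideal F \<Longrightarrow> two_sided_ideal (Opp ` F)"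
  by (auto simp: two_sided_ideal_def Opp_mem_iff of_opp_simps zero_opp.rep_eq simp del: image_iff)

lemma mult_algebra:
  assumes X: "cdim (UNIV :: 'x::cbanach set) = \<infinity>" and Y: "cdim (UNIV :: 'y::cbanach set) = \<infinity>"
  shows "algebra_tensor_ideals (\<lambda>(a :: 'x endo) (b :: 'y endo opp). Endo (mult_op (of_endo a) (of_endo (of_opp b))))
    fin_rank (Opp ` fin_rank) fin_rank"
proof (unfold_locales, goal_cases)
  case (1 a a' b)
  show ?case unfolding Endo_plus Endo_eq_iff
    by (intro cblinfun_eqI) (simp add: mult_op_apply of_endo_simps cblinfun_apply_add_left)
next
  case (2 a b b')
  show ?case unfolding Endo_plus Endo_eq_iff
    by (intro cblinfun_eqI)
      (simp add: mult_op_apply of_endo_simps of_opp_simps cblinfun_apply_add_left cblinfun_apply_add_right)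
next
  case (3 c a b)
  show ?case unfolding Endo_scaleC Endo_eq_iff
    by (intro cblinfun_eqI) (simp add: mult_op_apply of_endo_simps cblinfun_apply_scaleC_left)
next
  case (4 a c b)
  show ?case unfolding Endo_scaleC Endo_eq_iff
    by (intro cblinfun_eqI)
      (simp add: mult_op_apply of_endo_simps of_opp_simps cblinfun_apply_scaleC_left cblinfun_apply_scaleC_right)
next
  case (5 a b a' b')
  show ?case unfolding Endo_mult Endo_eq_iff
    by (intro cblinfun_eqI) (simp add: mult_op_apply of_endo_simps of_opp_simps)
next
  case 6
  show ?case unfolding one_endo_def[where 'a="'y \<Rightarrow>\<^sub>C\<^sub>L 'x"] Endo_eq_iff
    by (intro cblinfun_eqI) (simp add: mult_op_apply of_endo_simps of_opp_simps)
next
  case (7 a b)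
  show ?case by (simp only: norm_Endo mult_op_norm norm_of_endo norm_opp.rep_eq)
next
  case 8
  show ?case by (rule one_endo_nonzero[OF X])
next
  case 9
  show ?case using one_endo_nonzero[OF Y] by (simp add: of_opp_eq_0_iff[symmetric] of_opp_simps)
next
  case (10 p K x)
  then show ?case by (rule endo_drazin_bounds)
next
  case (11 p K x)
  then show ?case by (rule opp_drazin_bounds)
next
  case (15 c d)
  then show ?case using mult_fin_rank_iff[of "of_endo c" "of_endo (of_opp d)"]
    by (simp add: of_endo_eq_0_iff of_opp_eq_0_iff of_endo_inverse Opp_mem_iff)
qed (use one_not_fin_rank[OF X] one_not_fin_rank[OF Y] two_sided_ideal_fin_rank two_sided_ideal_Opp
    in \<open>auto simp: Opp_mem_iff of_opp_simps\<close>)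

section \<open>The main theorem\<close>

text \<open>Outside \<open>0\<close> the Drazin spectrum formula is unconditional; at \<open>0\<close> it needs the case distinction.\<close>

lemma (in algebra_tensor_ideals) drazin_spec_formula:
  assumes a: "\<And>n. a ^ n \<noteq> 0" and b: "\<And>n. b ^ n \<noteq> 0"
    and cases: "drazin_spec a \<noteq> {} \<and> drazin_spec b \<noteq> {} \<and> (0 \<in> spec (a \<odot> b) \<longrightarrow> 0 \<in> drazin_spec (a \<odot> b)) \<or>
      0 \<in> drazin_spec a \<or> 0 \<in> drazin_spec b"
  shows "drazin_spec (a \<odot> b) = spec a * drazin_spec b \<union> drazin_spec a * spec b"
proof -
  have "0 \<in> drazin_spec (a \<odot> b) \<longleftrightarrow> 0 \<in> spec a * drazin_spec b \<union> drazin_spec a * spec b"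
  proof
    \<comment> \<open>\<open>0\<close> then lies in \<open>spec (a \<odot> b)\<close>, and each
      alternative of \<open>cases\<close> puts it into the Drazin spectrum of the product, the last
      two through \<open>zero_drazin_spec_tens\<close>.\<close>
    assume R: "0 \<in> spec a * drazin_spec b \<union> drazin_spec a * spec b"
    then have "0 \<in> spec (a \<odot> b)"
      using set_times_mono2[OF order_refl drazin_spec_subset, of "spec a" b]
        set_times_mono2[OF drazin_spec_subset order_refl, of a "spec b"] unfolding spec_tens by blast
    then show "0 \<in> drazin_spec (a \<odot> b)" using cases zero_drazin_spec_tens[OF a b] by blast
  qed (use drazin_spec_tens_subset in blast)
  then show ?thesis using drazin_spec_tens_nonzero[of _ a b] by (metis (no_types, lifting) subsetI subset_antisym)
qed

text \<open>The Browder property of \<open>A\<close> and \<open>B\<close> turns the Drazin and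
  Browder spectra on the right-hand sides into B-Weyl and Weyl spectra, so either formula for
  \<open>T\<close> says that \<open>T\<close> itself has the Browder property.\<close>

lemma main_equivalence:
  fixes T :: "'w::cbanach \<Rightarrow>\<^sub>C\<^sub>L 'w"
  assumes gA: "generalized_browder A" and gB: "generalized_browder B"
    and D: "drazin_spec (Endo T) = spectrum A * drazin_spec (Endo B) \<union> drazin_spec (Endo A) * spectrum B"
    and W: "browder_spec fin_rank (Endo T) =
      spectrum A * browder_spec fin_rank (Endo B) \<union> browder_spec fin_rank (Endo A) * spectrum B"
  shows "(generalized_browder T \<longleftrightarrow>
      b_weyl_spectrum T = spectrum A * b_weyl_spectrum B \<union> b_weyl_spectrum A * spectrum B) \<and>
    (b_weyl_spectrum T = spectrum A * b_weyl_spectrum B \<union> b_weyl_spectrum A * spectrum B \<longleftrightarrow>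
      weyl_spectrum T = weyl_spectrum A * spectrum B \<union> spectrum A * weyl_spectrum B)"
proof -
  have "b_weyl_spectrum A = drazin_spec (Endo A)" "b_weyl_spectrum B = drazin_spec (Endo B)"
    using gA gB by (simp_all add: generalized_browder_iff)
  then have 1: "generalized_browder T \<longleftrightarrow>
      b_weyl_spectrum T = spectrum A * b_weyl_spectrum B \<union> b_weyl_spectrum A * spectrum B"
    by (simp add: generalized_browder_iff D)
  have "weyl_spectrum A = browder_spec fin_rank (Endo A)" "weyl_spectrum B = browder_spec fin_rank (Endo B)"
    using gA gB by (simp_all add: generalized_browder_iff_browder)
  then have "generalized_browder T \<longleftrightarrow>
      weyl_spectrum T = weyl_spectrum A * spectrum B \<union> spectrum A * weyl_spectrum B"
    by (simp add: generalized_browder_iff_browder W Un_commute)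
  then show ?thesis using 1 by blast
qed

theorem theorem4p7:
  fixes A :: "'x::cbanach \<Rightarrow>\<^sub>C\<^sub>L 'x" and B :: "'y::cbanach \<Rightarrow>\<^sub>C\<^sub>L 'y"
    and t :: "'x \<Rightarrow> 'y \<Rightarrow> 'z::cbanach"
  assumes "cdim (UNIV :: 'x set) = \<infinity>" and "cdim (UNIV :: 'y set) = \<infinity>"
    and "tensor_completion t"
    and "generalized_browder A" and "generalized_browder B"
    and "(\<not> algebraic_op A \<and> \<not> algebraic_op B \<and> 0 \<notin> poles (tensor_op t A B)) \<or>
         (algebraic_op A \<and> \<not> algebraic_op B \<and> \<not> nilpotent_op A \<and> \<not> drazin_invertible B) \<or>
         (algebraic_op B \<and> \<not> algebraic_op A \<and> \<not> nilpotent_op B \<and> \<not> drazin_invertible A)"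
  shows "poles (tensor_op t A B) = poles (mult_op A B) \<and>
    ((generalized_browder (tensor_op t A B) \<longleftrightarrow>
        b_weyl_spectrum (tensor_op t A B) =
          spectrum A * b_weyl_spectrum B \<union> b_weyl_spectrum A * spectrum B) \<and>
     (b_weyl_spectrum (tensor_op t A B) =
          spectrum A * b_weyl_spectrum B \<union> b_weyl_spectrum A * spectrum B \<longleftrightarrow>
        weyl_spectrum (tensor_op t A B) =
          weyl_spectrum A * spectrum B \<union> spectrum A * weyl_spectrum B)) \<and>
    ((generalized_browder (mult_op A B) \<longleftrightarrow>
        b_weyl_spectrum (mult_op A B) =
          spectrum A * b_weyl_spectrum B \<union> b_weyl_spectrum A * spectrum B) \<and>
     (b_weyl_spectrum (mult_op A B) =
          spectrum A * b_weyl_spectrum B \<union> b_weyl_spectrum A * spectrum B \<longleftrightarrow>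
        weyl_spectrum (mult_op A B) =
          weyl_spectrum A * spectrum B \<union> spectrum A * weyl_spectrum B))"
proof -
  interpret tensor: algebra_tensor_ideals "\<lambda>a b. Endo (tensor_op t (of_endo a) (of_endo b))" fin_rank fin_rank fin_rank
    using assms(1-3) by (intro tensor_algebra)
  interpret mult: algebra_tensor_ideals
    "\<lambda>(a :: 'x endo) (b :: 'y endo opp). Endo (mult_op (of_endo a) (of_endo (of_opp b)))"
    fin_rank "Opp ` fin_rank" fin_rank
    using assms(1,2) by (intro mult_algebra)
  note inv = Endo_inverse[OF UNIV_I] Opp_inverse[OF UNIV_I]
  let ?a = "Endo A" and ?b = "Endo B"
  have dA: "0 \<in> drazin_spec ?a" if "\<not> drazin_invertible A"
    using that drazin_elem_imp_drazin_invertible by (auto simp: drazin_spec_def)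
  have dB: "0 \<in> drazin_spec ?b" if "\<not> drazin_invertible B"
    using that drazin_elem_imp_drazin_invertible by (auto simp: drazin_spec_def)
  \<comment> \<open>Powers can vanish only for an algebraic operator, and an algebraic factor is
    assumed not to be nilpotent.\<close>
  have a: "?a ^ n \<noteq> 0" for n
    using assms(6) not_algebraic_power[of A n] not_nilpotent_power[of A n] by blast
  have b: "?b ^ n \<noteq> 0" for n
    using assms(6) not_algebraic_power[of B n] not_nilpotent_power[of B n] by blast
  have b': "Opp ?b ^ n \<noteq> 0" for n
    using b[of n] by (simp add: Opp_power zero_opp_def Opp_inject)
  have spec_T: "spectrum (tensor_op t A B) = spectrum A * spectrum B"
    using tensor.spec_tens[of ?a ?b] by (simp add: spectrum_eq_spec inv)
  have spec_M: "spectrum (mult_op A B) = spectrum A * spectrum B"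
    using mult.spec_tens[of ?a "Opp ?b"] by (simp add: spectrum_eq_spec spec_Opp inv)
  have zero_T: "0 \<in> drazin_spec (Endo (tensor_op t A B)) \<longleftrightarrow> 0 \<in> drazin_spec ?a \<or> 0 \<in> drazin_spec ?b"
    using tensor.zero_drazin_spec_tens[OF a b] by (simp add: inv)
  have zero_M: "0 \<in> drazin_spec (Endo (mult_op A B)) \<longleftrightarrow> 0 \<in> drazin_spec ?a \<or> 0 \<in> drazin_spec ?b"
    using mult.zero_drazin_spec_tens[OF a b'] by (simp add: inv drazin_spec_Opp)
  \<comment> \<open>Stated in terms of the factors so that it serves both products.
    \<open>zero_T\<close> turns the pole condition on the tensor product into one on
    \<open>A\<close> and \<open>B\<close>; in the mixed cases the factor that is not Drazin
    invertible has \<open>0\<close> in its Drazin spectrum.\<close>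
  have cases: "drazin_spec ?a \<noteq> {} \<and> drazin_spec ?b \<noteq> {} \<and>
      (0 \<in> spectrum A * spectrum B \<longrightarrow> 0 \<in> drazin_spec ?a \<or> 0 \<in> drazin_spec ?b) \<or>
      0 \<in> drazin_spec ?a \<or> 0 \<in> drazin_spec ?b"
    using assms(6)
  proof (elim disjE conjE)
    assume nA: "\<not> algebraic_op A" and nB: "\<not> algebraic_op B" and 0: "0 \<notin> poles (tensor_op t A B)"
    have "0 \<in> spectrum A * spectrum B \<longrightarrow> 0 \<in> drazin_spec ?a \<or> 0 \<in> drazin_spec ?b"
      using 0 unfolding poles_eq spec_T Diff_iff zero_T by simp
    then show ?thesis using not_algebraic_drazin_spec[OF nA] not_algebraic_drazin_spec[OF nB] by simp
  qed (use dA dB in simp_all)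
  have DT: "drazin_spec (Endo (tensor_op t A B)) = spectrum A * drazin_spec ?b \<union> drazin_spec ?a * spectrum B"
    using tensor.drazin_spec_formula[OF a b] cases zero_T spec_T by (simp add: spectrum_eq_spec inv)
  have DM: "drazin_spec (Endo (mult_op A B)) = spectrum A * drazin_spec ?b \<union> drazin_spec ?a * spectrum B"
    using mult.drazin_spec_formula[OF a b'] cases zero_M spec_M
    by (simp add: spectrum_eq_spec inv drazin_spec_Opp spec_Opp)
  have WT: "browder_spec fin_rank (Endo (tensor_op t A B)) =
      spectrum A * browder_spec fin_rank ?b \<union> browder_spec fin_rank ?a * spectrum B"
    using tensor.browder_spec_tens[of ?a ?b] by (simp add: spectrum_eq_spec inv)
  have WM: "browder_spec fin_rank (Endo (mult_op A B)) =
      spectrum A * browder_spec fin_rank ?b \<union> browder_spec fin_rank ?a * spectrum B"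
    using mult.browder_spec_tens[of ?a "Opp ?b"] by (simp add: spectrum_eq_spec inv browder_spec_Opp spec_Opp)
  \<comment> \<open>Spectrum and Drazin spectrum of both products are given by the same expressions
    in \<open>A\<close> and \<open>B\<close>.\<close>
  have "poles (tensor_op t A B) = poles (mult_op A B)"
    unfolding poles_eq spec_T spec_M DT DM ..
  then show ?thesis
    using main_equivalence[OF assms(4,5) DT WT] main_equivalence[OF assms(4,5) DM WM] by (intro conjI) simp_all
qed

end
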